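(* Let $k$ be a field, let $\mathcal{W}_n$ be $S_n$, $B_n$ or $D_n$, and let $V_n\cong k^n$ be the canonical representation of $\mathcal{W}_n$ by (signed) permutation matrices. Given $r\in\mathbb{Z}_{>0}$, the sequence of coinvariant algebras $\mathcal{C}^{(r)}:=k[V_\bullet^{\oplus r}]/\mathcal{I}$ is a graded co-$\mathrm{FI}_{\mathcal{W}}$-algebra of finite type. When $k$ has characteristic zero, the weight of the multigraded component $\mathcal{C}^{(r)}_J$ is $\le|J|$ for every $J\in\mathbb{Z}_{\ge0}^r$.
   Context: **Categories and modules.** For $n\ge0$ let $\mathbf{n}=\{\pm1,\dots,\pm n\}$, $\mathbf{0}=\varnothing$. $\mathrm{FI}_{BC}$ has objects $\mathbf{n}$ and morphisms the injections $f:\mathbf{m}\to\mathbf{n}$ with $f(-a)=-f(a)$; $\mathrm{FI}_D$ is the subcategory with the same objects and morphisms except that isomorphisms must reverse an even number of signs; $\mathrm{FI}_A$ is the subcategory of sign-preserving morphisms. $\mathrm{End}(\mathbf{n})\cong\mathcal{W}_n$ is $B_n$, $D_n$ (even-signed permutations), $S_n$ respectively; $I_n:\mathbf{n}\hookrightarrow\mathbf{n+1}$ is the natural inclusion. An $\mathrm{FI}_{\mathcal{W}}$-module over $k$ is a functor $\mathrm{FI}_{\mathcal{W}}\to k\text{-Mod}$, $V_n:=V(\mathbf{n})$; it is finitely generated if some finite subset of $\coprod_nV_n$ lies in no proper sub-$\mathrm{FI}_{\mathcal{W}}$-module. A graded co-$\mathrm{FI}_{\mathcal{W}}$-module (resp.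 algebra) is a functor from $\mathrm{FI}_{\mathcal{W}}^{op}$ to graded $k$-modules (resp. graded $k$-algebras). Over a field $k$, it has finite type if for each graded piece $V$ the dual $\mathrm{FI}_{\mathcal{W}}$-module $V^*_n=\mathrm{Hom}_k(V_n,k)$ is finitely generated; the weight of a co-$\mathrm{FI}_{\mathcal{W}}$-module is the weight of its dual $\mathrm{FI}_{\mathcal{W}}$-module. **Coinvariant algebras.** $V_n=\mathrm{Span}_k\langle x_1,\dots,x_n\rangle$, on which $S_n$ acts by permutation matrices, $B_n$ by signed permutation matrices, and $D_n$ by signed permutation matrices with an even number of entries $-1$. With the diagonal action of $\mathcal{W}_n$ on $V_n^{\oplus r}$, $k[V_n^{\oplus r}]:=\mathrm{Sym}(V_n^{\oplus r})\cong k[x^{(1)}_1,\dots,x^{(1)}_n,\dots,x^{(r)}_1,\dots,x^{(r)}_n]$, multigraded by $J=(j_1,\dots,j_r)\in\mathbb{Z}_{\ge0}^r$ with $j_i$ the total degree in $x^{(i)}_1,\dots,x^{(i)}_n$; $|J|=j_1+\cdots+j_r$. $\mathcal{I}_n$ is the ideal generated by the $\mathcal{W}_n$-invariant polynomials with zero constant term; $\mathcal{C}^{(r)}(n)=k[V_n^{\oplus r}]/\mathcal{I}_n=\bigoplus_J\mathcal{C}^{(r)}_J(n)$. The co-$\mathrm{FI}_{\mathcal{W}}$-structure is the one induced on quotients by the $\mathcal{W}_n$-actions and the maps $(I_n)^*:k[V_{n+1}^{\oplus r}]\to k[V_n^{\oplus r}]$, $x^{(i)}_j\mapsto x^{(i)}_j$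 for $j\le n$ and $x^{(i)}_{n+1}\mapsto0$. **Weight (characteristic zero).** For $\lambda\vdash n$, $V_\lambda$ is the irreducible $S_n$-representation. Irreducible $B_n$-representations are $V_{(\lambda,\nu)}$, $|\lambda|+|\nu|=n$: $V_{(\lambda,\varnothing)}$ is the pullback of $V_\lambda$ along $B_n\twoheadrightarrow S_n$; $V_{(\varnothing,\nu)}=V_{(\nu,\varnothing)}\otimes k^\varepsilon$ with $\varepsilon:B_n\to\{\pm1\}$ the character with kernel $D_n$; $V_{(\lambda,\nu)}=\mathrm{Ind}_{B_m\times B_{n-m}}^{B_n}V_{(\lambda,\varnothing)}\boxtimes V_{(\varnothing,\nu)}$, $\lambda\vdash m$. For $\lambda=(\lambda_1,\dots,\lambda_t)\vdash m$, $\lambda[n]=(n-m,\lambda_1,\dots,\lambda_t)$ when $n-m\ge\lambda_1$. Write $V(\lambda)_n=V_{\lambda[n]}$ (type $A$) and, for a double partition $\lambda=(\lambda^+,\lambda^-)$, $V(\lambda)_n=V_{(\lambda^+[n-|\lambda^-|],\lambda^-)}$ (type $BC$), $|\lambda|=|\lambda^+|+|\lambda^-|$. An $\mathrm{FI}_A$- or $\mathrm{FI}_{BC}$-module $V$ has weight $\le d$ if for every $n$ every irreducible constituent $V(\lambda)_n$ of $V_n$ has $|\lambda|\le d$. The weight of an $\mathrm{FI}_D$-module $V$ is that of the $\mathrm{FI}_{BC}$-module $\mathrm{Ind}_D^{BC}V$, whose $n$-th term is the quotient of $\bigoplus_{r\le n}k[\mathrm{Hom}_{\mathrm{FI}_{BC}}(\mathbf{r},\mathbf{n})]\otimes_kV_r$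 by the relations $f\otimes g_*(v)=(f\circ g)\otimes v$ for all $\mathrm{FI}_D$-morphisms $g$, with $\mathrm{FI}_{BC}$-morphisms acting by postcomposition. *)

theory Defs
  imports
    "HOL-Library.Poly_Mapping"
    "HOL-Combinatorics.Permutations"
    "HOL-Algebra.Algebra"
    "HOL-Algebra.Algebraic_Closure_Type"
begin

section \<open>Linear algebra over a field given as a type\<close>

text \<open>
  The ground field is a type \<open>'k :: field\<close>. Modules and algebras over it are the carrier-based ones of
  HOL-Algebra, because quotients, duals and submodules have to be formed. For a record that is only
  used as a module the fields \<open>mult\<close> and \<open>one\<close> are meaningless.
\<close>

abbreviation scalars :: "'k::field ring"
  where "scalars \<equiv> ring_of_type_algebra"

definition lin_maps :: "('k::field, 'a) module \<Rightarrow> ('k, 'b) module \<Rightarrow> ('a \<Rightarrow> 'b) set"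
  where "lin_maps M N = {\<phi> \<in> carrier M \<rightarrow> carrier N.
     (\<forall>x\<in>carrier M. \<forall>y\<in>carrier M. \<phi> (x \<oplus>\<^bsub>M\<^esub> y) = \<phi> x \<oplus>\<^bsub>N\<^esub> \<phi> y) \<and>
     (\<forall>c. \<forall>x\<in>carrier M. \<phi> (c \<odot>\<^bsub>M\<^esub> x) = c \<odot>\<^bsub>N\<^esub> \<phi> x)}"

text \<open>Used both for the quotient of a module by a submodule and of an algebra by an ideal.\<close>

definition quot_mod :: "('k::field, 'a) module \<Rightarrow> 'a set \<Rightarrow> ('k, 'a set) module"
  where "quot_mod M N = ring.extend (M Quot N)
     \<lparr>module.smult = (\<lambda>c Z. \<Union>x\<in>Z. N +>\<^bsub>M\<^esub> (c \<odot>\<^bsub>M\<^esub> x))\<rparr>"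

text \<open>The map into \<open>quot_mod M N\<close> which \<open>\<phi>\<close> (with values in \<open>M\<close>) induces on cosets.\<close>

definition quot_map :: "('k::field, 'b) module \<Rightarrow> 'b set \<Rightarrow> ('a \<Rightarrow> 'b) \<Rightarrow> 'a set \<Rightarrow> 'b set"
  where "quot_map M N \<phi> Z = (\<Union>x\<in>Z. N +>\<^bsub>M\<^esub> \<phi> x)"

definition free_module :: "'x set \<Rightarrow> ('k::field, 'x \<Rightarrow>\<^sub>0 'k) module"
  where "free_module Z = \<lparr>carrier = {u. Poly_Mapping.keys u \<subseteq> Z}, monoid.mult = undefined, monoid.one = undefined,
     ring.zero = 0, ring.add = (+), module.smult = (\<lambda>c. Poly_Mapping.map ((*) c))\<rparr>"

definition free_map :: "('x \<Rightarrow> 'y) \<Rightarrow> ('x \<Rightarrow>\<^sub>0 'k::field) \<Rightarrow> ('y \<Rightarrow>\<^sub>0 'k)"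
  where "free_map h u =
     (\<Sum>x\<in>Poly_Mapping.keys u. Poly_Mapping.single (h x) (Poly_Mapping.lookup u x))"

definition lin_span :: "('k::field, 'a) module \<Rightarrow> 'a set \<Rightarrow> 'a set"
  where "lin_span M S = (\<lambda>U. submodule U scalars M) hull S"

text \<open>The module with generators \<open>Z\<close> and relations \<open>R\<close>, and the map into it induced by a map of
  generators.\<close>

definition presented :: "'x set \<Rightarrow> ('x \<Rightarrow>\<^sub>0 'k) set \<Rightarrow> ('k::field, ('x \<Rightarrow>\<^sub>0 'k) set) module"
  where "presented Z R = quot_mod (free_module Z) (lin_span (free_module Z) R)"

definition presented_map ::
    "'y set \<Rightarrow> ('y \<Rightarrow>\<^sub>0 'k) set \<Rightarrow> ('x \<Rightarrow> 'y) \<Rightarrow> ('x \<Rightarrow>\<^sub>0 'k) set \<Rightarrow> ('y \<Rightarrow>\<^sub>0 'k::field) set"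
  where "presented_map Y R h =
     quot_map (free_module Y) (lin_span (free_module Y) R) (free_map h)"

abbreviation gen :: "'x \<Rightarrow> ('x \<Rightarrow>\<^sub>0 'k::field)"
  where "gen x \<equiv> Poly_Mapping.single x 1"

text \<open>The tensor product over \<open>k\<close>; \<open>gen (x, y)\<close> represents \<open>x \<otimes> y\<close>.\<close>

definition tensor_rels :: "('k::field, 'a) module \<Rightarrow> ('k, 'b) module \<Rightarrow> ('a \<times> 'b \<Rightarrow>\<^sub>0 'k) set"
  where "tensor_rels M N =
     {gen (x \<oplus>\<^bsub>M\<^esub> x', y) - gen (x, y) - gen (x', y) | x x' y.
        x \<in> carrier M \<and> x' \<in> carrier M \<and> y \<in> carrier N} \<union>
     {gen (x, y \<oplus>\<^bsub>N\<^esub> y') - gen (x, y) - gen (x, y') | x y y'.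
        x \<in> carrier M \<and> y \<in> carrier N \<and> y' \<in> carrier N} \<union>
     {gen (c \<odot>\<^bsub>M\<^esub> x, y) - Poly_Mapping.single (x, y) c | c x y. x \<in> carrier M \<and> y \<in> carrier N} \<union>
     {gen (x, c \<odot>\<^bsub>N\<^esub> y) - Poly_Mapping.single (x, y) c | c x y. x \<in> carrier M \<and> y \<in> carrier N}"

definition tensor ::
    "('k::field, 'a) module \<Rightarrow> ('k, 'b) module \<Rightarrow> ('k, ('a \<times> 'b \<Rightarrow>\<^sub>0 'k) set) module"
  where "tensor M N = presented (carrier M \<times> carrier N) (tensor_rels M N)"

text \<open>The relations which turn the free module on the pairs \<open>(t, v)\<close>, \<open>v \<in> M t\<close>, into the direct sum
  over \<open>t \<in> T\<close> of the modules \<open>M t\<close>. If \<open>M t = V\<close> for all \<open>t\<close>, this is \<open>k[T] \<otimes> V\<close>, and \<open>gen (t, v)\<close>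
  represents \<open>t \<otimes> v\<close>.\<close>

definition lin_rels :: "'t set \<Rightarrow> ('t \<Rightarrow> ('k::field, 'v) module) \<Rightarrow> ('t \<times> 'v \<Rightarrow>\<^sub>0 'k) set"
  where "lin_rels T M =
     {gen (t, v \<oplus>\<^bsub>M t\<^esub> v') - gen (t, v) - gen (t, v') | t v v'.
        t \<in> T \<and> v \<in> carrier (M t) \<and> v' \<in> carrier (M t)} \<union>
     {gen (t, c \<odot>\<^bsub>M t\<^esub> v) - Poly_Mapping.single (t, v) c | c t v. t \<in> T \<and> v \<in> carrier (M t)}"


section \<open>The categories\<close>

datatype FI_type = FI_A | FI_BC | FI_D

definition ob :: "nat \<Rightarrow> int set"
  where "ob n = {a. a \<noteq> 0 \<and> \<bar>a\<bar> \<le> int n}"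

text \<open>Morphisms are extensional functions, composed by \<^const>\<open>compose\<close>. For \<open>m = n\<close> an injection is
  an isomorphism.\<close>

definition FI_hom :: "FI_type \<Rightarrow> nat \<Rightarrow> nat \<Rightarrow> (int \<Rightarrow> int) set"
  where "FI_hom W m n = {f \<in> ob m \<rightarrow>\<^sub>E ob n. inj_on f (ob m) \<and> (\<forall>a\<in>ob m. f (- a) = - f a) \<and>
     (case W of
        FI_A \<Rightarrow> \<forall>a\<in>ob m. 0 < a \<longrightarrow> 0 < f a
      | FI_BC \<Rightarrow> True
      | FI_D \<Rightarrow> m = n \<longrightarrow> even (card {a \<in> ob m. 0 < a \<and> f a < 0}))}"

text \<open>A family of modules and maps, used for both variances: for \<open>f \<in> FI_hom W m n\<close> the map
  \<open>fmap V m n f\<close> goes from \<open>fobj V m\<close> to \<open>fobj V n\<close> in the covariant case, and from \<open>fobj V n\<close> to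
  \<open>fobj V m\<close> in the contravariant (co-FI) case.\<close>

record ('k, 'v) FI_diagram =
  fobj :: "nat \<Rightarrow> ('k, 'v) module"
  fmap :: "nat \<Rightarrow> nat \<Rightarrow> (int \<Rightarrow> int) \<Rightarrow> 'v \<Rightarrow> 'v"

locale FI_module =
  fixes W :: FI_type and V :: "('k::field, 'v) FI_diagram"
  assumes is_module: "Module.module scalars (fobj V n)"
    and map_linear: "f \<in> FI_hom W m n \<Longrightarrow> fmap V m n f \<in> lin_maps (fobj V m) (fobj V n)"
    and map_id: "v \<in> carrier (fobj V n) \<Longrightarrow> fmap V n n (\<lambda>a\<in>ob n. a) v = v"
    and map_comp: "\<lbrakk>f \<in> FI_hom W l m; g \<in> FI_hom W m n; v \<in> carrier (fobj V l)\<rbrakk> \<Longrightarrow>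
       fmap V l n (compose (ob l) g f) v = fmap V m n g (fmap V l m f v)"

definition sub_FI_module :: "FI_type \<Rightarrow> ('k::field, 'v) FI_diagram \<Rightarrow> (nat \<Rightarrow> 'v set) \<Rightarrow> bool"
  where "sub_FI_module W V U \<longleftrightarrow>
     (\<forall>n. submodule (U n) scalars (fobj V n)) \<and>
     (\<forall>m n. \<forall>f\<in>FI_hom W m n. fmap V m n f ` U m \<subseteq> U n)"

definition FI_fin_gen :: "FI_type \<Rightarrow> ('k::field, 'v) FI_diagram \<Rightarrow> bool"
  where "FI_fin_gen W V \<longleftrightarrow> FI_module W V \<and>
     (\<exists>S. finite S \<and> S \<subseteq> (SIGMA n:UNIV. carrier (fobj V n)) \<and>
        (\<forall>U. sub_FI_module W V U \<and> (\<forall>(n, v)\<in>S. v \<in> U n) \<longrightarrow> (\<forall>n. U n = carrier (fobj V n))))"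

definition dual_module :: "('k::field, 'v) module \<Rightarrow> ('k, 'v \<Rightarrow> 'k) module"
  where "dual_module M =
     \<lparr>carrier = {\<phi> \<in> carrier M \<rightarrow>\<^sub>E UNIV.
        (\<forall>x\<in>carrier M. \<forall>y\<in>carrier M. \<phi> (x \<oplus>\<^bsub>M\<^esub> y) = \<phi> x + \<phi> y) \<and>
        (\<forall>c. \<forall>x\<in>carrier M. \<phi> (c \<odot>\<^bsub>M\<^esub> x) = c * \<phi> x)},
      monoid.mult = undefined, monoid.one = undefined, ring.zero = (\<lambda>x\<in>carrier M. 0),
      ring.add = (\<lambda>\<phi> \<psi>. \<lambda>x\<in>carrier M. \<phi> x + \<psi> x), module.smult = (\<lambda>c \<phi>. \<lambda>x\<in>carrier M. c * \<phi> x)\<rparr>"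

text \<open>The dual of a contravariant family is covariant.\<close>

definition dual_FI :: "('k::field, 'v) FI_diagram \<Rightarrow> ('k, 'v \<Rightarrow> 'k) FI_diagram"
  where "dual_FI V = \<lparr>fobj = (\<lambda>n. dual_module (fobj V n)),
     fmap = (\<lambda>m n f \<phi>. \<lambda>x\<in>carrier (fobj V n). \<phi> (fmap V m n f x))\<rparr>"


section \<open>Graded co-FI-algebras\<close>

text \<open>Gradings are by a subset \<open>I\<close> of a commutative monoid; \<open>P j\<close> is the piece of degree \<open>j\<close>.\<close>

definition graded_algebra ::
    "('k::field, 'a) module \<Rightarrow> 'j::comm_monoid_add set \<Rightarrow> ('j \<Rightarrow> 'a set) \<Rightarrow> bool"
  where "graded_algebra A I P \<longleftrightarrow> Module.algebra scalars A \<and>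
     (\<forall>j\<in>I. submodule (P j) scalars A) \<and>
     (\<forall>x\<in>carrier A. \<exists>!c. c \<in> PiE I P \<and> finite {j\<in>I. c j \<noteq> \<zero>\<^bsub>A\<^esub>} \<and>
        x = (\<Oplus>\<^bsub>A\<^esub> j\<in>{j\<in>I. c j \<noteq> \<zero>\<^bsub>A\<^esub>}. c j)) \<and>
     0 \<in> I \<and> \<one>\<^bsub>A\<^esub> \<in> P 0 \<and>
     (\<forall>i\<in>I. \<forall>j\<in>I. i + j \<in> I \<and> (\<forall>x\<in>P i. \<forall>y\<in>P j. x \<otimes>\<^bsub>A\<^esub> y \<in> P (i + j)))"

locale graded_co_FI_algebra =
  fixes W :: FI_type and C :: "('k::field, 'a) FI_diagram"
    and I :: "'j::comm_monoid_add set" and P :: "nat \<Rightarrow> 'j \<Rightarrow> 'a set"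
  assumes graded: "graded_algebra (fobj C n) I (P n)"
    and map_hom: "f \<in> FI_hom W m n \<Longrightarrow>
       fmap C m n f \<in> ring_hom (fobj C n) (fobj C m) \<inter> lin_maps (fobj C n) (fobj C m)"
    and map_graded: "\<lbrakk>f \<in> FI_hom W m n; j \<in> I\<rbrakk> \<Longrightarrow> fmap C m n f ` P n j \<subseteq> P m j"
    and map_id: "x \<in> carrier (fobj C n) \<Longrightarrow> fmap C n n (\<lambda>a\<in>ob n. a) x = x"
    and map_comp: "\<lbrakk>f \<in> FI_hom W l m; g \<in> FI_hom W m n; x \<in> carrier (fobj C n)\<rbrakk> \<Longrightarrow>
       fmap C l n (compose (ob l) g f) x = fmap C l m f (fmap C m n g x)"

definition graded_piece ::
    "('k::field, 'a) FI_diagram \<Rightarrow> (nat \<Rightarrow> 'j \<Rightarrow> 'a set) \<Rightarrow> 'j \<Rightarrow> ('k, 'a) FI_diagram"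
  where "graded_piece C P j =
     \<lparr>fobj = (\<lambda>n. (fobj C n)\<lparr>carrier := P n j\<rparr>), fmap = fmap C\<rparr>"

definition finite_type ::
    "FI_type \<Rightarrow> ('k::field, 'a) FI_diagram \<Rightarrow> 'j set \<Rightarrow> (nat \<Rightarrow> 'j \<Rightarrow> 'a set) \<Rightarrow> bool"
  where "finite_type W C I P \<longleftrightarrow> (\<forall>j\<in>I. FI_fin_gen W (dual_FI (graded_piece C P j)))"


section \<open>Coinvariant algebras\<close>

text \<open>The variable indexed by \<open>(i, j)\<close> is the \<open>j\<close>-th variable of the \<open>i\<close>-th copy of \<open>V\<^sub>n\<close>,
  where \<open>1 \<le> i \<le> r\<close> and \<open>1 \<le> j \<le> n\<close>.\<close>

type_synonym monomial = "nat \<times> nat \<Rightarrow>\<^sub>0 nat"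
type_synonym 'k mpoly = "monomial \<Rightarrow>\<^sub>0 'k"

definition poly_alg :: "nat \<Rightarrow> nat \<Rightarrow> ('k::field, 'k mpoly) module"
  where "poly_alg r n =
     \<lparr>carrier = {p. \<forall>m\<in>Poly_Mapping.keys p. Poly_Mapping.keys m \<subseteq> {1..r} \<times> {1..n}},
      monoid.mult = (*), monoid.one = 1, ring.zero = 0, ring.add = (+), module.smult = (\<lambda>c. Poly_Mapping.map ((*) c))\<rparr>"

definition mpoly_subst :: "(nat \<times> nat \<Rightarrow> 'k mpoly) \<Rightarrow> 'k mpoly \<Rightarrow> 'k::field mpoly"
  where "mpoly_subst \<sigma> p = (\<Sum>m\<in>Poly_Mapping.keys p.
     Poly_Mapping.single 0 (Poly_Mapping.lookup p m) *
     (\<Prod>v\<in>Poly_Mapping.keys m. \<sigma> v ^ Poly_Mapping.lookup m v))"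

text \<open>Variables with signed second index: \<open>x\<^sub>-\<^sub>a = - x\<^sub>a\<close>, and \<open>x\<^sub>0 = 0\<close>.\<close>

definition svar :: "nat \<Rightarrow> int \<Rightarrow> 'k::field mpoly"
  where "svar i a =
     Poly_Mapping.single (Poly_Mapping.single (i, nat \<bar>a\<bar>) 1) (of_int (sgn a))"

text \<open>The diagonal action of a signed permutation, \<open>w \<cdot> x\<^sub>j = x\<^sub>w\<^sub>(\<^sub>j\<^sub>)\<close>.\<close>

definition poly_act :: "(int \<Rightarrow> int) \<Rightarrow> 'k mpoly \<Rightarrow> 'k::field mpoly"
  where "poly_act w = mpoly_subst (\<lambda>(i, j). svar i (w (int j)))"

text \<open>The contravariant map of \<open>f : m \<rightarrow> n\<close> sends \<open>x\<^sub>j\<close> to \<open>x\<^sub>a\<close> if \<open>f a = j\<close>, and to \<open>0\<close> if \<open>j\<close> is not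
  in the image of \<open>f\<close>. For \<open>f\<close> in the group this is the action of the inverse of \<open>f\<close>, and for the
  natural inclusion it puts the last variables to zero.\<close>

definition poly_pull :: "nat \<Rightarrow> (int \<Rightarrow> int) \<Rightarrow> 'k mpoly \<Rightarrow> 'k::field mpoly"
  where "poly_pull m f = mpoly_subst (\<lambda>(i, j).
     svar i (if int j \<in> f ` ob m then inv_into (ob m) f (int j) else 0))"

text \<open>These facts characterize the two maps on variables; on \<open>FI_hom W n n\<close> they are mutually inverse.\<close>

lemma mpoly_subst_svar:
  "mpoly_subst \<sigma> (svar i a) = Poly_Mapping.single 0 (of_int (sgn a)) * \<sigma> (i, nat \<bar>a\<bar>)"
  by (cases "a = 0"; cases "0 < a") (simp_all add: mpoly_subst_def svar_def)

lemma svar_uminus: "svar i (- a) = - svar i a"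
  by (simp add: svar_def sgn_minus single_uminus)

lemma poly_act_svar:
  assumes "w \<in> FI_hom W n n" "a \<in> ob n"
  shows "poly_act w (svar i a) = svar i (w a)"
proof (cases "0 < a")
  case True
  then show ?thesis by (simp add: poly_act_def mpoly_subst_svar)
next
  case False
  then have "a < 0" using assms(2) by (auto simp: ob_def)
  moreover have "w (- a) = - w a" using assms by (auto simp: FI_hom_def)
  ultimately show ?thesis
    by (simp add: poly_act_def mpoly_subst_svar svar_uminus single_uminus)
qed

lemma poly_pull_svar:
  assumes f: "f \<in> FI_hom W m n" and a: "a \<in> ob m"
  shows "poly_pull m f (svar i (f a)) = svar i a"
proof -
  have inv: "inv_into (ob m) f (f b) = b" if "b \<in> ob m" for b
    using f that by (auto simp: FI_hom_def)
  have a': "- a \<in> ob m" and fa: "f (- a) = - f a" and n0: "f a \<noteq> 0"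
    using f a by (auto simp: FI_hom_def ob_def Pi_def PiE_def)
  show ?thesis
  proof (cases "0 < f a")
    case True
    then show ?thesis using inv[OF a] a by (simp add: poly_pull_def mpoly_subst_svar)
  next
    case False
    then have neg: "f a < 0" using n0 by simp
    then have "int (nat \<bar>f a\<bar>) = f (- a)" using fa by simp
    then show ?thesis using inv[OF a'] a' neg
      by (simp add: poly_pull_def mpoly_subst_svar svar_uminus single_uminus)
  qed
qed

lemma poly_pull_svar_0:
  assumes "0 < j" "j \<notin> f ` ob m"
  shows "poly_pull m f (svar i j) = 0"
proof -
  have "svar i 0 = (0 :: 'a mpoly)" by (simp add: svar_def)
  then show ?thesis using assms by (simp add: poly_pull_def mpoly_subst_svar)
qed

definition coinv_ideal :: "FI_type \<Rightarrow> nat \<Rightarrow> nat \<Rightarrow> 'k::field mpoly set"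
  where "coinv_ideal W r n = genideal (poly_alg r n)
     {p \<in> carrier (poly_alg r n).
        (\<forall>w\<in>FI_hom W n n. poly_act w p = p) \<and> Poly_Mapping.lookup p 0 = 0}"

definition coinv :: "FI_type \<Rightarrow> nat \<Rightarrow> ('k::field, 'k mpoly set) FI_diagram"
  where "coinv W r =
     \<lparr>fobj = (\<lambda>n. quot_mod (poly_alg r n) (coinv_ideal W r n)),
      fmap = (\<lambda>m n f. quot_map (poly_alg r m) (coinv_ideal W r m) (poly_pull m f))\<rparr>"

text \<open>For a degree function \<open>dg\<close> on monomials: the classes of the polynomials that are homogeneous
  of degree \<open>j\<close>.\<close>

definition coinv_piece ::
    "(monomial \<Rightarrow> 'j) \<Rightarrow> FI_type \<Rightarrow> nat \<Rightarrow> nat \<Rightarrow> 'j \<Rightarrow> 'k::field mpoly set set"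
  where "coinv_piece dg W r n j =
     {coinv_ideal W r n +>\<^bsub>poly_alg r n\<^esub> p | p.
        p \<in> carrier (poly_alg r n) \<and> (\<forall>m\<in>Poly_Mapping.keys p. dg m = j)}"

text \<open>Multidegrees \<open>(j\<^sub>1, \<dots>, j\<^sub>r)\<close> are finitely supported functions supported on \<open>{1..r}\<close>.\<close>

definition multidegs :: "nat \<Rightarrow> (nat \<Rightarrow>\<^sub>0 nat) set"
  where "multidegs r = {J. Poly_Mapping.keys J \<subseteq> {1..r}}"

definition size_multideg :: "(nat \<Rightarrow>\<^sub>0 nat) \<Rightarrow> nat"
  where "size_multideg J = (\<Sum>i\<in>Poly_Mapping.keys J. Poly_Mapping.lookup J i)"

definition multideg :: "monomial \<Rightarrow> nat \<Rightarrow>\<^sub>0 nat"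
  where "multideg m =
     (\<Sum>v\<in>Poly_Mapping.keys m. Poly_Mapping.single (fst v) (Poly_Mapping.lookup m v))"

definition total_deg :: "monomial \<Rightarrow> nat"
  where "total_deg m = (\<Sum>v\<in>Poly_Mapping.keys m. Poly_Mapping.lookup m v)"


section \<open>Irreducible representations in characteristic zero\<close>

definition is_partition :: "nat list \<Rightarrow> bool"
  where "is_partition \<mu> \<longleftrightarrow> sorted_wrt (\<ge>) \<mu> \<and> 0 \<notin> set \<mu>"

definition first_part :: "nat list \<Rightarrow> nat"
  where "first_part \<mu> = (case \<mu> of [] \<Rightarrow> 0 | a # _ \<Rightarrow> a)"

text \<open>\<open>\<mu>[n]\<close>, meaningful when \<open>sum_list \<mu> + first_part \<mu> \<le> n\<close>. For \<open>n = 0\<close> it is \<open>[0]\<close>, whose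
  Young diagram is empty.\<close>

definition pad :: "nat list \<Rightarrow> nat \<Rightarrow> nat list"
  where "pad \<mu> n = (n - sum_list \<mu>) # \<mu>"

text \<open>The canonical tableau: the numbers \<open>1, 2, \<dots>\<close> are put into the cells (row, column) row by row.\<close>

definition cells :: "nat list \<Rightarrow> (nat \<times> nat) list"
  where "cells \<mu> = concat (map (\<lambda>i. map (\<lambda>j. (i, j)) [0..<\<mu> ! i]) [0..<length \<mu>])"

definition cell :: "nat list \<Rightarrow> nat \<Rightarrow> nat \<times> nat"
  where "cell \<mu> t = cells \<mu> ! (t - 1)"

definition sym_grp :: "nat \<Rightarrow> (nat \<Rightarrow> nat) set"
  where "sym_grp n = {p. p permutes {1..n}}"

definition row_group :: "nat list \<Rightarrow> (nat \<Rightarrow> nat) set"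
  where "row_group \<mu> = {p \<in> sym_grp (sum_list \<mu>).
     \<forall>t\<in>{1..sum_list \<mu>}. fst (cell \<mu> (p t)) = fst (cell \<mu> t)}"

definition col_group :: "nat list \<Rightarrow> (nat \<Rightarrow> nat) set"
  where "col_group \<mu> = {q \<in> sym_grp (sum_list \<mu>).
     \<forall>t\<in>{1..sum_list \<mu>}. snd (cell \<mu> (q t)) = snd (cell \<mu> t)}"

type_synonym 'k grp_alg = "(nat \<Rightarrow> nat) \<Rightarrow>\<^sub>0 'k"

text \<open>The Young symmetrizer \<open>c\<^sub>\<mu> = a\<^sub>\<mu> b\<^sub>\<mu>\<close>, the left multiplication on the group algebra, and
  \<open>V\<^sub>\<mu> = k[S\<^sub>n] c\<^sub>\<mu>\<close>.\<close>

definition young_sym :: "nat list \<Rightarrow> 'k::field grp_alg"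
  where "young_sym \<mu> = (\<Sum>p\<in>row_group \<mu>. \<Sum>q\<in>col_group \<mu>.
     Poly_Mapping.single (p \<circ> q) (of_int (sign q)))"

definition sym_act :: "(nat \<Rightarrow> nat) \<Rightarrow> 'k grp_alg \<Rightarrow> 'k::field grp_alg"
  where "sym_act g = free_map ((\<circ>) g)"

definition S_irr :: "nat list \<Rightarrow> ('k::field, 'k grp_alg) module"
  where "S_irr \<mu> = (let A = free_module (sym_grp (sum_list \<mu>)) in
     A\<lparr>carrier := lin_span A {sym_act g (young_sym \<mu>) | g. g \<in> sym_grp (sum_list \<mu>)}\<rparr>)"

text \<open>The surjection \<open>B\<^sub>n \<rightarrow> S\<^sub>n\<close> (on \<open>FI_hom FI_A n n\<close> it is the identification with \<open>S\<^sub>n\<close>) and the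
  character of \<open>B\<^sub>n\<close> with kernel \<open>D\<^sub>n\<close>.\<close>

definition to_perm :: "nat \<Rightarrow> (int \<Rightarrow> int) \<Rightarrow> nat \<Rightarrow> nat"
  where "to_perm n w i = (if i \<in> {1..n} then nat \<bar>w (int i)\<bar> else i)"

definition eps :: "nat \<Rightarrow> (int \<Rightarrow> int) \<Rightarrow> int"
  where "eps n w = (- 1) ^ card {a \<in> ob n. 0 < a \<and> w a < 0}"

lemma eps_ker: "FI_hom FI_D n n = {w \<in> FI_hom FI_BC n n. eps n w = 1}"
  by (auto simp: FI_hom_def eps_def minus_one_power_iff split: if_splits)

text \<open>\<open>V\<^bsub>(\<mu>,\<emptyset>)\<^esub>\<close> and \<open>V\<^bsub>(\<emptyset>,\<nu>)\<^esub>\<close> have the underlying spaces \<open>V\<^sub>\<mu>\<close> and \<open>V\<^sub>\<nu>\<close>, with the following actions.\<close>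

definition plus_act :: "nat list \<Rightarrow> (int \<Rightarrow> int) \<Rightarrow> 'k grp_alg \<Rightarrow> 'k::field grp_alg"
  where "plus_act \<mu> w = sym_act (to_perm (sum_list \<mu>) w)"

definition minus_act :: "nat list \<Rightarrow> (int \<Rightarrow> int) \<Rightarrow> 'k grp_alg \<Rightarrow> 'k::field grp_alg"
  where "minus_act \<nu> w x = of_int (eps (sum_list \<nu>) w) \<odot>\<^bsub>S_irr \<nu>\<^esub> sym_act (to_perm (sum_list \<nu>) w) x"

text \<open>\<open>B\<^sub>m \<times> B\<^sub>l\<close> as a subgroup of \<open>B\<^bsub>m+l\<^esub>\<close>, with its two projections.\<close>

definition B_sub :: "nat \<Rightarrow> nat \<Rightarrow> (int \<Rightarrow> int) set"
  where "B_sub m l = {w \<in> FI_hom FI_BC (m + l) (m + l). w ` ob m = ob m}"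

definition B_left :: "nat \<Rightarrow> (int \<Rightarrow> int) \<Rightarrow> int \<Rightarrow> int"
  where "B_left m w = restrict w (ob m)"

definition B_right :: "nat \<Rightarrow> nat \<Rightarrow> (int \<Rightarrow> int) \<Rightarrow> int \<Rightarrow> int"
  where "B_right m l w =
     (\<lambda>a\<in>ob l. let b = w (a + sgn a * int m) in b - sgn b * int m)"

type_synonym 'k tens = "('k grp_alg \<times> 'k grp_alg \<Rightarrow>\<^sub>0 'k) set"

definition box_mod :: "nat list \<Rightarrow> nat list \<Rightarrow> ('k::field, 'k tens) module"
  where "box_mod \<mu> \<nu> = tensor (S_irr \<mu>) (S_irr \<nu>)"

definition box_act :: "nat list \<Rightarrow> nat list \<Rightarrow> (int \<Rightarrow> int) \<Rightarrow> 'k tens \<Rightarrow> 'k::field tens"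
  where "box_act \<mu> \<nu> w =
     presented_map (carrier (S_irr \<mu>) \<times> carrier (S_irr \<nu>)) (tensor_rels (S_irr \<mu>) (S_irr \<nu>))
       (map_prod (plus_act \<mu> (B_left (sum_list \<mu>) w))
                 (minus_act \<nu> (B_right (sum_list \<mu>) (sum_list \<nu>) w)))"

text \<open>The representation induced from a subgroup \<open>H\<close> of \<open>G\<close> is \<open>k[G] \<otimes>\<^bsub>k[H]\<^esub> V\<close>. Here \<open>G = B\<^sub>n\<close>.\<close>

definition ind_gens :: "nat \<Rightarrow> ('k::field, 'v) module \<Rightarrow> ((int \<Rightarrow> int) \<times> 'v) set"
  where "ind_gens n V = FI_hom FI_BC n n \<times> carrier V"

definition ind_rels :: "nat \<Rightarrow> (int \<Rightarrow> int) set \<Rightarrow> ('k::field, 'v) module \<Rightarrow>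
    ((int \<Rightarrow> int) \<Rightarrow> 'v \<Rightarrow> 'v) \<Rightarrow> ((int \<Rightarrow> int) \<times> 'v \<Rightarrow>\<^sub>0 'k) set"
  where "ind_rels n H V \<rho> = lin_rels (FI_hom FI_BC n n) (\<lambda>_. V) \<union>
     {gen (compose (ob n) g h, v) - gen (g, \<rho> h v) | g h v.
        g \<in> FI_hom FI_BC n n \<and> h \<in> H \<and> v \<in> carrier V}"

type_synonym 'k birr = "((int \<Rightarrow> int) \<times> 'k tens \<Rightarrow>\<^sub>0 'k) set"

definition B_irr :: "nat list \<Rightarrow> nat list \<Rightarrow> ('k::field, 'k birr) module"
  where "B_irr \<mu> \<nu> = (let m = sum_list \<mu>; l = sum_list \<nu>; V = box_mod \<mu> \<nu> in
     presented (ind_gens (m + l) V) (ind_rels (m + l) (B_sub m l) V (box_act \<mu> \<nu>)))"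

definition B_act :: "nat list \<Rightarrow> nat list \<Rightarrow> (int \<Rightarrow> int) \<Rightarrow> 'k birr \<Rightarrow> 'k::field birr"
  where "B_act \<mu> \<nu> w = (let m = sum_list \<mu>; l = sum_list \<nu>; V = box_mod \<mu> \<nu> in
     presented_map (ind_gens (m + l) V) (ind_rels (m + l) (B_sub m l) V (box_act \<mu> \<nu>))
       (\<lambda>(g, v). (compose (ob (m + l)) w g, v)))"


section \<open>Weight\<close>

text \<open>The representation \<open>M\<close> (with action \<open>\<rho>\<close>) is isomorphic to a subrepresentation of \<open>N\<close> (with
  action \<open>\<tau>\<close>). In characteristic zero and for finite groups these are, for irreducible \<open>M\<close>, the
  irreducible constituents.\<close>

definition constituent :: "'g set \<Rightarrow> ('k::field, 'a) module \<Rightarrow> ('g \<Rightarrow> 'a \<Rightarrow> 'a) \<Rightarrow>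
    ('k, 'b) module \<Rightarrow> ('g \<Rightarrow> 'b \<Rightarrow> 'b) \<Rightarrow> bool"
  where "constituent G M \<rho> N \<tau> \<longleftrightarrow> (\<exists>\<phi>\<in>lin_maps M N. inj_on \<phi> (carrier M) \<and>
     (\<forall>g\<in>G. \<forall>x\<in>carrier M. \<phi> (\<rho> g x) = \<tau> g (\<phi> x)))"

definition weight_le_A :: "('k::field, 'v) FI_diagram \<Rightarrow> nat \<Rightarrow> bool"
  where "weight_le_A V d \<longleftrightarrow> (\<forall>n \<mu>.
     is_partition \<mu> \<and> sum_list \<mu> + first_part \<mu> \<le> n \<and>
     constituent (FI_hom FI_A n n) (S_irr (pad \<mu> n)) (\<lambda>w. sym_act (to_perm n w))
       (fobj V n) (fmap V n n) \<longrightarrow>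
     sum_list \<mu> \<le> d)"

definition weight_le_BC :: "('k::field, 'v) FI_diagram \<Rightarrow> nat \<Rightarrow> bool"
  where "weight_le_BC V d \<longleftrightarrow> (\<forall>n \<mu> \<nu>.
     is_partition \<mu> \<and> is_partition \<nu> \<and> sum_list \<nu> + sum_list \<mu> + first_part \<mu> \<le> n \<and>
     constituent (FI_hom FI_BC n n) (B_irr (pad \<mu> (n - sum_list \<nu>)) \<nu>)
       (B_act (pad \<mu> (n - sum_list \<nu>)) \<nu>) (fobj V n) (fmap V n n) \<longrightarrow>
     sum_list \<mu> + sum_list \<nu> \<le> d)"

text \<open>The generator \<open>((s, f), v)\<close> represents \<open>f \<otimes> v\<close> with \<open>f : s \<rightarrow> n\<close> and \<open>v \<in> V\<^sub>s\<close>; such \<open>f\<close> exist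
  only for \<open>s \<le> n\<close>.\<close>

definition IndD_index :: "nat \<Rightarrow> (nat \<times> (int \<Rightarrow> int)) set"
  where "IndD_index n = (SIGMA s:{..n}. FI_hom FI_BC s n)"

definition IndD_gens ::
    "('k::field, 'v) FI_diagram \<Rightarrow> nat \<Rightarrow> ((nat \<times> (int \<Rightarrow> int)) \<times> 'v) set"
  where "IndD_gens V n = (SIGMA t:IndD_index n. carrier (fobj V (fst t)))"

definition IndD_rels ::
    "('k::field, 'v) FI_diagram \<Rightarrow> nat \<Rightarrow> ((nat \<times> (int \<Rightarrow> int)) \<times> 'v \<Rightarrow>\<^sub>0 'k) set"
  where "IndD_rels V n = lin_rels (IndD_index n) (\<lambda>t. fobj V (fst t)) \<union>
     {gen ((s, f), fmap V q s g v) - gen ((q, compose (ob q) f g), v) | q s f g v.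
        f \<in> FI_hom FI_BC s n \<and> g \<in> FI_hom FI_D q s \<and> v \<in> carrier (fobj V q)}"

definition IndD :: "('k::field, 'v) FI_diagram \<Rightarrow>
    ('k, ((nat \<times> (int \<Rightarrow> int)) \<times> 'v \<Rightarrow>\<^sub>0 'k) set) FI_diagram"
  where "IndD V = \<lparr>fobj = (\<lambda>n. presented (IndD_gens V n) (IndD_rels V n)),
     fmap = (\<lambda>m n h. presented_map (IndD_gens V n) (IndD_rels V n)
       (\<lambda>((s, f), v). ((s, compose (ob s) h f), v)))\<rparr>"

definition weight_le :: "FI_type \<Rightarrow> ('k::field, 'v) FI_diagram \<Rightarrow> nat \<Rightarrow> bool"
  where "weight_le W V d = (case W of
     FI_A \<Rightarrow> weight_le_A V d | FI_BC \<Rightarrow> weight_le_BC V d | FI_D \<Rightarrow> weight_le_BC (IndD V) d)"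

definition co_weight_le :: "FI_type \<Rightarrow> ('k::field, 'v) FI_diagram \<Rightarrow> nat \<Rightarrow> bool"
  where "co_weight_le W V d = weight_le W (dual_FI V) d"

end

theory Submission
  imports
    Defs
    "HOL-Library.Product_Lexorder"
    "HOL-Library.Infinite_Set"
begin

text \<open>
  Monomials are transported along signed injections, and \<open>f\<close> pulls the transport of \<open>M\<close> along \<open>f\<close> back
  to \<open>\<plusminus>M\<close> and all other monomials to \<open>0\<close>. If \<open>p\<close> is invariant under \<open>D\<^sub>n\<close> and \<open>f : m \<rightarrow> n\<close> with
  \<open>m < n\<close>, then \<open>f\<^sup>* p\<close> is invariant under \<open>B\<^sub>m\<close>, because the sign of an extension of an element of
  \<open>B\<^sub>m\<close> can be corrected at a point outside the image. Hence the ideals are stable under the pullbacks.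

  An element of the dual of a piece is a function on monomials which vanishes on the ideal. Its leading
  monomial is a word with boundedly many nonzero letters from a finite alphabet, up to insertion of
  zeros. By Dickson's lemma these words are well-quasi-ordered, so finitely many leading monomials, and
  hence finitely many elements, generate.

  For the weight, an irreducible constituent contains a vector which is antisymmetric along the columns
  of the Young diagrams. As a function on monomials it is supported where each column of the diagram has
  at most one cell whose variables do not occur, and the eigenvalues of the sign changes determine the
  parities of the exponents. Counting gives the bound in types \<open>A\<close> and \<open>BC\<close>.

  In type \<open>D\<close> the induced module is \<open>1 \<otimes> V\<^sub>n + s \<otimes> V\<^sub>n\<close> for a sign change \<open>s\<close>. If the constituent were
  too large, averaging would write a multiple of such a vector as \<open>1 \<otimes> y\<^sub>0 + s \<otimes> y\<^sub>1\<close> with \<open>y\<^sub>0\<close>,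
  \<open>y\<^sub>1\<close> of opposite parity to the one in type \<open>BC\<close>. These come from \<open>V\<^bsub>n-1\<^esub>\<close>, as every even invariant
  in \<open>n - 1\<close> variables lifts to \<open>n\<close> variables, so that \<open>s \<otimes> y\<^sub>i = 1 \<otimes> s y\<^sub>i\<close>. This contradicts the
  eigenvalue of \<open>s\<close>.
\<close>

text \<open>The hard case is type D. Restricted to D_n, the double partitions (\<lambda>,\<nu>) and
  (\<nu>,\<lambda>) give the same representation, so the parities of the exponents are known only up
  to a simultaneous change. The parity of type BC is excluded by the degree count of that type. For
  the opposite parity the count fails, and the vector must be shown to come from n - 1 variables.
  The obstacle is that D_{n-1} has further invariants, such as x_1...x_{n-1} for r = 1, which do not
  lift. Degree deals with them: a multiple of such a term in degree d < n has n - 1 columns of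
  degree one, so d = n - 1, and the parities then force m = n - 1, which the size of the constituent
  excludes for d > 0. The preimage is the given function read on monomials with an empty column
  deleted, divided by the number of empty columns that could have been deleted. Its translates have
  to agree for this to work, so only columns that the vector treats symmetrically may be deleted:
  those of the cells of \<nu> that are alone in their column of the diagram. The same degree count
  shows that one of them is empty.\<close>

abbreviation scale :: "'k::field \<Rightarrow> ('x \<Rightarrow>\<^sub>0 'k) \<Rightarrow> ('x \<Rightarrow>\<^sub>0 'k)"
  where "scale c \<equiv> Poly_Mapping.map ((*) c)"

section \<open>Finitely supported functions: scaling, linear extension, change of generators\<close>

lemma lookup_scale [simp]: "Poly_Mapping.lookup (scale c p) x = c * Poly_Mapping.lookup p x"
  by transfer (simp add: when_def)

lemma scale_add: "scale c (p + q) = scale c p + scale c q"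
  by (rule poly_mapping_eqI) (simp add: lookup_add distrib_left)

lemma add_scale: "scale (c + d) p = scale c p + scale d p"
  by (rule poly_mapping_eqI) (simp add: lookup_add distrib_right)

lemma scale_scale: "scale c (scale d p) = scale (c * d) p"
  by (rule poly_mapping_eqI) (simp add: mult.assoc)

lemma scale_1: "scale 1 p = p"
  by (rule poly_mapping_eqI) simp

lemma scale_zero: "scale c 0 = 0"
  by (rule poly_mapping_eqI) simp

lemma scale_uminus_1: "scale (- 1) p = - p"
  by (rule poly_mapping_eqI) simp

lemma scale_single: "scale c (Poly_Mapping.single x d) = Poly_Mapping.single x (c * d)"
  by (rule poly_mapping_eqI) (simp add: lookup_single when_def)

lemma keys_scale: "Poly_Mapping.keys (scale c p) \<subseteq> Poly_Mapping.keys p"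
  by (auto simp: in_keys_iff)

lemma sum_singles: "(\<Sum>x\<in>Poly_Mapping.keys p. Poly_Mapping.single x (Poly_Mapping.lookup p x)) = p"
proof (rule poly_mapping_eqI)
  fix k
  show "Poly_Mapping.lookup (\<Sum>x\<in>Poly_Mapping.keys p. Poly_Mapping.single x (Poly_Mapping.lookup p x)) k
    = Poly_Mapping.lookup p k"
    by (cases "k \<in> Poly_Mapping.keys p")
      (auto simp: lookup_sum lookup_single when_def sum.delta in_keys_iff)
qed

text \<open>The support condition is kept for both summands, so that linear statements about a
  carrier reduce to single terms.\<close>

lemma poly_mapping_add_induct [consumes 1, case_names zero single add]:
  fixes p :: "'a \<Rightarrow>\<^sub>0 'b::comm_monoid_add"
  assumes "Poly_Mapping.keys p \<subseteq> Z"
    and "P 0"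
    and "\<And>x c. x \<in> Z \<Longrightarrow> P (Poly_Mapping.single x c)"
    and "\<And>p q. \<lbrakk>Poly_Mapping.keys p \<subseteq> Z; Poly_Mapping.keys q \<subseteq> Z; P p; P q\<rbrakk> \<Longrightarrow> P (p + q)"
  shows "P p"
proof -
  \<comment> \<open>The bound on the keys is proved along with \<open>P\<close>, because the rule
    for sums demands it of both summands.\<close>
  have "finite K \<Longrightarrow> K \<subseteq> Z \<Longrightarrow>
      P (\<Sum>x\<in>K. Poly_Mapping.single x (g x)) \<and>
      Poly_Mapping.keys (\<Sum>x\<in>K. Poly_Mapping.single x (g x)) \<subseteq> Z" for K and g :: "'a \<Rightarrow> 'b"
  proof (induction K rule: finite_induct)
    case (insert x K)
    have "Poly_Mapping.keys (Poly_Mapping.single x (g x)) \<subseteq> Z"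
      using insert.prems by (simp add: keys_single)
    with insert have keys: "Poly_Mapping.keys (Poly_Mapping.single x (g x) +
        (\<Sum>x\<in>K. Poly_Mapping.single x (g x))) \<subseteq> Z"
      by (intro order.trans[OF keys_add]) auto
    have "P (Poly_Mapping.single x (g x) + (\<Sum>x\<in>K. Poly_Mapping.single x (g x)))"
      using insert assms(3)[of x "g x"] by (intro assms(4)) (auto simp: keys_single)
    with keys show ?case using insert.hyps by simp
  qed (simp add: assms(2))
  from this[OF finite_keys assms(1), of "Poly_Mapping.lookup p"] show ?thesis
    by (simp add: sum_singles)
qed

text \<open>Every functional below, on free modules and on polynomials alike, is given by a function
  on the generators or monomials and extended in this way.\<close>

definition lin_ext :: "('x \<Rightarrow> 'k) \<Rightarrow> ('x \<Rightarrow>\<^sub>0 'k) \<Rightarrow> 'k::field"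
  where "lin_ext F u = (\<Sum>x\<in>Poly_Mapping.keys u. Poly_Mapping.lookup u x * F x)"

lemma lin_ext_add: "lin_ext F (u + v) = lin_ext F u + lin_ext F v"
  unfolding lin_ext_def by (rule setsum_keys_plus_distrib) (auto simp: distrib_right)

lemma lin_ext_zero [simp]: "lin_ext F 0 = 0"
  by (simp add: lin_ext_def)

lemma lin_ext_single [simp]: "lin_ext F (Poly_Mapping.single x c) = c * F x"
  by (simp add: lin_ext_def)

lemma lin_ext_superset:
  assumes "finite A" "Poly_Mapping.keys u \<subseteq> A"
  shows "lin_ext F u = (\<Sum>x\<in>A. Poly_Mapping.lookup u x * F x)"
  unfolding lin_ext_def by (rule sum.mono_neutral_left) (use assms in \<open>auto simp: in_keys_iff\<close>)

lemma lin_ext_scale: "lin_ext F (scale c u) = c * lin_ext F u"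
  using lin_ext_superset[OF finite_keys keys_scale, of F c u]
  by (simp add: lin_ext_def sum_distrib_left mult.assoc)

lemma lin_ext_uminus: "lin_ext F (- u) = - lin_ext F u"
  using lin_ext_scale[of F "- 1" u] by (simp add: scale_uminus_1)

lemma lin_ext_diff: "lin_ext F (u - v) = lin_ext F u - lin_ext F v"
  using lin_ext_add[of F u "- v"] by (simp add: lin_ext_uminus)

lemma lin_ext_cong: "(\<And>x. x \<in> Poly_Mapping.keys u \<Longrightarrow> F x = G x) \<Longrightarrow> lin_ext F u = lin_ext G u"
  by (simp add: lin_ext_def)

lemma free_map_add: "free_map h (u + v) = free_map h u + free_map h v"
  unfolding free_map_def by (rule setsum_keys_plus_distrib) (auto simp: single_add)

lemma free_map_zero [simp]: "free_map h 0 = 0"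
  by (simp add: free_map_def)

lemma free_map_single [simp]: "free_map h (Poly_Mapping.single x c) = Poly_Mapping.single (h x) c"
  by (cases "c = 0") (simp_all add: free_map_def)

lemma free_map_uminus: "free_map h (- u) = - free_map h u"
  using free_map_add[of h u "- u"] by (simp add: eq_neg_iff_add_eq_0 add.commute)

lemma free_map_diff: "free_map h (u - v) = free_map h u - free_map h v"
  using free_map_add[of h u "- v"] by (simp add: free_map_uminus)

lemma free_map_scale: "free_map h (scale c u) = scale c (free_map h u)"
  by (induction u rule: poly_mapping_add_induct[OF subset_UNIV])
    (auto simp: scale_zero scale_single scale_add free_map_add)

lemma free_map_keys: "Poly_Mapping.keys (free_map h u) \<subseteq> h ` Poly_Mapping.keys u"
  unfolding free_map_def
  by (rule order.trans[OF keys_sum]) (auto simp: keys_single split: if_splits)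

lemma free_map_comp: "free_map g (free_map h u) = free_map (g \<circ> h) u"
  by (induction u rule: poly_mapping_add_induct[OF subset_UNIV]) (auto simp: free_map_add)

lemma free_map_cong:
  "(\<And>x. x \<in> Poly_Mapping.keys u \<Longrightarrow> g x = h x) \<Longrightarrow> free_map g u = free_map h u"
  by (simp add: free_map_def)

lemma free_map_id: "free_map (\<lambda>x. x) u = u"
  by (simp add: free_map_def sum_singles)

section \<open>Modules of formal linear combinations and their quotients\<close>

lemma scalars_simps [simp]:
  "carrier (scalars :: 'k::field ring) = UNIV" "monoid.mult (scalars :: 'k ring) = (*)"
  "monoid.one (scalars :: 'k ring) = 1" "ring.zero (scalars :: 'k ring) = 0" "add (scalars :: 'k ring) = (+)"
  by (auto simp: ring_of_type_algebra_def)

lemma scalars_cring: "cring (scalars :: 'k::field ring)"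
  by (rule cring_from_type_algebra)

text \<open>As modules, \<open>free_module Z\<close> and \<open>poly_alg r n\<close> are both spaces
  of finitely supported functions with prescribed keys; the locale treats them together.\<close>

locale pm_module =
  fixes M :: "('k::field, 'x \<Rightarrow>\<^sub>0 'k) module" and Z :: "'x set"
  assumes carrier_eq: "carrier M = {u. Poly_Mapping.keys u \<subseteq> Z}"
    and add_eq [simp]: "add M = (+)" and zero_eq [simp]: "ring.zero M = 0"
    and smult_eq [simp]: "module.smult M = scale"
begin

lemma add_closed: "u \<in> carrier M \<Longrightarrow> v \<in> carrier M \<Longrightarrow> u + v \<in> carrier M"
  using keys_add by (fastforce simp: carrier_eq)

lemma scale_closed: "u \<in> carrier M \<Longrightarrow> scale c u \<in> carrier M"
  using keys_scale by (fastforce simp: carrier_eq)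

lemma zero_closed: "0 \<in> carrier M"
  by (simp add: carrier_eq)

lemma uminus_closed: "u \<in> carrier M \<Longrightarrow> - u \<in> carrier M"
  using scale_closed[of u "- 1"] by (simp add: scale_uminus_1)

lemma diff_closed: "u \<in> carrier M \<Longrightarrow> v \<in> carrier M \<Longrightarrow> u - v \<in> carrier M"
  using add_closed[of u "- v"] uminus_closed[of v] by simp

lemma single_closed: "x \<in> Z \<Longrightarrow> Poly_Mapping.single x c \<in> carrier M"
  by (simp add: carrier_eq keys_single)

lemma sum_closed: "(\<And>a. a \<in> A \<Longrightarrow> f a \<in> carrier M) \<Longrightarrow> sum f A \<in> carrier M"
  by (induction A rule: infinite_finite_induct) (auto intro: add_closed zero_closed)

lemma is_abelian_group: "abelian_group M"
proof (rule abelian_groupI)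
  fix x assume "x \<in> carrier M"
  then show "\<exists>y\<in>carrier M. y \<oplus>\<^bsub>M\<^esub> x = \<zero>\<^bsub>M\<^esub>"
    by (intro bexI[of _ "- x"]) (auto intro: uminus_closed)
qed (auto simp: add_closed zero_closed algebra_simps)

lemma is_module: "Module.module scalars M"
  by (rule moduleI)
    (auto simp: scalars_cring is_abelian_group scale_closed add_scale scale_add scale_scale scale_1)

end

text \<open>The conditions on a submodule, written for finitely supported functions;
  \<open>submodule_iff\<close> identifies them with the notion of the library. Spans of relations
  and ideals of polynomials are both instances.\<close>

locale pm_quotient = pm_module M Z for M :: "('k::field, 'x \<Rightarrow>\<^sub>0 'k) module" and Z +
  fixes N :: "('x \<Rightarrow>\<^sub>0 'k) set"
  assumes sub_carrier: "N \<subseteq> carrier M"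
    and sub_zero: "0 \<in> N"
    and sub_add: "u \<in> N \<Longrightarrow> v \<in> N \<Longrightarrow> u + v \<in> N"
    and sub_scale: "u \<in> N \<Longrightarrow> scale c u \<in> N"
begin

abbreviation cls where "cls p \<equiv> N +>\<^bsub>M\<^esub> p"

lemma sub_uminus: "u \<in> N \<Longrightarrow> - u \<in> N"
  using sub_scale[of u "- 1"] by (simp add: scale_uminus_1)

lemma sub_diff: "u \<in> N \<Longrightarrow> v \<in> N \<Longrightarrow> u - v \<in> N"
  using sub_add[of u "- v"] sub_uminus[of v] by simp

lemma sub_sum: "(\<And>a. a \<in> A \<Longrightarrow> f a \<in> N) \<Longrightarrow> sum f A \<in> N"
  by (induction A rule: infinite_finite_induct) (auto intro: sub_add sub_zero)

lemma cls_def: "cls p = {x + p | x. x \<in> N}"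
  by (auto simp: a_r_coset_def r_coset_def)

lemma mem_cls: "q \<in> cls p \<longleftrightarrow> q - p \<in> N"
proof
  assume "q - p \<in> N"
  then show "q \<in> cls p" unfolding cls_def by (force intro: exI[of _ "q - p"])
qed (auto simp: cls_def)

lemma cls_self: "p \<in> cls p"
  by (simp add: mem_cls sub_zero)

lemma cls_eq_iff: "cls p = cls q \<longleftrightarrow> p - q \<in> N"
proof
  assume "cls p = cls q" then show "p - q \<in> N" using cls_self[of p] by (simp add: mem_cls)
next
  assume pq: "p - q \<in> N"
  have "x - p \<in> N \<longleftrightarrow> x - q \<in> N" for x
    using sub_add[OF _ pq, of "x - p"] sub_diff[OF _ pq, of "x - q"] by auto
  then show "cls p = cls q" by (auto simp: mem_cls)
qed

lemma quot_carrier: "carrier (quot_mod M N) = cls ` carrier M"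
  by (auto simp: quot_mod_def ring.extend_def FactRing_def A_RCOSETS_def RCOSETS_def a_r_coset_def)

lemma quot_zero: "ring.zero (quot_mod M N) = cls 0"
  by (simp add: quot_mod_def ring.extend_def FactRing_def cls_def)

lemma cls_eq_zero_iff: "cls p = ring.zero (quot_mod M N) \<longleftrightarrow> p \<in> N"
  by (simp add: quot_zero cls_eq_iff)

lemma cls_closed: "p \<in> carrier M \<Longrightarrow> cls p \<in> carrier (quot_mod M N)"
  by (simp add: quot_carrier)

lemma quot_add: "cls p \<oplus>\<^bsub>quot_mod M N\<^esub> cls q = cls (p + q)"
proof -
  have "cls p \<oplus>\<^bsub>quot_mod M N\<^esub> cls q = {x + y | x y. x \<in> cls p \<and> y \<in> cls q}"
    by (auto simp: quot_mod_def ring.extend_def FactRing_def set_add_def set_mult_def)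
  also have "\<dots> = cls (p + q)"
  proof (intro equalityI subsetI)
    fix z assume "z \<in> {x + y | x y. x \<in> cls p \<and> y \<in> cls q}"
    then obtain x y where z: "z = x + y" "x - p \<in> N" "y - q \<in> N" by (auto simp: mem_cls)
    then show "z \<in> cls (p + q)" using sub_add[OF z(2,3)] by (simp add: mem_cls algebra_simps)
  next
    fix z assume "z \<in> cls (p + q)"
    then have "z - q \<in> cls p" "q \<in> cls q" "z = (z - q) + q"
      by (auto simp: mem_cls sub_zero algebra_simps)
    then show "z \<in> {x + y | x y. x \<in> cls p \<and> y \<in> cls q}" by blast
  qed
  finally show ?thesis .
qed

text \<open>The definition is a union over all representatives, and all of them contribute the same
  coset.\<close>

lemma quot_smult: "c \<odot>\<^bsub>quot_mod M N\<^esub> cls p = cls (scale c p)"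
proof -
  have "c \<odot>\<^bsub>quot_mod M N\<^esub> cls p = (\<Union>x\<in>cls p. cls (scale c x))"
    by (simp add: quot_mod_def ring.extend_def)
  also have "\<dots> = (\<Union>x\<in>cls p. cls (scale c p))"
  proof (rule SUP_cong[OF refl])
    fix x assume "x \<in> cls p"
    then have "scale c (x - p) \<in> N" by (simp add: mem_cls sub_scale)
    moreover have "scale c (x - p) = scale c x - scale c p"
      by (rule poly_mapping_eqI) (simp add: lookup_minus algebra_simps)
    ultimately show "cls (scale c x) = cls (scale c p)" by (simp add: cls_eq_iff)
  qed
  also have "\<dots> = cls (scale c p)" using cls_self[of p] by auto
  finally show ?thesis .
qed

lemma quot_abelian_group: "abelian_group (quot_mod M N)"
proof (rule abelian_groupI)
  fix x assume "x \<in> carrier (quot_mod M N)"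
  then obtain p where p: "p \<in> carrier M" "x = cls p" by (auto simp: quot_carrier)
  then have "cls (- p) \<in> carrier (quot_mod M N)" "cls (- p) \<oplus>\<^bsub>quot_mod M N\<^esub> x = \<zero>\<^bsub>quot_mod M N\<^esub>"
    by (auto simp: quot_carrier quot_add quot_zero intro: uminus_closed)
  then show "\<exists>y\<in>carrier (quot_mod M N). y \<oplus>\<^bsub>quot_mod M N\<^esub> x = \<zero>\<^bsub>quot_mod M N\<^esub>" by blast
qed (auto simp: quot_carrier quot_add quot_zero algebra_simps intro!: imageI intro: add_closed zero_closed)

lemma quot_is_module: "Module.module scalars (quot_mod M N)"
  by (rule moduleI)
    (auto simp: scalars_cring quot_abelian_group quot_carrier quot_smult quot_add scale_closed
        add_scale scale_add scale_scale scale_1)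

lemma quot_finsum:
  assumes "finite F" "\<And>a. a \<in> F \<Longrightarrow> q a \<in> carrier M"
  shows "(\<Oplus>\<^bsub>quot_mod M N\<^esub>a\<in>F. cls (q a)) = cls (\<Sum>a\<in>F. q a)"
proof -
  interpret Q: abelian_group "quot_mod M N" by (rule quot_abelian_group)
  show ?thesis
    using assms
  proof (induction F rule: finite_induct)
    case empty
    then show ?case by (simp add: quot_zero)
  next
    case (insert x F)
    then have "(\<Oplus>\<^bsub>quot_mod M N\<^esub>a\<in>insert x F. cls (q a))
        = cls (q x) \<oplus>\<^bsub>quot_mod M N\<^esub> (\<Oplus>\<^bsub>quot_mod M N\<^esub>a\<in>F. cls (q a))"
      by (intro Q.finsum_insert) (auto simp: quot_carrier)
    then show ?case using insert by (simp add: quot_add)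
  qed
qed

text \<open>The hypothesis says that \<phi> is well defined on the one class in question; the union
  in \<open>quot_map\<close> then runs over equal cosets.\<close>

lemma quot_map_cls:
  assumes "\<And>x. x \<in> N \<Longrightarrow> \<phi> (x + p) - \<phi> p \<in> N'" "pm_quotient M' Z' N'"
  shows "quot_map M' N' \<phi> (cls p) = N' +>\<^bsub>M'\<^esub> \<phi> p"
proof -
  interpret Q: pm_quotient M' Z' N' by fact
  have "quot_map M' N' \<phi> (cls p) = (\<Union>x\<in>cls p. Q.cls (\<phi> x))" by (simp add: quot_map_def)
  also have "\<dots> = (\<Union>x\<in>cls p. Q.cls (\<phi> p))"
  proof (rule SUP_cong[OF refl])
    fix x assume "x \<in> cls p"
    then have "\<phi> ((x - p) + p) - \<phi> p \<in> N'" by (intro assms(1)) (simp add: mem_cls)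
    then show "Q.cls (\<phi> x) = Q.cls (\<phi> p)" by (simp add: Q.cls_eq_iff)
  qed
  also have "\<dots> = Q.cls (\<phi> p)" using cls_self[of p] by auto
  finally show ?thesis .
qed

end

lemma submodule_closed:
  assumes "submodule U scalars M" "Module.module scalars M"
  shows "U \<subseteq> carrier M" "ring.zero M \<in> U" "\<And>u v. u \<in> U \<Longrightarrow> v \<in> U \<Longrightarrow> u \<oplus>\<^bsub>M\<^esub> v \<in> U"
    "\<And>c u. u \<in> U \<Longrightarrow> c \<odot>\<^bsub>M\<^esub> u \<in> U"
proof -
  interpret Module.module scalars M by fact
  interpret submodule U scalars M by fact
  show "U \<subseteq> carrier M" using subset by simp
  show "ring.zero M \<in> U" using one_closed by simp
  show "\<And>u v. u \<in> U \<Longrightarrow> v \<in> U \<Longrightarrow> u \<oplus>\<^bsub>M\<^esub> v \<in> U" using m_closed by simp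
  show "\<And>c u. u \<in> U \<Longrightarrow> c \<odot>\<^bsub>M\<^esub> u \<in> U" by (simp add: smult_closed)
qed

lemma submodule_closedI:
  assumes "Module.module scalars M"
    and "U \<subseteq> carrier M" "ring.zero M \<in> U" "\<And>u v. u \<in> U \<Longrightarrow> v \<in> U \<Longrightarrow> u \<oplus>\<^bsub>M\<^esub> v \<in> U"
    "\<And>c u. u \<in> U \<Longrightarrow> c \<odot>\<^bsub>M\<^esub> u \<in> U"
  shows "submodule U scalars M"
proof -
  interpret Module.module scalars M by fact
  \<comment> \<open>Negation is multiplication by -1, so closure under scalars already gives
    it.\<close>
  have inv: "\<ominus>\<^bsub>M\<^esub> a \<in> U" if "a \<in> U" for a
  proof -
    have "a \<in> carrier M" using that assms(2) by auto
    moreover have "\<ominus>\<^bsub>scalars\<^esub> (1::'a) \<in> carrier scalars" by simp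
    ultimately have "(\<ominus>\<^bsub>scalars\<^esub> \<one>\<^bsub>scalars\<^esub>) \<odot>\<^bsub>M\<^esub> a = \<ominus>\<^bsub>M\<^esub> a"
      using smult_l_minus[of "1" a] smult_one by simp
    then show ?thesis using assms(5)[OF that] by metis
  qed
  show ?thesis by (rule submoduleI) (use assms inv in auto)
qed

lemma (in pm_module) submodule_iff:
  "submodule N scalars M \<longleftrightarrow> pm_quotient M Z N"
proof
  assume "submodule N scalars M"
  note c = submodule_closed[OF this is_module]
  show "pm_quotient M Z N" by unfold_locales (use c in auto)
next
  assume "pm_quotient M Z N"
  then interpret pm_quotient M Z N .
  show "submodule N scalars M"
    by (rule submodule_closedI) (auto simp: is_module sub_zero sub_add sub_scale intro: subsetD[OF sub_carrier])
qed

section \<open>Free modules and modules given by generators and relations\<close>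

lemma free_module_pm: "pm_module (free_module Z) Z"
  by unfold_locales (auto simp: free_module_def)

lemma (in pm_module) lin_span_quotient:
  assumes "S \<subseteq> carrier M"
  shows "pm_quotient M Z (lin_span M S)" "S \<subseteq> lin_span M S"
    "\<And>U. \<lbrakk>pm_quotient M Z U; S \<subseteq> U\<rbrakk> \<Longrightarrow> lin_span M S \<subseteq> U"
proof -
  \<comment> \<open>The carrier itself is a submodule containing S, which keeps the intersection
    inside the carrier.\<close>
  have c: "pm_quotient M Z (carrier M)"
    by unfold_locales (auto simp: add_closed zero_closed scale_closed)
  have eq: "lin_span M S = \<Inter>{U. pm_quotient M Z U \<and> S \<subseteq> U}"
    by (simp add: lin_span_def hull_def submodule_iff)
  show "S \<subseteq> lin_span M S" by (auto simp: eq)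
  show "lin_span M S \<subseteq> U" if "pm_quotient M Z U" "S \<subseteq> U" for U using that by (auto simp: eq)
  show "pm_quotient M Z (lin_span M S)"
  proof unfold_locales
    show "lin_span M S \<subseteq> carrier M" using c assms by (auto simp: eq)
  qed (auto simp: eq pm_quotient.sub_zero pm_quotient.sub_add pm_quotient.sub_scale)
qed

locale presentation =
  fixes Z :: "'x set" and R :: "('x \<Rightarrow>\<^sub>0 'k::field) set"
  assumes rels: "R \<subseteq> carrier (free_module Z)"
begin

sublocale pm_quotient "free_module Z" Z "lin_span (free_module Z) R"
  by (rule pm_module.lin_span_quotient(1)[OF free_module_pm rels])

lemma rel_in_span: "u \<in> R \<Longrightarrow> u \<in> lin_span (free_module Z) R"
  using pm_module.lin_span_quotient(2)[OF free_module_pm rels] by auto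

lemma span_least: "pm_quotient (free_module Z) Z U \<Longrightarrow> R \<subseteq> U \<Longrightarrow> lin_span (free_module Z) R \<subseteq> U"
  by (rule pm_module.lin_span_quotient(3)[OF free_module_pm rels])

lemma presented_eq: "presented Z R = quot_mod (free_module Z) (lin_span (free_module Z) R)"
  by (simp add: presented_def)

text \<open>The kernel of the functional is a submodule of the free module containing the relations,
  hence it contains their span.\<close>

lemma lin_ext_span:
  assumes "\<And>u. u \<in> R \<Longrightarrow> lin_ext F u = 0" "u \<in> lin_span (free_module Z) R"
  shows "lin_ext F u = 0"
proof -
  let ?U = "{u \<in> carrier (free_module Z). lin_ext F u = 0}"
  have "pm_quotient (free_module Z) Z ?U"
    by unfold_locales (auto simp: add_closed zero_closed scale_closed lin_ext_add lin_ext_scale)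
  then have "lin_span (free_module Z) R \<subseteq> ?U" using assms(1) rels by (intro span_least) auto
  then show ?thesis using assms(2) by auto
qed

text \<open>The way to see that a generator survives in a presented module: exhibit a functional
  that kills the relations and not the generator.\<close>

lemma cls_gen_nonzero:
  assumes "\<And>u. u \<in> R \<Longrightarrow> lin_ext F u = 0" "F x \<noteq> 0"
  shows "cls (gen x) \<noteq> ring.zero (presented Z R)"
  using lin_ext_span[OF assms(1), of "gen x"] assms(2)
  by (auto simp: presented_eq cls_eq_zero_iff)

text \<open>Any representative may be chosen to evaluate a functional which respects the relations.\<close>

lemma lin_ext_some:
  assumes "\<And>u. u \<in> R \<Longrightarrow> lin_ext F u = 0"
  shows "lin_ext F (SOME u. u \<in> cls p) = lin_ext F p"
proof -
  have "(SOME u. u \<in> cls p) \<in> cls p" by (rule someI[of _ p]) (rule cls_self)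
  then have "(SOME u. u \<in> cls p) - p \<in> lin_span (free_module Z) R" by (simp add: mem_cls)
  from lin_ext_span[OF assms this] show ?thesis by (simp add: lin_ext_diff)
qed

text \<open>The preimage of the target span under \<open>free_map h\<close> is a submodule, so only
  the defining relations have to be tested.\<close>

lemma presented_map_cls:
  assumes "presentation Y S" and h: "\<And>x. x \<in> Z \<Longrightarrow> h x \<in> Y"
    and R: "\<And>u. u \<in> R \<Longrightarrow> free_map h u \<in> lin_span (free_module Y) S"
  shows "presented_map Y S h (cls p)
    = lin_span (free_module Y) S +>\<^bsub>free_module Y\<^esub> free_map h p"
proof -
  interpret P: presentation Y S by fact
  let ?U = "{u \<in> carrier (free_module Z). free_map h u \<in> lin_span (free_module Y) S}"
  have "pm_quotient (free_module Z) Z ?U"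
    by unfold_locales (auto simp: add_closed zero_closed scale_closed free_map_add free_map_scale
        P.sub_zero P.sub_add P.sub_scale)
  then have "lin_span (free_module Z) R \<subseteq> ?U" using R rels by (intro span_least) auto
  then show ?thesis
    unfolding presented_map_def
    by (intro quot_map_cls[where Z' = Y]) (auto simp: free_map_add P.pm_quotient_axioms)
qed

end

section \<open>Monomials and signed injections\<close>

definition monomials :: "nat \<Rightarrow> nat \<Rightarrow> monomial set"
  where "monomials r n = {M. Poly_Mapping.keys M \<subseteq> {1..r} \<times> {1..n}}"

definition mono_eval :: "(nat \<times> nat \<Rightarrow> 'a::comm_semiring_1) \<Rightarrow> monomial \<Rightarrow> 'a"
  where "mono_eval \<sigma> M = (\<Prod>v\<in>Poly_Mapping.keys M. \<sigma> v ^ Poly_Mapping.lookup M v)"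

lemma mono_eval_zero [simp]: "mono_eval \<sigma> 0 = 1"
  by (simp add: mono_eval_def)

lemma mono_eval_single [simp]: "mono_eval \<sigma> (Poly_Mapping.single v k) = \<sigma> v ^ k"
  by (cases "k = 0") (simp_all add: mono_eval_def)

lemma mono_eval_superset:
  assumes "finite A" "Poly_Mapping.keys M \<subseteq> A"
  shows "mono_eval \<sigma> M = (\<Prod>v\<in>A. \<sigma> v ^ Poly_Mapping.lookup M v)"
  unfolding mono_eval_def by (rule prod.mono_neutral_left) (use assms in \<open>auto simp: in_keys_iff\<close>)

lemma mono_eval_add: "mono_eval \<sigma> (M + N) = mono_eval \<sigma> M * mono_eval \<sigma> N"
proof -
  let ?A = "Poly_Mapping.keys M \<union> Poly_Mapping.keys N"
  have A: "finite ?A" "Poly_Mapping.keys M \<subseteq> ?A" "Poly_Mapping.keys N \<subseteq> ?A"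
    "Poly_Mapping.keys (M + N) \<subseteq> ?A" using keys_add[of M N] by auto
  show ?thesis
    by (simp add: mono_eval_superset[OF A(1,2)] mono_eval_superset[OF A(1,3)]
        mono_eval_superset[OF A(1,4)] lookup_add power_add prod.distrib)
qed

lemma mpoly_subst_eq: "mpoly_subst \<sigma> p = (\<Sum>M\<in>Poly_Mapping.keys p.
    Poly_Mapping.single 0 (Poly_Mapping.lookup p M) * mono_eval \<sigma> M)"
  by (simp add: mpoly_subst_def mono_eval_def)

lemma mpoly_subst_single [simp]:
  "mpoly_subst \<sigma> (Poly_Mapping.single M c) = Poly_Mapping.single 0 c * mono_eval \<sigma> M"
  by (cases "c = 0") (simp_all add: mpoly_subst_eq)

lemma mpoly_subst_zero [simp]: "mpoly_subst \<sigma> 0 = 0"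
  by (simp add: mpoly_subst_eq)

lemma mpoly_subst_add: "mpoly_subst \<sigma> (p + q) = mpoly_subst \<sigma> p + mpoly_subst \<sigma> q"
  unfolding mpoly_subst_eq
  by (rule setsum_keys_plus_distrib) (auto simp: single_add distrib_right)

lemma mpoly_subst_mult: "mpoly_subst \<sigma> (p * q) = mpoly_subst \<sigma> p * mpoly_subst \<sigma> q"
proof (induction p rule: poly_mapping_add_induct[OF subset_UNIV])
  case (2 M c)
  show ?case
  proof (induction q rule: poly_mapping_add_induct[OF subset_UNIV])
    case (2 N d)
    have "Poly_Mapping.single 0 (c * d) = Poly_Mapping.single 0 c * (Poly_Mapping.single 0 d :: 'a mpoly)"
      by (simp add: mult_single)
    then show ?case by (simp add: mult_single mono_eval_add algebra_simps)
  qed (simp_all add: distrib_left mpoly_subst_add)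
qed (simp_all add: distrib_right mpoly_subst_add)

lemma mpoly_subst_one: "mpoly_subst \<sigma> 1 = 1"
  using mpoly_subst_single[of \<sigma> 0 1] by simp

lemma scale_eq_mult: "scale c p = Poly_Mapping.single 0 c * (p :: 'k::field mpoly)"
  by (rule mult_map_scale_conv_mult)

lemma mpoly_subst_scale: "mpoly_subst \<sigma> (scale c p) = scale c (mpoly_subst \<sigma> p)"
  by (simp add: scale_eq_mult mpoly_subst_mult)


definition idx :: "(int \<Rightarrow> int) \<Rightarrow> nat \<Rightarrow> nat"
  where "idx f a = nat \<bar>f (int a)\<bar>"

text \<open>The variables are renumbered by the absolute value of f; the signs which f attaches to
  them are collected separately in \<open>tsgn\<close>.\<close>

definition transport :: "(int \<Rightarrow> int) \<Rightarrow> monomial \<Rightarrow> monomial"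
  where "transport f M =
    (\<Sum>v\<in>Poly_Mapping.keys M. Poly_Mapping.single (fst v, idx f (snd v)) (Poly_Mapping.lookup M v))"

definition tsgn :: "(int \<Rightarrow> int) \<Rightarrow> monomial \<Rightarrow> int"
  where "tsgn f M = mono_eval (\<lambda>v. sgn (f (int (snd v)))) M"

lemma transport_add: "transport f (M + N) = transport f M + transport f N"
  unfolding transport_def by (rule setsum_keys_plus_distrib) (auto simp: single_add)

lemma transport_zero [simp]: "transport f 0 = 0"
  by (simp add: transport_def)

lemma transport_single [simp]:
  "transport f (Poly_Mapping.single (i, a) k) = Poly_Mapping.single (i, idx f a) k"
  by (cases "k = 0") (simp_all add: transport_def)

lemma tsgn_add: "tsgn f (M + N) = tsgn f M * tsgn f N"
  by (simp add: tsgn_def mono_eval_add)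

lemma tsgn_zero [simp]: "tsgn f 0 = 1"
  by (simp add: tsgn_def)

lemma tsgn_single [simp]: "tsgn f (Poly_Mapping.single (i, a) k) = sgn (f (int a)) ^ k"
  by (simp add: tsgn_def)

lemma monomials_zero [simp]: "0 \<in> monomials r n"
  by (simp add: monomials_def)

lemma monomials_add: "M \<in> monomials r n \<Longrightarrow> N \<in> monomials r n \<Longrightarrow> M + N \<in> monomials r n"
  using keys_add by (fastforce simp: monomials_def)

lemma monomials_single: "i \<in> {1..r} \<Longrightarrow> a \<in> {1..n} \<Longrightarrow> Poly_Mapping.single (i, a) k \<in> monomials r n"
  by (simp add: monomials_def keys_single)

lemma monomials_lookup: "M \<in> monomials r n \<Longrightarrow> Poly_Mapping.lookup M (i, a) \<noteq> 0 \<Longrightarrow> i \<in> {1..r} \<and> a \<in> {1..n}"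
  unfolding monomials_def in_keys_iff[symmetric] by auto

lemma monomials_induct [consumes 1, case_names zero single add]:
  assumes "M \<in> monomials r n" "P 0"
    "\<And>i a k. i \<in> {1..r} \<Longrightarrow> a \<in> {1..n} \<Longrightarrow> P (Poly_Mapping.single (i, a) k)"
    "\<And>M N. M \<in> monomials r n \<Longrightarrow> N \<in> monomials r n \<Longrightarrow> P M \<Longrightarrow> P N \<Longrightarrow> P (M + N)"
  shows "P M"
proof -
  have "Poly_Mapping.keys M \<subseteq> {1..r} \<times> {1..n}" using assms(1) by (simp add: monomials_def)
  then show ?thesis
    by (induction M rule: poly_mapping_add_induct) (use assms in \<open>auto simp: monomials_def\<close>)
qed

lemma ob_int [simp]: "int a \<in> ob k \<longleftrightarrow> a \<in> {1..k}"
  by (auto simp: ob_def)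

context
  fixes f :: "int \<Rightarrow> int" and m n :: nat
  assumes f: "f \<in> FI_hom FI_BC m n"
begin

lemma FI_ob: "a \<in> ob m \<Longrightarrow> f a \<in> ob n"
  using f by (auto simp: FI_hom_def)

lemma FI_uminus: "a \<in> ob m \<Longrightarrow> f (- a) = - f a"
  using f by (auto simp: FI_hom_def)

lemma FI_inj: "a \<in> ob m \<Longrightarrow> b \<in> ob m \<Longrightarrow> f a = f b \<Longrightarrow> a = b"
  using f by (auto simp: FI_hom_def inj_on_def)

lemma FI_ext: "f \<in> extensional (ob m)"
  using f by (auto simp: FI_hom_def PiE_def)

lemma idx_in: "a \<in> {1..m} \<Longrightarrow> idx f a \<in> {1..n}"
  using FI_ob[of "int a"] by (auto simp: idx_def ob_def)

text \<open>Since f is odd, values that agree up to sign have arguments that agree up to sign, and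
  positive arguments are then equal.\<close>

lemma idx_inj: "inj_on (idx f) {1..m}"
proof (rule inj_onI)
  fix a b assume ab: "a \<in> {1..m}" "b \<in> {1..m}" and eq: "idx f a = idx f b"
  then have o: "int a \<in> ob m" "int b \<in> ob m" "- int b \<in> ob m" by (auto simp: ob_def)
  have "f (int a) = f (int b) \<or> f (int a) = - f (int b)"
    using eq by (auto simp: idx_def abs_if split: if_splits)
  then have "int a = int b \<or> int a = - int b"
    using FI_inj[OF o(1,2)] FI_inj[OF o(1,3)] FI_uminus[OF o(2)] by auto
  then show "a = b" using ab by auto
qed

lemma sgn_nonzero: "a \<in> {1..m} \<Longrightarrow> sgn (f (int a)) * sgn (f (int a)) = 1"
  using FI_ob[of "int a"] by (auto simp: ob_def sgn_if)

lemma transport_monomials: "M \<in> monomials r m \<Longrightarrow> transport f M \<in> monomials r n"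
  by (induction M rule: monomials_induct)
    (auto simp: transport_add simp del: atLeastAtMost_iff intro!: monomials_add monomials_single idx_in)

lemma lookup_transport:
  assumes "M \<in> monomials r m" "a \<in> {1..m}"
  shows "Poly_Mapping.lookup (transport f M) (i, idx f a) = Poly_Mapping.lookup M (i, a)"
  using assms(1)
proof (induction M rule: monomials_induct)
  case (single j b k)
  then show ?case using inj_onD[OF idx_inj, of a b] assms(2)
    by (auto simp: lookup_single when_def)
qed (auto simp: transport_add lookup_add)

lemma transport_inj: "inj_on (transport f) (monomials r m)"
proof (rule inj_onI, rule poly_mapping_eqI)
  fix M N and v :: "nat \<times> nat" assume MN: "M \<in> monomials r m" "N \<in> monomials r m" "transport f M = transport f N"
  obtain i a where v: "v = (i, a)" by (cases v)
  show "Poly_Mapping.lookup M v = Poly_Mapping.lookup N v"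
  proof (cases "a \<in> {1..m}")
    case True
    then show ?thesis using MN lookup_transport[OF MN(1) True] lookup_transport[OF MN(2) True] v
      by metis
  next
    case False
    then have "Poly_Mapping.lookup M (i, a) = 0" "Poly_Mapping.lookup N (i, a) = 0"
      using monomials_lookup[OF MN(1), of i a] monomials_lookup[OF MN(2), of i a] by blast+
    then show ?thesis using v by simp
  qed
qed

lemma transport_surj:
  assumes "Poly_Mapping.keys W \<subseteq> {1..r} \<times> (idx f ` {1..m})"
  shows "W \<in> transport f ` monomials r m"
  using assms
proof (induction W rule: poly_mapping_add_induct)
  case zero
  then show ?case by (auto intro!: image_eqI[of _ _ 0])
next
  case (single v k)
  then obtain i a where "v = (i, idx f a)" "i \<in> {1..r}" "a \<in> {1..m}" by auto
  then show ?case by (intro image_eqI[of _ _ "Poly_Mapping.single (i, a) k"]) (auto intro!: monomials_single)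
next
  case (add W W')
  then obtain M M' where "W = transport f M" "W' = transport f M'" "M \<in> monomials r m" "M' \<in> monomials r m"
    by auto
  then show ?case by (intro image_eqI[of _ _ "M + M'"]) (auto simp: transport_add intro!: monomials_add)
qed

lemma tsgn_square: "M \<in> monomials r m \<Longrightarrow> tsgn f M * tsgn f M = 1"
proof (induction M rule: monomials_induct)
  case (single i a k)
  then show ?case using sgn_nonzero[of a] by (simp flip: power_mult_distrib)
next
  case (add M N)
  have "tsgn f (M + N) * tsgn f (M + N) = (tsgn f M * tsgn f M) * (tsgn f N * tsgn f N)"
    by (simp add: tsgn_add algebra_simps)
  then show ?case using add by simp
qed simp

text \<open>The preimage of the positive number |f a| is a or -a, according to the sign of f
  a.\<close>

lemma inv_into_idx:
  assumes "a \<in> {1..m}"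
  shows "int (idx f a) \<in> f ` ob m" "inv_into (ob m) f (int (idx f a)) = sgn (f (int a)) * int a"
proof -
  have o: "int a \<in> ob m" "- int a \<in> ob m" using assms by (auto simp: ob_def)
  have n0: "f (int a) \<noteq> 0" using FI_ob[OF o(1)] by (auto simp: ob_def)
  have inj: "inj_on f (ob m)" using FI_inj by (auto intro: inj_onI)
  have eq: "int (idx f a) = f (sgn (f (int a)) * int a)" and mem: "sgn (f (int a)) * int a \<in> ob m"
    using n0 FI_uminus[OF o(1)] o by (auto simp: idx_def sgn_if abs_if)
  show "int (idx f a) \<in> f ` ob m" using eq mem by auto
  show "inv_into (ob m) f (int (idx f a)) = sgn (f (int a)) * int a"
    unfolding eq by (rule inv_into_f_f[OF inj mem])
qed

lemma pull_monomial:
  assumes "M \<in> monomials r m"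
  shows "poly_pull m f (Poly_Mapping.single (transport f M) c)
    = Poly_Mapping.single M (c * of_int (tsgn f M) :: 'k::field)"
proof -
  let ?\<sigma> = "\<lambda>(i, j). svar i (if int j \<in> f ` ob m then inv_into (ob m) f (int j) else 0) :: 'k mpoly"
  have pow: "(Poly_Mapping.single v c :: 'k mpoly) ^ k
      = Poly_Mapping.single (Poly_Mapping.single u (k * l)) (c ^ k)"
    if "v = Poly_Mapping.single u l" for v :: monomial and u l and c :: 'k and k
    unfolding that by (induction k) (simp_all add: mult_single flip: single_add)
  have "mono_eval ?\<sigma> (transport f M) = Poly_Mapping.single M (of_int (tsgn f M))"
    using assms
  proof (induction M rule: monomials_induct)
    case (single i a k)
    have a: "a > 0" using single by auto
    have "?\<sigma> (i, idx f a) = Poly_Mapping.single (Poly_Mapping.single (i, a) 1) (of_int (sgn (f (int a))))"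
      using inv_into_idx[OF single(2)] sgn_nonzero[OF single(2)] a
      by (auto simp: svar_def sgn_mult abs_mult sgn_if)
    then show ?case by (simp add: pow[of _ "(i, a)" 1])
  qed (simp_all add: transport_add mono_eval_add tsgn_add mult_single)
  then show ?thesis by (simp add: poly_pull_def mult_single)
qed

text \<open>Some variable of W has an index outside the image of f, and this variable is replaced by
  0.\<close>

lemma pull_monomial_0:
  assumes "W \<in> monomials r n" "W \<notin> transport f ` monomials r m"
  shows "poly_pull m f (Poly_Mapping.single W c) = (0 :: 'k::field mpoly)"
proof -
  let ?\<sigma> = "\<lambda>(i, j). svar i (if int j \<in> f ` ob m then inv_into (ob m) f (int j) else 0) :: 'k mpoly"
  have "\<not> Poly_Mapping.keys W \<subseteq> {1..r} \<times> (idx f ` {1..m})" using assms(2) transport_surj by blast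
  then obtain i j where ij: "(i, j) \<in> Poly_Mapping.keys W" "j \<notin> idx f ` {1..m}"
    using assms(1) by (auto simp: monomials_def)
  have "int j \<notin> f ` ob m"
  proof
    assume "int j \<in> f ` ob m"
    then obtain a where a: "a \<in> ob m" "int j = f a" by auto
    then have "nat \<bar>a\<bar> \<in> {1..m}" "idx f (nat \<bar>a\<bar>) = j"
      using FI_uminus[of a] by (auto simp: ob_def idx_def abs_if)
    then show False using ij by blast
  qed
  then have "?\<sigma> (i, j) = 0" by (simp add: svar_def)
  moreover have "Poly_Mapping.lookup W (i, j) \<noteq> 0" using ij(1) by (simp add: in_keys_iff)
  ultimately have "?\<sigma> (i, j) ^ Poly_Mapping.lookup W (i, j) = 0" by simp
  then have "mono_eval ?\<sigma> W = 0"
    unfolding mono_eval_def using ij(1) by (intro prod_zero finite_keys bexI[of _ "(i, j)"])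
  then show ?thesis by (simp add: poly_pull_def)
qed

end

section \<open>Polynomials\<close>

interpretation poly: pm_module "poly_alg r n" "monomials r n" for r n
  by unfold_locales (auto simp: poly_alg_def monomials_def)

lemma poly_alg_simps [simp]: "monoid.mult (poly_alg r n) = (*)" "monoid.one (poly_alg r n) = 1"
  by (simp_all add: poly_alg_def)

lemma poly_one_closed: "1 \<in> carrier (poly_alg r n)"
  by (simp add: poly.carrier_eq)

lemma poly_mult_closed:
  assumes "p \<in> carrier (poly_alg r n)" "q \<in> carrier (poly_alg r n)"
  shows "p * q \<in> carrier (poly_alg r n)"
  using assms keys_mult[of p q] by (fastforce simp: poly.carrier_eq dest: monomials_add)

lemma poly_const_closed: "Poly_Mapping.single 0 c \<in> carrier (poly_alg r n)"
  by (simp add: poly.single_closed)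

lemma poly_cring: "cring (poly_alg r n :: ('k::field, 'k mpoly) module)"
proof (rule cringI)
  show "abelian_group (poly_alg r n :: ('k, 'k mpoly) module)" by (rule poly.is_abelian_group)
  show "comm_monoid (poly_alg r n :: ('k, 'k mpoly) module)"
    by (rule comm_monoidI) (auto simp: poly_one_closed poly_mult_closed algebra_simps)
qed (simp add: distrib_right)

definition poly_ideal :: "nat \<Rightarrow> nat \<Rightarrow> 'k::field mpoly set \<Rightarrow> bool"
  where "poly_ideal r n I \<longleftrightarrow> I \<subseteq> carrier (poly_alg r n) \<and> 0 \<in> I \<and> (\<forall>p\<in>I. \<forall>q\<in>I. p + q \<in> I) \<and>
    (\<forall>q\<in>carrier (poly_alg r n). \<forall>p\<in>I. q * p \<in> I)"

text \<open>Scalars act as multiplication by constant polynomials, so closure under multiplication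
  includes closure under scalars.\<close>

lemma poly_ideal_quotient:
  assumes "poly_ideal r n I"
  shows "pm_quotient (poly_alg r n) (monomials r n) I"
  by unfold_locales
    (use assms in \<open>auto simp: poly_ideal_def scale_eq_mult poly_const_closed\<close>)

lemma poly_ideal_iff: "ideal I (poly_alg r n) \<longleftrightarrow> poly_ideal r n I"
proof
  assume "ideal I (poly_alg r n)"
  then interpret ideal I "poly_alg r n" .
  show "poly_ideal r n I"
    unfolding poly_ideal_def
    using a_subset additive_subgroup.zero_closed[OF additive_subgroup_axioms]
      additive_subgroup.a_closed[OF additive_subgroup_axioms] I_l_closed by auto
next
  assume I: "poly_ideal r n I"
  then interpret pm_quotient "poly_alg r n" "monomials r n" I by (rule poly_ideal_quotient)
  interpret cring "poly_alg r n :: ('a, 'a mpoly) module" by (rule poly_cring)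
  have "submodule I scalars (poly_alg r n)" by (simp add: poly.submodule_iff pm_quotient_axioms)
  then have "subgroup I (add_monoid (poly_alg r n))" by (rule submodule.axioms)
  then show "ideal I (poly_alg r n)"
    using I by (intro idealI) (auto simp: poly_ideal_def ring_axioms, metis mult.commute)
qed

lemma poly_genideal:
  assumes "S \<subseteq> carrier (poly_alg r n)"
  shows "poly_ideal r n (genideal (poly_alg r n) S)" "S \<subseteq> genideal (poly_alg r n) S"
    "\<And>I. \<lbrakk>poly_ideal r n I; S \<subseteq> I\<rbrakk> \<Longrightarrow> genideal (poly_alg r n) S \<subseteq> I"
proof -
  interpret cring "poly_alg r n :: ('a, 'a mpoly) module" by (rule poly_cring)
  show "poly_ideal r n (genideal (poly_alg r n) S)" using genideal_ideal[OF assms] by (simp add: poly_ideal_iff)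
  show "S \<subseteq> genideal (poly_alg r n) S" by (rule genideal_self[OF assms])
  show "\<And>I. \<lbrakk>poly_ideal r n I; S \<subseteq> I\<rbrakk> \<Longrightarrow> genideal (poly_alg r n) S \<subseteq> I"
    using genideal_minimal by (simp add: poly_ideal_iff)
qed

lemma poly_pull_add: "poly_pull m f (p + q) = poly_pull m f p + poly_pull m f q"
  by (simp add: poly_pull_def mpoly_subst_add)

lemma poly_pull_mult: "poly_pull m f (p * q) = poly_pull m f p * poly_pull m f q"
  by (simp add: poly_pull_def mpoly_subst_mult)

lemma poly_pull_zero [simp]: "poly_pull m f 0 = 0"
  by (simp add: poly_pull_def)

lemma poly_pull_one [simp]: "poly_pull m f 1 = 1"
  by (simp add: poly_pull_def mpoly_subst_one)

lemma poly_pull_scale: "poly_pull m f (scale c p) = scale c (poly_pull m f p)"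
  by (simp add: poly_pull_def mpoly_subst_scale)

lemma poly_induct [consumes 1, case_names zero single add]:
  assumes "p \<in> carrier (poly_alg r n)" "P 0"
    "\<And>M c. M \<in> monomials r n \<Longrightarrow> P (Poly_Mapping.single M c)"
    "\<And>p q. p \<in> carrier (poly_alg r n) \<Longrightarrow> q \<in> carrier (poly_alg r n) \<Longrightarrow> P p \<Longrightarrow> P q \<Longrightarrow> P (p + q)"
  shows "P p"
proof -
  have "Poly_Mapping.keys p \<subseteq> monomials r n" using assms(1) by (simp add: poly.carrier_eq)
  then show ?thesis
    by (induction p rule: poly_mapping_add_induct) (use assms in \<open>auto simp: poly.carrier_eq\<close>)
qed

lemma poly_pull_closed:
  assumes "f \<in> FI_hom FI_BC m n" "p \<in> carrier (poly_alg r n)"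
  shows "poly_pull m f p \<in> carrier (poly_alg r m)"
  using assms(2)
proof (induction p rule: poly_induct)
  case (single W c)
  show ?case
  proof (cases "W \<in> transport f ` monomials r m")
    case True
    then obtain M where "M \<in> monomials r m" "W = transport f M" by auto
    then show ?thesis by (auto simp: pull_monomial[OF assms(1)] intro: poly.single_closed)
  qed (simp add: pull_monomial_0[OF assms(1) single] poly.zero_closed)
qed (auto simp: poly_pull_add poly.zero_closed poly.add_closed)

text \<open>\<open>pull_monomial\<close> read on coefficients. Identities between pullbacks are
  checked in this form, one monomial at a time.\<close>

lemma lookup_poly_pull:
  assumes f: "f \<in> FI_hom FI_BC m n" and p: "p \<in> carrier (poly_alg r n)" and M: "M \<in> monomials r m"
  shows "Poly_Mapping.lookup (poly_pull m f p) M
    = of_int (tsgn f M) * Poly_Mapping.lookup p (transport f M)"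
  using p
proof (induction p rule: poly_induct)
  case (single W c)
  show ?case
  proof (cases "W \<in> transport f ` monomials r m")
    case True
    then obtain N where "N \<in> monomials r m" "W = transport f N" by auto
    then show ?thesis
      using inj_onD[OF transport_inj[OF f, of r], of N M] M
      by (auto simp: pull_monomial[OF f] lookup_single when_def)
  next
    case False
    then show ?thesis using M by (auto simp: pull_monomial_0[OF f single] lookup_single when_def)
  qed
qed (auto simp: poly_pull_add lookup_add distrib_left)

lemma poly_eqI:
  assumes "p \<in> carrier (poly_alg r n)" "q \<in> carrier (poly_alg r n)"
    "\<And>M. M \<in> monomials r n \<Longrightarrow> Poly_Mapping.lookup p M = Poly_Mapping.lookup q M"
  shows "p = q"
proof (rule poly_mapping_eqI)
  fix M show "Poly_Mapping.lookup p M = Poly_Mapping.lookup q M"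
    using assms by (cases "M \<in> monomials r n") (simp, metis (no_types, lifting) in_keys_iff mem_Collect_eq poly.carrier_eq subset_iff)
qed

text \<open>The signs form a cocycle and not a character: the sign of g is taken at the monomial
  already moved by f.\<close>

lemma transport_comp:
  assumes f: "f \<in> FI_hom FI_BC l m" and g: "g \<in> FI_hom FI_BC m n" and M: "M \<in> monomials r l"
  shows "transport (compose (ob l) g f) M = transport g (transport f M)"
    "tsgn (compose (ob l) g f) M = tsgn f M * tsgn g (transport f M)"
proof -
  have key: "idx (compose (ob l) g f) a = idx g (idx f a)"
    "sgn (g (f (int a))) = sgn (f (int a)) * sgn (g (int (idx f a)))"
    if a: "a \<in> {1..l}" for a
  proof -
    have o: "int a \<in> ob l" using a by simp
    have fo: "f (int a) \<in> ob m" by (rule FI_ob[OF f o])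
    then have "f (int a) \<noteq> 0" by (auto simp: ob_def)
    then show "idx (compose (ob l) g f) a = idx g (idx f a)"
      "sgn (g (f (int a))) = sgn (f (int a)) * sgn (g (int (idx f a)))"
      using o FI_uminus[OF g fo] by (auto simp: idx_def compose_def abs_if sgn_minus)
  qed
  show "transport (compose (ob l) g f) M = transport g (transport f M)"
    using M by (induction M rule: monomials_induct) (auto simp: transport_add key)
  show "tsgn (compose (ob l) g f) M = tsgn f M * tsgn g (transport f M)"
    using M
  proof (induction M rule: monomials_induct)
    case (single i a k)
    then show ?case by (simp add: key compose_def power_mult_distrib)
  qed (auto simp: tsgn_add transport_add)
qed

lemma compose_FI:
  assumes "f \<in> FI_hom FI_BC l m" "g \<in> FI_hom FI_BC m n"
  shows "compose (ob l) g f \<in> FI_hom FI_BC l n"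
proof -
  have "- a \<in> ob l" if "a \<in> ob l" for a using that by (auto simp: ob_def)
  then show ?thesis
    using FI_ob[OF assms(1)] FI_ob[OF assms(2)] FI_uminus[OF assms(1)] FI_uminus[OF assms(2)]
      FI_inj[OF assms(1)] FI_inj[OF assms(2)]
    by (auto simp: FI_hom_def compose_def inj_on_def)
qed

lemma id_FI: "(\<lambda>a\<in>ob n. a) \<in> FI_hom W n n"
proof -
  have "{a \<in> ob n. 0 < a \<and> (\<lambda>a\<in>ob n. a) a < 0} = {}" by auto
  then have "card {a \<in> ob n. 0 < a \<and> (\<lambda>a\<in>ob n. a) a < 0} = 0" by (metis card.empty)
  moreover have "- a \<in> ob n" if "a \<in> ob n" for a using that by (auto simp: ob_def)
  ultimately show ?thesis by (auto simp: FI_hom_def inj_on_def split: FI_type.splits)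
qed

lemma transport_id:
  assumes "M \<in> monomials r n"
  shows "transport (\<lambda>a\<in>ob n. a) M = M" "tsgn (\<lambda>a\<in>ob n. a) M = 1"
  using assms by (induction M rule: monomials_induct) (auto simp: transport_add tsgn_add idx_def)

lemma poly_pull_comp:
  assumes f: "f \<in> FI_hom FI_BC l m" and g: "g \<in> FI_hom FI_BC m n" and p: "p \<in> carrier (poly_alg r n)"
  shows "poly_pull l (compose (ob l) g f) p = poly_pull l f (poly_pull m g p)"
proof (rule poly_eqI[of _ r l])
  note c = poly_pull_closed[OF g p] compose_FI[OF f g]
  show "poly_pull l (compose (ob l) g f) p \<in> carrier (poly_alg r l)"
    "poly_pull l f (poly_pull m g p) \<in> carrier (poly_alg r l)"
    using c p f by (auto intro: poly_pull_closed)
  fix M assume M: "M \<in> monomials r l"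
  show "Poly_Mapping.lookup (poly_pull l (compose (ob l) g f) p) M
      = Poly_Mapping.lookup (poly_pull l f (poly_pull m g p)) M"
    by (simp add: lookup_poly_pull[OF c(2) p M] lookup_poly_pull[OF f c(1) M]
        lookup_poly_pull[OF g p transport_monomials[OF f M]] transport_comp[OF f g M] mult.assoc)
qed

lemma poly_pull_id:
  assumes "p \<in> carrier (poly_alg r n)"
  shows "poly_pull n (\<lambda>a\<in>ob n. a) p = p"
  by (rule poly_eqI[of _ r n])
    (auto simp: assms lookup_poly_pull[OF id_FI assms] transport_id intro: poly_pull_closed[OF id_FI])

section \<open>Invariants and the coinvariant ideal\<close>

lemma poly_act_monomial:
  assumes w: "w \<in> FI_hom FI_BC n n" and "M \<in> monomials r n"
  shows "poly_act w (Poly_Mapping.single M c)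
    = Poly_Mapping.single (transport w M) (c * of_int (tsgn w M) :: 'k::field)"
proof -
  let ?\<sigma> = "\<lambda>(i, j). svar i (w (int j)) :: 'k mpoly"
  have pow: "(Poly_Mapping.single (Poly_Mapping.single u 1) c :: 'k mpoly) ^ k
      = Poly_Mapping.single (Poly_Mapping.single u k) (c ^ k)" for u :: "nat \<times> nat" and c :: 'k and k
    by (induction k) (simp_all add: mult_single flip: single_add)
  have "mono_eval ?\<sigma> M = Poly_Mapping.single (transport w M) (of_int (tsgn w M))"
    using assms(2)
    by (induction M rule: monomials_induct)
      (simp_all add: transport_add mono_eval_add tsgn_add mult_single svar_def pow[unfolded One_nat_def] flip: idx_def)
  then show ?thesis by (simp add: poly_act_def mult_single)
qed

lemma poly_act_add: "poly_act w (p + q) = poly_act w p + poly_act w q"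
  by (simp add: poly_act_def mpoly_subst_add)

lemma poly_act_zero [simp]: "poly_act w 0 = 0"
  by (simp add: poly_act_def)

lemma idx_image:
  assumes "w \<in> FI_hom FI_BC n n"
  shows "idx w ` {1..n} = {1..n}"
  by (rule endo_inj_surj) (use idx_in[OF assms] idx_inj[OF assms] in auto)

lemma transport_image:
  assumes "w \<in> FI_hom FI_BC n n"
  shows "transport w ` monomials r n = monomials r n"
proof (intro equalityI subsetI)
  fix W assume "W \<in> monomials r n"
  then have "Poly_Mapping.keys W \<subseteq> {1..r} \<times> (idx w ` {1..n})"
    using idx_image[OF assms] by (simp add: monomials_def)
  then show "W \<in> transport w ` monomials r n" by (rule transport_surj[OF assms])
qed (use transport_monomials[OF assms] in auto)

lemma of_int_tsgn_square:
  assumes "f \<in> FI_hom FI_BC m n" "M \<in> monomials r m"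
  shows "of_int (tsgn f M) * of_int (tsgn f M) = (1 :: 'a::ring_1)"
  using tsgn_square[OF assms] by (simp flip: of_int_mult)

lemma pull_act:
  assumes w: "w \<in> FI_hom FI_BC n n" and p: "p \<in> carrier (poly_alg r n)"
  shows "poly_pull n w (poly_act w p) = p"
  using p
  by (induction p rule: poly_induct)
    (auto simp: poly_act_monomial[OF w] pull_monomial[OF w] mult.assoc of_int_tsgn_square[OF w]
      poly_act_add poly_pull_add)

lemma act_pull:
  assumes w: "w \<in> FI_hom FI_BC n n" and p: "p \<in> carrier (poly_alg r n)"
  shows "poly_act w (poly_pull n w p) = p"
  using p
proof (induction p rule: poly_induct)
  case (single W c)
  then obtain M where "M \<in> monomials r n" "W = transport w M"
    using transport_image[OF w, of r] by blast
  then show ?case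
    by (simp add: poly_act_monomial[OF w] pull_monomial[OF w] mult.assoc of_int_tsgn_square[OF w])
qed (auto simp: poly_act_add poly_pull_add)

lemma FI_BC: "f \<in> FI_hom W m n \<Longrightarrow> f \<in> FI_hom FI_BC m n"
  by (auto simp: FI_hom_def)

text \<open>Invariance is expressed by the pullback along w, which is inverse to the action of w, so
  that functoriality of pullbacks applies to invariants directly.\<close>

definition invs :: "FI_type \<Rightarrow> nat \<Rightarrow> nat \<Rightarrow> 'k::field mpoly set"
  where "invs W r n = {p \<in> carrier (poly_alg r n).
    (\<forall>w\<in>FI_hom W n n. poly_pull n w p = p) \<and> Poly_Mapping.lookup p 0 = 0}"

lemma coinv_ideal_eq: "coinv_ideal W r n = genideal (poly_alg r n) (invs W r n)"
proof -
  have "poly_act w p = p \<longleftrightarrow> poly_pull n w p = p"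
    if "p \<in> carrier (poly_alg r n)" "w \<in> FI_hom W n n" for w and p :: "'a mpoly"
    using pull_act[OF FI_BC[OF that(2)] that(1)] act_pull[OF FI_BC[OF that(2)] that(1)] by metis
  then have "{p \<in> carrier (poly_alg r n). (\<forall>w\<in>FI_hom W n n. poly_act w p = p) \<and> Poly_Mapping.lookup p 0 = 0}
      = (invs W r n :: 'a mpoly set)"
    unfolding invs_def by (intro Collect_cong conj_cong refl ball_cong) auto
  then show ?thesis by (simp add: coinv_ideal_def)
qed

lemma invs_carrier: "invs W r n \<subseteq> carrier (poly_alg r n)"
  by (auto simp: invs_def)

lemma coinv_poly_ideal: "poly_ideal r n (coinv_ideal W r n)"
  unfolding coinv_ideal_eq by (rule poly_genideal(1)[OF invs_carrier])

lemma invs_coinv_ideal: "p \<in> invs W r n \<Longrightarrow> p \<in> coinv_ideal W r n"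
  unfolding coinv_ideal_eq using poly_genideal(2)[OF invs_carrier] by auto

lemma coinv_ideal_least: "poly_ideal r n I \<Longrightarrow> invs W r n \<subseteq> I \<Longrightarrow> coinv_ideal W r n \<subseteq> I"
  unfolding coinv_ideal_eq by (rule poly_genideal(3)[OF invs_carrier])

interpretation coinv: pm_quotient "poly_alg r n" "monomials r n" "coinv_ideal W r n" for r n W
  by (rule poly_ideal_quotient[OF coinv_poly_ideal])

abbreviation ccls :: "FI_type \<Rightarrow> nat \<Rightarrow> nat \<Rightarrow> 'k::field mpoly \<Rightarrow> 'k mpoly set"
  where "ccls W r n p \<equiv> coinv_ideal W r n +>\<^bsub>poly_alg r n\<^esub> p"

lemma coinv_ideal_mult:
  fixes p q :: "'k::field mpoly"
  shows
  "q \<in> carrier (poly_alg r n) \<Longrightarrow> p \<in> coinv_ideal W r n \<Longrightarrow> q * p \<in> coinv_ideal W r n"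
  using coinv_poly_ideal[of r n W, where 'a = 'k] by (auto simp: poly_ideal_def)

section \<open>Functoriality of the coinvariant ideal\<close>

lemma ob_uminus [simp]: "- a \<in> ob n \<longleftrightarrow> a \<in> ob n"
  by (auto simp: ob_def)

lemma FI_le:
  assumes "f \<in> FI_hom W m n"
  shows "m \<le> n"
proof -
  note f = FI_BC[OF assms]
  have "card {1..m} \<le> card {1..n}"
    by (rule card_inj_on_le[OF idx_inj[OF f]]) (use idx_in[OF f] in auto)
  then show ?thesis by simp
qed

text \<open>On the image of f the extension is w carried over by f; elsewhere it is the identity,
  except for the sign s at the point c. The sign is left free so that it can be adjusted in type
  D.\<close>

lemma extend_along:
  fixes c :: nat
  assumes f: "f \<in> FI_hom FI_BC m n" and w: "w \<in> FI_hom FI_BC m m" and s: "s = 1 \<or> s = -1"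
  obtains w' where "w' \<in> FI_hom FI_BC n n" "\<And>a. a \<in> ob m \<Longrightarrow> w' (f a) = f (w a)"
    "\<And>b. b \<in> ob n \<Longrightarrow> b \<notin> f ` ob m \<Longrightarrow> w' b = (if \<bar>b\<bar> = int c then s * b else b)"
proof -
  define w' where "w' = (\<lambda>b\<in>ob n. if b \<in> f ` ob m then f (w (inv_into (ob m) f b))
    else if \<bar>b\<bar> = int c then s * b else b)"
  have inj: "inj_on f (ob m)" using FI_inj[OF f] by (auto intro: inj_onI)
  have 1: "w' (f a) = f (w a)" if "a \<in> ob m" for a
    using that FI_ob[OF f that] by (simp add: w'_def inv_into_f_f[OF inj])
  have 2: "w' b = (if \<bar>b\<bar> = int c then s * b else b)" if "b \<in> ob n" "b \<notin> f ` ob m" for b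
    using that by (simp add: w'_def)
  \<comment> \<open>The image of f is stable under negation, so b and -b always fall under the same
    case of the definition.\<close>
  have neg: "- b \<in> f ` ob m \<longleftrightarrow> b \<in> f ` ob m" for b
  proof -
    have "- b \<in> f ` ob m" if b: "b \<in> f ` ob m" for b
    proof -
      obtain a where "a \<in> ob m" "b = f a" using b by auto
      then show ?thesis using FI_uminus[OF f, of a] by (intro image_eqI[of _ _ "- a"]) auto
    qed
    from this[of b] this[of "- b"] show ?thesis by auto
  qed
  have out: "w' b \<in> ob n" "w' b \<notin> f ` ob m" "w' b = b \<or> w' b = - b" "w' (- b) = - w' b"
    if "b \<in> ob n" "b \<notin> f ` ob m" for b
    using that s neg[of b] by (auto simp: 2)
  have odd: "w' (- b) = - w' b" if "b \<in> ob n" for b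
  proof (cases "b \<in> f ` ob m")
    case True
    then obtain a where a: "a \<in> ob m" "b = f a" by auto
    then show ?thesis using 1[of a] 1[of "- a"] FI_uminus[OF f] FI_uminus[OF w] FI_ob[OF w] by simp
  qed (use out that in auto)
  have "w' b \<in> ob n" if "b \<in> ob n" for b
    using that out(1)[OF that] 1 FI_ob[OF f] FI_ob[OF w] by (cases "b \<in> f ` ob m") auto
  moreover have "inj_on w' (ob n)"
  proof (rule inj_onI)
    fix b b' assume b: "b \<in> ob n" "b' \<in> ob n" "w' b = w' b'"
    have im: "w' b \<in> f ` ob m \<longleftrightarrow> b \<in> f ` ob m" if "b \<in> ob n" for b
      using out(2)[OF that] 1 FI_ob[OF w] by (cases "b \<in> f ` ob m") auto
    show "b = b'"
    proof (cases "b \<in> f ` ob m")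
      case True
      then obtain a a' where a: "a \<in> ob m" "b = f a" "a' \<in> ob m" "b' = f a'"
        using im[OF b(1)] im[OF b(2)] b(3) by auto
      then have "f (w a) = f (w a')" using 1 b(3) by simp
      then have "w a = w a'" using FI_inj[OF f] FI_ob[OF w] a by blast
      then show ?thesis using FI_inj[OF w] a by blast
    next
      case False
      then have F': "b' \<notin> f ` ob m" using im[OF b(1)] im[OF b(2)] b(3) by auto
      then show ?thesis
        using 2[OF b(1) False] 2[OF b(2) F'] b(3) s by (auto split: if_splits)
    qed
  qed
  ultimately have "w' \<in> FI_hom FI_BC n n" using odd by (auto simp: FI_hom_def w'_def)
  from that[OF this 1 2] show ?thesis .
qed

lemma eps_eq_prod: "eps n w = (\<Prod>a\<in>{1..n}. if w (int a) < 0 then - 1 else 1)"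
proof -
  have "{a \<in> ob n. 0 < a \<and> w a < 0} = int ` {a \<in> {1..n}. w (int a) < 0}"
  proof (intro equalityI subsetI)
    fix a assume "a \<in> {a \<in> ob n. 0 < a \<and> w a < 0}"
    then show "a \<in> int ` {a \<in> {1..n}. w (int a) < 0}"
      by (intro image_eqI[of _ _ "nat a"]) (auto simp: ob_def)
  qed (auto simp: ob_def)
  then have "eps n w = (- 1) ^ card {a \<in> {1..n}. w (int a) < 0}"
    by (simp add: eps_def card_image)
  also have "\<dots> = (\<Prod>a\<in>{1..n}. if w (int a) < 0 then - 1 else 1)"
    by (subst prod.If_cases) (auto simp: Int_def)
  finally show ?thesis .
qed

text \<open>The sign of the composite at a is the sign of f at a times the sign of g at |f a|; the
  second factors are reindexed along the permutation \<open>idx f\<close>.\<close>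

lemma eps_compose:
  assumes f: "f \<in> FI_hom FI_BC n n" and g: "g \<in> FI_hom FI_BC n n"
  shows "eps n (compose (ob n) g f) = eps n g * eps n f"
proof -
  let ?s = "\<lambda>w a. if w (int a) < 0 then - 1 else 1 :: int"
  have "eps n (compose (ob n) g f) = (\<Prod>a\<in>{1..n}. ?s g (idx f a) * ?s f a)"
    unfolding eps_eq_prod
  proof (rule prod.cong[OF refl])
    fix a assume a: "a \<in> {1..n}"
    then have o: "int a \<in> ob n" by simp
    have fo: "f (int a) \<in> ob n" by (rule FI_ob[OF f o])
    have go: "g (f (int a)) \<in> ob n" by (rule FI_ob[OF g fo])
    show "?s (compose (ob n) g f) a = ?s g (idx f a) * ?s f a"
      using o fo go FI_uminus[OF g fo] by (auto simp: compose_def idx_def abs_if ob_def)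
  qed
  also have "\<dots> = (\<Prod>a\<in>{1..n}. ?s g (idx f a)) * eps n f"
    by (simp add: prod.distrib eps_eq_prod)
  also have "(\<Prod>a\<in>{1..n}. ?s g (idx f a)) = (\<Prod>a\<in>idx f ` {1..n}. ?s g a)"
    by (rule prod.reindex_cong[symmetric, OF idx_inj[OF f]]) auto
  also have "\<dots> = eps n g" unfolding idx_image[OF f] by (rule eps_eq_prod[symmetric])
  finally show ?thesis .
qed

lemma eps_cases: "eps n w = 1 \<or> eps n w = -1"
  by (simp add: eps_def minus_one_power_iff)

lemma FI_D_iff: "w \<in> FI_hom FI_D n n \<longleftrightarrow> w \<in> FI_hom FI_BC n n \<and> eps n w = 1"
  using eps_ker by auto

lemma FI_D_less: "m < n \<Longrightarrow> f \<in> FI_hom FI_D m n \<longleftrightarrow> f \<in> FI_hom FI_BC m n"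
  by (auto simp: FI_hom_def)

text \<open>The maps under which the coinvariant ideals are stable: for type \<open>D\<close> these are more than the
  morphisms of the category.\<close>

definition stab :: "FI_type \<Rightarrow> FI_type"
  where "stab W = (if W = FI_A then FI_A else FI_BC)"

lemma FI_stab: "f \<in> FI_hom W m n \<Longrightarrow> f \<in> FI_hom (stab W) m n"
  by (auto simp: stab_def intro: FI_BC)

text \<open>For type \<open>D\<close> and \<open>m < n\<close> the sign of the extension is corrected at a point outside the image.\<close>

lemma commute_along:
  assumes f: "f \<in> FI_hom (stab W) m n" and w: "w \<in> FI_hom W m m"
  obtains w' where "w' \<in> FI_hom W n n" "compose (ob m) w' f = compose (ob m) f w"
proof -
  note f' = FI_BC[OF f] and w' = FI_BC[OF w]
  have comp: "compose (ob m) v f = compose (ob m) f w" if "\<And>a. a \<in> ob m \<Longrightarrow> v (f a) = f (w a)" for v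
    using that by (auto simp: compose_def)
  show ?thesis
  proof (cases "W = FI_A")
    case True
    obtain v where v: "v \<in> FI_hom FI_BC n n" "\<And>a. a \<in> ob m \<Longrightarrow> v (f a) = f (w a)"
      "\<And>b. b \<in> ob n \<Longrightarrow> b \<notin> f ` ob m \<Longrightarrow> v b = (if \<bar>b\<bar> = int 0 then 1 * b else b)"
      by (rule extend_along[OF f' w', of 1 0]) auto
    have pos: "a \<in> ob m \<Longrightarrow> 0 < a \<Longrightarrow> 0 < f a" "a \<in> ob m \<Longrightarrow> 0 < a \<Longrightarrow> 0 < w a" for a
      using f w True by (auto simp: FI_hom_def stab_def)
    have pos': "0 < a" if "a \<in> ob m" "0 < f a" for a
      using that pos(1)[of "- a"] FI_uminus[OF f' that(1)] by (force simp: ob_def)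
    have "0 < v b" if b: "b \<in> ob n" "0 < b" for b
    proof (cases "b \<in> f ` ob m")
      case True
      then obtain a where a: "a \<in> ob m" "b = f a" by auto
      then show ?thesis using b v(2)[of a] pos'[of a] pos FI_ob[OF w' a(1)] by simp
    qed (use b v(3)[of b] in auto)
    then have "v \<in> FI_hom W n n" using v(1) True by (auto simp: FI_hom_def)
    then show ?thesis using that comp v(2) by blast
  next
    case nA: False
    show ?thesis
    proof (cases "W = FI_D \<and> m < n")
      case False
      obtain v where v: "v \<in> FI_hom FI_BC n n" "\<And>a. a \<in> ob m \<Longrightarrow> v (f a) = f (w a)"
        by (rule extend_along[OF f' w', of 1 0]) auto
      have "v \<in> FI_hom W n n"
      proof (cases "W = FI_D")
        case True
        then have [simp]: "m = n" using False FI_le[OF f] by auto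
        \<comment> \<open>Here f is itself a signed permutation, and multiplicativity of the sign
          shows that v has the sign of w.\<close>
        have "eps n v * eps n f = eps n f * eps n w"
          using comp[OF v(2)] eps_compose[OF _ v(1), of f] eps_compose[of w n f] f' w' by simp
        then show ?thesis using eps_cases[of n f] v(1) w True by (auto simp: FI_D_iff)
      next
        case False
        then have "W = FI_BC" using nA by (cases W) auto
        then show ?thesis using v by simp
      qed
      then show ?thesis using that comp v(2) by blast
    next
      case True
      \<comment> \<open>A point c outside the image exists because m < n. The extensions v and u
        differ only in their sign at c, so exactly one of them is even.\<close>
      have "card (idx f ` {1..m}) < card {1..n}" using True card_image[OF idx_inj[OF f']] by simp
      then have "\<not> {1..n} \<subseteq> idx f ` {1..m}" using card_mono[of "idx f ` {1..m}" "{1..n}"] by auto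
      then obtain c where c: "c \<in> {1..n}" "c \<notin> idx f ` {1..m}" by blast
      have cf: "int c \<notin> f ` ob m"
      proof
        assume "int c \<in> f ` ob m"
        then obtain a where a: "a \<in> ob m" "int c = f a" by auto
        then have "nat \<bar>a\<bar> \<in> {1..m}" "idx f (nat \<bar>a\<bar>) = c"
          using FI_uminus[OF f', of a] by (auto simp: ob_def idx_def abs_if)
        then show False using c by blast
      qed
      obtain v where v: "v \<in> FI_hom FI_BC n n" "\<And>a. a \<in> ob m \<Longrightarrow> v (f a) = f (w a)"
        "\<And>b. b \<in> ob n \<Longrightarrow> b \<notin> f ` ob m \<Longrightarrow> v b = (if \<bar>b\<bar> = int c then 1 * b else b)"
        by (rule extend_along[OF f' w', of 1 c]) auto
      obtain u where u: "u \<in> FI_hom FI_BC n n" "\<And>a. a \<in> ob m \<Longrightarrow> u (f a) = f (w a)"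
        "\<And>b. b \<in> ob n \<Longrightarrow> b \<notin> f ` ob m \<Longrightarrow> u b = (if \<bar>b\<bar> = int c then - 1 * b else b)"
        by (rule extend_along[OF f' w', of "- 1" c]) auto
      let ?s = "\<lambda>w a. if w (int a) < 0 then - 1 else 1 :: int"
      have ocv: "v (int c) = int c" and ocu: "u (int c) = - int c"
        using v(3)[OF _ cf] u(3)[OF _ cf] c by auto
      have "v b = u b" if "b \<in> ob n" "\<bar>b\<bar> \<noteq> int c" for b
        using that v(2,3) u(2,3) by (cases "b \<in> f ` ob m") auto
      then have rest: "(\<Prod>a\<in>{1..n} - {c}. ?s v a) = (\<Prod>a\<in>{1..n} - {c}. ?s u a)"
        by (intro prod.cong) auto
      have "eps n v = ?s v c * (\<Prod>a\<in>{1..n} - {c}. ?s v a)" "eps n u = ?s u c * (\<Prod>a\<in>{1..n} - {c}. ?s u a)"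
        unfolding eps_eq_prod by (rule prod.remove; use c in simp)+
      then have "eps n u = - eps n v" using rest ocv ocu c by simp
      then have "v \<in> FI_hom W n n \<or> u \<in> FI_hom W n n"
        using eps_cases[of n v] u(1) v(1) True by (auto simp: FI_D_iff)
      then show ?thesis using that comp v(2) u(2) by blast
    qed
  qed
qed

lemma pull_invs:
  assumes f: "f \<in> FI_hom (stab W) m n" and p: "p \<in> invs W r n"
  shows "poly_pull m f p \<in> invs W r m"
proof -
  note f' = FI_BC[OF f]
  have pc: "p \<in> carrier (poly_alg r n)" using p by (simp add: invs_def)
  have "poly_pull m w (poly_pull m f p) = poly_pull m f p" if w: "w \<in> FI_hom W m m" for w
  proof -
    obtain w' where w': "w' \<in> FI_hom W n n" "compose (ob m) w' f = compose (ob m) f w"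
      by (rule commute_along[OF f w])
    have "poly_pull m w (poly_pull m f p) = poly_pull m (compose (ob m) f w) p"
      by (rule poly_pull_comp[OF FI_BC[OF w] f' pc, symmetric])
    also have "\<dots> = poly_pull m f (poly_pull n w' p)"
      unfolding w'(2)[symmetric] by (rule poly_pull_comp[OF f' FI_BC[OF w'(1)] pc])
    also have "poly_pull n w' p = p" using p w'(1) by (simp add: invs_def)
    finally show ?thesis .
  qed
  moreover have "Poly_Mapping.lookup (poly_pull m f p) 0 = 0"
    using lookup_poly_pull[OF f' pc, of 0] p by (simp add: invs_def)
  ultimately show ?thesis using poly_pull_closed[OF f' pc] by (simp add: invs_def)
qed

text \<open>The preimage of the ideal in m variables is an ideal in n variables which contains the
  invariants.\<close>

lemma pull_coinv_ideal:
  assumes f: "f \<in> FI_hom (stab W) m n" and p: "p \<in> coinv_ideal W r n"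
  shows "poly_pull m f p \<in> coinv_ideal W r m"
proof -
  let ?I = "{p \<in> carrier (poly_alg r n). poly_pull m f p \<in> coinv_ideal W r m}"
  have "poly_ideal r n ?I"
    unfolding poly_ideal_def
    by (auto simp: poly.zero_closed poly.add_closed poly_mult_closed poly_pull_add poly_pull_mult
        coinv.sub_zero coinv.sub_add intro!: coinv_ideal_mult poly_pull_closed[OF FI_BC[OF f]])
  moreover have "invs W r n \<subseteq> ?I" using pull_invs[OF f] invs_carrier invs_coinv_ideal by blast
  ultimately show ?thesis using coinv_ideal_least p by blast
qed

lemma coinv_fmap_cls:
  assumes f: "f \<in> FI_hom (stab W) m n"
  shows "fmap (coinv W r) m n f (ccls W r n p) = ccls W r m (poly_pull m f p)"
  unfolding coinv_def using pull_coinv_ideal[OF f, where r = r]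
  by (simp, intro coinv.quot_map_cls[OF _ coinv.pm_quotient_axioms]) (simp add: poly_pull_add)

section \<open>Gradings\<close>

lemma total_deg_add: "total_deg (M + N) = total_deg M + total_deg N"
  unfolding total_deg_def by (rule setsum_keys_plus_distrib) auto

lemma total_deg_single [simp]: "total_deg (Poly_Mapping.single v k) = k"
  by (cases "k = 0") (simp_all add: total_deg_def)

lemma total_deg_zero [simp]: "total_deg 0 = 0"
  by (simp add: total_deg_def)

lemma multideg_add: "multideg (M + N) = multideg M + multideg N"
  unfolding multideg_def by (rule setsum_keys_plus_distrib) (auto simp: single_add)

lemma multideg_single [simp]:
  "multideg (Poly_Mapping.single v k) = Poly_Mapping.single (fst v) k"
  by (cases "k = 0") (simp_all add: multideg_def)

lemma multideg_zero [simp]: "multideg 0 = 0"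
  by (simp add: multideg_def)

lemma size_multideg_add: "size_multideg (J + K) = size_multideg J + size_multideg K"
  unfolding size_multideg_def by (rule setsum_keys_plus_distrib) auto

lemma size_multideg_zero [simp]: "size_multideg 0 = 0"
  by (simp add: size_multideg_def)

lemma total_deg_multideg: "total_deg M = size_multideg (multideg M)"
proof (induction M rule: poly_mapping_add_induct[OF subset_UNIV])
  case (2 v k)
  then show ?case by (cases "k = 0") (simp_all add: size_multideg_def)
qed (simp_all add: total_deg_add multideg_add size_multideg_add)

text \<open>Covers the multigrading and the total degree together. By \<open>dg_single\<close> the
  degree ignores the second index, so transport preserves it. \<open>bounded\<close> makes the set
  of monomials of a given degree finite for each n, and limits the number of variables in a monomial
  independently of n.\<close>

locale mono_grading =
  fixes dg :: "monomial \<Rightarrow> 'j::comm_monoid_add" and I :: "'j set" and r :: nat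
  assumes dg_zero: "dg 0 = 0" and dg_add: "dg (M + N) = dg M + dg N"
    and dg_single: "dg (Poly_Mapping.single (i, a) k) = dg (Poly_Mapping.single (i, b) k)"
    and dg_mem: "M \<in> monomials r n \<Longrightarrow> dg M \<in> I"
    and I_zero: "0 \<in> I" and I_add: "j \<in> I \<Longrightarrow> j' \<in> I \<Longrightarrow> j + j' \<in> I"
    and bounded: "\<exists>B. \<forall>M. dg M = j \<longrightarrow> total_deg M \<le> B"
begin

lemma dg_transport: "dg (transport f M) = dg M"
proof (induction M rule: poly_mapping_add_induct[OF subset_UNIV])
  case (2 v k)
  then show ?case using dg_single by (cases v) auto
qed (simp_all add: transport_add dg_add)

text \<open>The homogeneous component of degree j; there is no relation to composition.\<close>

definition comp :: "'j \<Rightarrow> 'k::field mpoly \<Rightarrow> 'k mpoly"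
  where "comp j p = (\<Sum>M\<in>Poly_Mapping.keys p.
    Poly_Mapping.single M (Poly_Mapping.lookup p M when dg M = j))"

definition hom :: "'j \<Rightarrow> 'k::field mpoly \<Rightarrow> bool"
  where "hom j p \<longleftrightarrow> (\<forall>M\<in>Poly_Mapping.keys p. dg M = j)"

lemma lookup_comp: "Poly_Mapping.lookup (comp j p) M = (Poly_Mapping.lookup p M when dg M = j)"
proof (cases "M \<in> Poly_Mapping.keys p")
  case True
  then have "(\<Sum>N\<in>Poly_Mapping.keys p. Poly_Mapping.lookup p N when dg N = j when N = M)
      = (Poly_Mapping.lookup p M when dg M = j)"
    by (simp add: when_def sum.delta)
  then show ?thesis by (simp add: comp_def lookup_sum lookup_single)
next
  case False
  then have "(\<Sum>N\<in>Poly_Mapping.keys p. Poly_Mapping.lookup p N when dg N = j when N = M) = 0"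
    by (intro sum.neutral) (auto simp: when_def)
  then show ?thesis using False by (simp add: comp_def lookup_sum lookup_single in_keys_iff)
qed

lemma comp_add: "comp j (p + q) = comp j p + comp j q"
  by (rule poly_mapping_eqI) (simp add: lookup_comp lookup_add when_def)

lemma comp_zero [simp]: "comp j 0 = 0"
  by (simp add: comp_def)

lemma comp_diff: "comp j (p - q) = comp j p - comp j q"
  by (rule poly_mapping_eqI) (simp add: lookup_comp lookup_minus when_def)

lemma comp_sum: "comp j (sum f A) = (\<Sum>a\<in>A. comp j (f a))"
  by (induction A rule: infinite_finite_induct) (auto simp: comp_add)

lemma comp_hom: "hom j p \<Longrightarrow> comp i p = (if i = j then p else 0)"
  by (rule poly_mapping_eqI) (auto simp: hom_def lookup_comp when_def in_keys_iff)

lemma hom_comp: "hom j (comp j p)"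
  by (auto simp: hom_def in_keys_iff lookup_comp when_def split: if_splits)

lemma hom_iff: "hom j p \<longleftrightarrow> comp j p = p"
  using comp_hom[of j p j] hom_comp[of j p] by auto

lemma hom_zero: "hom j 0"
  by (simp add: hom_def)

lemma hom_add: "hom j p \<Longrightarrow> hom j q \<Longrightarrow> hom j (p + q)"
  by (simp add: hom_iff comp_add)

lemma hom_scale: "hom j p \<Longrightarrow> hom j (scale c p)"
  using keys_scale by (fastforce simp: hom_def)

lemma hom_single: "hom (dg M) (Poly_Mapping.single M c)"
  by (simp add: hom_def)

lemma hom_mult: "hom i p \<Longrightarrow> hom j q \<Longrightarrow> hom (i + j) (p * q)"
  using keys_mult[of p q] by (fastforce simp: hom_def dg_add)

lemma comp_decomp: "(\<Sum>j\<in>dg ` Poly_Mapping.keys p. comp j p) = p"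
proof (rule poly_mapping_eqI)
  fix M
  show "Poly_Mapping.lookup (\<Sum>j\<in>dg ` Poly_Mapping.keys p. comp j p) M = Poly_Mapping.lookup p M"
    by (cases "M \<in> Poly_Mapping.keys p")
      (auto simp: lookup_sum lookup_comp when_def in_keys_iff sum.delta)
qed

lemma comp_eq_0: "j \<notin> dg ` Poly_Mapping.keys p \<Longrightarrow> comp j p = 0"
  by (rule poly_mapping_eqI) (auto simp: lookup_comp when_def in_keys_iff)

lemma comp_closed: "p \<in> carrier (poly_alg r n) \<Longrightarrow> comp j p \<in> carrier (poly_alg r n)"
  by (auto simp: poly.carrier_eq in_keys_iff lookup_comp when_def split: if_splits)

text \<open>The monoid of degrees need not be cancellative, so several components of p may
  contribute to degree j.\<close>

lemma comp_mult_single: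
  "comp j (Poly_Mapping.single N c * p)
    = (\<Sum>i\<in>dg ` Poly_Mapping.keys p. if j = dg N + i then Poly_Mapping.single N c * comp i p else 0)"
proof -
  have "comp j (Poly_Mapping.single N c * p)
      = comp j (\<Sum>i\<in>dg ` Poly_Mapping.keys p. Poly_Mapping.single N c * comp i p)"
    by (subst (1) comp_decomp[of p, symmetric]) (simp add: sum_distrib_left)
  also have "\<dots> = (\<Sum>i\<in>dg ` Poly_Mapping.keys p. comp j (Poly_Mapping.single N c * comp i p))"
    by (rule comp_sum)
  also have "\<dots> = (\<Sum>i\<in>dg ` Poly_Mapping.keys p.
      if j = dg N + i then Poly_Mapping.single N c * comp i p else 0)"
    by (intro sum.cong refl comp_hom hom_mult hom_single hom_comp)
  finally show ?thesis .
qed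

lemma pull_comp_commute:
  assumes "f \<in> FI_hom FI_BC m n" "p \<in> carrier (poly_alg r n)"
  shows "poly_pull m f (comp j p) = comp j (poly_pull m f p)"
proof (rule poly_eqI[of _ r m])
  fix M assume M: "M \<in> monomials r m"
  show "Poly_Mapping.lookup (poly_pull m f (comp j p)) M
      = Poly_Mapping.lookup (comp j (poly_pull m f p)) M"
    by (simp add: lookup_comp lookup_poly_pull[OF assms M] dg_transport when_def
        lookup_poly_pull[OF assms(1) comp_closed[OF assms(2)] M])
qed (use assms in \<open>auto intro: comp_closed poly_pull_closed\<close>)

text \<open>The homogeneous components of an invariant are invariant. The polynomials all of whose
  components lie in the ideal therefore form an ideal containing the generators; quantifying over
  all j at once is what makes it closed under multiplication.\<close>

lemma comp_coinv_ideal: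
  fixes p :: "'k::field mpoly"
  assumes "p \<in> coinv_ideal W r n"
  shows "comp j p \<in> coinv_ideal W r n"
proof -
  let ?I = "{p :: 'k mpoly. p \<in> carrier (poly_alg r n) \<and> (\<forall>j. comp j p \<in> coinv_ideal W r n)}"
  have "comp j (q * p) \<in> coinv_ideal W r n"
    if "q \<in> carrier (poly_alg r n)" "\<forall>j. comp j p \<in> coinv_ideal W r n" for p q :: "'k mpoly" and j
    using that(1)
  proof (induction q rule: poly_induct)
    case (single N c)
    then show ?case using that(2)
      by (auto simp: comp_mult_single intro!: coinv.sub_sum coinv.sub_zero coinv_ideal_mult poly.single_closed)
  qed (auto simp: distrib_right comp_add intro: coinv.sub_zero coinv.sub_add)
  then have "poly_ideal r n ?I"
    unfolding poly_ideal_def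
    by (auto simp: poly.zero_closed poly.add_closed poly_mult_closed comp_add coinv.sub_zero coinv.sub_add)
  moreover have "invs W r n \<subseteq> ?I"
  proof
    fix p :: "'k mpoly" assume p: "p \<in> invs W r n"
    then have pc: "p \<in> carrier (poly_alg r n)" by (simp add: invs_def)
    have "comp j p \<in> invs W r n" for j
      using p comp_closed[OF pc] pull_comp_commute[OF FI_BC pc]
      by (auto simp: invs_def lookup_comp when_def)
    then show "p \<in> ?I" using pc invs_coinv_ideal by blast
  qed
  ultimately show ?thesis using coinv_ideal_least[of r n ?I W] assms by blast
qed

section \<open>The grading of the coinvariant algebras and its functoriality\<close>

lemma piece_eq: "coinv_piece dg W r n j = {ccls W r n p | p. p \<in> carrier (poly_alg r n) \<and> hom j p}"
  by (simp add: coinv_piece_def hom_def)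

lemma piece_memI:
  "p \<in> carrier (poly_alg r n) \<Longrightarrow> hom j p \<Longrightarrow> ccls W r n p \<in> coinv_piece dg W r n j"
  by (auto simp: piece_eq)

abbreviation "quot W n \<equiv> quot_mod (poly_alg r n) (coinv_ideal W r n)"

lemma quot_mult:
  assumes "p \<in> carrier (poly_alg r n)" "q \<in> carrier (poly_alg r n)"
  shows "ccls W r n p \<otimes>\<^bsub>quot W n\<^esub> ccls W r n q = ccls W r n (p * q)"
proof -
  interpret ideal "coinv_ideal W r n" "poly_alg r n"
    using coinv_poly_ideal poly_ideal_iff by blast
  show ?thesis using rcoset_mult_add[OF assms] by (simp add: quot_mod_def ring.extend_def FactRing_def)
qed

lemma quot_one: "\<one>\<^bsub>quot W n\<^esub> = ccls W r n 1"
  by (simp add: quot_mod_def ring.extend_def FactRing_def)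

lemma quot_algebra: "Module.algebra scalars (quot W n :: ('k::field, 'k mpoly set) module)"
proof -
  interpret M: Module.module scalars "quot W n :: ('k, 'k mpoly set) module"
    by (rule coinv.quot_is_module)
  have "cring (quot W n :: ('k, 'k mpoly set) module)"
  proof (rule cringI)
    show "comm_monoid (quot W n :: ('k, 'k mpoly set) module)"
      by (rule comm_monoidI)
        (auto simp: coinv.quot_carrier quot_mult quot_one poly_mult_closed poly_one_closed algebra_simps)
  qed (auto simp: coinv.quot_abelian_group coinv.quot_carrier quot_mult coinv.quot_add
      poly.add_closed poly_mult_closed distrib_right)
  then show ?thesis
    using M.smult_l_distr M.smult_r_distr M.smult_assoc1
    by (intro algebraI)
      (auto simp: scalars_cring coinv.quot_carrier coinv.quot_smult quot_mult poly.scale_closed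
        poly_mult_closed coinv.quot_add,
       auto simp: scale_eq_mult mult.assoc)
qed

lemma piece_carrier: "coinv_piece dg W r n j \<subseteq> carrier (quot W n)"
  by (auto simp: piece_eq coinv.quot_carrier)

lemma piece_submodule:
  "submodule (coinv_piece dg W r n j) scalars (quot W n :: ('k::field, 'k mpoly set) module)"
proof (rule submodule_closedI[OF coinv.quot_is_module piece_carrier])
  show "\<zero>\<^bsub>quot W n\<^esub> \<in> coinv_piece dg W r n j"
    by (simp add: coinv.quot_zero piece_memI hom_zero poly.zero_closed)
next
  fix u v :: "'k mpoly set" and c :: 'k
  assume u: "u \<in> coinv_piece dg W r n j"
  then obtain p where p: "u = ccls W r n p" "p \<in> carrier (poly_alg r n)" "hom j p"
    by (auto simp: piece_eq)
  then show "c \<odot>\<^bsub>quot W n\<^esub> u \<in> coinv_piece dg W r n j"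
    by (simp add: coinv.quot_smult piece_memI hom_scale poly.scale_closed)
  assume "v \<in> coinv_piece dg W r n j"
  then obtain q where "v = ccls W r n q" "q \<in> carrier (poly_alg r n)" "hom j q"
    by (auto simp: piece_eq)
  with p show "u \<oplus>\<^bsub>quot W n\<^esub> v \<in> coinv_piece dg W r n j"
    by (simp add: coinv.quot_add piece_memI hom_add poly.add_closed)
qed

text \<open>A class is decomposed through the components of a representative. This is independent of
  choices because the ideal contains the components of its elements.\<close>

lemma decomposition:
  assumes "x \<in> carrier (quot W n :: ('k::field, 'k mpoly set) module)"
  shows "\<exists>!c. c \<in> PiE I (coinv_piece dg W r n) \<and> finite {j \<in> I. c j \<noteq> \<zero>\<^bsub>quot W n\<^esub>} \<and>
    x = (\<Oplus>\<^bsub>quot W n\<^esub>j\<in>{j \<in> I. c j \<noteq> \<zero>\<^bsub>quot W n\<^esub>}. c j)"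
proof -
  let ?c = "ccls W r n :: 'k mpoly \<Rightarrow> _"
  obtain p where p: "p \<in> carrier (poly_alg r n)" "x = ?c p" using assms by (auto simp: coinv.quot_carrier)
  interpret Q: abelian_group "quot W n :: ('k, 'k mpoly set) module" by (rule coinv.quot_abelian_group)
  define c0 where "c0 = (\<lambda>j\<in>I. ?c (comp j p))"
  show ?thesis
  proof (rule ex1I[of _ c0], intro conjI)
    let ?F = "{j \<in> I. c0 j \<noteq> \<zero>\<^bsub>quot W n\<^esub>}"
    show "c0 \<in> PiE I (coinv_piece dg W r n)"
      by (auto simp: c0_def intro!: piece_memI hom_comp comp_closed[OF p(1)])
    have sub: "?F \<subseteq> dg ` Poly_Mapping.keys p"
    proof
      fix j assume j: "j \<in> ?F"
      show "j \<in> dg ` Poly_Mapping.keys p"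
      proof (rule ccontr)
        assume "j \<notin> dg ` Poly_Mapping.keys p"
        from comp_eq_0[OF this] j show False by (auto simp: c0_def coinv.quot_zero)
      qed
    qed
    then show fin: "finite ?F" by (rule finite_subset) auto
    have "(\<Oplus>\<^bsub>quot W n\<^esub>j\<in>?F. c0 j) = (\<Oplus>\<^bsub>quot W n\<^esub>j\<in>?F. ?c (comp j p))"
      by (rule Q.finsum_cong') (auto simp: c0_def coinv.quot_carrier comp_closed[OF p(1)])
    also have "\<dots> = ?c (\<Sum>j\<in>?F. comp j p)"
      by (rule coinv.quot_finsum[OF fin]) (rule comp_closed[OF p(1)])
    also have "\<dots> = ?c p"
    proof -
      have "dg ` Poly_Mapping.keys p \<subseteq> I" using p(1) dg_mem by (auto simp: poly.carrier_eq)
      \<comment> \<open>Components of p whose class vanishes are absent from the support, but they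
        lie in the ideal and do not change the class of the sum.\<close>
      then have rest: "comp j p \<in> coinv_ideal W r n" if "j \<in> dg ` Poly_Mapping.keys p - ?F" for j
        using that coinv.cls_eq_zero_iff[where p = "comp j p" and W = W and r = r and n = n]
        by (auto simp: c0_def)
      have "p = (\<Sum>j\<in>?F. comp j p) + (\<Sum>j\<in>dg ` Poly_Mapping.keys p - ?F. comp j p)"
        using sum.subset_diff[OF sub, of "\<lambda>j. comp j p"] by (simp add: comp_decomp add.commute)
      then have "p - (\<Sum>j\<in>?F. comp j p) = (\<Sum>j\<in>dg ` Poly_Mapping.keys p - ?F. comp j p)"
        by (simp add: algebra_simps)
      also have "\<dots> \<in> coinv_ideal W r n" by (rule coinv.sub_sum) (rule rest)
      finally have "?c p = ?c (\<Sum>j\<in>?F. comp j p)" by (simp only: coinv.cls_eq_iff)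
      then show ?thesis by simp
    qed
    finally show "x = (\<Oplus>\<^bsub>quot W n\<^esub>j\<in>?F. c0 j)" using p(2) by simp
  next
    fix c :: "'j \<Rightarrow> 'k mpoly set"
    let ?F = "{j \<in> I. c j \<noteq> \<zero>\<^bsub>quot W n\<^esub>}"
    assume c: "c \<in> PiE I (coinv_piece dg W r n) \<and> finite ?F \<and> x = (\<Oplus>\<^bsub>quot W n\<^esub>j\<in>?F. c j)"
    have "\<forall>j\<in>I. \<exists>q. c j = ?c q \<and> q \<in> carrier (poly_alg r n) \<and> hom j q"
      using c by (fastforce simp: piece_eq)
    then obtain q where q: "\<And>j. j \<in> I \<Longrightarrow> c j = ?c (q j)"
      "\<And>j. j \<in> I \<Longrightarrow> q j \<in> carrier (poly_alg r n)" "\<And>j. j \<in> I \<Longrightarrow> hom j (q j)"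
      by metis
    have "(\<Oplus>\<^bsub>quot W n\<^esub>j\<in>?F. c j) = (\<Oplus>\<^bsub>quot W n\<^esub>j\<in>?F. ?c (q j))"
      by (rule Q.finsum_cong') (auto simp: q coinv.quot_carrier)
    also have "\<dots> = ?c (\<Sum>j\<in>?F. q j)"
      by (rule coinv.quot_finsum) (use c q in auto)
    finally have "?c p = ?c (\<Sum>j\<in>?F. q j)" using c p(2) by simp
    then have diff: "p - (\<Sum>j\<in>?F. q j) \<in> coinv_ideal W r n" by (simp only: coinv.cls_eq_iff)
    \<comment> \<open>Uniqueness: the component of degree j of the difference lies in the ideal, and
      it compares \<open>c j\<close> with the component of p.\<close>
    have "c j = ?c (comp j p)" if j: "j \<in> I" for j
    proof -
      have "comp j (\<Sum>j\<in>?F. q j) = (\<Sum>i\<in>?F. if j = i then q i else 0)"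
        unfolding comp_sum by (intro sum.cong refl comp_hom) (use q in auto)
      also have "\<dots> = (if j \<in> ?F then q j else 0)"
        using c by (simp add: sum.delta')
      finally have "comp j p - (if j \<in> ?F then q j else 0) \<in> coinv_ideal W r n"
        using comp_coinv_ideal[OF diff, of j] by (simp add: comp_diff)
      then have "?c (comp j p) = ?c (if j \<in> ?F then q j else 0)" by (simp only: coinv.cls_eq_iff)
      then show ?thesis using j q(1)[OF j] by (auto simp: coinv.quot_zero split: if_splits)
    qed
    then show "c = c0" using c by (intro ext) (auto simp: c0_def PiE_def extensional_def)
  qed
qed

lemma quot_graded:
  "graded_algebra (quot W n :: ('k::field, 'k mpoly set) module) I (coinv_piece dg W r n)"
  unfolding graded_algebra_def
proof (intro conjI ballI)
  show "\<one>\<^bsub>quot W n\<^esub> \<in> coinv_piece dg W r n 0"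
    by (simp add: quot_one piece_memI poly_one_closed hom_def dg_zero)
  fix i j assume "i \<in> I" "j \<in> I"
  then show "i + j \<in> I" by (rule I_add)
  fix x y :: "'k mpoly set" assume "x \<in> coinv_piece dg W r n i" "y \<in> coinv_piece dg W r n j"
  then show "x \<otimes>\<^bsub>quot W n\<^esub> y \<in> coinv_piece dg W r n (i + j)"
    by (auto simp: piece_eq[of W n i] piece_eq[of W n j] quot_mult
        intro!: piece_memI hom_mult poly_mult_closed)
qed (simp_all add: quot_algebra piece_submodule decomposition I_zero)

lemma coinv_graded_co_FI:
  "graded_co_FI_algebra W (coinv W r :: ('k::field, 'k mpoly set) FI_diagram) I (coinv_piece dg W r)"
proof
  fix n show "graded_algebra (fobj (coinv W r) n :: ('k, 'k mpoly set) module) I (coinv_piece dg W r n)"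
    using quot_graded by (simp add: coinv_def)
next
  fix f m n assume f: "f \<in> FI_hom W m n"
  let ?C = "coinv W r :: ('k, 'k mpoly set) FI_diagram"
  have ob: "fobj ?C k = quot W k" for k by (simp add: coinv_def)
  note map = coinv_fmap_cls[OF FI_stab[OF f], where r = r]
  have cl: "poly_pull m f p \<in> carrier (poly_alg r m)" if "p \<in> carrier (poly_alg r n)" for p :: "'k mpoly"
    using that by (rule poly_pull_closed[OF FI_BC[OF f]])
  show "fmap ?C m n f \<in> ring_hom (fobj ?C n) (fobj ?C m) \<inter> lin_maps (fobj ?C n) (fobj ?C m)"
    by (auto simp: ring_hom_def lin_maps_def ob coinv.quot_carrier map cl quot_mult poly_mult_closed
        poly_pull_mult coinv.quot_add poly_pull_add coinv.quot_smult poly_pull_scale quot_one)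
  fix j assume "j \<in> I"
  show "fmap ?C m n f ` coinv_piece dg W r n j \<subseteq> coinv_piece dg W r m j"
  proof
    fix y assume "y \<in> fmap ?C m n f ` coinv_piece dg W r n j"
    then obtain p where p: "p \<in> carrier (poly_alg r n)" "hom j p" "y = ccls W r m (poly_pull m f p)"
      by (auto simp: piece_eq map)
    then have "hom j (poly_pull m f p)"
      using pull_comp_commute[OF FI_BC[OF f] p(1), of j] by (simp add: hom_iff)
    then show "y \<in> coinv_piece dg W r m j" using p cl by (auto simp: piece_eq)
  qed
next
  let ?C = "coinv W r :: ('k, 'k mpoly set) FI_diagram"
  have ob: "fobj ?C k = quot W k" for k by (simp add: coinv_def)
  show "fmap ?C n n (\<lambda>a\<in>ob n. a) x = x" if "x \<in> carrier (fobj ?C n)" for x n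
    using that by (auto simp: ob coinv.quot_carrier coinv_fmap_cls[OF id_FI] poly_pull_id)
  fix f g l m n x
  assume f: "f \<in> FI_hom W l m" and g: "g \<in> FI_hom W m n" and x: "x \<in> carrier (fobj ?C n)"
  note st = FI_stab[OF f] FI_stab[OF g]
  have "compose (ob l) g f \<in> FI_hom (stab W) l n"
  proof (cases "W = FI_A")
    case True
    then show ?thesis
      using compose_FI[OF FI_BC[OF f] FI_BC[OF g]] f g FI_ob[OF FI_BC[OF f]]
      by (auto simp: stab_def FI_hom_def compose_def)
  qed (use compose_FI[OF FI_BC[OF f] FI_BC[OF g]] in \<open>simp add: stab_def\<close>)
  then show "fmap ?C l n (compose (ob l) g f) x = fmap ?C l m f (fmap ?C m n g x)"
    using x by (auto simp: ob coinv.quot_carrier coinv_fmap_cls st poly_pull_comp[OF FI_BC[OF f] FI_BC[OF g]])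
qed

end

interpretation multi: mono_grading multideg "multidegs r" r for r
proof
  fix n and M :: monomial assume "M \<in> monomials r n"
  then show "multideg M \<in> multidegs r"
  proof (induction M rule: monomials_induct)
    case (add M N)
    then show ?case using keys_add[of "multideg M" "multideg N"] by (auto simp: multidegs_def multideg_add)
  qed (auto simp: multidegs_def)
next
  fix i j :: "nat \<Rightarrow>\<^sub>0 nat" assume "i \<in> multidegs r" "j \<in> multidegs r"
  then show "i + j \<in> multidegs r" using keys_add[of i j] by (auto simp: multidegs_def)
next
  fix j show "\<exists>B. \<forall>M. multideg M = j \<longrightarrow> total_deg M \<le> B"
    by (intro exI[of _ "size_multideg j"]) (auto simp: total_deg_multideg)
qed (auto simp: multideg_add multidegs_def)

interpretation total: mono_grading total_deg UNIV r for r
  by unfold_locales (auto simp: total_deg_add)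

section \<open>Words up to insertion of zeros\<close>

text \<open>The letters will be the columns of exponents of a monomial. Inserted zeros correspond to
  variables outside the image of an increasing injection.\<close>

inductive zero_ins :: "'a::zero list \<Rightarrow> 'a list \<Rightarrow> bool" where
  Nil: "zero_ins [] []"
| Zero: "zero_ins xs ys \<Longrightarrow> zero_ins xs (0 # ys)"
| Cons: "zero_ins xs ys \<Longrightarrow> zero_ins (a # xs) (a # ys)"

lemma zero_ins_replicate:
  assumes "zero_ins xs ys"
  shows "zero_ins (replicate a 0 @ xs) (replicate (a + b) 0 @ ys)"
proof -
  have "zero_ins xs (replicate b 0 @ ys)"
    by (induction b) (auto intro: assms zero_ins.intros)
  then show ?thesis by (induction a) (auto intro: zero_ins.intros)
qed

lemma constant_subseq:
  assumes "finite A" "\<And>i::nat. t i \<in> A"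
  obtains \<phi> v where "strict_mono (\<phi> :: nat \<Rightarrow> nat)" "\<And>i. t (\<phi> i) = v" "v \<in> A"
proof -
  have "finite (t ` UNIV)" by (rule finite_subset[OF _ assms(1)]) (use assms(2) in auto)
  then obtain i0 where inf: "infinite {i. t i = t i0}"
    using pigeonhole_infinite[of UNIV t] by auto
  have "strict_mono (enumerate {i. t i = t i0})"
    by (rule strict_monoI) (rule enumerate_mono[OF _ inf])
  moreover have "t (enumerate {i. t i = t i0} i) = t i0" for i
    using enumerate_in_set[OF inf, of i] by simp
  ultimately show ?thesis using that assms(2) by blast
qed

text \<open>A monotone subsequence of natural numbers is either nondecreasing, or nonincreasing and
  hence constant from the point where it attains its minimum.\<close>

lemma mono_subseq:
  fixes t :: "nat \<Rightarrow> nat"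
  obtains \<phi> :: "nat \<Rightarrow> nat" where "strict_mono \<phi>" "\<And>i j. i \<le> j \<Longrightarrow> t (\<phi> i) \<le> t (\<phi> j)"
proof -
  obtain f :: "nat \<Rightarrow> nat" where f: "strict_mono f" "monoseq (\<lambda>n. t (f n))"
    using seq_monosub[of t] by blast
  show ?thesis
  proof (cases "\<forall>m n. m \<le> n \<longrightarrow> t (f m) \<le> t (f n)")
    case True
    then show ?thesis using that f(1) by blast
  next
    case False
    then have dec: "t (f n) \<le> t (f m)" if "m \<le> n" for m n
      using f(2) that by (auto simp: monoseq_def)
    obtain N where N: "\<And>n. t (f N) \<le> t (f n)"
      using ex_has_least_nat[of "\<lambda>_. True" 0 "\<lambda>n. t (f n)"] by blast
    have "t (f (N + i)) = t (f N)" for i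
      using dec[of N "N + i"] N[of "N + i"] by simp
    moreover have "strict_mono (\<lambda>i. f (N + i))"
      using f(1) by (auto simp: strict_mono_def)
    ultimately show ?thesis using that[of "\<lambda>i. f (N + i)"] by simp
  qed
qed

lemma zero_prefix:
  fixes xs :: "'a::zero list"
  assumes "length (filter (\<lambda>x. x \<noteq> 0) xs) = Suc k"
  obtains a c ys where "xs = replicate a 0 @ c # ys" "length (filter (\<lambda>x. x \<noteq> 0) ys) = k"
    "c \<in> set xs" "set ys \<subseteq> set xs"
proof -
  have "\<exists>a c ys. xs = replicate a 0 @ c # ys \<and> length (filter (\<lambda>x. x \<noteq> 0) ys) = k"
    using assms
  proof (induction xs)
    case (Cons x xs)
    show ?case
    proof (cases "x = 0")
      case True
      with Cons obtain a c ys where "xs = replicate a 0 @ c # ys" "length (filter (\<lambda>x. x \<noteq> 0) ys) = k"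
        by auto
      then show ?thesis using True by (intro exI[of _ "Suc a"]) auto
    next
      case False
      then show ?thesis using Cons.prems by (intro exI[of _ 0] exI[of _ x] exI[of _ xs]) auto
    qed
  qed auto
  then show ?thesis using that by fastforce
qed

text \<open>Dickson's lemma, applied to the lengths of the blocks of zeros.\<close>

lemma zero_ins_subseq:
  fixes s :: "nat \<Rightarrow> 'a::zero list"
  assumes "finite A" "\<And>i. set (s i) \<subseteq> A" "\<And>i. length (filter (\<lambda>x. x \<noteq> 0) (s i)) = k"
  shows "\<exists>\<phi> :: nat \<Rightarrow> nat. strict_mono \<phi> \<and> (\<forall>i j. i < j \<longrightarrow> zero_ins (s (\<phi> i)) (s (\<phi> j)))"
  using assms(2,3)
proof (induction k arbitrary: s)
  case 0
  have rep: "s i = replicate (length (s i)) 0" for i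
    using 0(2)[of i] by (auto simp: filter_empty_conv intro: replicate_eqI)
  obtain \<phi> where \<phi>: "strict_mono (\<phi> :: nat \<Rightarrow> nat)" "\<And>i j. i \<le> j \<Longrightarrow> length (s (\<phi> i)) \<le> length (s (\<phi> j))"
    using mono_subseq[of "\<lambda>i. length (s i)"] by blast
  have "zero_ins (s (\<phi> i)) (s (\<phi> j))" if "i < j" for i j
  proof -
    have "zero_ins (replicate (length (s (\<phi> i))) (0 :: 'a)) (replicate (length (s (\<phi> j))) 0)"
      using zero_ins_replicate[OF zero_ins.Nil, of "length (s (\<phi> i))" "length (s (\<phi> j)) - length (s (\<phi> i))"]
        \<phi>(2)[of i j] that by simp
    then show ?thesis by (metis rep)
  qed
  then show ?case using \<phi>(1) by blast
next
  case (Suc k)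
  have "\<forall>i. \<exists>a c ys. s i = replicate a 0 @ c # ys \<and> length (filter (\<lambda>x. x \<noteq> 0) ys) = k \<and>
      c \<in> A \<and> set ys \<subseteq> A"
    using zero_prefix[OF Suc.prems(2)] Suc.prems(1) by (metis order.trans subsetD)
  then obtain a c ys where s: "\<And>i. s i = replicate (a i) 0 @ c i # ys i"
    "\<And>i. length (filter (\<lambda>x. x \<noteq> 0) (ys i)) = k" "\<And>i. c i \<in> A" "\<And>i. set (ys i) \<subseteq> A"
    by metis
  \<comment> \<open>Three refinements in turn: constant leading nonzero letter, nondecreasing length
    of the initial block of zeros, and the induction hypothesis for the remaining words.\<close>
  obtain \<phi>1 v where \<phi>1: "strict_mono (\<phi>1 :: nat \<Rightarrow> nat)" "\<And>i. c (\<phi>1 i) = v"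
    using constant_subseq[of A c, OF assms(1) s(3)] by blast
  obtain \<phi>2 where \<phi>2: "strict_mono (\<phi>2 :: nat \<Rightarrow> nat)" "\<And>i j. i \<le> j \<Longrightarrow> a (\<phi>1 (\<phi>2 i)) \<le> a (\<phi>1 (\<phi>2 j))"
    using mono_subseq[of "\<lambda>i. a (\<phi>1 i)"] by blast
  obtain \<phi>3 where \<phi>3: "strict_mono (\<phi>3 :: nat \<Rightarrow> nat)"
    "\<And>i j. i < j \<Longrightarrow> zero_ins (ys (\<phi>1 (\<phi>2 (\<phi>3 i)))) (ys (\<phi>1 (\<phi>2 (\<phi>3 j))))"
    using Suc.IH[of "\<lambda>i. ys (\<phi>1 (\<phi>2 i))"] s(2,4) by blast
  let ?\<phi> = "\<lambda>i. \<phi>1 (\<phi>2 (\<phi>3 i))"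
  have "zero_ins (s (?\<phi> i)) (s (?\<phi> j))" if ij: "i < j" for i j
  proof -
    have "a (?\<phi> i) \<le> a (?\<phi> j)" using \<phi>2(2) strict_monoD[OF \<phi>3(1) ij] by simp
    then show ?thesis
      using zero_ins_replicate[OF zero_ins.Cons[OF \<phi>3(2)[OF ij], of v], of "a (?\<phi> i)" "a (?\<phi> j) - a (?\<phi> i)"]
      by (simp add: s(1) \<phi>1(2))
  qed
  moreover have "strict_mono ?\<phi>" using \<phi>1(1) \<phi>2(1) \<phi>3(1) by (simp add: strict_mono_def)
  ultimately show ?case by blast
qed

text \<open>Extracts the positions of the letters, from which an injection between sets of variables
  can be built.\<close>

lemma zero_ins_map:
  assumes "zero_ins xs ys"
  shows "\<exists>f. (\<forall>i j. i < j \<longrightarrow> j < length xs \<longrightarrow> f i < f j) \<and>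
    (\<forall>i<length xs. f i < length ys \<and> ys ! f i = xs ! i) \<and>
    (\<forall>j<length ys. j \<notin> f ` {..<length xs} \<longrightarrow> ys ! j = 0)"
  using assms
proof induction
  case (Zero xs ys)
  then obtain f where f: "\<forall>i j. i < j \<longrightarrow> j < length xs \<longrightarrow> f i < f j"
    "\<forall>i<length xs. f i < length ys \<and> ys ! f i = xs ! i"
    "\<forall>j<length ys. j \<notin> f ` {..<length xs} \<longrightarrow> ys ! j = 0" by blast
  have "(0 # ys) ! j = 0" if "j < length (0 # ys)" "j \<notin> (\<lambda>i. Suc (f i)) ` {..<length xs}" for j
    using that f(3) by (cases j) auto
  then show ?case using f(1,2) by (intro exI[of _ "\<lambda>i. Suc (f i)"]) simp
next
  case (Cons xs ys a)
  then obtain f where f: "\<And>i j. i < j \<Longrightarrow> j < length xs \<Longrightarrow> f i < f j"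
    "\<And>i. i < length xs \<Longrightarrow> f i < length ys \<and> ys ! f i = xs ! i"
    "\<And>j. j < length ys \<Longrightarrow> j \<notin> f ` {..<length xs} \<Longrightarrow> ys ! j = 0" by blast
  define g where "g i = (case i of 0 \<Rightarrow> 0 | Suc i \<Rightarrow> Suc (f i))" for i
  have "(a # ys) ! j = 0" if "j < length (a # ys)" "j \<notin> g ` {..<length (a # xs)}" for j
  proof (cases j)
    case 0
    then have "j \<in> g ` {..<length (a # xs)}" by (intro image_eqI[of _ _ 0]) (auto simp: g_def)
    then show ?thesis using that by simp
  next
    case (Suc l)
    have "l \<notin> f ` {..<length xs}"
    proof
      assume "l \<in> f ` {..<length xs}"
      then obtain i where "i < length xs" "l = f i" by auto
      then have "j \<in> g ` {..<length (a # xs)}"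
        using Suc by (intro image_eqI[of _ _ "Suc i"]) (auto simp: g_def)
      then show False using that by simp
    qed
    then show ?thesis using f(3) that Suc by simp
  qed
  moreover have "\<forall>i j. i < j \<longrightarrow> j < length (a # xs) \<longrightarrow> g i < g j"
    using f(1) by (auto simp: g_def split: nat.split)
  moreover have "\<forall>i<length (a # xs). g i < length (a # ys) \<and> (a # ys) ! g i = (a # xs) ! i"
    using f(2) by (auto simp: g_def split: nat.split)
  ultimately show ?case by (intro exI[of _ g]) simp
qed simp

section \<open>The quasi-order on monomials\<close>

text \<open>These morphisms belong to all three categories, so finite generation can be proved for
  all types at once; being increasing, they preserve the order of monomials.\<close>

definition FI_incr :: "nat \<Rightarrow> nat \<Rightarrow> (int \<Rightarrow> int) set"
  where "FI_incr m n = {f \<in> FI_hom FI_BC m n. (\<forall>a\<in>{1..m}. 0 < f (int a)) \<and>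
    (\<forall>a\<in>{1..m}. \<forall>b\<in>{1..m}. a < b \<longrightarrow> f (int a) < f (int b))}"

lemma FI_incr_hom:
  assumes "f \<in> FI_incr m n"
  shows "f \<in> FI_hom W m n"
proof -
  have pos: "0 < f a" if "a \<in> ob m" "0 < a" for a
  proof -
    have "nat a \<in> {1..m}" "int (nat a) = a" using that by (auto simp: ob_def)
    then show ?thesis using assms unfolding FI_incr_def by (metis (no_types, lifting) mem_Collect_eq)
  qed
  then have "{a \<in> ob m. 0 < a \<and> f a < 0} = {}" by force
  then have "card {a \<in> ob m. 0 < a \<and> f a < 0} = 0" by (metis card.empty)
  then show ?thesis using assms pos by (auto simp: FI_incr_def FI_hom_def split: FI_type.splits)
qed

lemma tsgn_incr:
  assumes f: "f \<in> FI_incr m n" and "M \<in> monomials r m"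
  shows "tsgn f M = 1"
  using assms(2) by (induction M rule: monomials_induct) (use f in \<open>auto simp: tsgn_add FI_incr_def\<close>)

lemma lookup_transport_outside:
  assumes "M \<in> monomials r m" "b \<notin> idx f ` {1..m}"
  shows "Poly_Mapping.lookup (transport f M) (k, b) = 0"
  using assms(1)
proof (induction M rule: monomials_induct)
  case (single j c l)
  then show ?case using assms(2) by (auto simp: lookup_single when_def)
qed (auto simp: transport_add lookup_add)

text \<open>The order compares exponents at the first variable where they differ, the variables
  being ordered lexicographically. An increasing map keeps this variable first, because outside its
  image both exponents are zero.\<close>

lemma transport_less:
  assumes f: "f \<in> FI_incr m n" and M: "M \<in> monomials r m" and N: "N \<in> monomials r m" and "M < N"
  shows "transport f M < transport f N"
proof -
  note f' = FI_incr_hom[OF f]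
  from \<open>M < N\<close> have "less_fun (Poly_Mapping.lookup M) (Poly_Mapping.lookup N)" by (simp add: less_poly_mapping.rep_eq)
  then obtain v where v: "Poly_Mapping.lookup M v < Poly_Mapping.lookup N v"
    "\<And>u. u < v \<Longrightarrow> Poly_Mapping.lookup M u = Poly_Mapping.lookup N u"
    by (rule less_funE) blast
  obtain i a where [simp]: "v = (i, a)" by (cases v)
  have a: "a \<in> {1..m}" using v(1) monomials_lookup[OF N, of i a] by simp
  have "less_fun (Poly_Mapping.lookup (transport f M)) (Poly_Mapping.lookup (transport f N))"
  proof (rule less_funI, intro exI conjI allI impI)
    show "Poly_Mapping.lookup (transport f M) (i, idx f a) < Poly_Mapping.lookup (transport f N) (i, idx f a)"
      using v(1) by (simp add: lookup_transport[OF f' M a] lookup_transport[OF f' N a])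
    fix u :: "nat \<times> nat" assume u: "u < (i, idx f a)"
    obtain k b where [simp]: "u = (k, b)" by (cases u)
    show "Poly_Mapping.lookup (transport f M) u = Poly_Mapping.lookup (transport f N) u"
    proof (cases "b \<in> idx f ` {1..m}")
      case True
      then obtain c where c: "c \<in> {1..m}" "b = idx f c" by auto
      have "c < a" if "b < idx f a"
      proof (rule ccontr)
        assume "\<not> c < a"
        then have "a = c \<or> a < c" by auto
        then have "f (int a) \<le> f (int c)"
        proof
          assume "a < c"
          then have "f (int a) < f (int c)" using f a c(1) unfolding FI_incr_def by blast
          then show ?thesis by simp
        qed simp
        moreover have "0 < f (int a)" using f a unfolding FI_incr_def by blast
        ultimately show False using that c by (simp add: idx_def)
      qed
      then have "(k, c) < v" using u c by (auto simp: less_prod_def')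
      then show ?thesis using v(2) c by (simp add: lookup_transport[OF f' M] lookup_transport[OF f' N])
    next
      case False
      then show ?thesis using M N by (simp add: lookup_transport_outside)
    qed
  qed
  then show ?thesis by (simp add: less_poly_mapping.rep_eq)
qed

text \<open>The exponents at the second index a in all r copies: one letter of the word of
  M.\<close>

definition col :: "nat \<Rightarrow> monomial \<Rightarrow> nat \<Rightarrow>\<^sub>0 nat"
  where "col a M = Poly_Mapping.map_key (\<lambda>i. (i, a)) M"

lemma lookup_col [simp]: "Poly_Mapping.lookup (col a M) i = Poly_Mapping.lookup M (i, a)"
  unfolding col_def by (subst map_key.rep_eq) (auto simp: inj_on_def)

lemma lookup_le_total_deg: "Poly_Mapping.lookup M v \<le> total_deg M"
proof (cases "v \<in> Poly_Mapping.keys M")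
  case True
  then show ?thesis unfolding total_deg_def by (intro member_le_sum) auto
qed (simp add: in_keys_iff)

lemma card_keys_le_total_deg: "card (Poly_Mapping.keys M) \<le> total_deg M"
proof -
  have "card (Poly_Mapping.keys M) = (\<Sum>v\<in>Poly_Mapping.keys M. 1)" by simp
  also have "\<dots> \<le> total_deg M"
    unfolding total_deg_def by (intro sum_mono) (auto simp: in_keys_iff Suc_le_eq)
  finally show ?thesis .
qed

lemma finite_bounded_mappings:
  assumes "finite K"
  shows "finite {p :: 'a \<Rightarrow>\<^sub>0 nat. Poly_Mapping.keys p \<subseteq> K \<and> (\<forall>x. Poly_Mapping.lookup p x \<le> B)}" (is "finite ?S")
proof (rule finite_imageD[of "\<lambda>p. restrict (Poly_Mapping.lookup p) K"])
  show "finite ((\<lambda>p. restrict (Poly_Mapping.lookup p) K) ` ?S)"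
    by (rule finite_subset[of _ "PiE K (\<lambda>_. {..B})"]) (auto intro: finite_PiE assms)
  show "inj_on (\<lambda>p. restrict (Poly_Mapping.lookup p) K) ?S"
  proof (rule inj_onI, rule poly_mapping_eqI)
    fix p q x assume pq: "p \<in> ?S" "q \<in> ?S"
      "restrict (Poly_Mapping.lookup p) K = restrict (Poly_Mapping.lookup q) K"
    show "Poly_Mapping.lookup p x = Poly_Mapping.lookup q x"
    proof (cases "x \<in> K")
      case True
      then show ?thesis using pq(3) by (metis restrict_apply')
    next
      case False
      then have "x \<notin> Poly_Mapping.keys p" "x \<notin> Poly_Mapping.keys q" using pq(1,2) by auto
      then show ?thesis by (simp add: in_keys_iff)
    qed
  qed
qed

lemma ob_less: "x \<in> ob k \<Longrightarrow> nat \<bar>x\<bar> - 1 < k"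
  by (auto simp: ob_def)

text \<open>Among infinitely many monomials of bounded degree, in varying numbers of variables, two
  are related by an increasing injection: their words have letters in a finite set and boundedly
  many nonzero letters.\<close>

lemma monomial_sequence_good:
  fixes n :: "nat \<Rightarrow> nat" and M :: "nat \<Rightarrow> monomial"
  assumes M: "\<And>i. M i \<in> monomials r (n i)" and B: "\<And>i. total_deg (M i) \<le> B"
  shows "\<exists>i j f. i < j \<and> f \<in> FI_incr (n i) (n j) \<and> transport f (M i) = M j"
proof -
  define s where "s i = map (\<lambda>a. col a (M i)) [1..<Suc (n i)]" for i
  define A where "A = {p :: nat \<Rightarrow>\<^sub>0 nat. Poly_Mapping.keys p \<subseteq> {1..r} \<and> (\<forall>x. Poly_Mapping.lookup p x \<le> B)}"
  have A: "finite A" unfolding A_def by (rule finite_bounded_mappings) simp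
  have setA: "set (s i) \<subseteq> A" for i
  proof -
    have "Poly_Mapping.lookup (M i) (k, a) \<le> B" for k a
      by (rule order.trans[OF lookup_le_total_deg B])
    then show ?thesis using monomials_lookup[OF M[of i]] by (auto simp: s_def A_def in_keys_iff)
  qed
  have "length (filter (\<lambda>x. x \<noteq> 0) (s i)) \<le> B" for i
  proof -
    have "length (filter (\<lambda>x. x \<noteq> 0) (s i)) = length (filter (\<lambda>a. col a (M i) \<noteq> 0) [1..<Suc (n i)])"
      by (simp add: s_def filter_map o_def)
    also have "\<dots> = card (set (filter (\<lambda>a. col a (M i) \<noteq> 0) [1..<Suc (n i)]))"
      by (rule distinct_card[symmetric]) simp
    also have "\<dots> \<le> card (snd ` Poly_Mapping.keys (M i))"
    proof (rule card_mono)
      show "set (filter (\<lambda>a. col a (M i) \<noteq> 0) [1..<Suc (n i)]) \<subseteq> snd ` Poly_Mapping.keys (M i)"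
      proof
        fix a assume "a \<in> set (filter (\<lambda>a. col a (M i) \<noteq> 0) [1..<Suc (n i)])"
        then have "col a (M i) \<noteq> 0" by simp
        then obtain k where "Poly_Mapping.lookup (M i) (k, a) \<noteq> 0"
          by (metis lookup_col poly_mapping_eqI lookup_zero)
        then show "a \<in> snd ` Poly_Mapping.keys (M i)" by (force simp: in_keys_iff)
      qed
    qed simp
    also have "\<dots> \<le> card (Poly_Mapping.keys (M i))" by (rule card_image_le) simp
    also have "\<dots> \<le> B" by (rule order.trans[OF card_keys_le_total_deg B])
    finally show ?thesis .
  qed
  then have le: "length (filter (\<lambda>x. x \<noteq> 0) (s i)) \<in> {..B}" for i by simp
  \<comment> \<open>\<open>zero_ins_subseq\<close> needs a fixed number of nonzero letters, and only
    finitely many numbers occur.\<close>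
  obtain \<phi> k where \<phi>: "strict_mono (\<phi> :: nat \<Rightarrow> nat)" "\<And>i. length (filter (\<lambda>x. x \<noteq> 0) (s (\<phi> i))) = k"
    using constant_subseq[of "{..B}" "\<lambda>i. length (filter (\<lambda>x. x \<noteq> 0) (s i))", OF finite_atMost le]
    by blast
  obtain \<psi> where \<psi>: "strict_mono (\<psi> :: nat \<Rightarrow> nat)" "\<And>i j. i < j \<Longrightarrow> zero_ins (s (\<phi> (\<psi> i))) (s (\<phi> (\<psi> j)))"
    using zero_ins_subseq[OF A, of "\<lambda>i. s (\<phi> i)" k] setA \<phi>(2) by blast
  define i where "i = \<phi> (\<psi> 0)"
  define j where "j = \<phi> (\<psi> 1)"
  have ij: "i < j" unfolding i_def j_def using \<phi>(1) \<psi>(1) by (simp add: strict_monoD)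
  have "zero_ins (s i) (s j)" unfolding i_def j_def using \<psi>(2) by simp
  moreover have "length (s l) = n l" for l by (simp add: s_def del: upt_Suc)
  ultimately obtain f where f:
    "\<And>a b. a < b \<Longrightarrow> b < n i \<Longrightarrow> f a < f b" "\<And>a. a < n i \<Longrightarrow> f a < n j"
    "\<And>a. a < n i \<Longrightarrow> s j ! f a = s i ! a"
    "\<And>b. b < n j \<Longrightarrow> b \<notin> f ` {..<n i} \<Longrightarrow> s j ! b = 0"
    using zero_ins_map[of "s i" "s j"] by metis
  \<comment> \<open>The odd extension of the position map. List positions start at 0 and variables
    at 1, which accounts for the two shifts.\<close>
  define g where "g = (\<lambda>a\<in>ob (n i). sgn a * (int (f (nat \<bar>a\<bar> - 1)) + 1))"
  have g_int: "g (int a) = int (f (a - 1)) + 1" if "a \<in> {1..n i}" for a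
    using that by (simp add: g_def)
  have g_in: "g a \<in> ob (n j)" if "a \<in> ob (n i)" for a
  proof -
    have "nat \<bar>a\<bar> - 1 < n i" using that by (auto simp: ob_def)
    from f(2)[OF this] show ?thesis using that by (auto simp: g_def ob_def sgn_if)
  qed
  have f_inj: "a = b" if "a < n i" "b < n i" "f a = f b" for a b
    using that f(1)[of a b] f(1)[of b a] by (cases a b rule: linorder_cases) auto
  have inj: "inj_on g (ob (n i))"
  proof (rule inj_onI)
    fix a b assume ab: "a \<in> ob (n i)" "b \<in> ob (n i)" "g a = g b"
    have g_sgn: "sgn (g x) = sgn x" "nat \<bar>g x\<bar> = Suc (f (nat \<bar>x\<bar> - 1))" if "x \<in> ob (n i)" for x
    proof -
      define k where "k = f (nat \<bar>x\<bar> - 1)"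
      have gx: "g x = sgn x * (int k + 1)" using that by (simp add: g_def k_def)
      have "x \<noteq> 0" using that by (simp add: ob_def)
      then consider "sgn x = 1" | "sgn x = -1" by (cases "0 < x") auto
      then have "sgn (g x) = sgn x \<and> nat \<bar>g x\<bar> = Suc k"
        by cases (simp_all add: gx)
      then show "sgn (g x) = sgn x" "nat \<bar>g x\<bar> = Suc (f (nat \<bar>x\<bar> - 1))"
        by (simp_all add: k_def)
    qed
    have f_eq: "f (nat \<bar>a\<bar> - 1) = f (nat \<bar>b\<bar> - 1)"
      using g_sgn(2)[OF ab(1)] g_sgn(2)[OF ab(2)] ab(3) by simp
    from ob_less[OF ab(1)] ob_less[OF ab(2)] have "nat \<bar>a\<bar> - 1 = nat \<bar>b\<bar> - 1" using f_eq by (rule f_inj)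
    moreover have "nat \<bar>a\<bar> > 0" "nat \<bar>b\<bar> > 0" using ab(1,2) by (simp_all add: ob_def)
    ultimately have "\<bar>a\<bar> = \<bar>b\<bar>" by linarith
    moreover have "sgn a = sgn b" using g_sgn(1)[OF ab(1)] g_sgn(1)[OF ab(2)] ab(3) by simp
    ultimately show "a = b" by (metis mult_sgn_abs)
  qed
  have g: "g \<in> FI_hom FI_BC (n i) (n j)"
  proof -
    have "g (- a) = - g a" if "a \<in> ob (n i)" for a using that by (simp add: g_def sgn_minus)
    moreover have "g \<in> extensional (ob (n i))" by (simp add: g_def)
    ultimately show ?thesis using inj g_in by (simp add: FI_hom_def PiE_def Pi_def)
  qed
  have "g \<in> FI_incr (n i) (n j)"
  proof -
    have "g (int a) < g (int b)" if "a \<in> {1..n i}" "b \<in> {1..n i}" "a < b" for a b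
    proof -
      have "a - 1 < b - 1" "b - 1 < n i" using that by auto
      from f(1)[OF this] show ?thesis by (simp only: g_int[OF that(1)] g_int[OF that(2)])
    qed
    then show ?thesis unfolding FI_incr_def using g g_int by simp
  qed
  moreover have "transport g (M i) = M j"
  proof (rule poly_mapping_eqI)
    fix v :: "nat \<times> nat"
    obtain k b where v: "v = (k, b)" by (cases v)
    have s_nth: "s l ! (a - 1) = col a (M l)" if "a \<in> {1..n l}" for a l
    proof -
      have "a - 1 < n l" "1 + (a - 1) = a" using that by auto
      then show ?thesis by (simp add: s_def del: upt_Suc)
    qed
    show "Poly_Mapping.lookup (transport g (M i)) v = Poly_Mapping.lookup (M j) v"
    proof (cases "b \<in> idx g ` {1..n i}")
      case True
      then obtain a where a: "a \<in> {1..n i}" "b = idx g a" by auto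
      then have b: "b = f (a - 1) + 1" using g_int[of a] by (simp add: idx_def)
      have "a - 1 < n i" using a(1) by auto
      note fa = f(2)[OF this] f(3)[OF this]
      have "col b (M j) = col a (M i)"
        using s_nth[of b j] s_nth[of a i] fa b a(1) by simp
      then have "Poly_Mapping.lookup (M j) (k, b) = Poly_Mapping.lookup (M i) (k, a)"
        by (metis lookup_col)
      then show ?thesis using lookup_transport[OF g M a(1), of k] a v by simp
    next
      case False
      have 1: "Poly_Mapping.lookup (transport g (M i)) (k, b) = 0"
        by (rule lookup_transport_outside[OF M False])
      have "Poly_Mapping.lookup (M j) (k, b) = 0"
      proof (cases "b \<in> {1..n j}")
        case True
        have "b - 1 \<notin> f ` {..<n i}"
        proof
          assume "b - 1 \<in> f ` {..<n i}"
          then obtain a where "a < n i" "b - 1 = f a" by auto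
          then have "Suc a \<in> {1..n i}" "idx g (Suc a) = b"
            using g_int[of "Suc a"] True by (auto simp: idx_def)
          then show False using False by blast
        qed
        moreover have "b - 1 < n j" using True by auto
        ultimately have "s j ! (b - 1) = 0" using f(4) by blast
        then have "col b (M j) = 0" using s_nth[OF True] by simp
        then show ?thesis by (metis lookup_col lookup_zero)
      next
        case False
        then show ?thesis using monomials_lookup[OF M[of j], of k b] by blast
      qed
      then show ?thesis using 1 v by simp
    qed
  qed
  ultimately show ?thesis using ij by blast
qed

section \<open>Duals\<close>

lemma dual_simps [simp]:
  "\<phi> \<oplus>\<^bsub>dual_module M\<^esub> \<psi> = (\<lambda>x\<in>carrier M. \<phi> x + \<psi> x)"
  "c \<odot>\<^bsub>dual_module M\<^esub> \<phi> = (\<lambda>x\<in>carrier M. c * \<phi> x)"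
  "\<zero>\<^bsub>dual_module M\<^esub> = (\<lambda>x\<in>carrier M. 0)"
  by (simp_all add: dual_module_def)

lemma dual_carrier: "\<phi> \<in> carrier (dual_module M) \<longleftrightarrow> \<phi> \<in> extensional (carrier M) \<and>
    (\<forall>x\<in>carrier M. \<forall>y\<in>carrier M. \<phi> (x \<oplus>\<^bsub>M\<^esub> y) = \<phi> x + \<phi> y) \<and>
    (\<forall>c. \<forall>x\<in>carrier M. \<phi> (c \<odot>\<^bsub>M\<^esub> x) = c * \<phi> x)"
  by (simp add: dual_module_def PiE_def)

lemma dual_is_module:
  fixes M :: "('k::field, 'a) module"
  assumes "Module.module scalars M"
  shows "Module.module scalars (dual_module M)"
proof -
  interpret Module.module scalars M by fact
  have cl: "x \<oplus>\<^bsub>M\<^esub> y \<in> carrier M" "c \<odot>\<^bsub>M\<^esub> x \<in> carrier M"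
    if "x \<in> carrier M" "y \<in> carrier M" for x y and c :: 'k
    using that smult_closed[of c x] by auto
  have ext: "\<phi> = \<psi>" if "\<phi> \<in> extensional (carrier M)" "\<psi> \<in> extensional (carrier M)"
    "\<And>x. x \<in> carrier M \<Longrightarrow> \<phi> x = \<psi> x" for \<phi> \<psi> :: "'a \<Rightarrow> 'k"
    using that by (rule extensionalityI)
  have sm: "c \<odot>\<^bsub>dual_module M\<^esub> \<phi> \<in> carrier (dual_module M)" if "\<phi> \<in> carrier (dual_module M)" for c \<phi>
    using that cl by (auto simp: dual_carrier algebra_simps)
  have "abelian_group (dual_module M)"
  proof (rule abelian_groupI)
    fix \<phi> assume p: "\<phi> \<in> carrier (dual_module M)"
    then show "\<exists>\<psi>\<in>carrier (dual_module M). \<psi> \<oplus>\<^bsub>dual_module M\<^esub> \<phi> = \<zero>\<^bsub>dual_module M\<^esub>"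
      by (intro bexI[OF _ sm[OF p, of "- 1"]]) (auto intro!: ext)
    show "\<zero>\<^bsub>dual_module M\<^esub> \<oplus>\<^bsub>dual_module M\<^esub> \<phi> = \<phi>"
      using p by (intro ext) (auto simp: dual_carrier)
  qed (use cl in \<open>auto simp: dual_carrier algebra_simps intro!: ext\<close>)
  then show ?thesis
    using sm
  proof (intro moduleI)
    fix \<phi> assume "\<phi> \<in> carrier (dual_module M)"
    then show "\<one>\<^bsub>scalars\<^esub> \<odot>\<^bsub>dual_module M\<^esub> \<phi> = \<phi>" by (intro ext) (auto simp: dual_carrier)
  qed (auto simp: scalars_cring algebra_simps intro!: ext)
qed

context graded_co_FI_algebra
begin

lemma piece_submodule:
  assumes "j \<in> I"
  shows "submodule (P n j) scalars (fobj C n)" "Module.module scalars (fobj C n)"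
proof -
  have "Module.algebra scalars (fobj C n)" using graded[of n] by (simp add: graded_algebra_def)
  then interpret Module.algebra scalars "fobj C n" .
  show "Module.module scalars (fobj C n)" by (rule local.module)
  show "submodule (P n j) scalars (fobj C n)" using graded[of n] assms by (simp add: graded_algebra_def)
qed

lemma dual_piece_FI_module:
  assumes j: "j \<in> I"
  shows "FI_module W (dual_FI (graded_piece C P j))" (is "FI_module W ?V")
proof (rule FI_module.intro)
  have ob: "fobj ?V n = dual_module ((fobj C n)\<lparr>carrier := P n j\<rparr>)" for n
    by (simp add: dual_FI_def graded_piece_def)
  have mp: "fmap ?V m n f = (\<lambda>\<phi>. \<lambda>x\<in>P n j. \<phi> (fmap C m n f x))" for m n f
    by (simp add: dual_FI_def graded_piece_def)
  have sub: "x \<in> carrier (fobj C n)" if "x \<in> P n j" for x n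
    using submodule_closed(1)[OF piece_submodule[OF j]] that by auto
  have cl: "x \<oplus>\<^bsub>fobj C n\<^esub> y \<in> P n j" "c \<odot>\<^bsub>fobj C n\<^esub> x \<in> P n j" if "x \<in> P n j" "y \<in> P n j" for x y n c
    using submodule_closed(3,4)[OF piece_submodule[OF j]] that by auto
  have mod: "Module.module scalars (fobj ?V n)" for n
    unfolding ob
    by (intro dual_is_module submodule.submodule_is_module[OF piece_submodule(1)[OF j]] piece_submodule(2)[OF j])
  show "Module.module scalars (fobj ?V n)" for n by (rule mod)
  fix m n f v
  show "fmap ?V n n (\<lambda>a\<in>ob n. a) v = v" if "v \<in> carrier (fobj ?V n)"
    using that unfolding mp ob
    by (intro extensionalityI[of _ "P n j"]) (auto simp: dual_carrier map_id[OF sub])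
  assume f: "f \<in> FI_hom W m n"
  have im: "fmap C m n f x \<in> P m j" if "x \<in> P n j" for x using map_graded[OF f j] that by auto
  have lin: "fmap C m n f \<in> lin_maps (fobj C n) (fobj C m)" using map_hom[OF f] by auto
  show "fmap ?V m n f \<in> lin_maps (fobj ?V m) (fobj ?V n)"
    using im lin sub cl
    by (auto simp: lin_maps_def mp ob dual_carrier intro!: extensionalityI[of _ "P n j"])
next
  have mp: "fmap ?V m n f = (\<lambda>\<phi>. \<lambda>x\<in>P n j. \<phi> (fmap C m n f x))" for m n f
    by (simp add: dual_FI_def graded_piece_def)
  fix l m n f g v assume f: "f \<in> FI_hom W l m" and g: "g \<in> FI_hom W m n"
  have "fmap C m n g x \<in> P m j" "x \<in> carrier (fobj C n)" if "x \<in> P n j" for x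
    using map_graded[OF g j] that submodule_closed(1)[OF piece_submodule[OF j]] by auto
  then show "fmap ?V l n (compose (ob l) g f) v = fmap ?V m n g (fmap ?V l m f v)"
    unfolding mp by (intro extensionalityI[of _ "P n j"]) (auto simp: map_comp[OF f g])
qed

end

section \<open>Functionals on a graded piece as functions on monomials\<close>

context mono_grading
begin

definition dmon :: "nat \<Rightarrow> 'j \<Rightarrow> monomial set"
  where "dmon n j = {M \<in> monomials r n. dg M = j}"

abbreviation dualp :: "FI_type \<Rightarrow> 'j \<Rightarrow> ('k::field, 'k mpoly set \<Rightarrow> 'k) FI_diagram"
  where "dualp W j \<equiv> dual_FI (graded_piece (coinv W r) (coinv_piece dg W r) j)"

lemma dualp_ob: "fobj (dualp W j) n = dual_module ((quot W n)\<lparr>carrier := coinv_piece dg W r n j\<rparr>)"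
  by (simp add: dual_FI_def graded_piece_def coinv_def)

lemma dualp_map: "fmap (dualp W j) m n f y
    = (\<lambda>x\<in>coinv_piece dg W r n j. y (fmap (coinv W r) m n f x))"
  by (simp add: dual_FI_def graded_piece_def coinv_def)

lemma finite_dmon: "finite (dmon n j)"
proof -
  obtain B where B: "\<And>M. dg M = j \<Longrightarrow> total_deg M \<le> B" using bounded by blast
  have "finite {M :: monomial. Poly_Mapping.keys M \<subseteq> {1..r} \<times> {1..n} \<and> (\<forall>v. Poly_Mapping.lookup M v \<le> B)}"
    by (rule finite_bounded_mappings) simp
  then show ?thesis
    by (rule finite_subset[rotated])
      (use order.trans[OF lookup_le_total_deg B] in \<open>auto simp: dmon_def monomials_def\<close>)
qed

text \<open>A functional on the classes of degree \<open>j\<close> is determined by its values on monomials. The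
  functions which arise in this way are those which annihilate the ideal.\<close>

definition vals :: "FI_type \<Rightarrow> 'j \<Rightarrow> nat \<Rightarrow> ('k::field mpoly set \<Rightarrow> 'k) \<Rightarrow> monomial \<Rightarrow> 'k"
  where "vals W j n y = (\<lambda>M. if M \<in> dmon n j then y (ccls W r n (gen M)) else 0)"

definition annihilator :: "FI_type \<Rightarrow> 'j \<Rightarrow> nat \<Rightarrow> (monomial \<Rightarrow> 'k::field) set"
  where "annihilator W j n = {Y. (\<forall>M. M \<notin> dmon n j \<longrightarrow> Y M = 0) \<and> (\<forall>p\<in>coinv_ideal W r n. lin_ext Y p = 0)}"

text \<open>The representative may be any element of the class, even an inhomogeneous one; as Y
  annihilates the ideal, the value does not depend on it.\<close>

definition functional :: "FI_type \<Rightarrow> 'j \<Rightarrow> nat \<Rightarrow> (monomial \<Rightarrow> 'k) \<Rightarrow> 'k::field mpoly set \<Rightarrow> 'k"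
  where "functional W j n Y = (\<lambda>Z\<in>coinv_piece dg W r n j. lin_ext Y (SOME p. p \<in> Z))"

lemma hom_keys:
  "p \<in> carrier (poly_alg r n) \<Longrightarrow> hom j p \<Longrightarrow> Poly_Mapping.keys p \<subseteq> dmon n j"
  by (auto simp: poly.carrier_eq hom_def dmon_def)

lemma keys_hom:
  "Poly_Mapping.keys p \<subseteq> dmon n j \<Longrightarrow> p \<in> carrier (poly_alg r n) \<and> hom j p"
  by (auto simp: poly.carrier_eq hom_def dmon_def)

lemma dual_eval:
  assumes y: "y \<in> carrier (fobj (dualp W j) n :: ('k::field, _) module)"
    and p: "p \<in> carrier (poly_alg r n)" "hom j p"
  shows "y (ccls W r n p) = lin_ext (vals W j n y) p"
  using hom_keys[OF p]
proof (induction p rule: poly_mapping_add_induct)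
  have piece: "ccls W r n q \<in> coinv_piece dg W r n j" if "Poly_Mapping.keys q \<subseteq> dmon n j" for q :: "'k mpoly"
    using keys_hom[OF that] by (simp add: piece_memI)
  have lin: "y (ccls W r n (q + q')) = y (ccls W r n q) + y (ccls W r n q')"
    "y (ccls W r n (scale c q)) = c * y (ccls W r n q)"
    if "Poly_Mapping.keys q \<subseteq> dmon n j" "Poly_Mapping.keys q' \<subseteq> dmon n j" for q q' :: "'k mpoly" and c
    using y piece[OF that(1)] piece[OF that(2)]
    by (auto simp: dualp_ob dual_carrier simp flip: coinv.quot_add coinv.quot_smult)
  {
    case zero
    show ?case using lin(2)[of 0 0 0] by (simp add: scale_zero)
  next
    case (single M c)
    then have "y (ccls W r n (scale c (gen M))) = c * y (ccls W r n (gen M))"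
      by (intro lin(2)[of _ 0]) (auto simp: keys_single)
    then show ?case using single by (simp add: scale_single vals_def)
  next
    case (add q q')
    then show ?case by (simp add: lin lin_ext_add)
  }
qed

text \<open>Y vanishes outside degree j, so it only sees the component of that degree.\<close>

lemma lin_ext_comp:
  assumes "\<And>M. M \<notin> dmon n j \<Longrightarrow> Y M = 0"
  shows "lin_ext Y (comp j p) = lin_ext Y p"
proof -
  have sub: "Poly_Mapping.keys (comp j p) \<subseteq> Poly_Mapping.keys p"
    by (auto simp: in_keys_iff lookup_comp when_def split: if_splits)
  have "lin_ext Y (comp j p) = (\<Sum>M\<in>Poly_Mapping.keys p. Poly_Mapping.lookup (comp j p) M * Y M)"
    by (rule lin_ext_superset[OF finite_keys sub])
  also have "\<dots> = lin_ext Y p"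
    unfolding lin_ext_def by (rule sum.cong) (use assms in \<open>auto simp: lookup_comp when_def dmon_def\<close>)
  finally show ?thesis .
qed

lemma vals_annihilator:
  assumes y: "y \<in> carrier (fobj (dualp W j) n :: ('k::field, _) module)"
  shows "vals W j n y \<in> annihilator W j n"
  unfolding annihilator_def
proof (intro CollectI conjI ballI allI impI)
  fix p :: "'k mpoly" assume p: "p \<in> coinv_ideal W r n"
  then have pc: "p \<in> carrier (poly_alg r n)" using coinv.sub_carrier by auto
  have "lin_ext (vals W j n y) p = lin_ext (vals W j n y) (comp j p)"
    by (rule lin_ext_comp[of n, symmetric]) (simp add: vals_def)
  also have "\<dots> = y (ccls W r n (comp j p))"
    by (rule dual_eval[OF y comp_closed[OF pc] hom_comp, symmetric])
  also have "ccls W r n (comp j p) = ccls W r n 0"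
    using comp_coinv_ideal[OF p] by (simp add: coinv.cls_eq_iff)
  also have "y (ccls W r n 0) = 0" using dual_eval[OF y poly.zero_closed hom_zero] by simp
  finally show "lin_ext (vals W j n y) p = 0" .
qed (simp add: vals_def)

lemma functional_eval:
  assumes Y: "Y \<in> annihilator W j n" and p: "p \<in> carrier (poly_alg r n)" "hom j p"
  shows "functional W j n Y (ccls W r n p) = lin_ext Y p"
proof -
  let ?Z = "ccls W r n p"
  have "(SOME q. q \<in> ?Z) \<in> ?Z" by (rule someI[of _ p]) (rule coinv.cls_self)
  then have "(SOME q. q \<in> ?Z) - p \<in> coinv_ideal W r n" by (simp add: coinv.mem_cls)
  then have "lin_ext Y (SOME q. q \<in> ?Z) = lin_ext Y p"
    using Y by (force simp: annihilator_def lin_ext_diff)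
  then show ?thesis using p by (simp add: functional_def piece_memI)
qed

lemma functional_closed:
  assumes Y: "Y \<in> annihilator W j n"
  shows "functional W j n Y \<in> carrier (fobj (dualp W j) n :: ('k::field, _) module)"
  unfolding dualp_ob dual_carrier
  by (auto simp: piece_eq coinv.quot_add coinv.quot_smult functional_eval[OF Y] poly.add_closed hom_add
      lin_ext_add lin_ext_scale poly.scale_closed hom_scale)
    (auto simp: functional_def piece_eq)

lemma vals_functional:
  assumes Y: "Y \<in> annihilator W j n"
  shows "vals W j n (functional W j n Y) = Y"
proof
  fix M show "vals W j n (functional W j n Y) M = Y M"
    using Y functional_eval[OF Y, of "gen M"]
    by (auto simp: vals_def annihilator_def dmon_def poly.single_closed hom_def)
qed

lemma vals_inj:
  assumes y: "y \<in> carrier (fobj (dualp W j) n :: ('k::field, _) module)"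
    and z: "z \<in> carrier (fobj (dualp W j) n)" and eq: "vals W j n y = vals W j n z"
  shows "y = z"
proof (rule extensionalityI[of _ "coinv_piece dg W r n j"])
  fix x :: "'k mpoly set" assume "x \<in> coinv_piece dg W r n j"
  then obtain p where p: "x = ccls W r n p" "p \<in> carrier (poly_alg r n)" "hom j p" by (auto simp: piece_eq)
  show "y x = z x" unfolding p(1) dual_eval[OF y p(2,3)] dual_eval[OF z p(2,3)] eq ..
qed (use y z in \<open>auto simp: dualp_ob dual_carrier\<close>)

lemma gen_piece: "M \<in> dmon n j \<Longrightarrow> ccls W r n (gen M) \<in> coinv_piece dg W r n j"
  by (rule piece_memI) (auto simp: dmon_def poly.single_closed hom_def)

lemma vals_add:
  "vals W j n (y \<oplus>\<^bsub>fobj (dualp W j) n\<^esub> z) = (\<lambda>M. vals W j n y M + vals W j n z M)"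
  by (auto simp: vals_def dualp_ob gen_piece)

lemma vals_smult:
  "vals W j n (c \<odot>\<^bsub>fobj (dualp W j) n\<^esub> y) = (\<lambda>M. c * vals W j n y M)"
  by (auto simp: vals_def dualp_ob gen_piece)

lemma vals_zero: "vals W j n (\<zero>\<^bsub>fobj (dualp W j) n\<^esub>) = (\<lambda>M. 0)"
  by (auto simp: vals_def dualp_ob gen_piece)

lemma stab_piece:
  assumes f: "f \<in> FI_hom (stab W) m n" and p: "p \<in> carrier (poly_alg r n)" "hom j p"
  shows "poly_pull m f p \<in> carrier (poly_alg r m)" "hom j (poly_pull m f p)"
  using poly_pull_closed[OF FI_BC[OF f] p(1)] pull_comp_commute[OF FI_BC[OF f] p(1), of j] p(2)
  by (simp_all add: hom_iff)

lemma dual_map_eval: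
  assumes f: "f \<in> FI_hom (stab W) m n" and y: "y \<in> carrier (fobj (dualp W j) m :: ('k::field, _) module)"
    and p: "p \<in> carrier (poly_alg r n)" "hom j p"
  shows "fmap (dualp W j) m n f y (ccls W r n p) = lin_ext (vals W j m y) (poly_pull m f p)"
  using dual_eval[OF y stab_piece[OF f p]] p
  by (simp add: dualp_map coinv_fmap_cls[OF f] piece_memI)

lemma dual_map_closed:
  assumes f: "f \<in> FI_hom (stab W) m n" and y: "y \<in> carrier (fobj (dualp W j) m :: ('k::field, _) module)"
  shows "fmap (dualp W j) m n f y \<in> carrier (fobj (dualp W j) n)"
  unfolding dualp_ob dual_carrier
  by (auto simp: piece_eq coinv.quot_add coinv.quot_smult dual_map_eval[OF f y] poly.add_closed hom_add
      poly_pull_add poly_pull_scale lin_ext_add lin_ext_scale poly.scale_closed hom_scale)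
    (auto simp: dualp_map piece_eq)

lemma vals_map:
  assumes f: "f \<in> FI_hom (stab W) m n" and y: "y \<in> carrier (fobj (dualp W j) m :: ('k::field, _) module)"
  shows "M \<in> monomials r m \<Longrightarrow>
      vals W j n (fmap (dualp W j) m n f y) (transport f M) = of_int (tsgn f M) * vals W j m y M"
    "N \<notin> transport f ` monomials r m \<Longrightarrow> vals W j n (fmap (dualp W j) m n f y) N = 0"
proof -
  note f' = FI_BC[OF f]
  have eval: "vals W j n (fmap (dualp W j) m n f y) N = lin_ext (vals W j m y) (poly_pull m f (gen N))"
    if "N \<in> dmon n j" for N
    using that dual_map_eval[OF f y, of "gen N"]
    by (simp add: vals_def dmon_def poly.single_closed hom_def)
  show "vals W j n (fmap (dualp W j) m n f y) (transport f M) = of_int (tsgn f M) * vals W j m y M"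
    if M: "M \<in> monomials r m"
  proof (cases "dg M = j")
    case True
    then have "transport f M \<in> dmon n j" using transport_monomials[OF f' M] dg_transport by (simp add: dmon_def)
    then show ?thesis by (simp add: eval pull_monomial[OF f' M])
  qed (simp add: vals_def dmon_def dg_transport)
  show "vals W j n (fmap (dualp W j) m n f y) N = 0" if "N \<notin> transport f ` monomials r m"
  proof (cases "N \<in> dmon n j")
    case True
    then show ?thesis using pull_monomial_0[OF f' _ that, of "1 :: 'k"] by (simp add: eval dmon_def)
  qed (simp add: vals_def)
qed

section \<open>Finite generation\<close>

definition leading :: "FI_type \<Rightarrow> 'j \<Rightarrow> nat \<Rightarrow> ('k::field mpoly set \<Rightarrow> 'k) \<Rightarrow> monomial \<Rightarrow> bool"
  where "leading W j n y M \<longleftrightarrow> vals W j n y M \<noteq> 0 \<and> (\<forall>N. vals W j n y N \<noteq> 0 \<longrightarrow> N \<le> M)"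

text \<open>The last argument only fixes the field, which does not occur in the type of the
  result.\<close>

definition lead_set :: "FI_type \<Rightarrow> 'j \<Rightarrow> 'k::field itself \<Rightarrow> (nat \<times> monomial) set"
  where "lead_set W j _ = {(n, M). \<exists>y\<in>carrier (fobj (dualp W j) n :: ('k, _) module). leading W j n y M}"

definition below :: "nat \<times> monomial \<Rightarrow> nat \<times> monomial \<Rightarrow> bool"
  where "below x y \<longleftrightarrow> (\<exists>f\<in>FI_incr (fst x) (fst y). transport f (snd x) = snd y)"

lemma vals_dmon: "vals W j n y M \<noteq> 0 \<Longrightarrow> M \<in> dmon n j"
  by (auto simp: vals_def split: if_splits)

lemma ex_leading:
  assumes "vals W j n y M \<noteq> 0"
  shows "\<exists>N. leading W j n y N"
proof -
  let ?S = "{M. vals W j n y M \<noteq> 0}"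
  have fin: "finite ?S" by (rule finite_subset[OF _ finite_dmon[of n j]]) (use vals_dmon in auto)
  have "Max ?S \<in> ?S" by (rule Max_in[OF fin]) (use assms in auto)
  then show ?thesis using Max_ge[OF fin] by (auto simp: leading_def)
qed

text \<open>If no finite set sufficed, elements could be chosen one after another, none lying above
  an earlier one, contrary to \<open>monomial_sequence_good\<close>.\<close>

lemma finite_basis:
  obtains F where "finite F" "F \<subseteq> lead_set W j TYPE('k::field)"
    "\<And>x. x \<in> lead_set W j TYPE('k) \<Longrightarrow> \<exists>b\<in>F. below b x"
proof -
  let ?T = "lead_set W j TYPE('k)"
  have "\<exists>F. finite F \<and> F \<subseteq> ?T \<and> (\<forall>x\<in>?T. \<exists>b\<in>F. below b x)"
  proof (rule ccontr)
    assume no: "\<not> ?thesis"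
    have "\<exists>s. \<forall>i::nat. s i \<in> ?T \<and> (\<forall>l<i. \<not> below (s l) (s i))"
    proof (rule dependent_wellorder_choice)
      fix i :: nat and s assume "\<And>l. l < i \<Longrightarrow> s l \<in> ?T \<and> (\<forall>l'<l. \<not> below (s l') (s l))"
      then have "s ` {..<i} \<subseteq> ?T" by auto
      then show "\<exists>x. x \<in> ?T \<and> (\<forall>l<i. \<not> below (s l) x)"
        using no by (metis (no_types, lifting) finite_imageI finite_lessThan imageI lessThan_iff)
    qed auto
    then obtain s where s: "\<And>i::nat. s i \<in> ?T" "\<And>l i. l < i \<Longrightarrow> \<not> below (s l) (s i)" by blast
    obtain B where B: "\<And>M. dg M = j \<Longrightarrow> total_deg M \<le> B" using bounded by blast
    have d: "snd (s i) \<in> dmon (fst (s i)) j" for i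
      using s(1)[of i] vals_dmon by (auto simp: lead_set_def leading_def)
    then have "snd (s i) \<in> monomials r (fst (s i))" "total_deg (snd (s i)) \<le> B" for i
      using B by (auto simp: dmon_def)
    from monomial_sequence_good[of "\<lambda>i. snd (s i)" r "\<lambda>i. fst (s i)" B, OF this]
    show False using s(2) by (auto simp: below_def)
  qed
  then show ?thesis using that by blast
qed

text \<open>Reduction in the manner of Groebner bases: choose one functional for each basic leading
  monomial, and cancel the leading value of any other functional by a multiple of an image of a
  chosen one.\<close>

lemma dual_finite_type:
  assumes j: "j \<in> I"
  shows "FI_fin_gen W (dualp W j :: ('k::field, _) FI_diagram)"
proof -
  let ?V = "dualp W j :: ('k, 'k mpoly set \<Rightarrow> 'k) FI_diagram"
  have FI: "FI_module W ?V"
    by (rule graded_co_FI_algebra.dual_piece_FI_module[OF coinv_graded_co_FI j])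
  obtain F where F: "finite F" "F \<subseteq> lead_set W j TYPE('k)"
    "\<And>x. x \<in> lead_set W j TYPE('k) \<Longrightarrow> \<exists>b\<in>F. below b x"
    using finite_basis[of W j, where 'k = 'k] by blast
  define pick where "pick b = (SOME y. y \<in> carrier (fobj ?V (fst b)) \<and> leading W j (fst b) y (snd b))" for b
  have pick: "pick b \<in> carrier (fobj ?V (fst b))" "leading W j (fst b) (pick b) (snd b)" if "b \<in> F" for b
  proof -
    have "\<exists>y. y \<in> carrier (fobj ?V (fst b)) \<and> leading W j (fst b) y (snd b)"
      using that F(2) by (cases b) (auto simp: lead_set_def)
    from someI_ex[OF this] show "pick b \<in> carrier (fobj ?V (fst b))" "leading W j (fst b) (pick b) (snd b)"
      by (auto simp: pick_def)
  qed
  let ?S = "(\<lambda>b. (fst b, pick b)) ` F"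
  have "U n = carrier (fobj ?V n)" if U: "sub_FI_module W ?V U" "\<And>b. b \<in> F \<Longrightarrow> pick b \<in> U (fst b)" for U n
  proof -
    have mod: "Module.module scalars (fobj ?V n)" by (rule FI_module.is_module[OF FI])
    have sub: "submodule (U n) scalars (fobj ?V n)" using U(1) by (simp add: sub_FI_module_def)
    note Uc = submodule_closed[OF sub mod]
    interpret V: Module.module scalars "fobj ?V n" by (rule mod)
    \<comment> \<open>The induction is on the number of monomials of degree j that do not exceed the
      leading one; it is 0 only for y = 0.\<close>
    have "\<And>y. y \<in> carrier (fobj ?V n) \<Longrightarrow>
        card {N \<in> dmon n j. \<exists>N'. vals W j n y N' \<noteq> 0 \<and> N \<le> N'} = k \<Longrightarrow> y \<in> U n" for k
    proof (induction k rule: less_induct)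
      case (less k y)
      show ?case
      proof (cases "\<exists>M. vals W j n y M \<noteq> 0")
        case False
        then have "vals W j n y = vals W j n \<zero>\<^bsub>fobj ?V n\<^esub>" by (auto simp: vals_zero)
        then have "y = \<zero>\<^bsub>fobj ?V n\<^esub>" by (rule vals_inj[OF less.prems(1) V.zero_closed])
        then show ?thesis using Uc(2) by metis
      next
        case True
        then obtain M where M: "leading W j n y M" using ex_leading by blast
        then have "(n, M) \<in> lead_set W j TYPE('k)" using less.prems(1) by (auto simp: lead_set_def)
        then obtain b f where b: "b \<in> F" and f: "f \<in> FI_incr (fst b) n" and fM: "transport f (snd b) = M"
          using F(3) by (fastforce simp: below_def)
        define z where "z = fmap ?V (fst b) n f (pick b)"
        note fs = FI_incr_hom[OF f, of "stab W"] and fW = FI_incr_hom[OF f, of W]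
        have zc: "z \<in> carrier (fobj ?V n)" unfolding z_def by (rule dual_map_closed[OF fs pick(1)[OF b]])
        have zU: "z \<in> U n" using U(1) U(2)[OF b] fW by (auto simp: z_def sub_FI_module_def image_subset_iff)
        have bm: "snd b \<in> monomials r (fst b)"
          using pick(2)[OF b] vals_dmon[of W j "fst b" "pick b" "snd b"] by (auto simp: leading_def dmon_def)
        have zM: "vals W j n z M \<noteq> 0"
          using vals_map(1)[OF fs pick(1)[OF b] bm] pick(2)[OF b] fM
          by (simp add: z_def tsgn_incr[OF f bm] leading_def)
        \<comment> \<open>Because f is increasing, it carries the leading monomial of the chosen
          functional to the leading monomial of its image.\<close>
        have zle: "N \<le> M" if "vals W j n z N \<noteq> 0" for N
        proof -
          from that vals_map(2)[OF fs pick(1)[OF b], of N] obtain N' where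
            N': "N' \<in> monomials r (fst b)" "N = transport f N'" by (auto simp: z_def)
          then have "vals W j (fst b) (pick b) N' \<noteq> 0"
            using vals_map(1)[OF fs pick(1)[OF b] N'(1)] that by (auto simp: z_def)
          then have "N' \<le> snd b" using pick(2)[OF b] by (simp add: leading_def)
          then show ?thesis using transport_less[OF f N'(1) bm] N'(2) fM by (metis le_less)
        qed
        define c where "c = vals W j n y M / vals W j n z M"
        define y' where "y' = y \<oplus>\<^bsub>fobj ?V n\<^esub> ((- c) \<odot>\<^bsub>fobj ?V n\<^esub> z)"
        have sm: "d \<odot>\<^bsub>fobj ?V n\<^esub> z \<in> carrier (fobj ?V n)" for d using zc V.smult_closed[of d z] by simp
        have y'c: "y' \<in> carrier (fobj ?V n)" unfolding y'_def using less.prems(1) sm by simp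
        have vy': "vals W j n y' N = vals W j n y N - c * vals W j n z N" for N
          by (simp add: y'_def vals_add vals_smult)
        have y'M: "vals W j n y' M = 0" using zM by (simp add: vy' c_def)
        have y'le: "N < M" if "vals W j n y' N \<noteq> 0" for N
        proof -
          have "vals W j n y N \<noteq> 0 \<or> vals W j n z N \<noteq> 0" using that by (auto simp: vy')
          then have "N \<le> M" using zle M by (auto simp: leading_def)
          moreover have "N \<noteq> M" using that y'M by auto
          ultimately show ?thesis by simp
        qed
        let ?A = "\<lambda>y. {N \<in> dmon n j. \<exists>N'. vals W j n y N' \<noteq> 0 \<and> N \<le> N'}"
        have "?A y' \<subset> ?A y"
        proof
          show "?A y' \<subseteq> ?A y" using y'le M by (force simp: leading_def)
          have "M \<in> ?A y" using M vals_dmon by (auto simp: leading_def)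
          moreover have "M \<notin> ?A y'" using y'le by force
          ultimately show "?A y' \<noteq> ?A y" by blast
        qed
        then have "card (?A y') < k"
          unfolding less.prems(2)[symmetric] by (intro psubset_card_mono) (auto simp: finite_dmon)
        then have "y' \<in> U n" using less.IH y'c by blast
        then have yU: "y' \<oplus>\<^bsub>fobj ?V n\<^esub> (c \<odot>\<^bsub>fobj ?V n\<^esub> z) \<in> U n" by (intro Uc zU)
        have veq: "vals W j n y = vals W j n (y' \<oplus>\<^bsub>fobj ?V n\<^esub> (c \<odot>\<^bsub>fobj ?V n\<^esub> z))"
          by (auto simp: vals_add vals_smult vy')
        have "y = y' \<oplus>\<^bsub>fobj ?V n\<^esub> (c \<odot>\<^bsub>fobj ?V n\<^esub> z)"
          by (rule vals_inj[OF less.prems(1) _ veq]) (use y'c sm in simp)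
        then show ?thesis using yU by metis
      qed
    qed
    then show ?thesis using Uc(1) by auto
  qed
  moreover have "?S \<subseteq> (SIGMA n:UNIV. carrier (fobj ?V n))" using pick(1) by auto
  ultimately show ?thesis
    unfolding FI_fin_gen_def using FI F(1) by (intro conjI exI[of _ ?S]) auto
qed

lemma coinv_finite_type:
  "finite_type W (coinv W r :: ('k::field, 'k mpoly set) FI_diagram) I (coinv_piece dg W r)"
  by (simp add: finite_type_def dual_finite_type)

end

section \<open>A vector antisymmetric along the columns\<close>

lemma length_cells [simp]: "length (cells \<mu>) = sum_list \<mu>"
proof -
  have "length (cells \<mu>) = (\<Sum>i\<leftarrow>[0..<length \<mu>]. \<mu> ! i)"
    by (simp add: cells_def length_concat o_def)
  also have "\<dots> = sum_list \<mu>" by (simp add: map_nth)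
  finally show ?thesis .
qed

lemma distinct_cells: "distinct (cells \<mu>)"
proof -
  have "distinct (concat (map (\<lambda>i. map (\<lambda>j. (i, j)) [0..<\<mu> ! i]) xs))" if "distinct xs" for xs
    using that by (induction xs) (auto simp: distinct_map inj_on_def)
  from this[of "[0..<length \<mu>]"] show ?thesis by (simp add: cells_def)
qed

lemma set_cells: "set (cells \<mu>) = {(i, j). i < length \<mu> \<and> j < \<mu> ! i}"
  by (auto simp: cells_def)

lemma bij_cell: "bij_betw (cell \<mu>) {1..sum_list \<mu>} (set (cells \<mu>))"
proof -
  have 1: "bij_betw (\<lambda>t. t - 1) {1..sum_list \<mu>} {..<sum_list \<mu>}"
    by (rule bij_betwI[of _ _ _ Suc]) auto
  have 2: "bij_betw ((!) (cells \<mu>)) {..<sum_list \<mu>} (set (cells \<mu>))"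
    by (rule bij_betw_nth[OF distinct_cells]) auto
  have "cell \<mu> = (!) (cells \<mu>) \<circ> (\<lambda>t. t - 1)" by (auto simp: cell_def)
  then show ?thesis using bij_betw_trans[OF 1 2] by simp
qed

lemma cell_inj: "s \<in> {1..sum_list \<mu>} \<Longrightarrow> t \<in> {1..sum_list \<mu>} \<Longrightarrow> cell \<mu> s = cell \<mu> t \<Longrightarrow> s = t"
  using inj_onD[OF bij_betw_imp_inj_on[OF bij_cell], of \<mu> s t] by blast

lemma cell_mem: "t \<in> {1..sum_list \<mu>} \<Longrightarrow> fst (cell \<mu> t) < length \<mu> \<and> snd (cell \<mu> t) < \<mu> ! fst (cell \<mu> t)"
  using bij_betw_apply[OF bij_cell, of t \<mu>] by (auto simp: set_cells case_prod_unfold)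

lemma cell_ex: "i < length \<mu> \<Longrightarrow> j < \<mu> ! i \<Longrightarrow> \<exists>t\<in>{1..sum_list \<mu>}. cell \<mu> t = (i, j)"
proof -
  assume "i < length \<mu>" "j < \<mu> ! i"
  then have "(i, j) \<in> cell \<mu> ` {1..sum_list \<mu>}"
    unfolding bij_betw_imp_surj_on[OF bij_cell] by (simp add: set_cells)
  then show ?thesis by (auto simp del: atLeastAtMost_iff)
qed

section \<open>Row and column groups and the antisymmetrized Young symmetrizer\<close>

lemma sym_grp_iff: "p \<in> sym_grp n \<longleftrightarrow> p permutes {1..n}"
  by (simp add: sym_grp_def)

lemma compose_sym_grp: "p \<in> sym_grp n \<Longrightarrow> q \<in> sym_grp n \<Longrightarrow> p \<circ> q \<in> sym_grp n"
  by (simp add: sym_grp_iff permutes_compose)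

lemma finite_sym_grp: "finite (sym_grp n)"
  unfolding sym_grp_def by (rule finite_permutations) simp

text \<open>Row group and column group are both stabilizers of a labelling of the cells; this lets
  their group properties be proved once.\<close>

definition fixing :: "(nat \<Rightarrow> nat) set \<Rightarrow> nat \<Rightarrow> (nat \<Rightarrow> 'a) \<Rightarrow> bool"
  where "fixing H n g \<longleftrightarrow> H = {p \<in> sym_grp n. \<forall>t\<in>{1..n}. g (p t) = g t}"

lemma fixing_group:
  assumes "fixing H n g"
  shows "H \<subseteq> sym_grp n" "finite H" "id \<in> H" "p \<in> H \<Longrightarrow> q \<in> H \<Longrightarrow> p \<circ> q \<in> H" "p \<in> H \<Longrightarrow> inv_into UNIV p \<in> H"
proof -
  have H: "H = {p \<in> sym_grp n. \<forall>t\<in>{1..n}. g (p t) = g t}" using assms by (simp add: fixing_def)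
  show sub: "H \<subseteq> sym_grp n" by (auto simp: H)
  show "finite H" by (rule finite_subset[OF sub finite_sym_grp])
  show "id \<in> H" by (simp add: H sym_grp_iff permutes_id)
  show "p \<circ> q \<in> H" if "p \<in> H" "q \<in> H"
    using that permutes_compose[of q "{1..n}" p] permutes_in_image[of q "{1..n}"]
    unfolding H sym_grp_iff mem_Collect_eq comp_def by metis
  show "inv_into UNIV p \<in> H" if p: "p \<in> H"
  proof -
    have pp: "p permutes {1..n}" using p by (simp add: H sym_grp_iff)
    have "g (inv_into UNIV p t) = g t" if t: "t \<in> {1..n}" for t
    proof -
      have "inv_into UNIV p t \<in> {1..n}" using permutes_in_image[OF permutes_inv[OF pp]] t by simp
      then have "g (p (inv_into UNIV p t)) = g (inv_into UNIV p t)" using p unfolding H by blast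
      then show ?thesis using permutes_inverses(1)[OF pp] by metis
    qed
    then show ?thesis using permutes_inv[OF pp] by (simp add: H sym_grp_iff)
  qed
qed

lemma row_fixing: "fixing (row_group \<mu>) (sum_list \<mu>) (\<lambda>t. fst (cell \<mu> t))"
  by (simp add: fixing_def row_group_def)

lemma col_fixing: "fixing (col_group \<mu>) (sum_list \<mu>) (\<lambda>t. snd (cell \<mu> t))"
  by (simp add: fixing_def col_group_def)

lemmas row_grp = fixing_group[OF row_fixing] and col_grp = fixing_group[OF col_fixing]

lemma row_col_id:
  assumes p: "p \<in> row_group \<mu>" "p \<in> col_group \<mu>"
  shows "p = id"
proof
  fix t
  have pp: "p permutes {1..sum_list \<mu>}" using p by (simp add: row_group_def sym_grp_iff)
  show "p t = id t"
  proof (cases "t \<in> {1..sum_list \<mu>}")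
    case True
    then have "cell \<mu> (p t) = cell \<mu> t" using p by (auto simp: row_group_def col_group_def prod_eq_iff)
    then show ?thesis using cell_inj[of "p t" \<mu> t] permutes_in_image[OF pp] True by auto
  qed (use permutes_not_in[OF pp] in auto)
qed

lemma sign_sym_grp: "p \<in> sym_grp n \<Longrightarrow> q \<in> sym_grp n \<Longrightarrow> sign (p \<circ> q) = sign p * sign q"
  by (rule sign_compose) (auto simp: sym_grp_iff permutation_permutes)

lemma sign_inv_sym_grp: "p \<in> sym_grp n \<Longrightarrow> sign (inv_into UNIV p) = sign p"
  by (rule sign_inverse) (auto simp: sym_grp_iff permutation_permutes)

lemma sym_grp_inverses: "p \<in> sym_grp n \<Longrightarrow> inv_into UNIV p \<circ> p = id" "p \<in> sym_grp n \<Longrightarrow> p \<circ> inv_into UNIV p = id"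
  by (auto simp: sym_grp_iff permutes_inv_o)

lemma sign_mult_self [simp]: "sign p * sign p = (1 :: int)"
  by (simp add: sign_def)

lemma sum_left_translate:
  assumes H: "fixing H n g" and t: "\<tau> \<in> H"
  shows "(\<Sum>q\<in>H. f (\<tau> \<circ> q)) = (\<Sum>q\<in>H. f q)"
proof (rule sum.reindex_bij_witness[of _ "\<lambda>q. inv_into UNIV \<tau> \<circ> q" "\<lambda>q. \<tau> \<circ> q"])
  note G = fixing_group[OF H]
  have "\<tau> \<in> sym_grp n" using G(1) t by auto
  note inv = sym_grp_inverses[OF this]
  show "inv_into UNIV \<tau> \<circ> (\<tau> \<circ> q) = q" "\<tau> \<circ> (inv_into UNIV \<tau> \<circ> q) = q" for q
    using inv by (simp_all flip: comp_assoc)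
  show "\<tau> \<circ> q \<in> H" "inv_into UNIV \<tau> \<circ> q \<in> H" if "q \<in> H" for q using G(4,5) t that by auto
qed simp

lemma sym_act_comp: "sym_act g (sym_act h x) = sym_act (g \<circ> h) x"
proof -
  have eq: "(\<circ>) g \<circ> (\<circ>) h = (\<circ>) (g \<circ> h)" by (auto simp: comp_assoc)
  show ?thesis unfolding sym_act_def free_map_comp eq ..
qed

lemma sym_act_add: "sym_act g (x + y) = sym_act g x + sym_act g y"
  by (simp add: sym_act_def free_map_add)

lemma sym_act_scale: "sym_act g (scale c x) = scale c (sym_act g x)"
  by (simp add: sym_act_def free_map_scale)

lemma sym_act_zero [simp]: "sym_act g 0 = 0"
  by (simp add: sym_act_def)

lemma sym_act_sum: "sym_act g (sum f A) = (\<Sum>a\<in>A. sym_act g (f a))"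
  by (induction A rule: infinite_finite_induct) (auto simp: sym_act_add)

lemma sym_act_single [simp]: "sym_act g (Poly_Mapping.single p c) = Poly_Mapping.single (g \<circ> p) c"
  by (simp add: sym_act_def)

lemma scale_sum: "scale c (sum f A) = (\<Sum>a\<in>A. scale c (f a))"
  by (induction A rule: infinite_finite_induct) (auto simp: scale_add scale_zero)

lemma sym_act_young_row:
  assumes "\<sigma> \<in> row_group \<mu>"
  shows "sym_act \<sigma> (young_sym \<mu>) = young_sym \<mu>"
proof -
  have "sym_act \<sigma> (young_sym \<mu>) = (\<Sum>p\<in>row_group \<mu>.
      \<Sum>q\<in>col_group \<mu>. Poly_Mapping.single ((\<sigma> \<circ> p) \<circ> q) (of_int (sign q)))"
    by (simp add: young_sym_def sym_act_sum comp_assoc)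
  also have "\<dots> = young_sym \<mu>"
    unfolding young_sym_def
    by (rule sum_left_translate[OF row_fixing assms, of "\<lambda>p. \<Sum>q\<in>col_group \<mu>. Poly_Mapping.single (p \<circ> q) (of_int (sign q))"])
  finally show ?thesis .
qed

text \<open>The element \<open>b\<^sub>\<mu> a\<^sub>\<mu> b\<^sub>\<mu>\<close> of the left ideal
  generated by the Young symmetrizer \<open>a\<^sub>\<mu> b\<^sub>\<mu>\<close>. The left factor
  makes it transform by the sign under the column group.\<close>

definition anti_vec :: "nat list \<Rightarrow> 'k::field grp_alg"
  where "anti_vec \<mu> = (\<Sum>q\<in>col_group \<mu>. scale (of_int (sign q)) (sym_act q (young_sym \<mu>)))"

lemma anti_vec_col:
  assumes t: "\<tau> \<in> col_group \<mu>"
  shows "sym_act \<tau> (anti_vec \<mu>) = scale (of_int (sign \<tau>)) (anti_vec \<mu> :: 'k::field grp_alg)"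
proof -
  let ?f = "\<lambda>q. scale (of_int (sign q)) (sym_act q (young_sym \<mu>)) :: 'k grp_alg"
  have sg: "sign q = sign \<tau> * sign (\<tau> \<circ> q)" if "q \<in> col_group \<mu>" for q
  proof -
    have "sign (\<tau> \<circ> q) = sign \<tau> * sign q"
      by (rule sign_sym_grp) (use col_grp(1) t that in blast)+
    then show ?thesis by (simp flip: mult.assoc)
  qed
  have "sym_act \<tau> (anti_vec \<mu>) = (\<Sum>q\<in>col_group \<mu>. scale (of_int (sign q)) (sym_act (\<tau> \<circ> q) (young_sym \<mu>)))"
    by (simp add: anti_vec_def sym_act_sum sym_act_scale sym_act_comp)
  also have "\<dots> = (\<Sum>q\<in>col_group \<mu>. scale (of_int (sign \<tau>)) (?f (\<tau> \<circ> q)))"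
    by (intro sum.cong refl) (simp add: scale_scale, subst sg, simp_all)
  also have "\<dots> = (\<Sum>q\<in>col_group \<mu>. scale (of_int (sign \<tau>)) (?f q))"
    by (rule sum_left_translate[OF col_fixing t, of "\<lambda>q. scale (of_int (sign \<tau>)) (?f q)"])
  finally show ?thesis by (simp add: anti_vec_def scale_sum)
qed

text \<open>Such a permutation passes through the left factor and is absorbed by the row
  symmetrizer.\<close>

lemma anti_vec_commuting:
  assumes "\<sigma> \<in> row_group \<mu>" "\<And>q. q \<in> col_group \<mu> \<Longrightarrow> \<sigma> \<circ> q = q \<circ> \<sigma>"
  shows "sym_act \<sigma> (anti_vec \<mu>) = (anti_vec \<mu> :: 'k::field grp_alg)"
proof -
  have "sym_act \<sigma> (sym_act q (young_sym \<mu>)) = (sym_act q (young_sym \<mu>) :: 'k grp_alg)" if "q \<in> col_group \<mu>" for q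
    using assms(2)[OF that] sym_act_young_row[OF assms(1)] by (metis sym_act_comp)
  then show ?thesis unfolding anti_vec_def sym_act_sum sym_act_scale by (intro sum.cong refl) simp
qed

text \<open>A product \<open>q p q'\<close> with \<open>p\<close> in the row group and \<open>q, q'\<close> in the column group is the identity
  only for \<open>p = 1\<close>.\<close>

lemma anti_vec_id: "Poly_Mapping.lookup (anti_vec \<mu>) id = (of_nat (card (col_group \<mu>)) :: 'k::field)"
proof -
  let ?R = "row_group \<mu>" and ?Q = "col_group \<mu>"
  have one: "(\<Sum>p\<in>?R. \<Sum>q'\<in>?Q. (of_int (sign q') when q \<circ> (p \<circ> q') = id)) * of_int (sign q) = (1 :: 'k)"
    if q: "q \<in> ?Q" for q
  proof -
    have eq: "q \<circ> (p \<circ> q') = id \<longleftrightarrow> q' = inv_into UNIV q \<and> p = id" if p: "p \<in> ?R" and q': "q' \<in> ?Q" for p q'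
    proof
      assume h: "q \<circ> (p \<circ> q') = id"
      have inv: "inv_into UNIV q \<circ> q = id" "q' \<circ> inv_into UNIV q' = id"
        using sym_grp_inverses col_grp(1) q q' by blast+
      have "p = (inv_into UNIV q \<circ> q) \<circ> p \<circ> (q' \<circ> inv_into UNIV q')" by (simp add: inv)
      also have "\<dots> = inv_into UNIV q \<circ> (q \<circ> (p \<circ> q')) \<circ> inv_into UNIV q'" by (simp only: comp_assoc)
      finally have "p = inv_into UNIV q \<circ> inv_into UNIV q'" by (simp add: h)
      then have "p \<in> ?Q" using col_grp(4,5) q q' by auto
      then have p1: "p = id" using row_col_id p by blast
      have "q' = (inv_into UNIV q \<circ> q) \<circ> q'" by (simp add: inv)
      also have "\<dots> = inv_into UNIV q \<circ> (q \<circ> (p \<circ> q'))" by (simp add: p1 comp_assoc)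
      finally show "q' = inv_into UNIV q \<and> p = id" using h p1 by simp
    next
      assume "q' = inv_into UNIV q \<and> p = id"
      then show "q \<circ> (p \<circ> q') = id" using sym_grp_inverses(2)[of q] col_grp(1) q by auto
    qed
    have "(\<Sum>p\<in>?R. \<Sum>q'\<in>?Q. (of_int (sign q') when q \<circ> (p \<circ> q') = id))
        = (\<Sum>p\<in>?R. \<Sum>q'\<in>?Q. if q' = inv_into UNIV q then if p = id then of_int (sign q') else 0 else 0 :: 'k)"
      by (intro sum.cong refl) (auto simp: eq when_def)
    also have "\<dots> = (\<Sum>p\<in>?R. if p = id then of_int (sign (inv_into UNIV q)) else 0)"
      using col_grp(2,5) q by (intro sum.cong refl) (subst sum.delta, auto)
    also have "\<dots> = of_int (sign (inv_into UNIV q))" using row_grp(2,3) by (simp add: sum.delta)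
    also have "sign (inv_into UNIV q) = sign q" using sign_inv_sym_grp col_grp(1) q by blast
    finally have "(\<Sum>p\<in>?R. \<Sum>q'\<in>?Q. (of_int (sign q') when q \<circ> (p \<circ> q') = id)) = (of_int (sign q) :: 'k)" .
    then show ?thesis by (simp only: sign_mult_self flip: of_int_mult) simp
  qed
  have "Poly_Mapping.lookup (anti_vec \<mu>) id = (\<Sum>q\<in>?Q. of_int (sign q) *
      (\<Sum>p\<in>?R. \<Sum>q'\<in>?Q. (of_int (sign q') when q \<circ> (p \<circ> q') = id) :: 'k))"
    by (simp add: anti_vec_def lookup_sum young_sym_def sym_act_sum lookup_single)
  also have "\<dots> = (\<Sum>q\<in>?Q. 1)" by (intro sum.cong refl) (rule trans[OF mult.commute one])
  finally show ?thesis by simp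
qed

lemma anti_vec_nonzero:
  assumes "CHAR('k::field) = 0"
  shows "Poly_Mapping.lookup (anti_vec \<mu> :: 'k grp_alg) id \<noteq> 0"
proof -
  have "card (col_group \<mu>) \<noteq> 0" using col_grp(2,3) by (auto simp: card_eq_0_iff)
  then show ?thesis using assms by (simp add: anti_vec_id of_nat_eq_0_iff_char_dvd)
qed

section \<open>The underlying space of the irreducible representations of the symmetric
  group\<close>

definition irr_span :: "nat list \<Rightarrow> 'k::field grp_alg set"
  where "irr_span \<mu> = lin_span (free_module (sym_grp (sum_list \<mu>)))
     {sym_act g (young_sym \<mu>) | g. g \<in> sym_grp (sum_list \<mu>)}"

lemma sym_act_closed:
  assumes "g \<in> sym_grp n" "x \<in> carrier (free_module (sym_grp n))"
  shows "sym_act g x \<in> carrier (free_module (sym_grp n))"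
proof -
  have "(\<circ>) g ` Poly_Mapping.keys x \<subseteq> sym_grp n"
    using assms by (auto simp: free_module_def intro!: compose_sym_grp)
  then show ?thesis using free_map_keys[of "(\<circ>) g" x] by (auto simp: free_module_def sym_act_def)
qed

lemma young_sym_closed: "young_sym \<mu> \<in> carrier (free_module (sym_grp (sum_list \<mu>)))"
  unfolding young_sym_def
  using row_grp(1) col_grp(1)
  by (intro pm_module.sum_closed[OF free_module_pm] pm_module.single_closed[OF free_module_pm]
      compose_sym_grp) auto

interpretation irr: pm_quotient "free_module (sym_grp (sum_list \<mu>))" "sym_grp (sum_list \<mu>)" "irr_span \<mu>" for \<mu>
  unfolding irr_span_def
  by (rule pm_module.lin_span_quotient(1)[OF free_module_pm]) (auto intro: sym_act_closed young_sym_closed)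

lemma irr_span_gen: "g \<in> sym_grp (sum_list \<mu>) \<Longrightarrow> sym_act g (young_sym \<mu>) \<in> irr_span \<mu>"
  unfolding irr_span_def
  by (rule subsetD[OF pm_module.lin_span_quotient(2)[OF free_module_pm]])
    (auto intro: sym_act_closed young_sym_closed)

lemma irr_span_act:
  assumes g: "g \<in> sym_grp (sum_list \<mu>)" and x: "x \<in> irr_span \<mu>"
  shows "sym_act g x \<in> irr_span \<mu>"
proof -
  let ?U = "{x \<in> irr_span \<mu>. sym_act g x \<in> irr_span \<mu>}"
  let ?S = "{sym_act g (young_sym \<mu>) | g. g \<in> sym_grp (sum_list \<mu>)}"
  have S: "?S \<subseteq> carrier (free_module (sym_grp (sum_list \<mu>)))" by (auto intro: sym_act_closed young_sym_closed)
  have "pm_quotient (free_module (sym_grp (sum_list \<mu>))) (sym_grp (sum_list \<mu>)) ?U"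
    by unfold_locales
      (use irr.sub_carrier in \<open>auto simp: irr.sub_zero irr.sub_add irr.sub_scale sym_act_add sym_act_scale\<close>)
  moreover have "?S \<subseteq> ?U"
  proof
    fix y assume "y \<in> ?S"
    then obtain h where h: "h \<in> sym_grp (sum_list \<mu>)" "y = sym_act h (young_sym \<mu>)" by auto
    then have "g \<circ> h \<in> sym_grp (sum_list \<mu>)" using g by (auto simp: sym_grp_iff intro: permutes_compose)
    then show "y \<in> ?U" using h by (auto simp: sym_act_comp intro!: irr_span_gen)
  qed
  ultimately have "irr_span \<mu> \<subseteq> ?U"
    unfolding irr_span_def[of \<mu>] by (intro pm_module.lin_span_quotient(3)[OF free_module_pm S])
      (simp_all add: irr_span_def)
  then show ?thesis using x by auto
qed

lemma S_irr_simps [simp]: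
  "carrier (S_irr \<mu>) = irr_span \<mu>" "add (S_irr \<mu>) = (+)" "ring.zero (S_irr \<mu>) = 0"
  "module.smult (S_irr \<mu>) = scale"
  by (simp_all add: S_irr_def Let_def irr_span_def free_module_def)

lemma anti_vec_mem: "anti_vec \<mu> \<in> irr_span \<mu>"
  unfolding anti_vec_def using col_grp(1)
  by (intro irr.sub_sum irr.sub_scale irr_span_gen) auto

text \<open>The cells of the first row which are alone in their column. Type D needs a set of cells
  under whose permutations the antisymmetric vector is invariant, and these have this
  property.\<close>

definition lone :: "nat list \<Rightarrow> nat set"
  where "lone \<mu> = {t \<in> {1..sum_list \<mu>}. fst (cell \<mu> t) = 0 \<and>
    (\<forall>s\<in>{1..sum_list \<mu>}. snd (cell \<mu> s) = snd (cell \<mu> t) \<longrightarrow> s = t)}"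

lemma transpose_sym_grp: "a \<in> {1..n} \<Longrightarrow> b \<in> {1..n} \<Longrightarrow> transpose a b \<in> sym_grp n"
  by (simp add: sym_grp_iff permutes_swap_id del: atLeastAtMost_iff)

lemma transpose_fixing:
  assumes "fixing H n g" "a \<in> {1..n}" "b \<in> {1..n}" "g a = g b"
  shows "transpose a b \<in> H"
  using assms transpose_sym_grp[of a n b] by (auto simp: fixing_def transpose_def)

lemma anti_vec_transpose:
  assumes "a \<in> {1..sum_list \<mu>}" "b \<in> {1..sum_list \<mu>}" "a \<noteq> b" "snd (cell \<mu> a) = snd (cell \<mu> b)"
  shows "sym_act (transpose a b) (anti_vec \<mu>) = - anti_vec \<mu>"
  using anti_vec_col[OF transpose_fixing[OF col_fixing, of a \<mu> b]] assms
  by (simp add: sign_swap_id scale_uminus_1)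

text \<open>The column group fixes the two cells, so it commutes with their transposition, which in
  turn belongs to the row group.\<close>

lemma anti_vec_lone:
  assumes a: "a \<in> lone \<mu>" and b: "b \<in> lone \<mu>"
  shows "sym_act (transpose a b) (anti_vec \<mu>) = anti_vec \<mu>"
proof (rule anti_vec_commuting)
  show "transpose a b \<in> row_group \<mu>"
    using transpose_fixing[OF row_fixing, of a \<mu> b] a b by (auto simp: lone_def)
  fix q assume q: "q \<in> col_group \<mu>"
  then have qp: "q permutes {1..sum_list \<mu>}" by (simp add: col_group_def sym_grp_iff)
  have fix_lone: "q t = t" if t: "t \<in> lone \<mu>" for t
  proof -
    have t': "t \<in> {1..sum_list \<mu>}" using t by (simp add: lone_def)
    then have "q t \<in> {1..sum_list \<mu>}" using permutes_in_image[OF qp] by simp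
    moreover have "snd (cell \<mu> (q t)) = snd (cell \<mu> t)" using q t' unfolding col_group_def by blast
    ultimately show ?thesis using t unfolding lone_def by blast
  qed
  show "transpose a b \<circ> q = q \<circ> transpose a b"
  proof
    fix t
    have inj: "q s = q t \<longleftrightarrow> s = t" for s t using permutes_inj[OF qp] by (auto dest: injD)
    show "(transpose a b \<circ> q) t = (q \<circ> transpose a b) t"
      using inj[of t a] inj[of t b] fix_lone[OF a] fix_lone[OF b] by (auto simp: transpose_def)
  qed
qed

section \<open>Elements of the hyperoctahedral group\<close>

lemma FI_int_ext:
  assumes "f \<in> FI_hom FI_BC m n" "g \<in> FI_hom FI_BC m n'" "\<And>i. i \<in> {1..m} \<Longrightarrow> f (int i) = g (int i)"
  shows "f = g"
proof (rule extensionalityI[OF FI_ext[OF assms(1)] FI_ext[OF assms(2)]])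
  fix a assume a: "a \<in> ob m"
  then have i: "nat \<bar>a\<bar> \<in> {1..m}" by (auto simp: ob_def)
  show "f a = g a"
  proof (cases "0 < a")
    case True
    then show ?thesis using assms(3)[OF i] by simp
  next
    case False
    then show ?thesis using assms(3)[OF i] FI_uminus[OF assms(1) a] FI_uminus[OF assms(2) a] by simp
  qed
qed

text \<open>The odd extension of a map given on 1, ..., m; with \<open>FI_int_ext\<close> a morphism
  is determined by these values.\<close>

definition signed_map :: "nat \<Rightarrow> (nat \<Rightarrow> int) \<Rightarrow> int \<Rightarrow> int"
  where "signed_map m h = (\<lambda>a\<in>ob m. sgn a * h (nat \<bar>a\<bar>))"

lemma signed_map_int: "i \<in> {1..m} \<Longrightarrow> signed_map m h (int i) = h i"
  by (simp add: signed_map_def)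

lemma signed_map_FI:
  assumes "\<And>i. i \<in> {1..m} \<Longrightarrow> h i \<in> ob n" "inj_on (\<lambda>i. \<bar>h i\<bar>) {1..m}"
  shows "signed_map m h \<in> FI_hom FI_BC m n"
proof -
  have idx: "nat \<bar>a\<bar> \<in> {1..m}" "a \<noteq> 0" if "a \<in> ob m" for a using that by (auto simp: ob_def)
  have eq: "signed_map m h a = sgn a * h (nat \<bar>a\<bar>)" if "a \<in> ob m" for a
    using that by (simp add: signed_map_def)
  have "signed_map m h a \<in> ob n" if "a \<in> ob m" for a
    using assms(1)[OF idx(1)[OF that]] idx(2)[OF that] by (cases "0 < a") (auto simp: eq[OF that])
  moreover have "inj_on (signed_map m h) (ob m)"
  proof (rule inj_onI)
    fix a b assume a: "a \<in> ob m" and b: "b \<in> ob m" and ab: "signed_map m h a = signed_map m h b"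
    have "\<bar>h (nat \<bar>a\<bar>)\<bar> = \<bar>h (nat \<bar>b\<bar>)\<bar>"
      using arg_cong[OF ab, of abs] idx(2)[OF a] idx(2)[OF b] by (simp add: eq[OF a] eq[OF b] abs_mult)
    then have "nat \<bar>a\<bar> = nat \<bar>b\<bar>" using inj_onD[OF assms(2) _ idx(1)[OF a] idx(1)[OF b]] by simp
    moreover from this have "sgn a = sgn b"
      using ab assms(1)[OF idx(1)[OF b]] by (simp add: eq[OF a] eq[OF b] ob_def)
    ultimately show "a = b" by (metis abs_ge_zero eq_nat_nat_iff mult_sgn_abs)
  qed
  moreover have "signed_map m h (- a) = - signed_map m h a" if "a \<in> ob m" for a
    using that by (simp add: signed_map_def sgn_minus)
  ultimately show ?thesis by (simp add: FI_hom_def PiE_def Pi_def signed_map_def)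
qed

definition swap_map :: "nat \<Rightarrow> nat \<Rightarrow> nat \<Rightarrow> int \<Rightarrow> int"
  where "swap_map n a b = signed_map n (\<lambda>i. int (transpose a b i))"

definition flip :: "nat \<Rightarrow> nat \<Rightarrow> int \<Rightarrow> int"
  where "flip n a = signed_map n (\<lambda>i. if i = a then - int i else int i)"

lemma transpose_in: "a \<in> {1..n} \<Longrightarrow> b \<in> {1..n} \<Longrightarrow> i \<in> {1..n} \<Longrightarrow> transpose a b i \<in> {1..n::nat}"
  by (auto simp: transpose_def)

lemma swap_map_FI:
  assumes "a \<in> {1..n}" "b \<in> {1..n}"
  shows "swap_map n a b \<in> FI_hom FI_BC n n"
  unfolding swap_map_def
proof (rule signed_map_FI)
  show "int (transpose a b i) \<in> ob n" if "i \<in> {1..n}" for i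
    using transpose_in[OF assms that] by simp
  show "inj_on (\<lambda>i. \<bar>int (transpose a b i)\<bar>) {1..n}"
    by (rule inj_onI) (metis abs_of_nat of_nat_eq_iff transpose_involutory)
qed

lemma swap_map_int: "i \<in> {1..n} \<Longrightarrow> swap_map n a b (int i) = int (transpose a b i)"
  by (simp add: swap_map_def signed_map_int)

lemma idx_swap_map: "i \<in> {1..n} \<Longrightarrow> idx (swap_map n a b) i = transpose a b i"
  by (simp add: idx_def swap_map_int)

lemma flip_FI: "flip n a \<in> FI_hom FI_BC n n"
  unfolding flip_def by (rule signed_map_FI) (auto simp: ob_def inj_on_def)

lemma flip_int: "i \<in> {1..n} \<Longrightarrow> flip n a (int i) = (if i = a then - int i else int i)"
  by (simp add: flip_def signed_map_int)

lemma idx_flip: "i \<in> {1..n} \<Longrightarrow> idx (flip n a) i = i"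
  by (auto simp: idx_def flip_int)

lemma swap_map_FI_A:
  assumes "a \<in> {1..n}" "b \<in> {1..n}"
  shows "swap_map n a b \<in> FI_hom FI_A n n"
proof -
  have "0 < swap_map n a b x" if x: "x \<in> ob n" "0 < x" for x
  proof -
    have i: "nat x \<in> {1..n}" "x = int (nat x)" using x by (auto simp: ob_def)
    then have "swap_map n a b x = int (transpose a b (nat x))" using swap_map_int[OF i(1), of a b] by simp
    then show ?thesis using transpose_in[OF assms i(1)] by simp
  qed
  then show ?thesis using swap_map_FI[OF assms] by (simp add: FI_hom_def)
qed

lemma eps_flip:
  assumes "a \<in> {1..n}"
  shows "eps n (flip n a) = - 1"
proof -
  have "eps n (flip n a) = (\<Prod>i\<in>{1..n}. if i = a then - 1 else 1)"
    unfolding eps_eq_prod by (rule prod.cong) (auto simp: flip_int)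
  then show ?thesis using assms by (simp add: prod.delta)
qed

lemma to_perm_eq: "to_perm n w i = (if i \<in> {1..n} then idx w i else i)"
  by (simp add: to_perm_def idx_def)

lemma to_perm_sym_grp:
  assumes "w \<in> FI_hom FI_BC n n"
  shows "to_perm n w \<in> sym_grp n"
  unfolding sym_grp_iff
proof (rule bij_imp_permutes)
  show "bij_betw (to_perm n w) {1..n} {1..n}"
    using idx_inj[OF assms] idx_image[OF assms]
    by (subst bij_betw_cong[of _ _ "idx w"]) (auto simp: to_perm_eq bij_betw_def)
qed (simp only: to_perm_eq if_False)

lemma to_perm_compose:
  assumes f: "f \<in> FI_hom FI_BC n n" and g: "g \<in> FI_hom FI_BC n n"
  shows "to_perm n (compose (ob n) g f) = to_perm n g \<circ> to_perm n f"
proof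
  fix i
  show "to_perm n (compose (ob n) g f) i = (to_perm n g \<circ> to_perm n f) i"
  proof (cases "i \<in> {1..n}")
    case True
    have o: "int i \<in> ob n" using True by simp
    have "idx (compose (ob n) g f) i = idx g (idx f i)"
      using o FI_uminus[OF g FI_ob[OF f o]] by (auto simp: idx_def compose_def abs_if)
    moreover have "idx f i \<in> {1..n}" by (rule idx_in[OF f True])
    ultimately show ?thesis using True by (simp only: to_perm_eq comp_apply if_True)
  qed (simp only: to_perm_eq comp_apply if_False)
qed

lemma to_perm_id [simp]: "to_perm n (\<lambda>a\<in>ob n. a) = id"
  by (auto simp: to_perm_eq idx_def)

lemma to_perm_swap_map:
  assumes "a \<in> {1..n}" "b \<in> {1..n}"
  shows "to_perm n (swap_map n a b) = transpose a b"
proof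
  fix i show "to_perm n (swap_map n a b) i = transpose a b i"
  proof (cases "i \<in> {1..n}")
    case False
    then have "i \<noteq> a" "i \<noteq> b" using assms by auto
    then show ?thesis using False by (simp only: to_perm_eq if_False) (metis transpose_apply_other)
  qed (simp only: to_perm_eq if_True idx_swap_map)
qed

lemma eps_id [simp]: "eps n (\<lambda>a\<in>ob n. a) = 1"
  unfolding eps_eq_prod by (rule prod.neutral) auto

section \<open>The subgroup B_m x B_l and its projections\<close>

lemma B_sub_FI: "w \<in> B_sub m l \<Longrightarrow> w \<in> FI_hom FI_BC (m + l) (m + l)"
  by (simp add: B_sub_def)

lemma ob_mono: "a \<in> ob m \<Longrightarrow> a \<in> ob (m + l)"
  by (auto simp: ob_def)

lemma B_left_FI:
  assumes w: "w \<in> B_sub m l"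
  shows "B_left m w \<in> FI_hom FI_BC m m"
proof -
  note w' = B_sub_FI[OF w]
  have im: "w a \<in> ob m" if "a \<in> ob m" for a using w that by (auto simp: B_sub_def)
  have "inj_on w (ob m)" using FI_inj[OF w'] ob_mono by (meson inj_onI)
  then show ?thesis using im FI_uminus[OF w'] ob_mono[of _ m l]
    by (simp add: FI_hom_def B_left_def PiE_def Pi_def inj_on_restrict_eq)
qed

lemma B_sub_right:
  assumes w: "w \<in> B_sub m l" and i: "i \<in> {1..l}"
  shows "w (int (i + m)) \<in> ob (m + l)" "w (int (i + m)) \<notin> ob m"
proof -
  note w' = B_sub_FI[OF w]
  have o: "int (i + m) \<in> ob (m + l)" "int (i + m) \<notin> ob m" using i by (auto simp: ob_def)
  show "w (int (i + m)) \<in> ob (m + l)" by (rule FI_ob[OF w' o(1)])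
  show "w (int (i + m)) \<notin> ob m"
  proof
    assume "w (int (i + m)) \<in> ob m"
    moreover have "w ` ob m = ob m" using w by (simp add: B_sub_def)
    ultimately have "w (int (i + m)) \<in> w ` ob m" by simp
    then obtain a where a: "a \<in> ob m" "w a = w (int (i + m))" by (metis imageE)
    then show False using FI_inj[OF w' ob_mono[OF a(1)] o(1)] o(2) by blast
  qed
qed

lemma B_right_eq_signed:
  assumes w: "w \<in> B_sub m l"
  shows "B_right m l w = signed_map l (\<lambda>i. let b = w (int (i + m)) in b - sgn b * int m)"
proof (rule extensionalityI[of _ "ob l"])
  fix a assume a: "a \<in> ob l"
  then have i: "nat \<bar>a\<bar> \<in> {1..l}" "int (nat \<bar>a\<bar> + m) \<in> ob (m + l)" by (auto simp: ob_def)
  note odd = FI_uminus[OF B_sub_FI[OF w] i(2)]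
  show "B_right m l w a = signed_map l (\<lambda>i. let b = w (int (i + m)) in b - sgn b * int m) a"
  proof (cases "0 < a")
    case True
    then show ?thesis using a by (simp add: B_right_def signed_map_def)
  next
    case False
    then have "a < 0" using a by (simp add: ob_def)
    moreover from this have "a - int m = - int (nat \<bar>a\<bar> + m)" by simp
    ultimately show ?thesis using a odd
      by (simp add: B_right_def signed_map_def Let_def sgn_minus)
  qed
qed (simp_all add: B_right_def signed_map_def)

lemma B_right_int:
  assumes w: "w \<in> B_sub m l" and i: "i \<in> {1..l}"
  shows "B_right m l w (int i) = (let b = w (int (i + m)) in b - sgn b * int m)"
  by (simp only: B_right_eq_signed[OF w] signed_map_int[OF i])

text \<open>Lowering the absolute value by m with the sign kept identifies the points beyond m with
  \<open>ob l\<close>; \<open>B_right\<close> uses this identification.\<close>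

lemma shift_abs:
  fixes b :: int
  assumes "b \<in> ob (m + l)" "b \<notin> ob m"
  shows "b - sgn b * int m \<in> ob l" "\<bar>b - sgn b * int m\<bar> = \<bar>b\<bar> - int m" "sgn (b - sgn b * int m) = sgn b"
  using assms by (cases "0 < b"; auto simp: ob_def)+

lemma B_right_FI:
  assumes w: "w \<in> B_sub m l"
  shows "B_right m l w \<in> FI_hom FI_BC l l"
  unfolding B_right_eq_signed[OF w] Let_def
proof (rule signed_map_FI)
  note sh = shift_abs[OF B_sub_right[OF w]]
  show "w (int (i + m)) - sgn (w (int (i + m))) * int m \<in> ob l" if "i \<in> {1..l}" for i
    by (rule sh(1)[OF that that])
  show "inj_on (\<lambda>i. \<bar>w (int (i + m)) - sgn (w (int (i + m))) * int m\<bar>) {1..l}"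
  proof (rule inj_onI)
    fix i j assume ij: "i \<in> {1..l}" "j \<in> {1..l}"
      "\<bar>w (int (i + m)) - sgn (w (int (i + m))) * int m\<bar> = \<bar>w (int (j + m)) - sgn (w (int (j + m))) * int m\<bar>"
    then have "idx w (i + m) = idx w (j + m)" using sh(2)[OF ij(1,1)] sh(2)[OF ij(2,2)] by (simp add: idx_def)
    then have "i + m = j + m" by (rule inj_onD[OF idx_inj[OF B_sub_FI[OF w]]]) (use ij in auto)
    then show "i = j" by simp
  qed
qed

lemma B_sub_compose:
  assumes g: "g \<in> FI_hom FI_BC (m + l) (m + l)" and h: "h \<in> B_sub m l"
  shows "compose (ob (m + l)) g h \<in> B_sub m l \<longleftrightarrow> g \<in> B_sub m l"
proof -
  have "compose (ob (m + l)) g h ` ob m = g ` (h ` ob m)"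
    using ob_mono[of _ m l] by (auto simp: compose_def image_iff)
  then have "compose (ob (m + l)) g h ` ob m = g ` ob m" using h by (simp add: B_sub_def)
  then show ?thesis using g compose_FI[OF B_sub_FI[OF h] g] by (simp add: B_sub_def)
qed

lemma B_left_compose:
  assumes g: "g \<in> B_sub m l" and h: "h \<in> B_sub m l"
  shows "B_left m (compose (ob (m + l)) g h) = compose (ob m) (B_left m g) (B_left m h)"
proof -
  have "h a \<in> ob m" if "a \<in> ob m" for a using h that by (auto simp: B_sub_def)
  then show ?thesis using ob_mono[of _ m l] by (intro ext) (simp add: B_left_def compose_def)
qed

lemma B_right_compose:
  assumes g: "g \<in> B_sub m l" and h: "h \<in> B_sub m l"
  shows "B_right m l (compose (ob (m + l)) g h) = compose (ob l) (B_right m l g) (B_right m l h)"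
proof -
  have gh: "compose (ob (m + l)) g h \<in> B_sub m l" using B_sub_compose[OF B_sub_FI[OF g] h] g by simp
  note FI = B_right_FI[OF g] B_right_FI[OF h] B_right_FI[OF gh]
  show ?thesis
  proof (rule FI_int_ext[OF FI(3) compose_FI[OF FI(2,1)]])
    fix i assume i: "i \<in> {1..l}"
    define b where "b = h (int (i + m))"
    have b: "b \<in> ob (m + l)" "b \<notin> ob m" using B_sub_right[OF h i] by (simp_all add: b_def)
    define c where "c = b - sgn b * int m"
    note sh = shift_abs[OF b, folded c_def]
    have bi: "int (i + m) \<in> ob (m + l)" using i by (auto simp: ob_def)
    have c: "B_right m l h (int i) = c" using B_right_int[OF h i] by (simp add: b_def c_def Let_def)
    have "b = c + sgn c * int m" using sh(3) by (simp add: c_def)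
    then have "B_right m l g c = (let d = g b in d - sgn d * int m)"
      using sh(1) by (simp add: B_right_def)
    then show "B_right m l (compose (ob (m + l)) g h) (int i) = compose (ob l) (B_right m l g) (B_right m l h) (int i)"
      using B_right_int[OF gh i] i bi c by (simp add: compose_def b_def)
  qed
qed

lemma B_left_id: "B_left m (\<lambda>a\<in>ob (m + l). a) = (\<lambda>a\<in>ob m. a)"
  by (intro ext) (use ob_mono[of _ m l] in \<open>auto simp: B_left_def\<close>)

lemma id_B_sub: "(\<lambda>a\<in>ob (m + l). a) \<in> B_sub m l"
  unfolding B_sub_def using id_FI[of "m + l" FI_BC] by (auto simp: ob_mono[of _ m l] image_iff)

lemma B_right_id: "B_right m l (\<lambda>a\<in>ob (m + l). a) = (\<lambda>a\<in>ob l. a)"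
proof (rule FI_int_ext[OF B_right_FI[OF id_B_sub] id_FI])
  fix i assume i: "i \<in> {1..l}"
  then have "int i + int m \<in> ob (m + l)" by (auto simp: ob_def)
  then show "B_right m l (\<lambda>a\<in>ob (m + l). a) (int i) = (\<lambda>a\<in>ob l. a) (int i)"
    using i by (simp add: B_right_int[OF id_B_sub i] Let_def)
qed

section \<open>A vector in the irreducible representations of type B\<close>

lemma gen_closed: "x \<in> Z \<Longrightarrow> Poly_Mapping.single x c \<in> carrier (free_module Z)"
  by (rule pm_module.single_closed[OF free_module_pm])

lemmas free_diff = pm_module.diff_closed[OF free_module_pm]

lemma tensor_relsI:
  "x \<in> carrier M \<Longrightarrow> x' \<in> carrier M \<Longrightarrow> y \<in> carrier N \<Longrightarrow>
    gen (x \<oplus>\<^bsub>M\<^esub> x', y) - gen (x, y) - gen (x', y) \<in> tensor_rels M N"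
  "x \<in> carrier M \<Longrightarrow> y \<in> carrier N \<Longrightarrow> y' \<in> carrier N \<Longrightarrow>
    gen (x, y \<oplus>\<^bsub>N\<^esub> y') - gen (x, y) - gen (x, y') \<in> tensor_rels M N"
  "x \<in> carrier M \<Longrightarrow> y \<in> carrier N \<Longrightarrow>
    gen (c \<odot>\<^bsub>M\<^esub> x, y) - Poly_Mapping.single (x, y) c \<in> tensor_rels M N"
  "x \<in> carrier M \<Longrightarrow> y \<in> carrier N \<Longrightarrow>
    gen (x, c \<odot>\<^bsub>N\<^esub> y) - Poly_Mapping.single (x, y) c \<in> tensor_rels M N"
  unfolding tensor_rels_def by blast+

lemma tensor_relsE:
  assumes "u \<in> tensor_rels M N"
    "\<And>x x' y. \<lbrakk>x \<in> carrier M; x' \<in> carrier M; y \<in> carrier N;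
      u = gen (x \<oplus>\<^bsub>M\<^esub> x', y) - gen (x, y) - gen (x', y)\<rbrakk> \<Longrightarrow> P"
    "\<And>x y y'. \<lbrakk>x \<in> carrier M; y \<in> carrier N; y' \<in> carrier N;
      u = gen (x, y \<oplus>\<^bsub>N\<^esub> y') - gen (x, y) - gen (x, y')\<rbrakk> \<Longrightarrow> P"
    "\<And>c x y. \<lbrakk>x \<in> carrier M; y \<in> carrier N;
      u = gen (c \<odot>\<^bsub>M\<^esub> x, y) - Poly_Mapping.single (x, y) c\<rbrakk> \<Longrightarrow> P"
    "\<And>c x y. \<lbrakk>x \<in> carrier M; y \<in> carrier N;
      u = gen (x, c \<odot>\<^bsub>N\<^esub> y) - Poly_Mapping.single (x, y) c\<rbrakk> \<Longrightarrow> P"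
  shows P
  using assms unfolding tensor_rels_def by blast

lemma tensor_presentation:
  assumes "Module.module scalars M" "Module.module scalars N"
  shows "presentation (carrier M \<times> carrier N) (tensor_rels M N)"
proof
  interpret M: Module.module scalars M by fact
  interpret N: Module.module scalars N by fact
  have cl: "x \<in> carrier M \<Longrightarrow> c \<odot>\<^bsub>M\<^esub> x \<in> carrier M" "y \<in> carrier N \<Longrightarrow> c \<odot>\<^bsub>N\<^esub> y \<in> carrier N" for c x y
    using M.smult_closed[of c x] N.smult_closed[of c y] by auto
  show "tensor_rels M N \<subseteq> carrier (free_module (carrier M \<times> carrier N))"
    unfolding tensor_rels_def by (auto intro!: free_diff gen_closed cl)
qed

lemma S_irr_module: "Module.module scalars (S_irr \<mu> :: ('k::field, 'k grp_alg) module)"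
proof -
  have "S_irr \<mu> = (free_module (sym_grp (sum_list \<mu>)))\<lparr>carrier := irr_span \<mu> :: 'k grp_alg set\<rparr>"
    by (simp add: S_irr_def irr_span_def Let_def)
  moreover have "submodule (irr_span \<mu> :: 'k grp_alg set) scalars (free_module (sym_grp (sum_list \<mu>)))"
    by (simp add: pm_module.submodule_iff[OF free_module_pm] irr.pm_quotient_axioms)
  ultimately show ?thesis
    using submodule.submodule_is_module pm_module.is_module[OF free_module_pm] by metis
qed

lemma plus_act_linear:
  "plus_act \<mu> w (x + y) = plus_act \<mu> w x + plus_act \<mu> w y" "plus_act \<mu> w (scale c x) = scale c (plus_act \<mu> w x)"
  by (simp_all add: plus_act_def sym_act_add sym_act_scale)

lemma minus_act_eq: "minus_act \<nu> w x = scale (of_int (eps (sum_list \<nu>) w)) (sym_act (to_perm (sum_list \<nu>) w) x)"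
  by (simp add: minus_act_def)

lemma minus_act_linear:
  "minus_act \<mu> w (x + y) = minus_act \<mu> w x + minus_act \<mu> w y"
  "minus_act \<mu> w (scale c x) = scale c (minus_act \<mu> w x)"
  by (simp_all add: minus_act_eq sym_act_add sym_act_scale scale_add scale_scale mult.commute)

lemma plus_act_closed: "w \<in> FI_hom FI_BC (sum_list \<mu>) (sum_list \<mu>) \<Longrightarrow> x \<in> irr_span \<mu> \<Longrightarrow> plus_act \<mu> w x \<in> irr_span \<mu>"
  by (simp add: plus_act_def irr_span_act to_perm_sym_grp)

lemma minus_act_closed: "w \<in> FI_hom FI_BC (sum_list \<mu>) (sum_list \<mu>) \<Longrightarrow> x \<in> irr_span \<mu> \<Longrightarrow> minus_act \<mu> w x \<in> irr_span \<mu>"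
  by (simp add: minus_act_eq irr_span_act to_perm_sym_grp irr.sub_scale)

lemma plus_act_compose:
  assumes "f \<in> FI_hom FI_BC (sum_list \<mu>) (sum_list \<mu>)" "g \<in> FI_hom FI_BC (sum_list \<mu>) (sum_list \<mu>)"
  shows "plus_act \<mu> (compose (ob (sum_list \<mu>)) g f) x = plus_act \<mu> g (plus_act \<mu> f x)"
  by (simp add: plus_act_def to_perm_compose[OF assms] sym_act_comp)

lemma minus_act_compose:
  assumes "f \<in> FI_hom FI_BC (sum_list \<mu>) (sum_list \<mu>)" "g \<in> FI_hom FI_BC (sum_list \<mu>) (sum_list \<mu>)"
  shows "minus_act \<mu> (compose (ob (sum_list \<mu>)) g f) x = minus_act \<mu> g (minus_act \<mu> f x)"
  by (simp add: minus_act_eq to_perm_compose[OF assms] eps_compose[OF assms] sym_act_comp sym_act_scale scale_scale)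

lemma free_map_gen_diff:
  "free_map h (gen x - gen y - gen z) = gen (h x) - gen (h y) - gen (h z)"
  "free_map h (gen x - Poly_Mapping.single y c) = gen (h x) - Poly_Mapping.single (h y) c"
  by (simp_all add: free_map_diff)

context
  fixes \<mu> \<nu> :: "nat list"
begin

abbreviation (input) "bm \<equiv> sum_list \<mu>"
abbreviation (input) "bl \<equiv> sum_list \<nu>"
abbreviation (input) "bn \<equiv> sum_list \<mu> + sum_list \<nu>"

interpretation box: presentation "irr_span \<mu> \<times> irr_span \<nu>" "tensor_rels (S_irr \<mu>) (S_irr \<nu>)"
  using tensor_presentation[OF S_irr_module[of \<mu>] S_irr_module[of \<nu>]] by simp

lemma box_mod_eq: "box_mod \<mu> \<nu> = quot_mod (free_module (irr_span \<mu> \<times> irr_span \<nu>))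
    (lin_span (free_module (irr_span \<mu> \<times> irr_span \<nu>)) (tensor_rels (S_irr \<mu>) (S_irr \<nu>)))"
  by (simp add: box_mod_def tensor_def box.presented_eq)

abbreviation (input) "box_pair h \<equiv> map_prod (plus_act \<mu> (B_left bm h)) (minus_act \<nu> (B_right bm bl h))"

lemma box_act_cls:
  assumes h: "h \<in> B_sub bm bl"
  shows "box_act \<mu> \<nu> h (box.cls p) = box.cls (free_map (box_pair h) p)"
  unfolding box_act_def S_irr_simps(1)
proof (rule box.presented_map_cls[OF box.presentation_axioms])
  note FI = B_left_FI[OF h] B_right_FI[OF h]
  show "box_pair h x \<in> irr_span \<mu> \<times> irr_span \<nu>" if "x \<in> irr_span \<mu> \<times> irr_span \<nu>" for x
    using that by (auto intro!: plus_act_closed minus_act_closed FI)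
  fix u assume "u \<in> tensor_rels (S_irr \<mu>) (S_irr \<nu>)"
  then have "free_map (box_pair h) u \<in> tensor_rels (S_irr \<mu>) (S_irr \<nu>)"
    by (rule tensor_relsE)
      (simp_all only: S_irr_simps free_map_gen_diff map_prod_simp plus_act_linear minus_act_linear,
        (rule tensor_relsI[where M = "S_irr \<mu>" and N = "S_irr \<nu>", unfolded S_irr_simps];
          intro plus_act_closed minus_act_closed FI; assumption)+)
  then show "free_map (box_pair h) u \<in> lin_span (free_module (irr_span \<mu> \<times> irr_span \<nu>)) (tensor_rels (S_irr \<mu>) (S_irr \<nu>))"
    by (rule box.rel_in_span)
qed

end

lemma free_map_closed:
  assumes "\<And>x. x \<in> Z \<Longrightarrow> h x \<in> Y" "p \<in> carrier (free_module Z)"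
  shows "free_map h p \<in> carrier (free_module Y)"
  using assms free_map_keys[of h p] by (fastforce simp: free_module_def)

lemma sym_act_id [simp]: "sym_act id x = x"
proof -
  have eq: "(\<circ>) id = (\<lambda>x :: nat \<Rightarrow> nat. x)" by auto
  show ?thesis unfolding sym_act_def eq by (rule free_map_id)
qed

lemma lin_relsI:
  "t \<in> T \<Longrightarrow> v \<in> carrier (M t) \<Longrightarrow> v' \<in> carrier (M t) \<Longrightarrow>
    gen (t, v \<oplus>\<^bsub>M t\<^esub> v') - gen (t, v) - gen (t, v') \<in> lin_rels T M"
  "t \<in> T \<Longrightarrow> v \<in> carrier (M t) \<Longrightarrow>
    gen (t, c \<odot>\<^bsub>M t\<^esub> v) - Poly_Mapping.single (t, v) c \<in> lin_rels T M"
  unfolding lin_rels_def by blast+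

lemma lin_relsE:
  assumes "u \<in> lin_rels T M"
    "\<And>t v v'. \<lbrakk>t \<in> T; v \<in> carrier (M t); v' \<in> carrier (M t);
      u = gen (t, v \<oplus>\<^bsub>M t\<^esub> v') - gen (t, v) - gen (t, v')\<rbrakk> \<Longrightarrow> P"
    "\<And>c t v. \<lbrakk>t \<in> T; v \<in> carrier (M t);
      u = gen (t, c \<odot>\<^bsub>M t\<^esub> v) - Poly_Mapping.single (t, v) c\<rbrakk> \<Longrightarrow> P"
  shows P
  using assms unfolding lin_rels_def by blast

lemma ind_relsE:
  assumes "u \<in> ind_rels n H V \<rho>" "u \<in> lin_rels (FI_hom FI_BC n n) (\<lambda>_. V) \<Longrightarrow> P"
    "\<And>g h v. \<lbrakk>g \<in> FI_hom FI_BC n n; h \<in> H; v \<in> carrier V;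
      u = gen (compose (ob n) g h, v) - gen (g, \<rho> h v)\<rbrakk> \<Longrightarrow> P"
  shows P
  using assms unfolding ind_rels_def by blast

lemma module_closed:
  assumes "Module.module scalars M"
  shows "x \<in> carrier M \<Longrightarrow> y \<in> carrier M \<Longrightarrow> x \<oplus>\<^bsub>M\<^esub> y \<in> carrier M"
    "x \<in> carrier M \<Longrightarrow> c \<odot>\<^bsub>M\<^esub> x \<in> carrier M" "\<zero>\<^bsub>M\<^esub> \<in> carrier M"
proof -
  interpret Module.module scalars M by fact
  show "x \<in> carrier M \<Longrightarrow> y \<in> carrier M \<Longrightarrow> x \<oplus>\<^bsub>M\<^esub> y \<in> carrier M" by simp
  show "x \<in> carrier M \<Longrightarrow> c \<odot>\<^bsub>M\<^esub> x \<in> carrier M" using smult_closed[of c x] by simp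
  show "\<zero>\<^bsub>M\<^esub> \<in> carrier M" by simp
qed

lemma module_zero_smult:
  assumes "Module.module scalars M" "x \<in> carrier M"
  shows "0 \<odot>\<^bsub>M\<^esub> x = \<zero>\<^bsub>M\<^esub>"
proof -
  interpret Module.module scalars M by fact
  show ?thesis using smult_l_null[OF assms(2)] by simp
qed

lemma ind_presentation:
  assumes V: "Module.module scalars V" and H: "H \<subseteq> FI_hom FI_BC n n"
    and \<rho>: "\<And>h v. h \<in> H \<Longrightarrow> v \<in> carrier V \<Longrightarrow> \<rho> h v \<in> carrier V"
  shows "presentation (ind_gens n V) (ind_rels n H V \<rho>)"
proof
  show "ind_rels n H V \<rho> \<subseteq> carrier (free_module (ind_gens n V))"
  proof
    fix u assume "u \<in> ind_rels n H V \<rho>"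
    then show "u \<in> carrier (free_module (ind_gens n V))"
    proof (rule ind_relsE)
      assume "u \<in> lin_rels (FI_hom FI_BC n n) (\<lambda>_. V)"
      then show ?thesis
        by (rule lin_relsE) (auto simp: ind_gens_def intro!: free_diff gen_closed module_closed[OF V])
    next
      fix g h v assume "g \<in> FI_hom FI_BC n n" "h \<in> H" "v \<in> carrier V"
        "u = gen (compose (ob n) g h, v) - gen (g, \<rho> h v)"
      then show ?thesis using H
        by (auto simp: ind_gens_def intro!: free_diff gen_closed \<rho> compose_FI)
    qed
  qed
qed

context presentation
begin

lemma cls_eq_rel: "u - v \<in> R \<Longrightarrow> cls u = cls v"
  using rel_in_span by (simp add: cls_eq_iff)

end

context
  fixes \<mu> \<nu> :: "nat list"
begin

interpretation box: presentation "irr_span \<mu> \<times> irr_span \<nu>" "tensor_rels (S_irr \<mu>) (S_irr \<nu>)"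
  using tensor_presentation[OF S_irr_module[of \<mu>] S_irr_module[of \<nu>]] by simp

lemma box_module: "Module.module scalars (box_mod \<mu> \<nu>)"
  unfolding box_mod_eq by (rule box.quot_is_module)

lemma box_carrier: "carrier (box_mod \<mu> \<nu>) = box.cls ` carrier (free_module (irr_span \<mu> \<times> irr_span \<nu>))"
  unfolding box_mod_eq by (rule box.quot_carrier)

abbreviation (input) "bH \<equiv> B_sub (sum_list \<mu>) (sum_list \<nu>)"
abbreviation (input) "nn \<equiv> sum_list \<mu> + sum_list \<nu>"

lemma box_pair_closed:
  assumes h: "h \<in> bH" and p: "p \<in> carrier (free_module (irr_span \<mu> \<times> irr_span \<nu>))"
  shows "free_map (map_prod (plus_act \<mu> (B_left (sum_list \<mu>) h)) (minus_act \<nu> (B_right (sum_list \<mu>) (sum_list \<nu>) h))) p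
    \<in> carrier (free_module (irr_span \<mu> \<times> irr_span \<nu>))"
  using p by (rule free_map_closed[rotated])
    (auto intro!: plus_act_closed minus_act_closed B_left_FI[OF h] B_right_FI[OF h])

lemma box_act_closed:
  assumes "h \<in> bH" "x \<in> carrier (box_mod \<mu> \<nu>)"
  shows "box_act \<mu> \<nu> h x \<in> carrier (box_mod \<mu> \<nu>)"
  using assms(2)
  by (auto simp: box_carrier box_act_cls[OF assms(1)] intro!: imageI box_pair_closed[OF assms(1)])

interpretation ind: presentation "ind_gens nn (box_mod \<mu> \<nu>)" "ind_rels nn bH (box_mod \<mu> \<nu>) (box_act \<mu> \<nu>)"
  by (rule ind_presentation[OF box_module])
    (use box_act_closed B_sub_FI in auto)

lemma B_irr_eq: "B_irr \<mu> \<nu> = quot_mod (free_module (ind_gens nn (box_mod \<mu> \<nu>)))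
    (lin_span (free_module (ind_gens nn (box_mod \<mu> \<nu>))) (ind_rels nn bH (box_mod \<mu> \<nu>) (box_act \<mu> \<nu>)))"
  by (simp add: B_irr_def Let_def ind.presented_eq)

lemma B_irr_module: "Module.module scalars (B_irr \<mu> \<nu>)"
  unfolding B_irr_eq by (rule ind.quot_is_module)

lemma B_act_cls:
  assumes w: "w \<in> FI_hom FI_BC nn nn"
  shows "B_act \<mu> \<nu> w (ind.cls p) = ind.cls (free_map (\<lambda>(g, v). (compose (ob nn) w g, v)) p)"
  unfolding B_act_def Let_def
proof (rule ind.presented_map_cls[OF ind.presentation_axioms])
  let ?k = "\<lambda>(g, v). (compose (ob nn) w g, v)"
  show "?k x \<in> ind_gens nn (box_mod \<mu> \<nu>)" if "x \<in> ind_gens nn (box_mod \<mu> \<nu>)" for x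
    using that w by (auto simp: ind_gens_def intro: compose_FI)
  fix u assume "u \<in> ind_rels nn bH (box_mod \<mu> \<nu>) (box_act \<mu> \<nu>)"
  then have "free_map ?k u \<in> ind_rels nn bH (box_mod \<mu> \<nu>) (box_act \<mu> \<nu>)"
  proof (rule ind_relsE)
    assume "u \<in> lin_rels (FI_hom FI_BC nn nn) (\<lambda>_. box_mod \<mu> \<nu>)"
    then have "free_map ?k u \<in> lin_rels (FI_hom FI_BC nn nn) (\<lambda>_. box_mod \<mu> \<nu>)"
      by (rule lin_relsE)
        (auto simp: free_map_gen_diff intro!: lin_relsI[where M = "\<lambda>_. box_mod \<mu> \<nu>"] compose_FI w)
    then show ?thesis by (simp add: ind_rels_def)
  next
    fix g h v assume g: "g \<in> FI_hom FI_BC nn nn" "h \<in> bH" "v \<in> carrier (box_mod \<mu> \<nu>)"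
      and u: "u = gen (compose (ob nn) g h, v) - gen (g, box_act \<mu> \<nu> h v)"
    have "compose (ob nn) w (compose (ob nn) g h) = compose (ob nn) (compose (ob nn) w g) h"
      using FI_ob[OF B_sub_FI[OF g(2)]] by (auto simp: compose_def)
    then have "free_map ?k u = gen (compose (ob nn) (compose (ob nn) w g) h, v) - gen (compose (ob nn) w g, box_act \<mu> \<nu> h v)"
      by (simp add: u free_map_diff)
    then show ?thesis using g compose_FI[OF g(1) w] unfolding ind_rels_def by blast
  qed
  then show "free_map ?k u \<in> lin_span (free_module (ind_gens nn (box_mod \<mu> \<nu>)))
      (ind_rels nn bH (box_mod \<mu> \<nu>) (box_act \<mu> \<nu>))"
    by (rule ind.rel_in_span)
qed

text \<open>The functional which detects the vector below: on \<open>g \<otimes> (x \<otimes> y)\<close> with \<open>g\<close> in the subgroup it is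
  the product of the coefficients at the identity of \<open>g x\<close> and \<open>g y\<close>.\<close>

definition coeff_pair :: "(int \<Rightarrow> int) \<Rightarrow> 'k grp_alg \<times> 'k grp_alg \<Rightarrow> 'k::field"
  where "coeff_pair g = (\<lambda>(x, y).
    Poly_Mapping.lookup (plus_act \<mu> (B_left (sum_list \<mu>) g) x) id *
    Poly_Mapping.lookup (minus_act \<nu> (B_right (sum_list \<mu>) (sum_list \<nu>) g) y) id)"

lemma coeff_pair_rels: "u \<in> tensor_rels (S_irr \<mu>) (S_irr \<nu>) \<Longrightarrow> lin_ext (coeff_pair g) u = 0"
  by (erule tensor_relsE; simp only: lin_ext_diff lin_ext_single)
    (simp_all add: coeff_pair_def plus_act_linear minus_act_linear lookup_add distrib_left distrib_right)

definition coeff_ind :: "(int \<Rightarrow> int) \<times> 'k tens \<Rightarrow> 'k::field"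
  where "coeff_ind = (\<lambda>(g, z). if g \<in> bH then lin_ext (coeff_pair g) (SOME u. u \<in> z) else 0)"

lemma coeff_ind_cls: "coeff_ind (g, box.cls p) = (if g \<in> bH then lin_ext (coeff_pair g) p else 0)"
  by (simp add: coeff_ind_def box.lin_ext_some coeff_pair_rels)

lemma box_add: "box.cls p \<oplus>\<^bsub>box_mod \<mu> \<nu>\<^esub> box.cls q = box.cls (p + q)"
  unfolding box_mod_eq by (rule box.quot_add)

lemma box_smult: "c \<odot>\<^bsub>box_mod \<mu> \<nu>\<^esub> box.cls p = box.cls (scale c p)"
  unfolding box_mod_eq by (rule box.quot_smult)

lemma coeff_pair_compose:
  assumes g: "g \<in> bH" and h: "h \<in> bH"
  shows "coeff_pair (compose (ob nn) g h) x = coeff_pair g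
    (map_prod (plus_act \<mu> (B_left (sum_list \<mu>) h)) (minus_act \<nu> (B_right (sum_list \<mu>) (sum_list \<nu>) h)) x)"
  by (cases x) (simp add: coeff_pair_def B_left_compose[OF g h] B_right_compose[OF g h]
      plus_act_compose[OF B_left_FI[OF h] B_left_FI[OF g]] minus_act_compose[OF B_right_FI[OF h] B_right_FI[OF g]])

lemma lin_ext_free_map: "lin_ext F (free_map k p) = lin_ext (\<lambda>x. F (k x)) p"
  by (induction p rule: poly_mapping_add_induct[OF subset_UNIV]) (auto simp: free_map_add lin_ext_add)

text \<open>Whether g lies in the subgroup H depends only on the coset g H, and inside H the
  functional is compatible with moving h across the tensor sign, by
  \<open>coeff_pair_compose\<close>.\<close>

lemma coeff_ind_rels:
  assumes "u \<in> ind_rels nn bH (box_mod \<mu> \<nu>) (box_act \<mu> \<nu>)"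
  shows "lin_ext coeff_ind u = 0"
  using assms
proof (rule ind_relsE)
  assume "u \<in> lin_rels (FI_hom FI_BC nn nn) (\<lambda>_. box_mod \<mu> \<nu>)"
  then show ?thesis
    by (rule lin_relsE)
      (auto simp: box_carrier box_add box_smult lin_ext_diff coeff_ind_cls lin_ext_add lin_ext_scale)
next
  fix g h v assume g: "g \<in> FI_hom FI_BC nn nn" "h \<in> bH" "v \<in> carrier (box_mod \<mu> \<nu>)"
    and u: "u = gen (compose (ob nn) g h, v) - gen (g, box_act \<mu> \<nu> h v)"
  obtain p where p: "v = box.cls p" using g(3) by (auto simp: box_carrier)
  show ?thesis
    using B_sub_compose[OF g(1,2)]
    by (auto simp: u lin_ext_diff p coeff_ind_cls box_act_cls[OF g(2)] lin_ext_free_map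
        coeff_pair_compose[OF _ g(2)] intro!: lin_ext_cong)
qed

text \<open>The vector is 1 \<otimes> (v \<otimes> w), where v and w are the antisymmetric vectors
  of the two diagrams. An element of the subgroup for which both are eigenvectors acts on it by the
  product of the eigenvalues.\<close>

lemma B_vector:
  assumes char: "CHAR('k::field) = 0"
  obtains \<xi> where "\<xi> \<in> carrier (B_irr \<mu> \<nu> :: ('k, 'k birr) module)" "\<xi> \<noteq> \<zero>\<^bsub>B_irr \<mu> \<nu>\<^esub>"
    "\<And>h c d. \<lbrakk>h \<in> bH; plus_act \<mu> (B_left (sum_list \<mu>) h) (anti_vec \<mu>) = scale c (anti_vec \<mu> :: 'k grp_alg);
      minus_act \<nu> (B_right (sum_list \<mu>) (sum_list \<nu>) h) (anti_vec \<nu>) = scale d (anti_vec \<nu> :: 'k grp_alg)\<rbrakk>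
      \<Longrightarrow> B_act \<mu> \<nu> h \<xi> = (c * d) \<odot>\<^bsub>B_irr \<mu> \<nu>\<^esub> \<xi>"
proof -
  let ?v = "anti_vec \<mu> :: 'k grp_alg" and ?w = "anti_vec \<nu> :: 'k grp_alg"
  define z where "z = box.cls (gen (?v, ?w))"
  have gz: "gen (x, y) \<in> carrier (free_module (irr_span \<mu> \<times> irr_span \<nu>))"
    if "x \<in> irr_span \<mu>" "y \<in> irr_span \<nu>" for x y :: "'k grp_alg"
    using that by (intro gen_closed) auto
  have z: "z \<in> carrier (box_mod \<mu> \<nu>)"
    unfolding z_def box_carrier by (intro imageI gz anti_vec_mem)
  let ?e = "\<lambda>a\<in>ob nn. a"
  have e: "?e \<in> FI_hom FI_BC nn nn" "?e \<in> bH" by (rule id_FI) (rule id_B_sub)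
  define \<xi> where "\<xi> = ind.cls (gen (?e, z))"
  show ?thesis
  proof (rule that[of \<xi>])
    show "\<xi> \<in> carrier (B_irr \<mu> \<nu>)"
      unfolding \<xi>_def B_irr_eq using e(1) z by (intro ind.cls_closed gen_closed) (simp add: ind_gens_def)
    have "coeff_ind (?e, z) = Poly_Mapping.lookup ?v id * Poly_Mapping.lookup ?w id"
      using e(2) by (simp add: z_def coeff_ind_cls coeff_pair_def B_left_id B_right_id plus_act_def minus_act_eq scale_1)
    then have "coeff_ind (?e, z) \<noteq> 0"
      using anti_vec_nonzero[OF char, of \<mu>] anti_vec_nonzero[OF char, of \<nu>] by simp
    from ind.cls_gen_nonzero[OF coeff_ind_rels this]
    show "\<xi> \<noteq> \<zero>\<^bsub>B_irr \<mu> \<nu>\<^esub>" by (simp add: \<xi>_def B_irr_eq ind.presented_eq)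
    fix h c d
    assume h: "h \<in> bH" and c: "plus_act \<mu> (B_left (sum_list \<mu>) h) ?v = scale c ?v"
      and d: "minus_act \<nu> (B_right (sum_list \<mu>) (sum_list \<nu>) h) ?w = scale d ?w"
    have "B_act \<mu> \<nu> h \<xi> = ind.cls (gen (compose (ob nn) h ?e, z))"
      by (simp add: \<xi>_def B_act_cls[OF B_sub_FI[OF h]])
    also have "compose (ob nn) h ?e = compose (ob nn) ?e h"
      using FI_ob[OF B_sub_FI[OF h]] by (auto simp: compose_def)
    also have "ind.cls (gen (compose (ob nn) ?e h, z)) = ind.cls (gen (?e, box_act \<mu> \<nu> h z))"
      by (rule ind.cls_eq_rel) (use e h z in \<open>auto simp: ind_rels_def\<close>)
    also have "box_act \<mu> \<nu> h z = box.cls (gen (scale c ?v, scale d ?w))"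
      by (simp add: z_def box_act_cls[OF h] c d)
    also have "\<dots> = box.cls (Poly_Mapping.single (?v, scale d ?w) c)"
      using tensor_relsI(3)[of ?v "S_irr \<mu>" "scale d ?w" "S_irr \<nu>" c]
      by (intro box.cls_eq_rel) (simp add: anti_vec_mem irr.sub_scale)
    also have "\<dots> = c \<odot>\<^bsub>box_mod \<mu> \<nu>\<^esub> box.cls (gen (?v, scale d ?w))"
      by (simp add: box_smult scale_single)
    also have "box.cls (gen (?v, scale d ?w)) = box.cls (Poly_Mapping.single (?v, ?w) d)"
      using tensor_relsI(4)[of ?v "S_irr \<mu>" ?w "S_irr \<nu>" d]
      by (intro box.cls_eq_rel) (simp add: anti_vec_mem irr.sub_scale)
    also have "c \<odot>\<^bsub>box_mod \<mu> \<nu>\<^esub> \<dots> = (c * d) \<odot>\<^bsub>box_mod \<mu> \<nu>\<^esub> z"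
      by (simp add: z_def box_smult scale_single)
    also have "ind.cls (gen (?e, (c * d) \<odot>\<^bsub>box_mod \<mu> \<nu>\<^esub> z)) = ind.cls (Poly_Mapping.single (?e, z) (c * d))"
      using lin_relsI(2)[of ?e "FI_hom FI_BC nn nn" z "\<lambda>_. box_mod \<mu> \<nu>" "c * d"] e z
      by (intro ind.cls_eq_rel) (simp add: ind_rels_def)
    also have "\<dots> = (c * d) \<odot>\<^bsub>B_irr \<mu> \<nu>\<^esub> \<xi>"
      by (simp add: \<xi>_def B_irr_eq ind.quot_smult scale_single)
    finally show "B_act \<mu> \<nu> h \<xi> = (c * d) \<odot>\<^bsub>B_irr \<mu> \<nu>\<^esub> \<xi>" .
  qed
qed

end

lemma B_subI:
  assumes h: "h \<in> FI_hom FI_BC (m + l) (m + l)" and "\<And>k. k \<in> {1..m} \<Longrightarrow> idx h k \<in> {1..m}"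
  shows "h \<in> B_sub m l"
proof -
  have "h a \<in> ob m" if a: "a \<in> ob m" for a
  proof -
    have k: "nat \<bar>a\<bar> \<in> {1..m}" using a by (auto simp: ob_def)
    have "idx h (nat \<bar>a\<bar>) = nat \<bar>h a\<bar>"
      using FI_uminus[OF h ob_mono[OF a]] by (cases "0 < a") (auto simp: idx_def)
    then show ?thesis using assms(2)[OF k] by (auto simp: ob_def)
  qed
  moreover have "inj_on h (ob m)" using FI_inj[OF h] ob_mono by (meson inj_onI)
  moreover have "finite (ob m)" by (rule finite_subset[of _ "{- int m..int m}"]) (auto simp: ob_def)
  ultimately have "h ` ob m = ob m" by (intro endo_inj_surj) auto
  then show ?thesis using h by (simp add: B_sub_def)
qed

lemma B_projections:
  assumes h: "h \<in> B_sub m l"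
  shows "to_perm m (B_left m h) = (\<lambda>k. if k \<in> {1..m} then idx h k else k)"
    "to_perm l (B_right m l h) = (\<lambda>k. if k \<in> {1..l} then idx h (k + m) - m else k)"
    "eps l (B_right m l h) = (\<Prod>k\<in>{1..l}. if h (int (k + m)) < 0 then - 1 else 1)"
proof -
  show "to_perm m (B_left m h) = (\<lambda>k. if k \<in> {1..m} then idx h k else k)"
    by (auto simp: to_perm_eq idx_def B_left_def)
  note sh = shift_abs[OF B_sub_right[OF h]]
  have r: "B_right m l h (int k) = h (int (k + m)) - sgn (h (int (k + m))) * int m" if "k \<in> {1..l}" for k
    using B_right_int[OF h that] by (simp add: Let_def)
  have "idx (B_right m l h) k = idx h (k + m) - m" if "k \<in> {1..l}" for k
    unfolding idx_def r[OF that] sh(2)[OF that that] by simp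
  then show "to_perm l (B_right m l h) = (\<lambda>k. if k \<in> {1..l} then idx h (k + m) - m else k)"
    by (auto simp: to_perm_eq)
  have "sgn (B_right m l h (int k)) = sgn (h (int (k + m)))" if "k \<in> {1..l}" for k
    unfolding r[OF that] by (rule sh(3)[OF that that])
  then have "B_right m l h (int k) < 0 \<longleftrightarrow> h (int (k + m)) < 0" if "k \<in> {1..l}" for k
    using that by (metis sgn_less)
  then show "eps l (B_right m l h) = (\<Prod>k\<in>{1..l}. if h (int (k + m)) < 0 then - 1 else 1)"
    unfolding eps_eq_prod by (intro prod.cong) auto
qed

lemma lin_maps_nonzero:
  assumes "\<phi> \<in> lin_maps M N" "inj_on \<phi> (carrier M)" "Module.module scalars M" "Module.module scalars N"
    "x \<in> carrier M" "x \<noteq> \<zero>\<^bsub>M\<^esub>"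
  shows "\<phi> x \<noteq> \<zero>\<^bsub>N\<^esub>"
proof
  assume "\<phi> x = \<zero>\<^bsub>N\<^esub>"
  have \<phi>: "\<phi> x \<in> carrier N" "\<phi> (0 \<odot>\<^bsub>M\<^esub> x) = 0 \<odot>\<^bsub>N\<^esub> \<phi> x"
    using assms(1,5) by (auto simp: lin_maps_def)
  have "\<phi> \<zero>\<^bsub>M\<^esub> = \<phi> (0 \<odot>\<^bsub>M\<^esub> x)" using module_zero_smult[OF assms(3,5)] by simp
  also have "\<dots> = \<zero>\<^bsub>N\<^esub>" using \<phi>(2) module_zero_smult[OF assms(4) \<phi>(1)] by simp
  finally have "\<phi> \<zero>\<^bsub>M\<^esub> = \<phi> x" using \<open>\<phi> x = \<zero>\<^bsub>N\<^esub>\<close> by simp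
  then show False using inj_onD[OF assms(2) _ module_closed(3)[OF assms(3)] assms(5)] assms(6) by metis
qed

text \<open>What the weight estimates need of an irreducible constituent: flips determine parities,
  transpositions within columns of the diagrams restrict supports, and the symmetry in the lone
  cells of \<nu> serves type D. The cells of \<nu> are numbered after those of \<mu>, which will be
  a padded partition.\<close>

definition antisym_vector :: "nat list \<Rightarrow> nat list \<Rightarrow> ((int \<Rightarrow> int) \<Rightarrow> 'a \<Rightarrow> 'a) \<Rightarrow>
    ('k::field, 'a) module \<Rightarrow> 'a \<Rightarrow> bool"
  where "antisym_vector \<mu> \<nu> \<tau> N \<psi> \<longleftrightarrow> \<psi> \<in> carrier N \<and> \<psi> \<noteq> \<zero>\<^bsub>N\<^esub> \<and>
    (\<forall>i\<in>{1..sum_list \<mu> + sum_list \<nu>}. \<tau> (flip (sum_list \<mu> + sum_list \<nu>) i) \<psi>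
      = (if i \<le> sum_list \<mu> then 1 else - 1) \<odot>\<^bsub>N\<^esub> \<psi>) \<and>
    (\<forall>a\<in>{1..sum_list \<mu>}. \<forall>b\<in>{1..sum_list \<mu>}. a \<noteq> b \<longrightarrow> snd (cell \<mu> a) = snd (cell \<mu> b) \<longrightarrow>
      \<tau> (swap_map (sum_list \<mu> + sum_list \<nu>) a b) \<psi> = (- 1) \<odot>\<^bsub>N\<^esub> \<psi>) \<and>
    (\<forall>a\<in>{1..sum_list \<nu>}. \<forall>b\<in>{1..sum_list \<nu>}. a \<noteq> b \<longrightarrow> snd (cell \<nu> a) = snd (cell \<nu> b) \<longrightarrow>
      \<tau> (swap_map (sum_list \<mu> + sum_list \<nu>) (a + sum_list \<mu>) (b + sum_list \<mu>)) \<psi> = (- 1) \<odot>\<^bsub>N\<^esub> \<psi>) \<and>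
    (\<forall>a\<in>lone \<nu>. \<forall>b\<in>lone \<nu>.
      \<tau> (swap_map (sum_list \<mu> + sum_list \<nu>) (a + sum_list \<mu>) (b + sum_list \<mu>)) \<psi> = 1 \<odot>\<^bsub>N\<^esub> \<psi>)"

lemma antisym_vectorD:
  assumes "antisym_vector \<mu> \<nu> \<tau> N \<psi>" and m: "m = sum_list \<mu>" and l: "l = sum_list \<nu>"
  shows "\<psi> \<in> carrier N" "\<psi> \<noteq> \<zero>\<^bsub>N\<^esub>"
    "i \<in> {1..m + l} \<Longrightarrow> \<tau> (flip (m + l) i) \<psi> = (if i \<le> m then 1 else - 1) \<odot>\<^bsub>N\<^esub> \<psi>"
    "\<lbrakk>a \<in> {1..m}; b \<in> {1..m}; a \<noteq> b; snd (cell \<mu> a) = snd (cell \<mu> b)\<rbrakk> \<Longrightarrow>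
      \<tau> (swap_map (m + l) a b) \<psi> = (- 1) \<odot>\<^bsub>N\<^esub> \<psi>"
    "\<lbrakk>c \<in> {1..l}; e \<in> {1..l}; c \<noteq> e; snd (cell \<nu> c) = snd (cell \<nu> e)\<rbrakk> \<Longrightarrow>
      \<tau> (swap_map (m + l) (c + m) (e + m)) \<psi> = (- 1) \<odot>\<^bsub>N\<^esub> \<psi>"
    "\<lbrakk>c \<in> lone \<nu>; e \<in> lone \<nu>\<rbrakk> \<Longrightarrow> \<tau> (swap_map (m + l) (c + m) (e + m)) \<psi> = 1 \<odot>\<^bsub>N\<^esub> \<psi>"
  using assms(1) unfolding antisym_vector_def m l by blast+

lemma constituent_vector:
  fixes N :: "('k::field, 'a) module" and \<mu> \<nu> :: "nat list"
  defines "m \<equiv> sum_list \<mu>" and "l \<equiv> sum_list \<nu>"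
  assumes char: "CHAR('k) = 0" and N: "Module.module scalars N"
    and con: "constituent (FI_hom FI_BC (m + l) (m + l)) (B_irr \<mu> \<nu> :: ('k, 'k birr) module) (B_act \<mu> \<nu>) N \<tau>"
  obtains \<psi> where "antisym_vector \<mu> \<nu> \<tau> N \<psi>"
proof -
  obtain \<phi> where \<phi>: "\<phi> \<in> lin_maps (B_irr \<mu> \<nu>) N" "inj_on \<phi> (carrier (B_irr \<mu> \<nu> :: ('k, 'k birr) module))"
    "\<And>g x. g \<in> FI_hom FI_BC (m + l) (m + l) \<Longrightarrow> x \<in> carrier (B_irr \<mu> \<nu> :: ('k, 'k birr) module) \<Longrightarrow>
      \<phi> (B_act \<mu> \<nu> g x) = \<tau> g (\<phi> x)"
    using con unfolding constituent_def by blast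
  obtain \<xi> where \<xi>: "\<xi> \<in> carrier (B_irr \<mu> \<nu> :: ('k, 'k birr) module)" "\<xi> \<noteq> \<zero>\<^bsub>B_irr \<mu> \<nu>\<^esub>"
    "\<And>h c d. \<lbrakk>h \<in> B_sub m l; plus_act \<mu> (B_left m h) (anti_vec \<mu>) = scale c (anti_vec \<mu> :: 'k grp_alg);
      minus_act \<nu> (B_right m l h) (anti_vec \<nu>) = scale d (anti_vec \<nu> :: 'k grp_alg)\<rbrakk>
      \<Longrightarrow> B_act \<mu> \<nu> h \<xi> = (c * d) \<odot>\<^bsub>B_irr \<mu> \<nu>\<^esub> \<xi>"
    using B_vector[OF char, of \<mu> \<nu>] unfolding m_def l_def by blast
  have act: "\<tau> h (\<phi> \<xi>) = (c * d) \<odot>\<^bsub>N\<^esub> \<phi> \<xi>"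
    if h: "h \<in> B_sub m l" and "sym_act (to_perm m (B_left m h)) (anti_vec \<mu>) = scale c (anti_vec \<mu> :: 'k grp_alg)"
      "scale (of_int (eps l (B_right m l h))) (sym_act (to_perm l (B_right m l h)) (anti_vec \<nu>))
        = scale d (anti_vec \<nu> :: 'k grp_alg)" for h c d
  proof -
    have "B_act \<mu> \<nu> h \<xi> = (c * d) \<odot>\<^bsub>B_irr \<mu> \<nu>\<^esub> \<xi>"
      by (rule \<xi>(3)[OF h]) (use that in \<open>simp_all add: plus_act_def minus_act_eq m_def l_def\<close>)
    moreover have "\<phi> (e \<odot>\<^bsub>B_irr \<mu> \<nu>\<^esub> \<xi>) = e \<odot>\<^bsub>N\<^esub> \<phi> \<xi>" for e
      using \<phi>(1) \<xi>(1) by (auto simp: lin_maps_def)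
    ultimately show ?thesis using \<phi>(3)[OF B_sub_FI[OF h] \<xi>(1)] by metis
  qed
  show ?thesis
  proof (rule that[of "\<phi> \<xi>"], unfold antisym_vector_def, fold m_def l_def, intro conjI ballI impI)
    show "\<phi> \<xi> \<in> carrier N" using \<phi>(1) \<xi>(1) by (auto simp: lin_maps_def)
    show "\<phi> \<xi> \<noteq> \<zero>\<^bsub>N\<^esub>" by (rule lin_maps_nonzero[OF \<phi>(1,2) B_irr_module N \<xi>(1,2)])
  next
    fix i assume i: "i \<in> {1..m + l}"
    let ?h = "flip (m + l) i"
    have h: "?h \<in> B_sub m l" by (rule B_subI[OF flip_FI]) (simp add: idx_flip)
    \<comment> \<open>A flip is trivial in both symmetric groups and is seen only by the sign
      character on the second factor.\<close>
    have 1: "to_perm m (B_left m ?h) = id" "to_perm l (B_right m l ?h) = id"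
      unfolding B_projections[OF h] by (auto simp: idx_flip)
    have "eps l (B_right m l ?h) = (\<Prod>k\<in>{1..l}. if k + m = i then - 1 else 1)"
      unfolding B_projections(3)[OF h] by (intro prod.cong refl) (simp add: flip_int del: of_nat_add)
    also have "\<dots> = (if i \<le> m then 1 else - 1)"
    proof (cases "i \<le> m")
      case False
      then have "(\<Prod>k\<in>{1..l}. if k + m = i then - 1 else 1 :: int) = (\<Prod>k\<in>{1..l}. if k = i - m then - 1 else 1)"
        by (intro prod.cong refl) auto
      moreover have "i - m \<in> {1..l}" using False i by auto
      ultimately show ?thesis using False by (simp only: prod.delta[OF finite_atLeastAtMost] if_True if_False)
    qed (auto intro!: prod.neutral)
    finally have "\<tau> ?h (\<phi> \<xi>) = (1 * (if i \<le> m then 1 else - 1)) \<odot>\<^bsub>N\<^esub> \<phi> \<xi>"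
      by (intro act[OF h]) (simp_all add: 1 scale_1)
    then show "\<tau> ?h (\<phi> \<xi>) = (if i \<le> m then 1 else - 1) \<odot>\<^bsub>N\<^esub> \<phi> \<xi>" by simp
  next
    fix a b assume ab: "a \<in> {1..m}" "b \<in> {1..m}" "a \<noteq> b" "snd (cell \<mu> a) = snd (cell \<mu> b)"
    let ?h = "swap_map (m + l) a b"
    have ab': "a \<in> {1..m + l}" "b \<in> {1..m + l}" using ab by auto
    have h: "?h \<in> B_sub m l"
    proof (rule B_subI[OF swap_map_FI[OF ab']])
      show "idx ?h k \<in> {1..m}" if "k \<in> {1..m}" for k
        using that transpose_in[OF ab(1,2) that] idx_swap_map[of k "m + l" a b] by simp
    qed
    have "to_perm m (B_left m ?h) = transpose a b"
      unfolding B_projections(1)[OF h] using ab by (intro ext) (auto simp: idx_swap_map transpose_def)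
    moreover have "to_perm l (B_right m l ?h) = id"
      unfolding B_projections(2)[OF h] using ab by (intro ext) (auto simp: idx_swap_map transpose_def)
    moreover have "eps l (B_right m l ?h) = 1"
      unfolding B_projections(3)[OF h] by (intro prod.neutral) (simp add: swap_map_int del: of_nat_add)
    ultimately have "\<tau> ?h (\<phi> \<xi>) = (- 1 * 1) \<odot>\<^bsub>N\<^esub> \<phi> \<xi>"
      using anti_vec_transpose[of a \<mu> b, where 'a = 'k] ab
      by (intro act[OF h]) (simp_all add: scale_1 scale_uminus_1 m_def)
    then show "\<tau> ?h (\<phi> \<xi>) = (- 1) \<odot>\<^bsub>N\<^esub> \<phi> \<xi>" by simp
  next
    have *: "\<tau> (swap_map (m + l) (a + m) (b + m)) (\<phi> \<xi>) = c \<odot>\<^bsub>N\<^esub> \<phi> \<xi>"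
      if ab: "a \<in> {1..l}" "b \<in> {1..l}" and c: "sym_act (transpose a b) (anti_vec \<nu>) = scale c (anti_vec \<nu> :: 'k grp_alg)"
      for a b c
    proof -
      let ?h = "swap_map (m + l) (a + m) (b + m)"
      have ab': "a + m \<in> {1..m + l}" "b + m \<in> {1..m + l}" using ab by auto
      have h: "?h \<in> B_sub m l"
        by (rule B_subI[OF swap_map_FI[OF ab']]) (use ab in \<open>auto simp: idx_swap_map transpose_def\<close>)
      have "to_perm m (B_left m ?h) = id"
        unfolding B_projections(1)[OF h] using ab by (intro ext) (auto simp: idx_swap_map transpose_def)
      moreover have "to_perm l (B_right m l ?h) = transpose a b"
        unfolding B_projections(2)[OF h] using ab by (intro ext) (auto simp: idx_swap_map transpose_def)
      moreover have "eps l (B_right m l ?h) = 1"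
        unfolding B_projections(3)[OF h] by (intro prod.neutral) (simp add: swap_map_int del: of_nat_add)
      ultimately have "\<tau> ?h (\<phi> \<xi>) = (1 * c) \<odot>\<^bsub>N\<^esub> \<phi> \<xi>"
        using c by (intro act[OF h]) (simp_all add: scale_1)
      then show ?thesis by simp
    qed
    show "\<tau> (swap_map (m + l) (a + m) (b + m)) (\<phi> \<xi>) = (- 1) \<odot>\<^bsub>N\<^esub> \<phi> \<xi>"
      if "a \<in> {1..l}" "b \<in> {1..l}" "a \<noteq> b" "snd (cell \<nu> a) = snd (cell \<nu> b)" for a b
      using * that anti_vec_transpose[of a \<nu> b, where 'a = 'k] by (simp add: l_def scale_uminus_1)
    show "\<tau> (swap_map (m + l) (a + m) (b + m)) (\<phi> \<xi>) = 1 \<odot>\<^bsub>N\<^esub> \<phi> \<xi>"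
      if "a \<in> lone \<nu>" "b \<in> lone \<nu>" for a b
    proof (rule *)
      show "a \<in> {1..l}" "b \<in> {1..l}" using that by (auto simp: lone_def l_def)
      show "sym_act (transpose a b) (anti_vec \<nu>) = scale 1 (anti_vec \<nu> :: 'k grp_alg)"
        by (simp add: anti_vec_lone[OF that] scale_1)
    qed
  qed
qed

section \<open>Degrees of columns of exponents\<close>

text \<open>Zero exactly if no variable with second index a occurs in M; its parity gives the sign
  by which M changes under the flip at a.\<close>

definition cdeg :: "nat \<Rightarrow> monomial \<Rightarrow> nat"
  where "cdeg a M = (\<Sum>v\<in>Poly_Mapping.keys M. Poly_Mapping.lookup M v when snd v = a)"

lemma cdeg_add: "cdeg a (M + N) = cdeg a M + cdeg a N"
  unfolding cdeg_def by (rule setsum_keys_plus_distrib) (auto simp: when_def)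

lemma cdeg_zero [simp]: "cdeg a 0 = 0"
  by (simp add: cdeg_def)

lemma cdeg_single [simp]: "cdeg a (Poly_Mapping.single (i, b) k) = (k when b = a)"
  by (cases "k = 0") (simp_all add: cdeg_def)

lemma cdeg_lookup: "cdeg a M = 0 \<Longrightarrow> Poly_Mapping.lookup M (i, a) = 0"
proof -
  assume "cdeg a M = 0"
  then have all: "\<forall>v\<in>Poly_Mapping.keys M. (Poly_Mapping.lookup M v when snd v = a) = 0"
    unfolding cdeg_def by (simp only: sum_eq_0_iff[OF finite_keys])
  show ?thesis
  proof (cases "(i, a) \<in> Poly_Mapping.keys M")
    case True
    from bspec[OF all True] show ?thesis by simp
  qed (simp add: in_keys_iff)
qed

lemma total_deg_cdeg:
  assumes "M \<in> monomials r n"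
  shows "total_deg M = (\<Sum>a\<in>{1..n}. cdeg a M)"
  using assms
  by (induction M rule: monomials_induct) (auto simp: total_deg_add cdeg_add sum.distrib when_def)

lemma transport_flip: "M \<in> monomials r n \<Longrightarrow> transport (flip n a) M = M"
  by (induction M rule: monomials_induct) (simp_all add: transport_add idx_flip)

lemma tsgn_flip: "M \<in> monomials r n \<Longrightarrow> tsgn (flip n a) M = (- 1) ^ cdeg a M"
  by (induction M rule: monomials_induct) (auto simp: tsgn_add cdeg_add power_add flip_int when_def)

lemma tsgn_swap:
  assumes "a \<in> {1..n}" "b \<in> {1..n}" "M \<in> monomials r n"
  shows "tsgn (swap_map n a b) M = 1"
  using assms(3)
proof (induction M rule: monomials_induct)
  case (single i c k)
  then show ?case using transpose_in[OF assms(1,2), of c] by (simp add: swap_map_int)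
qed (simp_all add: tsgn_add)

lemma lookup_transport_swap:
  assumes ab: "a \<in> {1..n}" "b \<in> {1..n}" and M: "M \<in> monomials r n"
  shows "Poly_Mapping.lookup (transport (swap_map n a b) M) (i, c) = Poly_Mapping.lookup M (i, transpose a b c)"
  using M
proof (induction M rule: monomials_induct)
  case (single j e k)
  then have "transpose a b e = c \<longleftrightarrow> e = transpose a b c" by (metis transpose_involutory)
  then show ?case using single by (auto simp: idx_swap_map lookup_single when_def)
qed (simp_all add: transport_add lookup_add)

lemma transport_swap_zero:
  assumes "a \<in> {1..n}" "b \<in> {1..n}" "M \<in> monomials r n" "cdeg a M = 0" "cdeg b M = 0"
  shows "transport (swap_map n a b) M = M"
proof (rule poly_mapping_eqI)
  fix v :: "nat \<times> nat"
  obtain i c where v: "v = (i, c)" by (cases v)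
  show "Poly_Mapping.lookup (transport (swap_map n a b) M) v = Poly_Mapping.lookup M v"
    using cdeg_lookup[OF assms(4), of i] cdeg_lookup[OF assms(5), of i]
    by (auto simp: v lookup_transport_swap[OF assms(1-3)] transpose_def)
qed

lemma partition_nth_le:
  assumes "is_partition \<mu>" "i < length \<mu>"
  shows "\<mu> ! i \<le> first_part \<mu>"
proof (cases \<mu>)
  case (Cons a xs)
  then show ?thesis using assms by (cases i) (auto simp: is_partition_def first_part_def)
qed (use assms in simp)

text \<open>The row put in front is the longest one, so the diagram has as many columns as this row
  has cells.\<close>

lemma pad_cells:
  assumes "is_partition \<mu>" "sum_list \<mu> + first_part \<mu> \<le> n"
  shows "sum_list (pad \<mu> n) = n" "t \<in> {1..n} \<Longrightarrow> snd (cell (pad \<mu> n) t) < n - sum_list \<mu>"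
proof -
  show sum: "sum_list (pad \<mu> n) = n" using assms by (simp add: pad_def)
  assume "t \<in> {1..n}"
  then have c: "fst (cell (pad \<mu> n) t) < length (pad \<mu> n)"
    "snd (cell (pad \<mu> n) t) < pad \<mu> n ! fst (cell (pad \<mu> n) t)"
    using cell_mem[of t "pad \<mu> n"] by (simp_all add: sum)
  have "pad \<mu> n ! i \<le> n - sum_list \<mu>" if "i < length (pad \<mu> n)" for i
    using that partition_nth_le[OF assms(1)] assms(2) by (cases i) (fastforce simp: pad_def)+
  then show "snd (cell (pad \<mu> n) t) < n - sum_list \<mu>" using c by (meson less_le_trans)
qed

text \<open>An antisymmetric function lives on monomials with at most one zero column of exponents for each
  column of the tableau.\<close>

lemma nonzero_columns:
  assumes "is_partition \<mu>" "sum_list \<mu> + first_part \<mu> \<le> n"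
    and "\<And>a b. \<lbrakk>a \<in> {1..n}; b \<in> {1..n}; a \<noteq> b; snd (cell (pad \<mu> n) a) = snd (cell (pad \<mu> n) b)\<rbrakk>
      \<Longrightarrow> \<not> (cdeg a M = 0 \<and> cdeg b M = 0)"
  shows "sum_list \<mu> \<le> card {a \<in> {1..n}. cdeg a M \<noteq> 0}"
proof -
  let ?Z = "{a \<in> {1..n}. cdeg a M = 0}" and ?Y = "{a \<in> {1..n}. cdeg a M \<noteq> 0}"
  have "?Z \<union> ?Y = {1..n}" by auto
  moreover have "card (?Z \<union> ?Y) = card ?Z + card ?Y" by (rule card_Un_disjoint) auto
  ultimately have sum: "card {1..n} = card ?Z + card ?Y" by simp
  \<comment> \<open>The indices with a zero column of exponents lie in different columns of the
    diagram.\<close>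
  have "card ?Z \<le> card {..<n - sum_list \<mu>}"
  proof (rule card_inj_on_le)
    show "inj_on (\<lambda>t. snd (cell (pad \<mu> n) t)) ?Z" using assms(3) by (intro inj_onI) blast
    show "(\<lambda>t. snd (cell (pad \<mu> n) t)) ` ?Z \<subseteq> {..<n - sum_list \<mu>}"
      using pad_cells(2)[OF assms(1,2)] by auto
  qed simp
  then show ?thesis using sum assms(2) by simp
qed

lemma char_zero_two: "CHAR('k::field) = 0 \<Longrightarrow> (2 :: 'k) \<noteq> 0"
  using of_nat_eq_0_iff_char_dvd[where 'a = 'k, of 2] by simp

lemma eq_uminus_zero:
  assumes "CHAR('k::field) = 0" "x = - (x :: 'k)"
  shows "x = 0"
proof -
  have "2 * x = x + x" by simp
  also have "\<dots> = 0" using assms(2) by (metis add.right_inverse)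
  finally show ?thesis using char_zero_two[OF assms(1)] by simp
qed

section \<open>Eigenvectors as functions on monomials, and the weight in type A\<close>

context mono_grading
begin

lemma dualp_module:
  assumes "j \<in> I"
  shows "Module.module scalars (fobj (dualp W j) n :: ('k::field, _) module)"
  by (rule FI_module.is_module[OF graded_co_FI_algebra.dual_piece_FI_module[OF coinv_graded_co_FI assms]])

lemma vals_eigen:
  assumes h: "h \<in> FI_hom (stab W) n n" and y: "y \<in> carrier (fobj (dualp W j) n :: ('k::field, _) module)"
    and eq: "fmap (dualp W j) n n h y = c \<odot>\<^bsub>fobj (dualp W j) n\<^esub> y" and M: "M \<in> monomials r n"
  shows "of_int (tsgn h M) * vals W j n y M = c * vals W j n y (transport h M)"
  using vals_map(1)[OF h y M] by (simp add: eq vals_smult)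

lemma vals_nonzero:
  assumes "y \<in> carrier (fobj (dualp W j) n :: ('k::field, _) module)" "y \<noteq> \<zero>\<^bsub>fobj (dualp W j) n\<^esub>" "j \<in> I"
  obtains M where "vals W j n y M \<noteq> 0" "M \<in> monomials r n" "dg M = j"
proof -
  obtain M where M: "vals W j n y M \<noteq> 0"
  proof (rule ccontr)
    assume "\<not> thesis"
    then have "vals W j n y = vals W j n \<zero>\<^bsub>fobj (dualp W j) n\<^esub>" using that by (auto simp: vals_zero)
    then show False using vals_inj[OF assms(1) module_closed(3)[OF dualp_module[OF assms(3)]]] assms(2) by metis
  qed
  then show ?thesis using that[OF M] vals_dmon[OF M] by (auto simp: dmon_def)
qed

text \<open>If both columns of exponents were zero, the transposition would fix M, and the value at
  M would equal its own negative.\<close>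

lemma vals_antisym:
  assumes char: "CHAR('k::field) = 0" and ab: "a \<in> {1..n}" "b \<in> {1..n}"
    and st: "swap_map n a b \<in> FI_hom (stab W) n n"
    and y: "y \<in> carrier (fobj (dualp W j) n :: ('k, _) module)"
    and eq: "fmap (dualp W j) n n (swap_map n a b) y = (- 1) \<odot>\<^bsub>fobj (dualp W j) n\<^esub> y"
    and M: "M \<in> monomials r n" "vals W j n y M \<noteq> 0"
  shows "\<not> (cdeg a M = 0 \<and> cdeg b M = 0)"
proof
  assume z: "cdeg a M = 0 \<and> cdeg b M = 0"
  have "vals W j n y M = - vals W j n y M"
    using vals_eigen[OF st y eq M(1)] transport_swap_zero[OF ab M(1)] z tsgn_swap[OF ab M(1)] by simp
  then show False using eq_uminus_zero[OF char] M(2) by blast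
qed

lemma weight_A:
  assumes char: "CHAR('k::field) = 0" and j: "j \<in> I" and d: "\<And>M. dg M = j \<Longrightarrow> total_deg M = d"
  shows "weight_le_A (dualp FI_A j :: ('k, _) FI_diagram) d"
  unfolding weight_le_A_def
proof (intro allI impI, elim conjE)
  fix n \<mu>
  let ?V = "dualp FI_A j :: ('k, 'k mpoly set \<Rightarrow> 'k) FI_diagram" and ?L = "pad \<mu> n"
  assume \<mu>: "is_partition \<mu>" "sum_list \<mu> + first_part \<mu> \<le> n"
    and con: "constituent (FI_hom FI_A n n) (S_irr ?L) (\<lambda>w. sym_act (to_perm n w)) (fobj ?V n) (fmap ?V n n)"
  obtain \<phi> where \<phi>: "\<phi> \<in> lin_maps (S_irr ?L) (fobj ?V n)" "inj_on \<phi> (irr_span ?L)"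
    "\<And>g x. g \<in> FI_hom FI_A n n \<Longrightarrow> x \<in> irr_span ?L \<Longrightarrow> \<phi> (sym_act (to_perm n g) x) = fmap ?V n n g (\<phi> x)"
    using con unfolding constituent_def by auto
  define v where "v = (anti_vec ?L :: 'k grp_alg)"
  have v: "v \<in> irr_span ?L" "v \<noteq> 0"
    using anti_vec_nonzero[OF char, of ?L] by (auto simp: v_def anti_vec_mem)
  have y: "\<phi> v \<in> carrier (fobj ?V n)" using \<phi>(1) v(1) by (auto simp: lin_maps_def)
  have "\<phi> v \<noteq> \<zero>\<^bsub>fobj ?V n\<^esub>"
    by (rule lin_maps_nonzero[OF \<phi>(1) _ S_irr_module dualp_module[OF j]]) (use \<phi>(2) v in auto)
  from vals_nonzero[OF y this j] obtain M where M: "vals FI_A j n (\<phi> v) M \<noteq> 0" "M \<in> monomials r n" "dg M = j"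
    by blast
  note sum = pad_cells(1)[OF \<mu>]
  have "\<not> (cdeg a M = 0 \<and> cdeg b M = 0)"
    if ab: "a \<in> {1..n}" "b \<in> {1..n}" "a \<noteq> b" "snd (cell ?L a) = snd (cell ?L b)" for a b
  proof (rule vals_antisym[OF char ab(1,2) _ y _ M(2,1)])
    note A = swap_map_FI_A[OF ab(1,2)]
    show "swap_map n a b \<in> FI_hom (stab FI_A) n n" using A by (simp add: stab_def)
    have "fmap ?V n n (swap_map n a b) (\<phi> v) = \<phi> (sym_act (transpose a b) v)"
      using \<phi>(3)[OF A v(1)] by (simp add: to_perm_swap_map[OF ab(1,2)])
    also have "sym_act (transpose a b) v = scale (- 1) v"
      using anti_vec_transpose[of a ?L b, where 'a = 'k] ab by (simp add: sum v_def scale_uminus_1)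
    also have "\<phi> (scale (- 1) v) = (- 1) \<odot>\<^bsub>fobj ?V n\<^esub> \<phi> v" using \<phi>(1) v(1) by (auto simp: lin_maps_def)
    finally show "fmap ?V n n (swap_map n a b) (\<phi> v) = (- 1) \<odot>\<^bsub>fobj ?V n\<^esub> \<phi> v" .
  qed
  from nonzero_columns[OF \<mu> this] have "sum_list \<mu> \<le> card {a \<in> {1..n}. cdeg a M \<noteq> 0}" by blast
  also have "\<dots> = (\<Sum>a\<in>{a \<in> {1..n}. cdeg a M \<noteq> 0}. 1)" by simp
  also have "\<dots> \<le> (\<Sum>a\<in>{a \<in> {1..n}. cdeg a M \<noteq> 0}. cdeg a M)" by (intro sum_mono) (auto simp: Suc_le_eq)
  also have "\<dots> \<le> (\<Sum>a\<in>{1..n}. cdeg a M)" by (intro sum_mono2) auto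
  also have "\<dots> = d" using total_deg_cdeg[OF M(2)] d[OF M(3)] by simp
  finally show "sum_list \<mu> \<le> d" .
qed

end

lemma idx_abs:
  assumes f: "f \<in> FI_hom FI_BC m n" and a: "a \<in> ob m"
  shows "idx f (nat \<bar>a\<bar>) = nat \<bar>f a\<bar>"
proof (cases "0 < a")
  case True
  then show ?thesis by (simp add: idx_def)
next
  case False
  then show ?thesis using FI_uminus[OF f a] by (simp add: idx_def)
qed

lemma idx_compose:
  assumes f: "f \<in> FI_hom FI_BC l m" and g: "g \<in> FI_hom FI_BC m n" and a: "a \<in> {1..l}"
  shows "idx (compose (ob l) g f) a = idx g (idx f a)"
proof -
  have o: "int a \<in> ob l" using a by simp
  have "idx (compose (ob l) g f) a = nat \<bar>g (f (int a))\<bar>" using o by (simp add: idx_def compose_def)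
  also have "\<dots> = idx g (nat \<bar>f (int a)\<bar>)" by (rule idx_abs[OF g FI_ob[OF f o], symmetric])
  finally show ?thesis by (simp add: idx_def)
qed

text \<open>Each nonzero column of exponents adds at least 1 to the degree: there are at least
  |\<mu>| of them among the first m, and all of the last l are nonzero. Types BC and D share this
  count.\<close>

lemma weighted_count:
  assumes "is_partition \<mu>" "sum_list \<mu> + first_part \<mu> \<le> m" "M \<in> monomials r (m + l)"
    and "\<And>a b. \<lbrakk>a \<in> {1..m}; b \<in> {1..m}; a \<noteq> b; snd (cell (pad \<mu> m) a) = snd (cell (pad \<mu> m) b)\<rbrakk>
      \<Longrightarrow> \<not> (cdeg a M = 0 \<and> cdeg b M = 0)"
    and "\<And>i. i \<in> {1..m + l} \<Longrightarrow> m < i \<Longrightarrow> cdeg i M \<noteq> 0"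
  shows "sum_list \<mu> + l \<le> total_deg M"
proof -
  have "sum_list \<mu> \<le> card {a \<in> {1..m}. cdeg a M \<noteq> 0}" by (rule nonzero_columns[OF assms(1,2,4)])
  also have "\<dots> = (\<Sum>a\<in>{a \<in> {1..m}. cdeg a M \<noteq> 0}. 1)" by simp
  also have "\<dots> \<le> (\<Sum>a\<in>{a \<in> {1..m}. cdeg a M \<noteq> 0}. cdeg a M)" by (intro sum_mono) (auto simp: Suc_le_eq)
  also have "\<dots> \<le> (\<Sum>a\<in>{1..m}. cdeg a M)" by (intro sum_mono2) auto
  finally have 1: "sum_list \<mu> \<le> (\<Sum>a\<in>{1..m}. cdeg a M)" .
  have "(\<Sum>a\<in>{m + 1..m + l}. 1) \<le> (\<Sum>a\<in>{m + 1..m + l}. cdeg a M)"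
    by (rule sum_mono) (use assms(5) in \<open>auto simp: Suc_le_eq\<close>)
  then have 2: "l \<le> (\<Sum>a\<in>{m + 1..m + l}. cdeg a M)" by simp
  have "(\<Sum>a\<in>{1..m + l}. cdeg a M) = (\<Sum>a\<in>{1..m}. cdeg a M) + (\<Sum>a\<in>{m + 1..m + l}. cdeg a M)"
    by (rule sum.ub_add_nat) simp
  then show ?thesis using 1 2 total_deg_cdeg[OF assms(3)] by simp
qed

lemma sign_parity:
  assumes "CHAR('k::field) = 0" "of_int ((- 1) ^ k) * y = c * (y :: 'k)" "y \<noteq> 0"
  shows "c = 1 \<Longrightarrow> even k" "c = - 1 \<Longrightarrow> odd k"
proof -
  have "of_int ((- 1) ^ k) = c" using assms(2,3) by simp
  moreover have "(1 :: 'k) \<noteq> - 1" using eq_uminus_zero[OF assms(1), of 1] by auto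
  ultimately show "c = 1 \<Longrightarrow> even k" "c = - 1 \<Longrightarrow> odd k" by (auto simp: minus_one_power_iff split: if_splits)
qed

section \<open>The weight in type BC\<close>

context mono_grading
begin

lemma weight_BC:
  assumes char: "CHAR('k::field) = 0" and j: "j \<in> I" and d: "\<And>M. dg M = j \<Longrightarrow> total_deg M = d"
  shows "weight_le_BC (dualp FI_BC j :: ('k, _) FI_diagram) d"
  unfolding weight_le_BC_def
proof (intro allI impI, elim conjE)
  fix n and \<mu> \<nu> :: "nat list"
  let ?V = "dualp FI_BC j :: ('k, 'k mpoly set \<Rightarrow> 'k) FI_diagram"
  define m where "m = n - sum_list \<nu>"
  define l where "l = sum_list \<nu>"
  assume \<mu>: "is_partition \<mu>" and \<nu>: "is_partition \<nu>" and n: "sum_list \<nu> + sum_list \<mu> + first_part \<mu> \<le> n"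
    and con: "constituent (FI_hom FI_BC n n) (B_irr (pad \<mu> (n - sum_list \<nu>)) \<nu>)
       (B_act (pad \<mu> (n - sum_list \<nu>)) \<nu>) (fobj ?V n) (fmap ?V n n)"
  have \<mu>': "sum_list \<mu> + first_part \<mu> \<le> m" and nml: "n = m + l" using n by (auto simp: m_def l_def)
  note sum = pad_cells(1)[OF \<mu> \<mu>']
  have "sum_list (pad \<mu> m) + sum_list \<nu> = n" by (simp only: sum nml l_def)
  note con' = con[folded m_def, folded this]
  from constituent_vector[OF char dualp_module[OF j] con'] obtain \<psi>
    where "antisym_vector (pad \<mu> m) \<nu> (fmap ?V n n) (fobj ?V n) \<psi>"
    unfolding \<open>sum_list (pad \<mu> m) + sum_list \<nu> = n\<close> by blast
  note av = antisym_vectorD[OF this sum[symmetric] l_def, folded nml]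
  note y = av(1,2) and fl = av(3) and sw = av(4)
  from vals_nonzero[OF y j] obtain M where M: "vals FI_BC j n \<psi> M \<noteq> 0" "M \<in> monomials r n" "dg M = j"
    by blast
  have st: "h \<in> FI_hom (stab FI_BC) n n" if "h \<in> FI_hom FI_BC n n" for h using that by (simp add: stab_def)
  have "sum_list \<mu> + l \<le> total_deg M"
  proof (rule weighted_count[OF \<mu> \<mu>'])
    show "M \<in> monomials r (m + l)" using M(2) nml by simp
    show "\<not> (cdeg a M = 0 \<and> cdeg b M = 0)"
      if "a \<in> {1..m}" "b \<in> {1..m}" "a \<noteq> b" "snd (cell (pad \<mu> m) a) = snd (cell (pad \<mu> m) b)" for a b
    proof (rule vals_antisym[OF char _ _ _ y(1) sw[OF that] M(2,1)])
      show ab: "a \<in> {1..n}" "b \<in> {1..n}" using that nml by auto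
      show "swap_map n a b \<in> FI_hom (stab FI_BC) n n" by (rule st[OF swap_map_FI[OF ab]])
    qed
    show "cdeg i M \<noteq> 0" if i: "i \<in> {1..m + l}" "m < i" for i
    proof -
      have i': "i \<in> {1..n}" "\<not> i \<le> m" using i nml by auto
      \<comment> \<open>Beyond m the flip has eigenvalue -1, so the degree of the column is odd and
        in particular positive.\<close>
      have "of_int ((- 1) ^ cdeg i M) * vals FI_BC j n \<psi> M = - 1 * vals FI_BC j n \<psi> M"
        using vals_eigen[OF st[OF flip_FI] y(1) fl[OF i'(1)] M(2)]
        by (simp add: i'(2) transport_flip[OF M(2)] tsgn_flip[OF M(2)])
      from sign_parity(2)[OF char this M(1)] show ?thesis by (metis even_zero)
    qed
  qed
  then show "sum_list \<mu> + sum_list \<nu> \<le> d" using d[OF M(3)] by (simp add: l_def)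
qed

end

section \<open>Lifting even invariants\<close>

lemma factor_same_image:
  assumes f: "f \<in> FI_hom FI_BC m n" and g: "g \<in> FI_hom FI_BC m n" and im: "f ` ob m \<subseteq> g ` ob m"
  obtains w where "w \<in> FI_hom FI_BC m m" "compose (ob m) g w = f"
proof -
  define w where "w = (\<lambda>a\<in>ob m. inv_into (ob m) g (f a))"
  have w: "w a \<in> ob m" "g (w a) = f a" if "a \<in> ob m" for a
    using that im by (auto simp: w_def inv_into_into f_inv_into_f subset_iff)
  have gw: "compose (ob m) g w = f"
  proof (rule extensionalityI[of _ "ob m"])
    show "f \<in> extensional (ob m)" by (rule FI_ext[OF f])
  qed (auto simp: compose_def w)
  have "inj_on w (ob m)"
  proof (rule inj_onI)
    fix a b assume "a \<in> ob m" "b \<in> ob m" "w a = w b"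
    then show "a = b" using w(2)[of a] w(2)[of b] FI_inj[OF f] by metis
  qed
  moreover have "w (- a) = - w a" if a: "a \<in> ob m" for a
  proof (rule FI_inj[OF g])
    show "w (- a) \<in> ob m" "- w a \<in> ob m" using w(1) a by auto
    show "g (w (- a)) = g (- w a)"
      using w(2)[of "- a"] w[OF a] FI_uminus[OF f a] FI_uminus[OF g, of "w a"] a by simp
  qed
  ultimately have "w \<in> FI_hom FI_BC m m" using w(1) by (simp add: FI_hom_def PiE_def Pi_def w_def)
  then show ?thesis using that gw by blast
qed

lemma ob_finite: "finite (ob n)"
  by (rule finite_subset[of _ "{- int n..int n}"]) (auto simp: ob_def)

lemma FI_image:
  assumes "w \<in> FI_hom FI_BC n n"
  shows "w ` ob n = ob n"
  by (rule endo_inj_surj[OF ob_finite]) (use FI_ob[OF assms] FI_inj[OF assms] in \<open>auto intro: inj_onI\<close>)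

lemma FI_right_inverse:
  assumes "w \<in> FI_hom FI_BC n n"
  obtains v where "v \<in> FI_hom FI_BC n n" "compose (ob n) w v = (\<lambda>a\<in>ob n. a)"
  using factor_same_image[OF id_FI assms, of thesis] FI_image[OF assms] by auto

lemma finite_FI: "finite (FI_hom FI_BC m n)"
  by (rule finite_subset[OF _ finite_PiE[OF ob_finite, of m "\<lambda>_. ob n"]]) (auto simp: FI_hom_def ob_finite)

lemma cdeg_transport:
  assumes f: "f \<in> FI_hom FI_BC m n" and M: "M \<in> monomials r m"
  shows "a \<in> {1..m} \<Longrightarrow> cdeg (idx f a) (transport f M) = cdeg a M"
    "c \<notin> idx f ` {1..m} \<Longrightarrow> cdeg c (transport f M) = 0"
proof -
  show "cdeg (idx f a) (transport f M) = cdeg a M" if a: "a \<in> {1..m}"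
    using M
  proof (induction M rule: monomials_induct)
    case (single i b k)
    then show ?case using inj_onD[OF idx_inj[OF f], of a b] a by (auto simp: when_def)
  qed (simp_all add: transport_add cdeg_add)
  show "cdeg c (transport f M) = 0" if c: "c \<notin> idx f ` {1..m}"
    using M by (induction M rule: monomials_induct) (use c in \<open>auto simp: transport_add cdeg_add when_def\<close>)
qed

lemma tsgn_cdeg:
  assumes "M \<in> monomials r n"
  shows "tsgn w M = (\<Prod>a\<in>{1..n}. sgn (w (int a)) ^ cdeg a M)"
  using assms
proof (induction M rule: monomials_induct)
  case (single i b k)
  have "(\<Prod>a\<in>{1..n}. sgn (w (int a)) ^ cdeg a (Poly_Mapping.single (i, b) k))
      = (\<Prod>a\<in>{1..n}. if a = b then sgn (w (int b)) ^ k else 1)"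
    by (intro prod.cong) (auto simp: when_def)
  then show ?case using single by (simp add: prod.delta)
qed (simp_all add: tsgn_add cdeg_add power_add prod.distrib)

definition all_even :: "nat \<Rightarrow> monomial \<Rightarrow> bool"
  where "all_even n M \<longleftrightarrow> (\<forall>a\<in>{1..n}. even (cdeg a M))"

lemma tsgn_even:
  assumes "w \<in> FI_hom FI_BC n n'" "M \<in> monomials r n" "all_even n M"
  shows "tsgn w M = 1"
  unfolding tsgn_cdeg[OF assms(2)]
proof (rule prod.neutral, rule ballI)
  fix a assume a: "a \<in> {1..n}"
  then have "even (cdeg a M)" using assms(3) unfolding all_even_def by blast
  then obtain k where "cdeg a M = 2 * k" by (rule evenE)
  then show "sgn (w (int a)) ^ cdeg a M = 1"
    using sgn_nonzero[OF assms(1) a] by (simp add: power_mult power2_eq_square)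
qed

lemma all_even_transport:
  assumes f: "f \<in> FI_hom FI_BC m n" and M: "M \<in> monomials r m"
  shows "all_even n (transport f M) \<longleftrightarrow> all_even m M"
proof
  assume "all_even n (transport f M)"
  then show "all_even m M"
    using cdeg_transport(1)[OF f M] idx_in[OF f] unfolding all_even_def by metis
next
  assume ev: "all_even m M"
  show "all_even n (transport f M)"
    unfolding all_even_def
  proof
    fix c assume "c \<in> {1..n}"
    show "even (cdeg c (transport f M))"
    proof (cases "c \<in> idx f ` {1..m}")
      case True
      then obtain a where "a \<in> {1..m}" "c = idx f a" by blast
      then show ?thesis using cdeg_transport(1)[OF f M] ev by (simp add: all_even_def)
    qed (use cdeg_transport(2)[OF f M] in simp)
  qed
qed

text \<open>Dropping the signs of w does not affect transport. As the result is even, invariance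
  under D_n already controls transport along arbitrary signed permutations.\<close>

lemma positive_part:
  assumes w: "w \<in> FI_hom FI_BC n n"
  obtains v where "v \<in> FI_hom FI_A n n" "\<And>M r. M \<in> monomials r n \<Longrightarrow> transport v M = transport w M"
    "\<And>M r. M \<in> monomials r n \<Longrightarrow> tsgn v M = 1"
proof -
  define v where "v = signed_map n (\<lambda>i. int (idx w i))"
  have v: "v \<in> FI_hom FI_BC n n"
    unfolding v_def
  proof (rule signed_map_FI)
    show "int (idx w i) \<in> ob n" if "i \<in> {1..n}" for i using idx_in[OF w that] by simp
    show "inj_on (\<lambda>i. \<bar>int (idx w i)\<bar>) {1..n}" using inj_onD[OF idx_inj[OF w]] by (intro inj_onI) simp
  qed
  have vi: "v (int i) = int (idx w i)" if "i \<in> {1..n}" for i using that by (simp add: v_def signed_map_int)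
  have "0 < v a" if a: "a \<in> ob n" "0 < a" for a
  proof -
    have i: "nat a \<in> {1..n}" "int (nat a) = a" using a by (auto simp: ob_def)
    then have "v a = int (idx w (nat a))" using vi[OF i(1)] by simp
    then show ?thesis using idx_in[OF w i(1)] by simp
  qed
  then have "v \<in> FI_hom FI_A n n" using v by (simp add: FI_hom_def)
  moreover have iv: "idx v i = idx w i" if "i \<in> {1..n}" for i using vi[OF that] by (simp add: idx_def)
  have "transport v M = transport w M" if "M \<in> monomials r n" for M r
    using that by (induction M rule: monomials_induct) (simp_all only: transport_add transport_single transport_zero iv)
  moreover have "tsgn v M = 1" if "M \<in> monomials r n" for M r
    unfolding tsgn_cdeg[OF that] using vi idx_in[OF w] by (intro prod.neutral) fastforce
  ultimately show ?thesis using that by blast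
qed

lemma FI_A_D: "f \<in> FI_hom FI_A n n \<Longrightarrow> f \<in> FI_hom FI_D n n"
proof -
  assume f: "f \<in> FI_hom FI_A n n"
  have "f (int i) > 0" if "i \<in> {1..n}" for i
    using f that by (simp add: FI_hom_def)
  then have "eps n f = 1" unfolding eps_eq_prod by (intro prod.neutral) (fastforce dest: not_less_iff_gr_or_eq[THEN iffD2])
  then show ?thesis using FI_BC[OF f] by (simp add: FI_D_iff)
qed

text \<open>Single flips are not in D_n but products of two are, so D_n sees the parities of the
  columns only relative to one another.\<close>

lemma double_flip:
  assumes "a \<in> {1..n}" "b \<in> {1..n}"
  defines "w \<equiv> compose (ob n) (flip n a) (flip n b)"
  shows "w \<in> FI_hom FI_D n n" "M \<in> monomials r n \<Longrightarrow> transport w M = M"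
    "M \<in> monomials r n \<Longrightarrow> tsgn w M = (- 1) ^ (cdeg a M + cdeg b M)"
proof -
  show "w \<in> FI_hom FI_D n n"
    unfolding FI_D_iff w_def
    by (simp add: compose_FI[OF flip_FI flip_FI] eps_compose[OF flip_FI flip_FI] eps_flip[OF assms(1)] eps_flip[OF assms(2)])
  assume M: "M \<in> monomials r n"
  show "transport w M = M" "tsgn w M = (- 1) ^ (cdeg a M + cdeg b M)"
    unfolding w_def transport_comp[OF flip_FI flip_FI M] transport_flip[OF M] tsgn_flip[OF M]
    by (simp_all add: power_add)
qed

lemma swap_map_D: "a \<in> {1..n} \<Longrightarrow> b \<in> {1..n} \<Longrightarrow> swap_map n a b \<in> FI_hom FI_D n n"
  by (rule FI_A_D[OF swap_map_FI_A])

text \<open>The coefficient of the lift at a monomial with a zero column of exponents is read off after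
  removing such a column. The lift has no monomials without zero columns.\<close>

lemma even_lift:
  fixes p :: "'k::field mpoly"
  assumes p: "p \<in> invs FI_D r m" and ev: "\<And>M. M \<in> Poly_Mapping.keys p \<Longrightarrow> all_even m M" and n: "n = Suc m"
  obtains P where "P \<in> invs FI_D r n" "\<And>f. f \<in> FI_hom FI_BC m n \<Longrightarrow> poly_pull m f P = p"
proof -
  have pc: "p \<in> carrier (poly_alg r m)" using p by (simp add: invs_def)
  have keys: "M \<in> monomials r m" if "M \<in> Poly_Mapping.keys p" for M
    using that pc by (auto simp: poly.carrier_eq)
  have inv: "Poly_Mapping.lookup p (transport w M) = Poly_Mapping.lookup p M"
    if w: "w \<in> FI_hom FI_BC m m" and M: "M \<in> monomials r m" for w M
  proof -
    obtain v where v: "v \<in> FI_hom FI_A m m" "\<And>M r. M \<in> monomials r m \<Longrightarrow> transport v M = transport w M"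
      "\<And>M r. M \<in> monomials r m \<Longrightarrow> tsgn v M = 1" by (rule positive_part[OF w]) blast
    have "poly_pull m v p = p" using p FI_A_D[OF v(1)] by (simp add: invs_def)
    then show ?thesis using lookup_poly_pull[OF FI_BC[OF v(1)] pc M] v(2,3)[OF M] by simp
  qed
  \<comment> \<open>Well-definedness of the lift: the coefficient must not depend on which zero
    column is removed, nor on the numbering of the others.\<close>
  have wd: "Poly_Mapping.lookup p M = Poly_Mapping.lookup p N"
    if f: "f \<in> FI_hom FI_BC m n" and g: "g \<in> FI_hom FI_BC m n" and M: "M \<in> monomials r m" and N: "N \<in> monomials r m"
      and eq: "transport f M = transport g N" for f g M N
  proof -
    have missing: "\<exists>c\<in>{1..n}. idx h ` {1..m} = {1..n} - {c}" if h: "h \<in> FI_hom FI_BC m n" for h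
    proof -
      have sub: "idx h ` {1..m} \<subseteq> {1..n}" using idx_in[OF h] by blast
      have "card ({1..n} - idx h ` {1..m}) = 1"
        using card_image[OF idx_inj[OF h]] card_Diff_subset[OF _ sub] n by simp
      then obtain c where c: "{1..n} - idx h ` {1..m} = {c}" by (auto simp: card_1_singleton_iff)
      then have "c \<in> {1..n}" "idx h ` {1..m} = {1..n} - {c}" using sub by blast+
      then show ?thesis by blast
    qed
    obtain c where c: "c \<in> {1..n}" "idx f ` {1..m} = {1..n} - {c}" using missing[OF f] by blast
    obtain c' where c': "c' \<in> {1..n}" "idx g ` {1..m} = {1..n} - {c'}" using missing[OF g] by blast
    \<comment> \<open>c and c' are the positions missed by f and g. Both columns of the common
      monomial are zero, so exchanging them changes nothing and lets g' miss the same position as f;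
      the two then differ by a signed permutation of the source.\<close>
    define g' where "g' = compose (ob m) (swap_map n c c') g"
    have g': "g' \<in> FI_hom FI_BC m n" unfolding g'_def by (rule compose_FI[OF g swap_map_FI[OF c(1) c'(1)]])
    have zero: "cdeg c (transport f M) = 0" "cdeg c' (transport g N) = 0"
      using cdeg_transport(2)[OF f M] cdeg_transport(2)[OF g N] c(2) c'(2) by blast+
    have "transport g' N = transport (swap_map n c c') (transport g N)"
      unfolding g'_def by (rule transport_comp(1)[OF g swap_map_FI[OF c(1) c'(1)] N])
    also have "\<dots> = transport g N"
      using zero eq by (intro transport_swap_zero[OF c(1) c'(1) transport_monomials[OF g N]]) auto
    finally have eq': "transport f M = transport g' N" using eq by simp
    have "idx g' a = transpose c c' (idx g a)" if a: "a \<in> {1..m}" for a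
      unfolding g'_def idx_compose[OF g swap_map_FI[OF c(1) c'(1)] a]
      by (rule idx_swap_map[OF idx_in[OF g a]])
    then have "idx g' ` {1..m} = transpose c c' ` ({1..n} - {c'})" unfolding c'(2)[symmetric] image_image by (rule image_cong[OF refl])
    also have "\<dots> \<subseteq> {1..n} - {c}"
    proof
      fix x assume "x \<in> transpose c c' ` ({1..n} - {c'})"
      then obtain y where y: "y \<in> {1..n}" "y \<noteq> c'" "x = transpose c c' y" by blast
      then have "x \<noteq> c" by (auto simp: transpose_def)
      then show "x \<in> {1..n} - {c}" using transpose_in[OF c(1) c'(1) y(1)] y(3) by blast
    qed
    finally have img: "idx g' ` {1..m} \<subseteq> {1..n} - {c}" .
    have "card (idx g' ` {1..m}) = card ({1..n} - {c})" using card_image[OF idx_inj[OF g']] c(1) n by simp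
    then have img: "idx g' ` {1..m} = idx f ` {1..m}" using card_subset_eq[OF _ img] c(2) by simp
    have "f ` ob m \<subseteq> g' ` ob m"
    proof
      fix b assume "b \<in> f ` ob m"
      then obtain a where a: "a \<in> ob m" "b = f a" by blast
      then have i: "nat \<bar>a\<bar> \<in> {1..m}" by (auto simp: ob_def)
      have "idx f (nat \<bar>a\<bar>) = nat \<bar>b\<bar>" using idx_abs[OF f a(1)] a(2) by simp
      moreover have "idx f (nat \<bar>a\<bar>) \<in> idx g' ` {1..m}" unfolding img using i by (rule imageI)
      ultimately obtain e where e: "e \<in> {1..m}" "idx g' e = nat \<bar>b\<bar>" by auto
      then have oe: "int e \<in> ob m" "- int e \<in> ob m" by (auto simp: ob_def)
      have "b = g' (int e) \<or> b = - g' (int e)" using e(2) by (auto simp: idx_def abs_if split: if_splits)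
      then have "b = g' (int e) \<or> b = g' (- int e)" using FI_uminus[OF g' oe(1)] by simp
      then show "b \<in> g' ` ob m" using oe by blast
    qed
    from factor_same_image[OF f g' this] obtain w where w: "w \<in> FI_hom FI_BC m m" "compose (ob m) g' w = f" by blast
    have "transport g' (transport w M) = transport g' N"
      using transport_comp(1)[OF w(1) g' M] w(2) eq' by simp
    then have "transport w M = N"
      using inj_onD[OF transport_inj[OF g', of r]] transport_monomials[OF w(1) M] N by blast
    then show ?thesis using inv[OF w(1) M] by simp
  qed
  \<comment> \<open>All transports of monomials of p. There are finitely many, so P is a
    polynomial.\<close>
  define S where "S = (\<Union>f\<in>FI_hom FI_BC m n. transport f ` Poly_Mapping.keys p)"
  have finS: "finite S" unfolding S_def by (intro finite_UN_I finite_FI finite_imageI finite_keys)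
  define rep where "rep W = (SOME M. M \<in> monomials r m \<and> (\<exists>f\<in>FI_hom FI_BC m n. transport f M = W))" for W
  define P where "P = (\<Sum>W\<in>S. Poly_Mapping.single W (Poly_Mapping.lookup p (rep W)))"
  have lookP: "Poly_Mapping.lookup P W = (if W \<in> S then Poly_Mapping.lookup p (rep W) else 0)" for W
    unfolding P_def lookup_sum lookup_single when_def using finS by (simp add: sum.delta)
  have rep: "Poly_Mapping.lookup p (rep (transport f M)) = Poly_Mapping.lookup p M"
    if f: "f \<in> FI_hom FI_BC m n" and M: "M \<in> monomials r m" for f M
  proof -
    have "\<exists>N. N \<in> monomials r m \<and> (\<exists>g\<in>FI_hom FI_BC m n. transport g N = transport f M)" using f M by blast
    from someI_ex[OF this] obtain g where "rep (transport f M) \<in> monomials r m" "g \<in> FI_hom FI_BC m n"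
      "transport g (rep (transport f M)) = transport f M" unfolding rep_def by blast
    then show ?thesis using wd[OF _ f _ M] by blast
  qed
  have look: "Poly_Mapping.lookup P (transport f M) = Poly_Mapping.lookup p M"
    if f: "f \<in> FI_hom FI_BC m n" and M: "M \<in> monomials r m" for f M
  proof (cases "transport f M \<in> S")
    case False
    then have "M \<notin> Poly_Mapping.keys p" using f by (auto simp: S_def)
    then show ?thesis using False by (simp add: lookP in_keys_iff)
  qed (simp add: lookP rep[OF f M])
  have out: "Poly_Mapping.lookup P W = 0"
    if "\<And>f M. f \<in> FI_hom FI_BC m n \<Longrightarrow> M \<in> monomials r m \<Longrightarrow> W \<noteq> transport f M" for W
    using that keys by (auto simp: lookP S_def)
  have "Poly_Mapping.keys P \<subseteq> S" by (auto simp: in_keys_iff lookP split: if_splits)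
  also have "S \<subseteq> monomials r n" using transport_monomials keys by (auto simp: S_def)
  finally have Pc: "P \<in> carrier (poly_alg r n)" by (simp add: poly.carrier_eq)
  \<comment> \<open>This uses evenness: no signed injection contributes a sign on the monomials of
    p.\<close>
  have sgn: "of_int (tsgn h M) * Poly_Mapping.lookup p M = Poly_Mapping.lookup p M"
    if "h \<in> FI_hom FI_BC m n'" "M \<in> monomials r m" for h M n'
    using tsgn_even[OF that] ev[of M] by (cases "M \<in> Poly_Mapping.keys p") (auto simp: in_keys_iff)
  have "poly_pull n w P = P" if "w \<in> FI_hom FI_D n n" for w
  proof (rule poly_eqI[of _ r n])
    note w = FI_BC[OF that]
    show "poly_pull n w P \<in> carrier (poly_alg r n)" by (rule poly_pull_closed[OF w Pc])
    fix W assume W: "W \<in> monomials r n"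
    note l = lookup_poly_pull[OF w Pc W]
    show "Poly_Mapping.lookup (poly_pull n w P) W = Poly_Mapping.lookup P W"
    proof (cases "\<exists>f\<in>FI_hom FI_BC m n. \<exists>M\<in>monomials r m. W = transport f M")
      case True
      then obtain f M where f: "f \<in> FI_hom FI_BC m n" and M: "M \<in> monomials r m" and fM: "W = transport f M" by blast
      note wf = compose_FI[OF f w]
      have "Poly_Mapping.lookup P (transport w W) = Poly_Mapping.lookup p M"
        using look[OF wf M] transport_comp(1)[OF f w M] fM by simp
      moreover have "of_int (tsgn w W) * Poly_Mapping.lookup p M = Poly_Mapping.lookup p M"
      proof (cases "M \<in> Poly_Mapping.keys p")
        case True
        then have "all_even n W" using ev all_even_transport[OF f M] fM by simp
        then show ?thesis using tsgn_even[OF w W] by simp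
      qed (simp add: in_keys_iff)
      ultimately show ?thesis using l look[OF f M] fM by simp
    next
      case False
      \<comment> \<open>Since w is invertible, a monomial that is not a transport from m variables
        is not moved to one.\<close>
      have "transport w W \<noteq> transport f M" if f: "f \<in> FI_hom FI_BC m n" and M: "M \<in> monomials r m" for f M
      proof
        assume eq: "transport w W = transport f M"
        obtain v where v: "v \<in> FI_hom FI_BC n n" "compose (ob n) w v = (\<lambda>a\<in>ob n. a)"
          by (rule FI_right_inverse[OF w])
        have fM: "transport f M \<in> monomials r n" by (rule transport_monomials[OF f M])
        have "transport w (transport v (transport f M)) = transport w W"
          using transport_comp(1)[OF v(1) w fM] v(2) transport_id(1)[OF fM] eq by simp
        then have "transport v (transport f M) = W"
          using inj_onD[OF transport_inj[OF w, of r]] transport_monomials[OF v(1) fM] W by blast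
        then have "W = transport (compose (ob m) v f) M" using transport_comp(1)[OF f v(1) M] by simp
        then show False using False compose_FI[OF f v(1)] M by blast
      qed
      then show ?thesis using l out[of W] out[of "transport w W"] False by force
    qed
  qed (rule Pc)
  moreover have "Poly_Mapping.lookup P 0 = 0"
  proof -
    have "Poly_Mapping.lookup p 0 = 0" using p by (simp add: invs_def)
    moreover have "M = 0" if "f \<in> FI_hom FI_BC m n" "M \<in> monomials r m" "transport f M = 0" for f M
      using inj_onD[OF transport_inj[OF that(1), of r], of M 0] that by simp
    ultimately show ?thesis using look out[of 0] by (metis transport_zero)
  qed
  ultimately have "P \<in> invs FI_D r n" using Pc by (simp add: invs_def)
  moreover have "poly_pull m f P = p" if f: "f \<in> FI_hom FI_BC m n" for f
  proof (rule poly_eqI[of _ r m])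
    fix M assume M: "M \<in> monomials r m"
    show "Poly_Mapping.lookup (poly_pull m f P) M = Poly_Mapping.lookup p M"
      using lookup_poly_pull[OF f Pc M] look[OF f M] sgn[OF f M] by simp
  qed (use poly_pull_closed[OF f Pc] pc in auto)
  ultimately show ?thesis using that by blast
qed

text \<open>The covariant action of f, on arbitrary functions on monomials. It is thus available
  before U is known to annihilate the ideal.\<close>

definition push :: "nat \<Rightarrow> (int \<Rightarrow> int) \<Rightarrow> (monomial \<Rightarrow> 'k) \<Rightarrow> monomial \<Rightarrow> 'k::field"
  where "push m f U M = lin_ext U (poly_pull m f (gen M))"

lemma lin_ext_push:
  assumes "p \<in> carrier (poly_alg r n)"
  shows "lin_ext (push m f U) p = lin_ext U (poly_pull m f p)"
  using assms
proof (induction p rule: poly_induct)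
  case (single M c)
  have "Poly_Mapping.single M c = scale c (gen M)" by (simp add: scale_single)
  then show ?case by (simp only: lin_ext_scale poly_pull_scale) (simp add: push_def)
qed (simp_all add: lin_ext_add poly_pull_add)

lemma push_transport:
  assumes "f \<in> FI_hom FI_BC m n"
  shows "M \<in> monomials r m \<Longrightarrow> push m f U (transport f M) = of_int (tsgn f M) * U M"
    "W \<in> monomials r n \<Longrightarrow> W \<notin> transport f ` monomials r m \<Longrightarrow> push m f U W = 0"
  by (simp_all add: push_def pull_monomial[OF assms] pull_monomial_0[OF assms])

lemma transport_swap_twice:
  assumes "a \<in> {1..n}" "b \<in> {1..n}" "M \<in> monomials r n"
  shows "transport (swap_map n a b) (transport (swap_map n a b) M) = M"
proof (rule poly_mapping_eqI)
  fix v :: "nat \<times> nat"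
  obtain i c where v: "v = (i, c)" by (cases v)
  show "Poly_Mapping.lookup (transport (swap_map n a b) (transport (swap_map n a b) M)) v = Poly_Mapping.lookup M v"
    using lookup_transport_swap[OF assms(1,2) transport_monomials[OF swap_map_FI[OF assms(1,2)] assms(3)]]
      lookup_transport_swap[OF assms] by (simp add: v)
qed

lemma cdeg_transport_swap:
  assumes "a \<in> {1..n}" "b \<in> {1..n}" "M \<in> monomials r n"
  shows "cdeg c (transport (swap_map n a b) M) = cdeg (transpose a b c) M"
  using assms(3)
proof (induction M rule: monomials_induct)
  case (single i e k)
  then have "transpose a b e = c \<longleftrightarrow> e = transpose a b c" by (metis transpose_involutory)
  then show ?case using single by (simp add: idx_swap_map when_def)
qed (simp_all add: transport_add cdeg_add)

section \<open>Functionals that come from n - 1 variables\<close>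

context mono_grading
begin

lemma vals_push:
  assumes f: "f \<in> FI_hom (stab W) m n" and y: "y \<in> carrier (fobj (dualp W j) m :: ('k::field, _) module)"
    and M: "M \<in> dmon n j"
  shows "vals W j n (fmap (dualp W j) m n f y) M = push m f (vals W j m y) M"
  using M dual_map_eval[OF f y, of "gen M"]
  by (simp add: vals_def push_def dmon_def poly.single_closed hom_def)

text \<open>The element u is y read on monomials whose column \<open>i0\<close> is deleted, and
  \<open>F i\<close> reinserts the empty column at i. The main work is to show that u annihilates
  the coinvariant ideal in n - 1 variables: even invariants are lifted to n variables, where y is
  known to vanish, and the odd ones are excluded by degree.\<close>

lemma generated_from_below:
  fixes y :: "'k::field mpoly set \<Rightarrow> 'k"
  assumes char: "CHAR('k) = 0" and d: "\<And>M. dg M = j \<Longrightarrow> total_deg M = d" and dn: "d < n"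
    and y: "y \<in> carrier (fobj (dualp FI_D j) n)" and T: "T \<subseteq> {1..n}"
    and parity: "\<And>M c. vals FI_D j n y M \<noteq> 0 \<Longrightarrow> c \<in> {1..n} \<Longrightarrow> odd (cdeg c M) \<longleftrightarrow> c \<le> m"
    and zero: "\<And>M. vals FI_D j n y M \<noteq> 0 \<Longrightarrow> \<exists>t\<in>T. cdeg t M = 0"
    and sym: "\<And>a b. a \<in> T \<Longrightarrow> b \<in> T \<Longrightarrow>
      fmap (dualp FI_D j) n n (swap_map n a b) y = 1 \<odot>\<^bsub>fobj (dualp FI_D j) n\<^esub> y"
    and small: "Suc d = n \<Longrightarrow> Suc m = n \<Longrightarrow> d = 0" and j: "j \<in> I"
  obtains u F where "u \<in> carrier (fobj (dualp FI_D j) (n - 1) :: ('k, _) module)"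
    "\<And>i. i \<in> T \<Longrightarrow> F i \<in> FI_hom FI_BC (n - 1) n"
    "vals FI_D j n y = (\<lambda>M. \<Sum>i\<in>T. vals FI_D j n (fmap (dualp FI_D j) (n - 1) n (F i) u) M)"
proof (cases "T = {}")
  case True
  then have "vals FI_D j n y = (\<lambda>M. 0)" using zero by auto
  then show ?thesis using True by (intro that[OF module_closed(3)[OF dualp_module[OF j]]]) auto
next
  case False
  then obtain i0 where i0: "i0 \<in> T" by blast
  let ?V = "dualp FI_D j :: ('k, 'k mpoly set \<Rightarrow> 'k) FI_diagram"
  let ?Y = "vals FI_D j n y"
  have st: "stab FI_D = FI_BC" by (simp add: stab_def)
  have i0n: "i0 \<in> {1..n}" using i0 T by blast
  have finT: "finite T" using T by (rule finite_subset) simp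
  define k where "k = n - 1"
  have nk: "n = Suc k" using dn by (simp add: k_def)
  \<comment> \<open>A positive injection that misses exactly \<open>i0\<close>: the place of
    \<open>i0\<close> is given to n. For \<open>i0 = n\<close> it is the natural inclusion.\<close>
  define \<iota> where "\<iota> = signed_map k (\<lambda>i. int (if i = i0 then n else i))"
  have \<iota>: "\<iota> \<in> FI_hom FI_BC k n"
    unfolding \<iota>_def by (rule signed_map_FI) (auto simp: nk inj_on_def)
  have \<iota>_int: "\<iota> (int i) = int (if i = i0 then n else i)" if "i \<in> {1..k}" for i
    unfolding \<iota>_def by (rule signed_map_int[OF that])
  have \<iota>_idx: "idx \<iota> i = (if i = i0 then n else i)" if "i \<in> {1..k}" for i
    unfolding idx_def \<iota>_int[OF that] by simp
  have \<iota>_img: "idx \<iota> ` {1..k} = {1..n} - {i0}"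
  proof (intro equalityI subsetI)
    fix c assume c: "c \<in> {1..n} - {i0}"
    show "c \<in> idx \<iota> ` {1..k}"
    proof (cases "c = n")
      case True
      then have "i0 \<in> {1..k}" using c i0n nk by auto
      then show ?thesis using True \<iota>_idx by (intro image_eqI[of _ _ i0]) auto
    next
      case False
      then have "c \<in> {1..k}" using c nk by auto
      then show ?thesis using c \<iota>_idx[of c] by (intro image_eqI[of _ _ c]) auto
    qed
  qed (use \<iota>_idx i0n nk in \<open>auto split: if_splits\<close>)
  have \<iota>_sgn: "tsgn \<iota> w = 1" if "w \<in> monomials r k" for w
    unfolding tsgn_cdeg[OF that] by (rule prod.neutral) (use \<iota>_int nk in auto)
  have \<iota>_surj: "W \<in> transport \<iota> ` monomials r k" if W: "W \<in> monomials r n" "cdeg i0 W = 0" for W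
  proof (rule transport_surj[OF \<iota>])
    show "Poly_Mapping.keys W \<subseteq> {1..r} \<times> (idx \<iota> ` {1..k})"
    proof
      fix v assume v: "v \<in> Poly_Mapping.keys W"
      obtain i c where [simp]: "v = (i, c)" by (cases v)
      have "c \<noteq> i0" using v cdeg_lookup[OF W(2), of i] by (auto simp: in_keys_iff)
      then show "v \<in> {1..r} \<times> (idx \<iota> ` {1..k})"
        using v W(1) unfolding \<iota>_img by (auto simp: monomials_def)
    qed
  qed
  have \<iota>_zero: "cdeg i0 (transport \<iota> w) = 0" if "w \<in> monomials r k" for w
    by (rule cdeg_transport(2)[OF \<iota> that]) (unfold \<iota>_img, simp)
  define s where "s i = swap_map n i i0" for i
  define F where "F i = compose (ob k) (s i) \<iota>" for i
  have iT: "i \<in> {1..n}" if "i \<in> T" for i using that T by blast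
  have s: "s i \<in> FI_hom FI_BC n n" if "i \<in> T" for i
    unfolding s_def by (rule swap_map_FI[OF iT[OF that] i0n])
  have F: "F i \<in> FI_hom FI_BC k n" if "i \<in> T" for i
    unfolding F_def by (rule compose_FI[OF \<iota> s[OF that]])
  have F_tr: "transport (F i) w = transport (s i) (transport \<iota> w)" "tsgn (F i) w = 1"
    if "i \<in> T" "w \<in> monomials r k" for i w
    unfolding F_def transport_comp[OF \<iota> s[OF that(1)] that(2)] \<iota>_sgn[OF that(2)]
    using tsgn_swap[OF iT[OF that(1)] i0n transport_monomials[OF \<iota> that(2)]] by (simp_all add: s_def)
  define z where "z M = card {t \<in> T. cdeg t M = 0}" for M
  \<comment> \<open>The division makes the translates of \<open>U\<close> along the \<open>F i\<close> sum to the given function.\<close>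
  define U where "U w = (if w \<in> dmon k j then ?Y (transport \<iota> w) / of_nat (z (transport \<iota> w)) else 0)" for w
  \<comment> \<open>A translate sees only monomials with zero column i. By the symmetry under T its
    value there is the same for every such i.\<close>
  have push_F: "push k (F i) U W = (if cdeg i W = 0 then ?Y W / of_nat (z W) else 0)"
    if i: "i \<in> T" and W: "W \<in> monomials r n" for i W
  proof (cases "cdeg i W = 0")
    case True
    let ?W = "transport (s i) W"
    have W': "?W \<in> monomials r n" by (rule transport_monomials[OF s[OF i] W])
    have cd: "cdeg c ?W = cdeg (transpose i i0 c) W" for c
      unfolding s_def by (rule cdeg_transport_swap[OF iT[OF i] i0n W])
    then have "cdeg i0 ?W = 0" using True by simp
    from \<iota>_surj[OF W' this] obtain w where w: "w \<in> monomials r k" "?W = transport \<iota> w" by blast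
    have Fw: "W = transport (F i) w"
      using F_tr(1)[OF i w(1)] w(2) transport_swap_twice[OF iT[OF i] i0n W] by (simp add: s_def)
    have "push k (F i) U W = U w"
      using push_transport(1)[OF F[OF i] w(1), of U] Fw F_tr(2)[OF i w(1)] by simp
    also have "\<dots> = ?Y W / of_nat (z W)"
    proof (cases "dg w = j")
      case True
      have "?Y ?W = ?Y W"
        using vals_eigen[OF _ y sym[OF i i0] W] s[OF i] tsgn_swap[OF iT[OF i] i0n W] by (simp add: st s_def)
      moreover have "z ?W = z W"
      proof -
        have tT: "transpose i i0 t \<in> T" if "t \<in> T" for t using that i i0 by (auto simp: transpose_def)
        have "{t \<in> T. cdeg t ?W = 0} = transpose i i0 ` {t \<in> T. cdeg t W = 0}"
        proof (intro equalityI subsetI)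
          fix t assume "t \<in> {t \<in> T. cdeg t ?W = 0}"
          then have "transpose i i0 t \<in> {t \<in> T. cdeg t W = 0}" using tT cd by simp
          then show "t \<in> transpose i i0 ` {t \<in> T. cdeg t W = 0}" by (rule image_eqI[rotated]) simp
        qed (use tT cd in auto)
        then show ?thesis unfolding z_def by (simp add: card_image)
      qed
      ultimately show ?thesis using True w by (simp add: U_def dmon_def)
    next
      case False
      then have "dg W \<noteq> j" using Fw dg_transport by simp
      then show ?thesis using False by (simp add: U_def dmon_def vals_def)
    qed
    finally show ?thesis using True by simp
  next
    case False
    have "W \<notin> transport (F i) ` monomials r k"
    proof
      assume "W \<in> transport (F i) ` monomials r k"
      then obtain w where w: "w \<in> monomials r k" "W = transport (F i) w" by blast
      have "cdeg i W = cdeg i0 (transport \<iota> w)"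
        using cdeg_transport_swap[OF iT[OF i] i0n transport_monomials[OF \<iota> w(1)], of i]
        by (simp add: w(2) F_tr(1)[OF i w(1)] s_def)
      then show False using \<iota>_zero[OF w(1)] False by simp
    qed
    then show ?thesis using push_transport(2)[OF F[OF i] W] False by simp
  qed
  \<comment> \<open>At a monomial with z zero columns in T exactly z translates contribute, each the
    z-th part of the value; z is positive by \<open>zero\<close> and invertible in characteristic
    zero.\<close>
  have total: "?Y W = (\<Sum>i\<in>T. push k (F i) U W)" if W: "W \<in> monomials r n" for W
  proof (cases "?Y W = 0")
    case True
    show ?thesis unfolding True by (rule sum.neutral[symmetric]) (simp add: push_F[OF _ W] True)
  next
    case False
    have "z W \<noteq> 0" unfolding z_def using zero[OF False] finT by (auto simp: card_eq_0_iff)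
    then have "(of_nat (z W) :: 'k) \<noteq> 0" using char by (simp add: of_nat_eq_0_iff_char_dvd)
    moreover have "(\<Sum>i\<in>T. push k (F i) U W) = (\<Sum>i\<in>T. if cdeg i W = 0 then ?Y W / of_nat (z W) else 0)"
      by (intro sum.cong refl push_F W)
    moreover have "\<dots> = (\<Sum>i\<in>{t \<in> T. cdeg t W = 0}. ?Y W / of_nat (z W))"
      by (rule sum.inter_filter[OF finT, symmetric])
    moreover have "\<dots> = of_nat (z W) * (?Y W / of_nat (z W))" by (simp add: z_def)
    ultimately show ?thesis by simp
  qed
  \<comment> \<open>All k columns of N + M are nonzero, while the degree is at most k. Hence d = k
    and every column has degree one; the parities then force m = k, which \<open>small\<close>
    excludes unless k = 0, and then M would be trivial.\<close>
  have U_odd: "U (N + M) = 0"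
    if N: "N \<in> monomials r k" and M: "M \<in> monomials r k" "M \<noteq> 0" and od: "\<And>a. a \<in> {1..k} \<Longrightarrow> odd (cdeg a M)" for N M
  proof (rule ccontr)
    assume U: "U (N + M) \<noteq> 0"
    have NM: "N + M \<in> monomials r k" by (rule monomials_add[OF N M(1)])
    let ?W = "transport \<iota> (N + M)"
    have Y: "?Y ?W \<noteq> 0" and "dg (N + M) = j" using U by (auto simp: U_def dmon_def split: if_splits)
    then have deg: "(\<Sum>a\<in>{1..k}. cdeg a (N + M)) = d" using d total_deg_cdeg[OF NM] by simp
    have ge: "1 \<le> cdeg a (N + M)" if "a \<in> {1..k}" for a using od[OF that] by (cases "cdeg a M") (auto simp: cdeg_add)
    have "(\<Sum>a\<in>{1..k}. 1) \<le> (\<Sum>a\<in>{1..k}. cdeg a (N + M))" using ge by (rule sum_mono)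
    then have dk: "d = k" using deg dn nk by simp
    have one: "cdeg a (N + M) = 1" if a: "a \<in> {1..k}" for a
    proof (rule ccontr)
      assume "cdeg a (N + M) \<noteq> 1"
      then have "1 < cdeg a (N + M)" using ge[OF a] by simp
      then have "(\<Sum>a\<in>{1..k}. 1) < (\<Sum>a\<in>{1..k}. cdeg a (N + M))"
        using ge a by (intro sum_strict_mono_ex1) auto
      then show False using deg dk by simp
    qed
    have cm: "c \<le> m \<longleftrightarrow> c \<noteq> i0" if c: "c \<in> {1..n}" for c
    proof (cases "c = i0")
      case True
      then show ?thesis using parity[OF Y c] \<iota>_zero[OF NM] by simp
    next
      case False
      then have "c \<in> idx \<iota> ` {1..k}" unfolding \<iota>_img using c by simp
      then obtain a where "a \<in> {1..k}" "c = idx \<iota> a" by blast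
      then have "cdeg c ?W = 1" using cdeg_transport(1)[OF \<iota> NM] one by simp
      then show ?thesis using parity[OF Y c] False by simp
    qed
    have "m < i0" using cm[OF i0n] by simp
    moreover have "n \<le> m \<longleftrightarrow> n \<noteq> i0" by (rule cm) (simp add: nk)
    ultimately have n: "n = i0" "m < n" using i0n by auto
    have "k = 0"
    proof (rule ccontr)
      assume "k \<noteq> 0"
      then have "k \<le> m" using cm[of k] n(1) nk by simp
      then show False using small dk nk n(2) \<open>k \<noteq> 0\<close> by simp
    qed
    then have "M = 0" using M(1) by (auto simp: monomials_def)
    then show False using M(2) by simp
  qed
  have kill: "lin_ext U (Poly_Mapping.single N c * p) = 0"
    if p: "p \<in> invs FI_D r k" and N: "N \<in> monomials r k" for p :: "'k mpoly" and N c
  proof -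
    have pc: "p \<in> carrier (poly_alg r k)" using p by (simp add: invs_def)
    define pe where "pe = (\<Sum>M\<in>{M \<in> Poly_Mapping.keys p. all_even k M}. Poly_Mapping.single M (Poly_Mapping.lookup p M))"
    have look: "Poly_Mapping.lookup pe M = (if all_even k M then Poly_Mapping.lookup p M else 0)" for M
      unfolding pe_def lookup_sum lookup_single when_def by (auto simp: sum.delta in_keys_iff)
    have pec: "pe \<in> carrier (poly_alg r k)"
      using pc by (auto simp: poly.carrier_eq in_keys_iff look split: if_splits)
    \<comment> \<open>Pairs of flips show that the columns of a monomial of p have equal parity, so
      p is the sum of its even part \<open>pe\<close> and terms with all columns odd.\<close>
    have same: "even (cdeg a M) \<longleftrightarrow> even (cdeg b M)"
      if M: "M \<in> Poly_Mapping.keys p" and ab: "a \<in> {1..k}" "b \<in> {1..k}" for M a b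
    proof -
      have Mm: "M \<in> monomials r k" using M pc by (auto simp: poly.carrier_eq)
      note df = double_flip[OF ab]
      have "poly_pull k (compose (ob k) (flip k a) (flip k b)) p = p" using p df(1) by (simp add: invs_def)
      then have "of_int ((- 1) ^ (cdeg a M + cdeg b M)) * Poly_Mapping.lookup p M = 1 * Poly_Mapping.lookup p M"
        using lookup_poly_pull[OF FI_BC[OF df(1)] pc Mm] df(2,3)[OF Mm] by simp
      from sign_parity(1)[OF char this] M show ?thesis by (simp add: in_keys_iff)
    qed
    have pe: "pe \<in> invs FI_D r k"
      unfolding invs_def
    proof (intro CollectI conjI ballI pec)
      show "Poly_Mapping.lookup pe 0 = 0" using p by (simp add: look invs_def)
      fix w assume w: "w \<in> FI_hom FI_D k k"
      note w' = FI_BC[OF w]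
      show "poly_pull k w pe = pe"
      proof (rule poly_eqI[OF poly_pull_closed[OF w' pec] pec])
        fix M assume M: "M \<in> monomials r k"
        have "poly_pull k w p = p" using p w by (simp add: invs_def)
        then show "Poly_Mapping.lookup (poly_pull k w pe) M = Poly_Mapping.lookup pe M"
          using lookup_poly_pull[OF w' pc M] lookup_poly_pull[OF w' pec M] all_even_transport[OF w' M]
          by (simp add: look)
      qed
    qed
    obtain P where P: "P \<in> invs FI_D r n" "\<And>f. f \<in> FI_hom FI_BC k n \<Longrightarrow> poly_pull k f P = pe"
      by (rule even_lift[OF pe _ nk]) (auto simp: in_keys_iff look split: if_splits)
    have Pc: "P \<in> carrier (poly_alg r n)" using P(1) by (simp add: invs_def)
    let ?N = "transport \<iota> N"
    have N': "?N \<in> monomials r n" by (rule transport_monomials[OF \<iota> N])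
    have gN: "gen ?N \<in> carrier (poly_alg r n)" by (rule poly.single_closed[OF N'])
    have pull: "poly_pull k (F i) (gen ?N) = (if cdeg i ?N = 0 then gen N else 0)" if i: "i \<in> T" for i
    proof (cases "cdeg i ?N = 0")
      case True
      have "transport (F i) N = ?N"
        unfolding F_tr(1)[OF i N] s_def by (rule transport_swap_zero[OF iT[OF i] i0n N' True \<iota>_zero[OF N]])
      then show ?thesis using pull_monomial[OF F[OF i] N, of 1] F_tr(2)[OF i N] True by simp
    next
      case False
      have "?N \<notin> transport (F i) ` monomials r k"
      proof
        assume "?N \<in> transport (F i) ` monomials r k"
        then obtain w where w: "w \<in> monomials r k" "?N = transport (F i) w" by blast
        have "cdeg i ?N = cdeg i0 (transport \<iota> w)"
          using cdeg_transport_swap[OF iT[OF i] i0n transport_monomials[OF \<iota> w(1)], of i]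
          by (simp add: w(2) F_tr(1)[OF i w(1)] s_def)
        then show False using \<iota>_zero[OF w(1)] False by simp
      qed
      then show ?thesis using pull_monomial_0[OF F[OF i] N'] False by simp
    qed
    \<comment> \<open>The lift P lies in the ideal on which y vanishes. Expanding y into translates
      turns its value on \<open>gen ?N * P\<close> into a multiple of the value of U on
      \<open>gen N * pe\<close>; the factor is nonzero because column \<open>i0\<close> of
      \<open>?N\<close> is zero.\<close>
    have "0 = lin_ext ?Y (gen ?N * P)"
      using vals_annihilator[OF y] coinv_ideal_mult[OF gN invs_coinv_ideal[OF P(1)]] by (simp add: annihilator_def)
    also have "\<dots> = lin_ext (\<lambda>W. \<Sum>i\<in>T. push k (F i) U W) (gen ?N * P)"
      using poly_mult_closed[OF gN Pc] total by (intro lin_ext_cong) (auto simp: poly.carrier_eq)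
    also have "\<dots> = (\<Sum>i\<in>T. lin_ext (push k (F i) U) (gen ?N * P))"
      unfolding lin_ext_def sum_distrib_left by (rule sum.swap)
    also have "\<dots> = (\<Sum>i\<in>T. if cdeg i ?N = 0 then lin_ext U (gen N * pe) else 0)"
      by (intro sum.cong refl)
        (simp add: lin_ext_push[OF poly_mult_closed[OF gN Pc]] poly_pull_mult pull P(2)[OF F])
    also have "\<dots> = (\<Sum>i\<in>{t \<in> T. cdeg t ?N = 0}. lin_ext U (gen N * pe))"
      by (rule sum.inter_filter[OF finT, symmetric])
    also have "\<dots> = of_nat (z ?N) * lin_ext U (gen N * pe)" by (simp add: z_def)
    finally have "of_nat (z ?N) * lin_ext U (gen N * pe) = 0" by simp
    moreover have "z ?N \<noteq> 0" unfolding z_def using i0 \<iota>_zero[OF N] finT by (auto simp: card_eq_0_iff)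
    ultimately have even: "lin_ext U (gen N * pe) = 0" using char by (simp add: of_nat_eq_0_iff_char_dvd)
    have odd: "lin_ext U (gen N * q) = 0"
      if "Poly_Mapping.keys q \<subseteq> {M \<in> Poly_Mapping.keys p. \<not> all_even k M}" for q
      using that
    proof (induction q rule: poly_mapping_add_induct)
      case (single M e)
      then have M: "M \<in> Poly_Mapping.keys p" "\<not> all_even k M" by auto
      obtain b where b: "b \<in> {1..k}" "odd (cdeg b M)" using M(2) by (auto simp: all_even_def)
      have "M \<noteq> 0" using b(2) by auto
      have "U (N + M) = 0"
      proof (rule U_odd[OF N _ \<open>M \<noteq> 0\<close>])
        show "M \<in> monomials r k" using M(1) pc by (auto simp: poly.carrier_eq)
        show "odd (cdeg a M)" if "a \<in> {1..k}" for a using same[OF M(1) that b(1)] b(2) by simp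
      qed
      then show ?case by (simp add: mult_single)
    qed (simp_all add: distrib_left lin_ext_add)
    have "lin_ext U (gen N * (p - pe)) = 0"
      by (rule odd) (auto simp: in_keys_iff lookup_minus look split: if_splits)
    then have "lin_ext U (gen N * p) = 0" using even by (simp add: right_diff_distrib lin_ext_diff)
    moreover have "Poly_Mapping.single N c * p = scale c (gen N * p)"
      by (simp add: scale_eq_mult mult_single flip: mult.assoc)
    ultimately show ?thesis by (simp add: lin_ext_scale)
  qed
  have "U \<in> annihilator FI_D j k"
    unfolding annihilator_def
  proof (intro CollectI conjI allI impI ballI)
    fix p :: "'k mpoly" assume p: "p \<in> coinv_ideal FI_D r k"
    \<comment> \<open>The kernel of U need not be an ideal; the polynomials all of whose multiples
      it contains form one.\<close>
    let ?Q = "{p \<in> carrier (poly_alg r k). \<forall>q\<in>carrier (poly_alg r k). lin_ext U (q * p) = 0}"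
    have "poly_ideal r k ?Q"
      unfolding poly_ideal_def
      by (auto simp: poly.zero_closed poly.add_closed poly_mult_closed distrib_left lin_ext_add mult.assoc[symmetric])
    moreover have "invs FI_D r k \<subseteq> ?Q"
    proof (intro subsetI CollectI conjI ballI)
      fix p q :: "'k mpoly" assume p: "p \<in> invs FI_D r k" and q: "q \<in> carrier (poly_alg r k)"
      show "lin_ext U (q * p) = 0"
        using q by (induction q rule: poly_induct) (simp_all add: kill[OF p] distrib_right lin_ext_add)
    qed (auto simp: invs_def)
    ultimately have "p \<in> ?Q" using coinv_ideal_least p by blast
    then have "lin_ext U (1 * p) = 0" using poly_one_closed by blast
    then show "lin_ext U p = 0" by simp
  qed (simp add: U_def)
  then have u: "functional FI_D j k U \<in> carrier (fobj ?V k)" "vals FI_D j k (functional FI_D j k U) = U"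
    by (rule functional_closed, rule vals_functional)
  show ?thesis
  proof (rule that[of "functional FI_D j k U" F])
    show "functional FI_D j k U \<in> carrier (fobj ?V (n - 1))" using u(1) by (simp add: k_def)
    show "F i \<in> FI_hom FI_BC (n - 1) n" if "i \<in> T" for i using F[OF that] by (simp add: k_def)
    show "?Y = (\<lambda>M. \<Sum>i\<in>T. vals FI_D j n (fmap ?V (n - 1) n (F i) (functional FI_D j k U)) M)"
    proof
      fix M
      show "?Y M = (\<Sum>i\<in>T. vals FI_D j n (fmap ?V (n - 1) n (F i) (functional FI_D j k U)) M)"
      proof (cases "M \<in> dmon n j")
        case True
        have "vals FI_D j n (fmap ?V k n (F i) (functional FI_D j k U)) M = push k (F i) U M" if "i \<in> T" for i
          using vals_push[OF _ u(1) True, of "F i"] F[OF that] u(2) by (simp add: st)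
        then show ?thesis using total[of M] True by (simp add: k_def dmon_def)
      qed (simp add: vals_def)
    qed
  qed
qed

end

section \<open>The induced module of type D\<close>

lemma compose_assoc_FI:
  assumes "f \<in> FI_hom FI_BC l m"
  shows "compose (ob l) h (compose (ob l) g f) = compose (ob l) (compose (ob m) h g) f"
  using FI_ob[OF assms] by (auto simp: compose_def)

lemma compose_id_FI:
  assumes "f \<in> FI_hom FI_BC l m"
  shows "compose (ob l) (\<lambda>a\<in>ob m. a) f = f"
  using FI_ob[OF assms] by (intro extensionalityI[OF _ FI_ext[OF assms]]) (auto simp: compose_def)

lemma compose_id_right:
  assumes "f \<in> FI_hom FI_BC l m"
  shows "compose (ob l) f (\<lambda>a\<in>ob l. a) = f"
  by (intro extensionalityI[OF _ FI_ext[OF assms]]) (auto simp: compose_def)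

lemma flip_flip: "compose (ob n) (flip n i) (flip n i) = (\<lambda>a\<in>ob n. a)"
proof (rule FI_int_ext[OF compose_FI[OF flip_FI flip_FI] id_FI])
  fix a assume a: "a \<in> {1..n}"
  then have "int a \<in> ob n" by simp
  then show "compose (ob n) (flip n i) (flip n i) (int a) = (\<lambda>a\<in>ob n. a) (int a)"
    using flip_int[OF a, of i] FI_uminus[OF flip_FI, of "int a" n i] by (auto simp: compose_def)
qed

lemma smult_eq_zero:
  assumes N: "Module.module scalars N" and x: "x \<in> carrier N" and c: "(c::'k::field) \<noteq> 0" "c \<odot>\<^bsub>N\<^esub> x = \<zero>\<^bsub>N\<^esub>"
  shows "x = \<zero>\<^bsub>N\<^esub>"
proof -
  interpret Module.module scalars N by fact
  have "x = (inverse c * c) \<odot>\<^bsub>N\<^esub> x" using smult_one[OF x] c(1) by simp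
  also have "\<dots> = inverse c \<odot>\<^bsub>N\<^esub> (c \<odot>\<^bsub>N\<^esub> x)" using smult_assoc1[of "inverse c" c x] x by simp
  also have "\<dots> = \<zero>\<^bsub>N\<^esub>" using smult_r_null[of "inverse c"] c(2) by simp
  finally show ?thesis .
qed

lemma smult_cancel:
  assumes N: "Module.module scalars N" and x: "x \<in> carrier N" "x \<noteq> \<zero>\<^bsub>N\<^esub>" and eq: "c \<odot>\<^bsub>N\<^esub> x = (d::'k::field) \<odot>\<^bsub>N\<^esub> x"
  shows "c = d"
proof (rule ccontr)
  interpret Module.module scalars N by fact
  assume cd: "c \<noteq> d"
  have cl: "e \<odot>\<^bsub>N\<^esub> x \<in> carrier N" for e using smult_closed[of e x] x(1) by simp
  have "(c - d) \<odot>\<^bsub>N\<^esub> x \<oplus>\<^bsub>N\<^esub> d \<odot>\<^bsub>N\<^esub> x = \<zero>\<^bsub>N\<^esub> \<oplus>\<^bsub>N\<^esub> d \<odot>\<^bsub>N\<^esub> x"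
    using smult_l_distr[of "c - d" d x] x(1) eq cl by simp
  then have "(c - d) \<odot>\<^bsub>N\<^esub> x = \<zero>\<^bsub>N\<^esub>" using cl M.add.r_cancel by blast
  from smult_eq_zero[OF N x(1) _ this] show False using cd x(2) by simp
qed

context
  fixes V :: "('k::field, 'v) FI_diagram"
  assumes V: "FI_module FI_D V"
begin

lemma V_closed: "f \<in> FI_hom FI_D m n \<Longrightarrow> v \<in> carrier (fobj V m) \<Longrightarrow> fmap V m n f v \<in> carrier (fobj V n)"
  using FI_module.map_linear[OF V, of f m n] by (auto simp: lin_maps_def)

lemma IndD_presentation: "presentation (IndD_gens V n) (IndD_rels V n)"
proof
  show "IndD_rels V n \<subseteq> carrier (free_module (IndD_gens V n))"
    unfolding IndD_rels_def
  proof (intro Un_least subsetI)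
    fix u assume "u \<in> lin_rels (IndD_index n) (\<lambda>t. fobj V (fst t))"
    then show "u \<in> carrier (free_module (IndD_gens V n))"
      by (rule lin_relsE)
        (auto simp: IndD_gens_def intro!: free_diff gen_closed module_closed[OF FI_module.is_module[OF V]])
  next
    fix u assume "u \<in> {gen ((s, f), fmap V q s g v) - gen ((q, compose (ob q) f g), v) | q s f g v.
        f \<in> FI_hom FI_BC s n \<and> g \<in> FI_hom FI_D q s \<and> v \<in> carrier (fobj V q)}"
    then obtain q s f g v where u: "u = gen ((s, f), fmap V q s g v) - gen ((q, compose (ob q) f g), v)"
      and f: "f \<in> FI_hom FI_BC s n" and g: "g \<in> FI_hom FI_D q s" and v: "v \<in> carrier (fobj V q)" by blast
    have "compose (ob q) f g \<in> FI_hom FI_BC q n" by (rule compose_FI[OF FI_BC[OF g] f])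
    then show "u \<in> carrier (free_module (IndD_gens V n))"
      unfolding u using f g v FI_le[OF f] FI_le[OF g] V_closed[OF g v]
      by (intro free_diff gen_closed) (auto simp: IndD_gens_def IndD_index_def)
  qed
qed

interpretation ind: presentation "IndD_gens V n" "IndD_rels V n" for n
  by (rule IndD_presentation)

lemma IndD_ob: "fobj (IndD V) n = quot_mod (free_module (IndD_gens V n)) (lin_span (free_module (IndD_gens V n)) (IndD_rels V n))"
  by (simp add: IndD_def ind.presented_eq)

lemma IndD_module: "Module.module scalars (fobj (IndD V) n)"
  unfolding IndD_ob by (rule ind.quot_is_module)

lemma IndD_map_cls:
  assumes h: "h \<in> FI_hom FI_BC n n"
  shows "fmap (IndD V) n n h (ind.cls n p) = ind.cls n (free_map (\<lambda>((s, f), v). ((s, compose (ob s) h f), v)) p)"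
proof -
  let ?k = "\<lambda>((s, f), v). ((s, compose (ob s) h f), v)"
  have "presented_map (IndD_gens V n) (IndD_rels V n) ?k (ind.cls n p) = ind.cls n (free_map ?k p)"
  proof (rule ind.presented_map_cls[OF IndD_presentation])
    show "?k x \<in> IndD_gens V n" if "x \<in> IndD_gens V n" for x
      using that compose_FI[OF _ h] by (auto simp: IndD_gens_def IndD_index_def)
    fix u assume "u \<in> IndD_rels V n"
    then consider "u \<in> lin_rels (IndD_index n) (\<lambda>t. fobj V (fst t))"
      | q s f g v where "u = gen ((s, f), fmap V q s g v) - gen ((q, compose (ob q) f g), v)"
        "f \<in> FI_hom FI_BC s n" "g \<in> FI_hom FI_D q s" "v \<in> carrier (fobj V q)"
      unfolding IndD_rels_def by blast
    then have "free_map ?k u \<in> IndD_rels V n"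
    proof cases
      case 1
      have idx: "(fst t, compose (ob (fst t)) h (snd t)) \<in> IndD_index n" if "t \<in> IndD_index n" for t
        using that compose_FI[OF _ h] by (auto simp: IndD_index_def)
      from 1 have "free_map ?k u \<in> lin_rels (IndD_index n) (\<lambda>t. fobj V (fst t))"
      proof (rule lin_relsE)
        fix t v v' assume t: "t \<in> IndD_index n" "v \<in> carrier (fobj V (fst t))" "v' \<in> carrier (fobj V (fst t))"
          and u: "u = gen (t, v \<oplus>\<^bsub>fobj V (fst t)\<^esub> v') - gen (t, v) - gen (t, v')"
        show ?thesis
          using lin_relsI(1)[of "(fst t, compose (ob (fst t)) h (snd t))" "IndD_index n" v "\<lambda>t. fobj V (fst t)" v'] idx[OF t(1)] t
          by (simp add: u free_map_gen_diff case_prod_beta)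
      next
        fix c t v assume t: "t \<in> IndD_index n" "v \<in> carrier (fobj V (fst t))"
          and u: "u = gen (t, c \<odot>\<^bsub>fobj V (fst t)\<^esub> v) - Poly_Mapping.single (t, v) c"
        show ?thesis
          using lin_relsI(2)[of "(fst t, compose (ob (fst t)) h (snd t))" "IndD_index n" v "\<lambda>t. fobj V (fst t)" c] idx[OF t(1)] t
          by (simp add: u free_map_gen_diff case_prod_beta)
      qed
      then show ?thesis by (simp add: IndD_rels_def)
    next
      case 2
      have "free_map ?k u = gen ((s, compose (ob s) h f), fmap V q s g v) - gen ((q, compose (ob q) (compose (ob s) h f) g), v)"
        by (simp add: 2(1) free_map_diff compose_assoc_FI[OF FI_BC[OF 2(3)]])
      then show ?thesis using compose_FI[OF 2(2) h] 2(3,4) unfolding IndD_rels_def by blast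
    qed
    then show "free_map ?k u \<in> lin_span (free_module (IndD_gens V n)) (IndD_rels V n)" by (rule ind.rel_in_span)
  qed
  then show ?thesis by (simp add: IndD_def)
qed

definition tens :: "nat \<Rightarrow> (int \<Rightarrow> int) \<Rightarrow> 'v \<Rightarrow> ((nat \<times> (int \<Rightarrow> int)) \<times> 'v \<Rightarrow>\<^sub>0 'k) set"
  where "tens n g v = ind.cls n (gen ((n, g), v))"

lemma tens_closed: "g \<in> FI_hom FI_BC n n \<Longrightarrow> v \<in> carrier (fobj V n) \<Longrightarrow> tens n g v \<in> carrier (fobj (IndD V) n)"
  unfolding tens_def IndD_ob by (intro ind.cls_closed gen_closed) (auto simp: IndD_gens_def IndD_index_def)

lemma tens_add:
  assumes "g \<in> FI_hom FI_BC n n" "v \<in> carrier (fobj V n)" "w \<in> carrier (fobj V n)"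
  shows "tens n g (v \<oplus>\<^bsub>fobj V n\<^esub> w) = tens n g v \<oplus>\<^bsub>fobj (IndD V) n\<^esub> tens n g w"
  unfolding tens_def IndD_ob ind.quot_add
  using lin_relsI(1)[of "(n, g)" "IndD_index n" v "\<lambda>t. fobj V (fst t)" w] assms
  by (intro ind.cls_eq_rel) (simp add: IndD_rels_def IndD_index_def diff_diff_eq)

lemma tens_smult:
  assumes "g \<in> FI_hom FI_BC n n" "v \<in> carrier (fobj V n)"
  shows "tens n g (c \<odot>\<^bsub>fobj V n\<^esub> v) = c \<odot>\<^bsub>fobj (IndD V) n\<^esub> tens n g v"
  unfolding tens_def IndD_ob ind.quot_smult scale_single
  using lin_relsI(2)[of "(n, g)" "IndD_index n" v "\<lambda>t. fobj V (fst t)" c] assms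
  by (intro ind.cls_eq_rel) (simp add: IndD_rels_def IndD_index_def)

lemma tens_lin: "g \<in> FI_hom FI_BC n n \<Longrightarrow> tens n g \<in> lin_maps (fobj V n) (fobj (IndD V) n)"
  using tens_closed tens_add tens_smult by (auto simp: lin_maps_def)

lemma tens_rel:
  assumes "f \<in> FI_hom FI_BC s n" "g \<in> FI_hom FI_D q s" "v \<in> carrier (fobj V q)"
  shows "ind.cls n (gen ((q, compose (ob q) f g), v)) = ind.cls n (gen ((s, f), fmap V q s g v))"
  by (rule sym, rule ind.cls_eq_rel) (use assms in \<open>auto simp: IndD_rels_def\<close>)

lemma tens_compose:
  assumes "f \<in> FI_hom FI_BC n n" "g \<in> FI_hom FI_D n n" "v \<in> carrier (fobj V n)"
  shows "tens n (compose (ob n) f g) v = tens n f (fmap V n n g v)"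
  unfolding tens_def by (rule tens_rel[OF assms])

text \<open>Because m < n, both f and s f are morphisms of type D, so both can be moved across the
  tensor sign.\<close>

lemma tens_below:
  assumes "s \<in> FI_hom FI_BC n n" "f \<in> FI_hom FI_BC m n" "m < n" "v \<in> carrier (fobj V m)"
  shows "tens n s (fmap V m n f v) = tens n (\<lambda>a\<in>ob n. a) (fmap V m n (compose (ob m) s f) v)"
proof -
  have sf: "compose (ob m) s f \<in> FI_hom FI_BC m n" by (rule compose_FI[OF assms(2,1)])
  have D: "f \<in> FI_hom FI_D m n" "compose (ob m) s f \<in> FI_hom FI_D m n"
    using assms(2,3) sf FI_D_less by auto
  have "tens n s (fmap V m n f v) = ind.cls n (gen ((m, compose (ob m) s f), v))"
    unfolding tens_def by (rule tens_rel[OF assms(1) D(1) assms(4), symmetric])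
  also have "\<dots> = ind.cls n (gen ((m, compose (ob m) (\<lambda>a\<in>ob n. a) (compose (ob m) s f)), v))"
    by (simp only: compose_id_FI[OF sf])
  also have "\<dots> = tens n (\<lambda>a\<in>ob n. a) (fmap V m n (compose (ob m) s f) v)"
    unfolding tens_def by (rule tens_rel[OF id_FI D(2) assms(4)])
  finally show ?thesis .
qed

lemma tens_act:
  assumes h: "h \<in> FI_hom FI_BC n n"
  shows "fmap (IndD V) n n h (tens n g v) = tens n (compose (ob n) h g) v"
  unfolding tens_def IndD_map_cls[OF h] by simp

lemma IndD_carrier: "carrier (fobj (IndD V) n) = ind.cls n ` carrier (free_module (IndD_gens V n))"
  unfolding IndD_ob by (rule ind.quot_carrier)

lemma IndD_map_linear:
  assumes h: "h \<in> FI_hom FI_BC n n" and x: "x \<in> carrier (fobj (IndD V) n)" "y \<in> carrier (fobj (IndD V) n)"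
  shows "fmap (IndD V) n n h (x \<oplus>\<^bsub>fobj (IndD V) n\<^esub> y) = fmap (IndD V) n n h x \<oplus>\<^bsub>fobj (IndD V) n\<^esub> fmap (IndD V) n n h y"
    "fmap (IndD V) n n h (c \<odot>\<^bsub>fobj (IndD V) n\<^esub> x) = c \<odot>\<^bsub>fobj (IndD V) n\<^esub> fmap (IndD V) n n h x"
proof -
  obtain p q where pq: "x = ind.cls n p" "y = ind.cls n q" using x by (auto simp: IndD_carrier)
  show "fmap (IndD V) n n h (x \<oplus>\<^bsub>fobj (IndD V) n\<^esub> y) = fmap (IndD V) n n h x \<oplus>\<^bsub>fobj (IndD V) n\<^esub> fmap (IndD V) n n h y"
    "fmap (IndD V) n n h (c \<odot>\<^bsub>fobj (IndD V) n\<^esub> x) = c \<odot>\<^bsub>fobj (IndD V) n\<^esub> fmap (IndD V) n n h x"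
    unfolding pq IndD_ob ind.quot_add ind.quot_smult
    by (simp_all only: IndD_map_cls[OF h] ind.quot_add ind.quot_smult free_map_add free_map_scale)
qed

lemma IndD_map_comp:
  assumes g: "g \<in> FI_hom FI_BC n n" and h: "h \<in> FI_hom FI_BC n n" and x: "x \<in> carrier (fobj (IndD V) n)"
  shows "fmap (IndD V) n n (compose (ob n) g h) x = fmap (IndD V) n n g (fmap (IndD V) n n h x)"
proof -
  obtain p where p: "x = ind.cls n p" "p \<in> carrier (free_module (IndD_gens V n))" using x by (auto simp: IndD_carrier)
  have "free_map (\<lambda>((s, f), v). ((s, compose (ob s) (compose (ob n) g h) f), v)) p
      = free_map ((\<lambda>((s, f), v). ((s, compose (ob s) g f), v)) \<circ> (\<lambda>((s, f), v). ((s, compose (ob s) h f), v))) p"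
  proof (rule free_map_cong, goal_cases)
    case (1 y)
    then have "y \<in> IndD_gens V n" using p(2) by (auto simp: free_module_def)
    then show ?case by (auto simp: IndD_gens_def IndD_index_def compose_assoc_FI)
  qed
  then show ?thesis 
    unfolding p(1) IndD_map_cls[OF g] IndD_map_cls[OF h] IndD_map_cls[OF compose_FI[OF h g]] free_map_comp by simp
qed

text \<open>Below degree \<open>n\<close> every morphism of type \<open>BC\<close> is one of type \<open>D\<close>, so only two cosets are needed.\<close>

lemma IndD_decomp:
  assumes i: "i \<in> {1..n}" and x: "x \<in> carrier (fobj (IndD V) n)"
  shows "\<exists>v\<in>carrier (fobj V n). \<exists>w\<in>carrier (fobj V n).
    x = tens n (\<lambda>a\<in>ob n. a) v \<oplus>\<^bsub>fobj (IndD V) n\<^esub> tens n (flip n i) w"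
proof -
  let ?N = "fobj (IndD V) n" and ?e = "\<lambda>a\<in>ob n. a" and ?s = "flip n i"
  interpret N: Module.module scalars ?N by (rule IndD_module)
  interpret Vn: Module.module scalars "fobj V n" by (rule FI_module.is_module[OF V])
  let ?P = "\<lambda>x. \<exists>v\<in>carrier (fobj V n). \<exists>w\<in>carrier (fobj V n). x = tens n ?e v \<oplus>\<^bsub>?N\<^esub> tens n ?s w"
  note cl = tens_closed[OF id_FI] tens_closed[OF flip_FI]
  have tens_zero: "tens n g \<zero>\<^bsub>fobj V n\<^esub> = \<zero>\<^bsub>?N\<^esub>" if g: "g \<in> FI_hom FI_BC n n" for g
    using tens_smult[OF g Vn.zero_closed, of 0] module_zero_smult[OF FI_module.is_module[OF V] Vn.zero_closed]
      module_zero_smult[OF IndD_module tens_closed[OF g Vn.zero_closed]] by simp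
  have P1: "?P (tens n ?e v)" if "v \<in> carrier (fobj V n)" for v
    by (rule bexI[OF bexI[OF _ Vn.zero_closed] that]) (use that cl in \<open>simp add: tens_zero flip_FI\<close>)
  have P2: "?P (tens n ?s v)" if "v \<in> carrier (fobj V n)" for v
    by (rule bexI[OF bexI[OF _ that] Vn.zero_closed]) (use that cl in \<open>simp add: tens_zero id_FI\<close>)
  have P_add: "?P (x \<oplus>\<^bsub>?N\<^esub> y)" if P: "?P x" "?P y" for x y
  proof -
    obtain v w v' w' where v: "v \<in> carrier (fobj V n)" "w \<in> carrier (fobj V n)" "v' \<in> carrier (fobj V n)" "w' \<in> carrier (fobj V n)"
      and xy: "x = tens n ?e v \<oplus>\<^bsub>?N\<^esub> tens n ?s w" "y = tens n ?e v' \<oplus>\<^bsub>?N\<^esub> tens n ?s w'"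
      using P by (elim bexE) (rule that)
    have "x \<oplus>\<^bsub>?N\<^esub> y = tens n ?e (v \<oplus>\<^bsub>fobj V n\<^esub> v') \<oplus>\<^bsub>?N\<^esub> tens n ?s (w \<oplus>\<^bsub>fobj V n\<^esub> w')"
      unfolding xy using v cl by (simp add: tens_add id_FI flip_FI N.M.a_ac)
    then show ?thesis using Vn.M.a_closed[OF v(1,3)] Vn.M.a_closed[OF v(2,4)] by (intro bexI)
  qed
  have P_smult: "?P (c \<odot>\<^bsub>?N\<^esub> x)" if P: "?P x" for c x
  proof -
    obtain v w where v: "v \<in> carrier (fobj V n)" "w \<in> carrier (fobj V n)"
      and x: "x = tens n ?e v \<oplus>\<^bsub>?N\<^esub> tens n ?s w" using P by (elim bexE) (rule that)
    have "c \<odot>\<^bsub>?N\<^esub> x = tens n ?e (c \<odot>\<^bsub>fobj V n\<^esub> v) \<oplus>\<^bsub>?N\<^esub> tens n ?s (c \<odot>\<^bsub>fobj V n\<^esub> w)"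
      unfolding x using v cl N.smult_r_distr[of c] by (simp add: tens_smult id_FI flip_FI)
    then show ?thesis using module_closed(2)[OF FI_module.is_module[OF V]] v by (intro bexI)
  qed
  have P_gen: "?P (ind.cls n (gen ((t, f), v)))"
    if f: "f \<in> FI_hom FI_BC t n" and v: "v \<in> carrier (fobj V t)" for t f v
  proof (cases "t = n")
    case False
    then have "t < n" using FI_le[OF f] by simp
    then have D: "f \<in> FI_hom FI_D t n" using f FI_D_less by blast
    have "ind.cls n (gen ((t, f), v)) = ind.cls n (gen ((t, compose (ob t) ?e f), v))"
      by (simp only: compose_id_FI[OF f])
    also have "\<dots> = tens n ?e (fmap V t n f v)" unfolding tens_def by (rule tens_rel[OF id_FI D v])
    finally show ?thesis using P1[OF V_closed[OF D v]] by simp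
  next
    case True
    note f' = f[unfolded True] and v' = v[unfolded True]
    show ?thesis
    proof (cases "eps n f = 1")
      case eps: True
      then have D: "f \<in> FI_hom FI_D n n" using f' by (simp add: FI_D_iff)
      have "tens n f v = tens n ?e (fmap V n n f v)"
        using tens_compose[OF id_FI D v'] compose_id_FI[OF f'] by simp
      then show ?thesis using P1[OF V_closed[OF D v']] True by (simp add: tens_def)
    next
      case False
      \<comment> \<open>An element of sign -1 is written as s g with g = s f of sign 1.\<close>
      define g where "g = compose (ob n) ?s f"
      have g: "g \<in> FI_hom FI_BC n n" unfolding g_def by (rule compose_FI[OF f' flip_FI])
      have "eps n g = 1" using eps_compose[OF f' flip_FI] eps_flip[OF i] eps_cases[of n f] False by (auto simp: g_def)
      then have D: "g \<in> FI_hom FI_D n n" using g by (simp add: FI_D_iff)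
      have "compose (ob n) ?s g = f"
        unfolding g_def by (simp add: compose_assoc_FI[OF f'] flip_flip compose_id_FI[OF f'])
      then have "tens n f v = tens n ?s (fmap V n n g v)" using tens_compose[OF flip_FI D v', of i] by simp
      then show ?thesis using P2[OF V_closed[OF D v']] True by (simp add: tens_def)
    qed
  qed
  obtain p where p: "x = ind.cls n p" "p \<in> carrier (free_module (IndD_gens V n))" using x by (auto simp: IndD_carrier)
  have "Poly_Mapping.keys p \<subseteq> IndD_gens V n" using p(2) by (simp add: free_module_def)
  then have "?P (ind.cls n p)"
  proof (induction p rule: poly_mapping_add_induct)
    case zero
    have "ind.cls n 0 = tens n ?e \<zero>\<^bsub>fobj V n\<^esub>" unfolding tens_zero[OF id_FI] by (simp add: IndD_ob ind.quot_zero)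
    then show ?case using P1[OF Vn.zero_closed] by (simp only:)
  next
    case (single x c)
    obtain t f v where x: "x = ((t, f), v)" by (metis surj_pair)
    then have "f \<in> FI_hom FI_BC t n" "v \<in> carrier (fobj V t)" using single by (auto simp: IndD_gens_def IndD_index_def)
    from P_smult[OF P_gen[OF this], of c]
    have "?P (ind.cls n (Poly_Mapping.single ((t, f), v) c))" by (simp add: IndD_ob ind.quot_smult scale_single)
    then show ?case unfolding x .
  next
    case (add p q)
    have eq: "ind.cls n p \<oplus>\<^bsub>?N\<^esub> ind.cls n q = ind.cls n (p + q)" by (simp add: IndD_ob ind.quot_add)
    from P_add[OF add(3,4), unfolded eq] show ?case .
  qed
  then show ?thesis using p(1) by simp
qed

end

section \<open>Finite sums, and averaging against a sign character\<close>

lemma lin_maps_D: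
  assumes "\<phi> \<in> lin_maps M N" "x \<in> carrier M"
  shows "\<phi> x \<in> carrier N" "y \<in> carrier M \<Longrightarrow> \<phi> (x \<oplus>\<^bsub>M\<^esub> y) = \<phi> x \<oplus>\<^bsub>N\<^esub> \<phi> y"
    "\<phi> (c \<odot>\<^bsub>M\<^esub> x) = c \<odot>\<^bsub>N\<^esub> \<phi> x"
  using assms by (auto simp: lin_maps_def)

lemma lin_maps_zero:
  assumes "Module.module scalars M" "Module.module scalars N" "\<phi> \<in> lin_maps M N"
  shows "\<phi> \<zero>\<^bsub>M\<^esub> = \<zero>\<^bsub>N\<^esub>"
proof -
  note z = module_closed(3)[OF assms(1)]
  have "\<phi> \<zero>\<^bsub>M\<^esub> = \<phi> (0 \<odot>\<^bsub>M\<^esub> \<zero>\<^bsub>M\<^esub>)" by (simp only: module_zero_smult[OF assms(1) z])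
  also have "\<dots> = \<zero>\<^bsub>N\<^esub>"
    by (simp only: lin_maps_D(3)[OF assms(3) z] module_zero_smult[OF assms(2) lin_maps_D(1)[OF assms(3) z]])
  finally show ?thesis .
qed

lemma lin_maps_finsum:
  assumes M: "Module.module scalars M" and N: "Module.module scalars N" and \<phi>: "\<phi> \<in> lin_maps M N"
    and F: "finite F" "\<And>i. i \<in> F \<Longrightarrow> f i \<in> carrier M"
  shows "\<phi> (\<Oplus>\<^bsub>M\<^esub>i\<in>F. f i) = (\<Oplus>\<^bsub>N\<^esub>i\<in>F. \<phi> (f i))"
proof -
  interpret M: Module.module scalars M by fact
  interpret N: Module.module scalars N by fact
  show ?thesis
    using F
  proof (induction F)
    case empty
    show ?case by (simp add: lin_maps_zero[OF M N \<phi>])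
  next
    case (insert x F)
    have fx: "f x \<in> carrier M" and fF: "f \<in> F \<rightarrow> carrier M" using insert by auto
    have "\<phi> (\<Oplus>\<^bsub>M\<^esub>i\<in>insert x F. f i) = \<phi> (f x \<oplus>\<^bsub>M\<^esub> (\<Oplus>\<^bsub>M\<^esub>i\<in>F. f i))"
      by (simp only: M.finsum_insert[OF insert(1,2) fF fx])
    also have "\<dots> = \<phi> (f x) \<oplus>\<^bsub>N\<^esub> (\<Oplus>\<^bsub>N\<^esub>i\<in>F. \<phi> (f i))"
      using lin_maps_D(2)[OF \<phi> fx M.finsum_closed[OF fF]] insert by simp
    also have "\<dots> = (\<Oplus>\<^bsub>N\<^esub>i\<in>insert x F. \<phi> (f i))"
      by (rule N.finsum_insert[OF insert(1,2), symmetric]) (use fF fx lin_maps_D(1)[OF \<phi>] in auto)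
    finally show ?case .
  qed
qed

lemma smult_lin_maps:
  assumes "Module.module scalars M"
  shows "(\<lambda>x. c \<odot>\<^bsub>M\<^esub> x) \<in> lin_maps M M"
proof -
  interpret Module.module scalars M by fact
  have "c \<odot>\<^bsub>M\<^esub> (e \<odot>\<^bsub>M\<^esub> x) = e \<odot>\<^bsub>M\<^esub> (c \<odot>\<^bsub>M\<^esub> x)" if "x \<in> carrier M" for e x
    using smult_assoc1[of c e x] smult_assoc1[of e c x] that by (simp add: mult.commute)
  then show ?thesis using smult_r_distr[of c] module_closed[OF assms] by (auto simp: lin_maps_def)
qed

lemma finsum_const_smult:
  assumes M: "Module.module scalars M" and F: "finite F" and x: "x \<in> carrier M"
  shows "(\<Oplus>\<^bsub>M\<^esub>i\<in>F. x) = of_nat (card F) \<odot>\<^bsub>M\<^esub> x"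
proof -
  interpret Module.module scalars M by fact
  show ?thesis
    using F
  proof (induction F)
    case empty
    show ?case by (simp add: module_zero_smult[OF M x])
  next
    case (insert a F)
    have "(\<Oplus>\<^bsub>M\<^esub>i\<in>insert a F. x) = x \<oplus>\<^bsub>M\<^esub> (\<Oplus>\<^bsub>M\<^esub>i\<in>F. x)"
      by (rule M.finsum_insert) (use insert x in auto)
    also have "\<dots> = 1 \<odot>\<^bsub>M\<^esub> x \<oplus>\<^bsub>M\<^esub> of_nat (card F) \<odot>\<^bsub>M\<^esub> x" using insert(3) smult_one[OF x] by simp
    also have "\<dots> = (1 + of_nat (card F)) \<odot>\<^bsub>M\<^esub> x" using smult_l_distr[of 1 "of_nat (card F)" x] x by simp
    finally show ?case using insert by simp
  qed
qed

lemma compose_left_cancel: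
  assumes "h \<in> FI_hom FI_BC n n" "v \<in> FI_hom FI_BC n n" "w \<in> FI_hom FI_BC n n"
    "compose (ob n) h v = compose (ob n) h w"
  shows "v = w"
proof (rule extensionalityI[OF FI_ext[OF assms(2)] FI_ext[OF assms(3)]])
  fix a assume a: "a \<in> ob n"
  have "h (v a) = h (w a)" using fun_cong[OF assms(4), of a] a by (simp add: compose_def)
  then show "v a = w a" using FI_inj[OF assms(1)] FI_ob[OF assms(2) a] FI_ob[OF assms(3) a] by blast
qed

text \<open>K will consist of even elements that act on a vector by signs, and \<chi> will be these
  signs. Being its own inverse, \<chi> can be used in the average without inverting group
  elements.\<close>

locale sign_character =
  fixes n :: nat and K :: "(int \<Rightarrow> int) set" and \<chi> :: "(int \<Rightarrow> int) \<Rightarrow> 'k::field"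
  assumes K: "K \<subseteq> FI_hom FI_D n n"
    and K_mult: "g \<in> K \<Longrightarrow> h \<in> K \<Longrightarrow> compose (ob n) g h \<in> K \<and> \<chi> (compose (ob n) g h) = \<chi> g * \<chi> h"
    and \<chi>_sq: "h \<in> K \<Longrightarrow> \<chi> h * \<chi> h = 1"
begin

lemma K_D: "h \<in> K \<Longrightarrow> h \<in> FI_hom FI_D n n" "h \<in> K \<Longrightarrow> h \<in> FI_hom FI_BC n n"
  using K FI_BC by blast+

lemma finite_K: "finite K"
  by (rule finite_subset[OF _ finite_FI]) (use K_D(2) in blast)

lemma translate_K:
  assumes "h \<in> K"
  shows "inj_on (compose (ob n) h) K" "compose (ob n) h ` K = K"
proof -
  show inj: "inj_on (compose (ob n) h) K"
    using compose_left_cancel K_D(2) assms by (meson inj_onI)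
  show "compose (ob n) h ` K = K"
    by (rule endo_inj_surj[OF finite_K _ inj]) (use K_mult[OF assms] in blast)
qed

text \<open>Up to the factor \<open>card K\<close>, the projection to the vectors on which K acts
  through \<chi>.\<close>

definition avg :: "('k, 'v) FI_diagram \<Rightarrow> 'v \<Rightarrow> 'v"
  where "avg V v = (\<Oplus>\<^bsub>fobj V n\<^esub>w\<in>K. \<chi> w \<odot>\<^bsub>fobj V n\<^esub> fmap V n n w v)"

context
  fixes V :: "('k, 'v) FI_diagram"
  assumes V: "FI_module FI_D V"
begin

lemma avg_closed:
  assumes "v \<in> carrier (fobj V n)"
  shows "avg V v \<in> carrier (fobj V n)"
proof -
  interpret M: Module.module scalars "fobj V n" by (rule FI_module.is_module[OF V])
  show ?thesis unfolding avg_def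
    using module_closed(2)[OF M.module_axioms V_closed[OF V K_D(1) assms]] by (intro M.finsum_closed) auto
qed

text \<open>Left translation by h permutes the summands and multiplies their coefficients by
  \<chi>(h).\<close>

lemma avg_eigen:
  assumes h: "h \<in> K" and v: "v \<in> carrier (fobj V n)"
  shows "fmap V n n h (avg V v) = \<chi> h \<odot>\<^bsub>fobj V n\<^esub> avg V v"
proof -
  interpret M: Module.module scalars "fobj V n" by (rule FI_module.is_module[OF V])
  note mod = M.module_axioms
  let ?M = "fobj V n" and ?f = "\<lambda>w. \<chi> w \<odot>\<^bsub>fobj V n\<^esub> fmap V n n w v"
  have wv: "fmap V n n w v \<in> carrier ?M" if "w \<in> K" for w by (rule V_closed[OF V K_D(1)[OF that] v])
  have cl: "?f w \<in> carrier ?M" if "w \<in> K" for w by (rule module_closed(2)[OF mod wv[OF that]])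
  have "\<chi> h \<odot>\<^bsub>?M\<^esub> avg V v = (\<Oplus>\<^bsub>?M\<^esub>w\<in>K. \<chi> h \<odot>\<^bsub>?M\<^esub> ?f w)"
    unfolding avg_def by (rule lin_maps_finsum[OF mod mod smult_lin_maps[OF mod] finite_K cl])
  also have "\<dots> = (\<Oplus>\<^bsub>?M\<^esub>w\<in>K. \<chi> h \<odot>\<^bsub>?M\<^esub> ?f (compose (ob n) h w))"
    using M.finsum_reindex[of "\<lambda>w. \<chi> h \<odot>\<^bsub>?M\<^esub> ?f w" "compose (ob n) h" K] translate_K[OF h]
      module_closed(2)[OF mod cl] by simp
  also have "\<dots> = (\<Oplus>\<^bsub>?M\<^esub>w\<in>K. fmap V n n h (?f w))"
  proof (rule M.finsum_cong')
    show "(\<lambda>w. fmap V n n h (?f w)) \<in> K \<rightarrow> carrier ?M" using V_closed[OF V K_D(1)[OF h] cl] by blast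
    fix w assume w: "w \<in> K"
    have "\<chi> h * \<chi> (compose (ob n) h w) = \<chi> w"
      using K_mult[OF h w] \<chi>_sq[OF h] by (simp add: mult.assoc[symmetric])
    moreover have "fmap V n n (compose (ob n) h w) v = fmap V n n h (fmap V n n w v)"
      by (rule FI_module.map_comp[OF V K_D(1)[OF w] K_D(1)[OF h] v])
    moreover have "compose (ob n) h w \<in> K" using K_mult[OF h w] by blast
    ultimately show "\<chi> h \<odot>\<^bsub>?M\<^esub> ?f (compose (ob n) h w) = fmap V n n h (?f w)"
      using M.smult_assoc1[of "\<chi> h" "\<chi> (compose (ob n) h w)" "fmap V n n (compose (ob n) h w) v"]
        V_closed[OF V K_D(1)[OF h] wv[OF w]] lin_maps_D(3)[OF FI_module.map_linear[OF V K_D(1)[OF h]] wv[OF w]] by simp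
  qed simp
  also have "\<dots> = fmap V n n h (avg V v)"
    unfolding avg_def
    by (rule lin_maps_finsum[OF mod mod FI_module.map_linear[OF V K_D(1)[OF h]] finite_K cl, symmetric])
  finally show ?thesis by simp
qed

lemma tens_avg:
  assumes g: "g \<in> FI_hom FI_BC n n" and v: "v \<in> carrier (fobj V n)"
  shows "tens V n g (avg V v) = (\<Oplus>\<^bsub>fobj (IndD V) n\<^esub>w\<in>K. \<chi> w \<odot>\<^bsub>fobj (IndD V) n\<^esub> tens V n (compose (ob n) g w) v)"
proof -
  interpret N: Module.module scalars "fobj (IndD V) n" by (rule IndD_module[OF V])
  note modV = FI_module.is_module[OF V]
  note wv = V_closed[OF V K_D(1) v]
  have "tens V n g (avg V v)
      = (\<Oplus>\<^bsub>fobj (IndD V) n\<^esub>w\<in>K. tens V n g (\<chi> w \<odot>\<^bsub>fobj V n\<^esub> fmap V n n w v))"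
    unfolding avg_def
    by (rule lin_maps_finsum[OF modV IndD_module[OF V] tens_lin[OF V g] finite_K module_closed(2)[OF modV wv]])
  also have "\<dots> = (\<Oplus>\<^bsub>fobj (IndD V) n\<^esub>w\<in>K. \<chi> w \<odot>\<^bsub>fobj (IndD V) n\<^esub> tens V n (compose (ob n) g w) v)"
  proof (rule N.finsum_cong')
    show "(\<lambda>w. \<chi> w \<odot>\<^bsub>fobj (IndD V) n\<^esub> tens V n (compose (ob n) g w) v) \<in> K \<rightarrow> carrier (fobj (IndD V) n)"
      using module_closed(2)[OF IndD_module[OF V] tens_closed[OF V compose_FI[OF K_D(2) g] v]] by blast
    show "tens V n g (\<chi> w \<odot>\<^bsub>fobj V n\<^esub> fmap V n n w v)
        = \<chi> w \<odot>\<^bsub>fobj (IndD V) n\<^esub> tens V n (compose (ob n) g w) v" if "w \<in> K" for w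
      using tens_smult[OF V g wv[OF that], of "\<chi> w"] tens_compose[OF V g K_D(1)[OF that] v] by simp
  qed simp
  finally show ?thesis .
qed

text \<open>\<psi> is averaged inside the induced module. In its second component w s is rewritten
  as s (s w s); conjugation by s preserves K and \<chi>, so that this component becomes s applied to
  an average as well.\<close>

lemma IndD_eigen_decomp:
  fixes i :: nat
  defines "s \<equiv> flip n i" and "N \<equiv> fobj (IndD V) n"
  assumes i: "i \<in> {1..n}" and conj: "\<And>w. w \<in> K \<Longrightarrow> compose (ob n) s (compose (ob n) w s) \<in> K \<and>
      \<chi> (compose (ob n) s (compose (ob n) w s)) = \<chi> w"
    and \<psi>: "\<psi> \<in> carrier N" and eig: "\<And>w. w \<in> K \<Longrightarrow> fmap (IndD V) n n w \<psi> = \<chi> w \<odot>\<^bsub>N\<^esub> \<psi>"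
  shows "\<exists>v0\<in>carrier (fobj V n). \<exists>v1\<in>carrier (fobj V n).
    of_nat (card K) \<odot>\<^bsub>N\<^esub> \<psi> = tens V n (\<lambda>a\<in>ob n. a) (avg V v0) \<oplus>\<^bsub>N\<^esub> tens V n s (avg V v1)"
proof -
  interpret N: Module.module scalars N unfolding N_def by (rule IndD_module[OF V])
  note modN = N.module_axioms
  let ?e = "\<lambda>a\<in>ob n. a" and ?\<tau> = "fmap (IndD V) n n"
  have s: "s \<in> FI_hom FI_BC n n" unfolding s_def by (rule flip_FI)
  have ss: "compose (ob n) s s = ?e" unfolding s_def by (rule flip_flip)
  from IndD_decomp[OF V i \<psi>[unfolded N_def]] obtain v0 v1
    where v: "v0 \<in> carrier (fobj V n)" "v1 \<in> carrier (fobj V n)"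
      and dec: "\<psi> = tens V n ?e v0 \<oplus>\<^bsub>N\<^esub> tens V n s v1"
    unfolding N_def s_def by blast
  note cl = tens_closed[OF V, where n = n, folded N_def]
  let ?A = "\<lambda>w. \<chi> w \<odot>\<^bsub>N\<^esub> tens V n w v0" and ?B = "\<lambda>w. \<chi> w \<odot>\<^bsub>N\<^esub> tens V n (compose (ob n) w s) v1"
  have A: "?A w \<in> carrier N" and B: "?B w \<in> carrier N" if "w \<in> K" for w
    using module_closed(2)[OF modN cl[OF K_D(2)[OF that] v(1)]]
      module_closed(2)[OF modN cl[OF compose_FI[OF s K_D(2)[OF that]] v(2)]] by blast+
  have "of_nat (card K) \<odot>\<^bsub>N\<^esub> \<psi> = (\<Oplus>\<^bsub>N\<^esub>w\<in>K. \<psi>)"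
    by (rule finsum_const_smult[OF modN finite_K \<psi>, symmetric])
  also have "\<dots> = (\<Oplus>\<^bsub>N\<^esub>w\<in>K. ?A w \<oplus>\<^bsub>N\<^esub> ?B w)"
  proof (rule N.M.finsum_cong')
    show "(\<lambda>w. ?A w \<oplus>\<^bsub>N\<^esub> ?B w) \<in> K \<rightarrow> carrier N" using module_closed(1)[OF modN A B] by blast
    fix w assume w: "w \<in> K"
    note w' = K_D(2)[OF w]
    \<comment> \<open>The summand \<open>\<psi>\<close> equals \<chi>(w) w \<psi>, because \<chi>(w)
      squares to 1.\<close>
    have "\<psi> = \<chi> w \<odot>\<^bsub>N\<^esub> ?\<tau> w \<psi>"
      using eig[OF w] N.smult_assoc1[of "\<chi> w" "\<chi> w" \<psi>] \<chi>_sq[OF w] N.smult_one[OF \<psi>] \<psi> by simp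
    also have "?\<tau> w \<psi> = tens V n w v0 \<oplus>\<^bsub>N\<^esub> tens V n (compose (ob n) w s) v1"
      unfolding dec
      using IndD_map_linear(1)[OF V w' tens_closed[OF V id_FI v(1)] tens_closed[OF V s v(2)], folded N_def]
        tens_act[OF V w', of ?e v0] tens_act[OF V w', of s v1] compose_id_right[OF w'] by simp
    also have "\<chi> w \<odot>\<^bsub>N\<^esub> \<dots> = ?A w \<oplus>\<^bsub>N\<^esub> ?B w"
      using N.smult_r_distr[of "\<chi> w"] cl[OF w' v(1)] cl[OF compose_FI[OF s w'] v(2)] by simp
    finally show "\<psi> = ?A w \<oplus>\<^bsub>N\<^esub> ?B w" .
  qed simp
  also have "\<dots> = (\<Oplus>\<^bsub>N\<^esub>w\<in>K. ?A w) \<oplus>\<^bsub>N\<^esub> (\<Oplus>\<^bsub>N\<^esub>w\<in>K. ?B w)"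
    by (rule N.M.finsum_addf) (use A B in auto)
  also have "(\<Oplus>\<^bsub>N\<^esub>w\<in>K. ?A w) = tens V n ?e (avg V v0)"
    unfolding tens_avg[OF id_FI v(1), folded N_def]
    by (rule N.M.finsum_cong') (use A compose_id_FI[OF K_D(2)] in auto)
  also have "(\<Oplus>\<^bsub>N\<^esub>w\<in>K. ?B w) = tens V n s (avg V v1)"
  proof -
    define \<theta> where "\<theta> w = compose (ob n) s (compose (ob n) w s)" for w
    have \<theta>s: "compose (ob n) (\<theta> w) s = compose (ob n) s w" if "w \<in> K" for w
    proof -
      have "compose (ob n) (\<theta> w) s = compose (ob n) s (compose (ob n) w (compose (ob n) s s))"
        unfolding \<theta>_def by (simp only: compose_assoc_FI[OF s])
      then show ?thesis by (simp only: ss compose_id_right[OF K_D(2)[OF that]])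
    qed
    have inj: "inj_on \<theta> K"
    proof (rule inj_onI)
      fix u w assume u: "u \<in> K" and w: "w \<in> K" and eq: "\<theta> u = \<theta> w"
      have "compose (ob n) s u = compose (ob n) s w" using \<theta>s[OF u] \<theta>s[OF w] eq by simp
      then show "u = w" by (rule compose_left_cancel[OF s K_D(2)[OF u] K_D(2)[OF w]])
    qed
    have "\<theta> ` K = K" by (rule endo_inj_surj[OF finite_K _ inj]) (use conj in \<open>auto simp: \<theta>_def\<close>)
    then have "(\<Oplus>\<^bsub>N\<^esub>w\<in>K. ?B w) = (\<Oplus>\<^bsub>N\<^esub>w\<in>K. ?B (\<theta> w))"
      using N.M.finsum_reindex[of ?B \<theta> K] inj B by simp
    also have "\<dots> = tens V n s (avg V v1)"
      unfolding tens_avg[OF s v(2), folded N_def]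
    proof (rule N.M.finsum_cong')
      show "(\<lambda>w. \<chi> w \<odot>\<^bsub>N\<^esub> tens V n (compose (ob n) s w) v1) \<in> K \<rightarrow> carrier N"
        using module_closed(2)[OF modN cl[OF compose_FI[OF K_D(2) s] v(2)]] by blast
      show "?B (\<theta> w) = \<chi> w \<odot>\<^bsub>N\<^esub> tens V n (compose (ob n) s w) v1" if "w \<in> K" for w
        using conj[OF that] \<theta>s[OF that] by (simp only: \<theta>_def)
    qed simp
    finally show ?thesis .
  qed
  finally show ?thesis using v by blast
qed

text \<open>The flip \<open>s\<close> has eigenvalue \<open>-c\<close> on \<open>\<psi>\<close>, but it acts on the average by \<open>c\<close>.\<close>

lemma IndD_eigen_zero:
  fixes i :: nat
  defines "s \<equiv> flip n i" and "N \<equiv> fobj (IndD V) n"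
  assumes i: "i \<in> {1..n}" and conj: "\<And>w. w \<in> K \<Longrightarrow> compose (ob n) s (compose (ob n) w s) \<in> K \<and>
      \<chi> (compose (ob n) s (compose (ob n) w s)) = \<chi> w"
    and \<psi>: "\<psi> \<in> carrier N" and eig: "\<And>w. w \<in> K \<Longrightarrow> fmap (IndD V) n n w \<psi> = \<chi> w \<odot>\<^bsub>N\<^esub> \<psi>"
    and s_eig: "fmap (IndD V) n n s \<psi> = (- c) \<odot>\<^bsub>N\<^esub> \<psi>" and c: "c \<noteq> - c"
    and K0: "of_nat (card K) \<noteq> (0 :: 'k)"
    and flip: "\<And>y. \<lbrakk>y \<in> carrier (fobj V n); \<And>h. h \<in> K \<Longrightarrow> fmap V n n h y = \<chi> h \<odot>\<^bsub>fobj V n\<^esub> y\<rbrakk>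
      \<Longrightarrow> tens V n s y = c \<odot>\<^bsub>N\<^esub> tens V n (\<lambda>a\<in>ob n. a) y"
  shows "\<psi> = \<zero>\<^bsub>N\<^esub>"
proof -
  interpret N: Module.module scalars N unfolding N_def by (rule IndD_module[OF V])
  note modN = N.module_axioms
  let ?e = "\<lambda>a\<in>ob n. a" and ?\<tau> = "fmap (IndD V) n n"
  have s: "s \<in> FI_hom FI_BC n n" unfolding s_def by (rule flip_FI)
  note lin = IndD_map_linear[OF V s, folded N_def]
  obtain v0 v1 where v: "v0 \<in> carrier (fobj V n)" "v1 \<in> carrier (fobj V n)"
    and dec: "of_nat (card K) \<odot>\<^bsub>N\<^esub> \<psi> = tens V n ?e (avg V v0) \<oplus>\<^bsub>N\<^esub> tens V n s (avg V v1)"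
    using IndD_eigen_decomp[OF i conj[unfolded s_def] \<psi>[unfolded N_def] eig[unfolded N_def]]
    unfolding N_def s_def by blast
  define z where "z = of_nat (card K) \<odot>\<^bsub>N\<^esub> \<psi>"
  \<comment> \<open>The truth value distinguishes the two components, which are treated
    alike.\<close>
  define y where "y k = tens V n ?e (avg V (if k then v0 else v1))" for k
  have y: "y k \<in> carrier N" "tens V n s (avg V (if k then v0 else v1)) = c \<odot>\<^bsub>N\<^esub> y k" for k
    using tens_closed[OF V id_FI avg_closed, folded N_def] flip[OF avg_closed avg_eigen] v
    unfolding y_def by (cases k; simp)+
  have sy: "?\<tau> s (y k) = c \<odot>\<^bsub>N\<^esub> y k" for k
    using tens_act[OF V s, of ?e] compose_id_right[OF s] y(2)[of k] by (simp add: y_def)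
  have cy: "c \<odot>\<^bsub>N\<^esub> y k \<in> carrier N" for k by (rule module_closed(2)[OF modN y(1)])
  have z: "z = y True \<oplus>\<^bsub>N\<^esub> c \<odot>\<^bsub>N\<^esub> y False" using dec y(2)[of False] by (simp add: z_def y_def)
  have zc: "z \<in> carrier N" unfolding z_def by (rule module_closed(2)[OF modN \<psi>])
  have "?\<tau> s z = c \<odot>\<^bsub>N\<^esub> y True \<oplus>\<^bsub>N\<^esub> c \<odot>\<^bsub>N\<^esub> (c \<odot>\<^bsub>N\<^esub> y False)"
    unfolding z lin(1)[OF y(1) cy] lin(2)[OF y(1) y(1)] sy ..
  also have "\<dots> = c \<odot>\<^bsub>N\<^esub> z" unfolding z using N.smult_r_distr[of c, OF _ y(1) cy] by simp
  finally have 1: "?\<tau> s z = c \<odot>\<^bsub>N\<^esub> z" .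
  have "?\<tau> s z = (- c) \<odot>\<^bsub>N\<^esub> z"
    unfolding z_def lin(2)[OF \<psi> \<psi>] s_eig
    using N.smult_assoc1[of "of_nat (card K)" "- c" \<psi>] N.smult_assoc1[of "- c" "of_nat (card K)" \<psi>] \<psi>
    by (simp add: mult.commute)
  then have "z = \<zero>\<^bsub>N\<^esub>" using smult_cancel[OF modN zc, of c "- c"] 1 c by metis
  then show ?thesis using smult_eq_zero[OF modN \<psi> K0] by (simp add: z_def)
qed

end

end

section \<open>Counting zero columns, and the weight in type D\<close>

text \<open>For a cell below the first row the partner is the first-row cell of its column, which
  exists because no row is longer than the first.\<close>

lemma not_lone:
  assumes \<nu>: "is_partition \<nu>" and t: "t \<in> {1..sum_list \<nu>}" "t \<notin> lone \<nu>"
  shows "\<exists>s\<in>{1..sum_list \<nu>}. s \<noteq> t \<and> snd (cell \<nu> s) = snd (cell \<nu> t)"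
proof (cases "fst (cell \<nu> t) = 0")
  case True
  then show ?thesis using t by (auto simp: lone_def)
next
  case False
  have c: "fst (cell \<nu> t) < length \<nu>" "snd (cell \<nu> t) < \<nu> ! fst (cell \<nu> t)" using cell_mem[OF t(1)] by auto
  have "\<nu> ! fst (cell \<nu> t) \<le> \<nu> ! 0"
    using partition_nth_le[OF \<nu> c(1)] c(1) by (cases \<nu>) (auto simp: first_part_def)
  then have "snd (cell \<nu> t) < \<nu> ! 0" "0 < length \<nu>" using c by linarith+
  then obtain s where s: "s \<in> {1..sum_list \<nu>}" "cell \<nu> s = (0, snd (cell \<nu> t))"
    using cell_ex[of 0 \<nu> "snd (cell \<nu> t)"] by blast
  moreover have "s \<noteq> t"
  proof
    assume "s = t"
    then have "fst (cell \<nu> t) = 0" using s(2) by (metis fst_conv)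
    then show False using False by simp
  qed
  ultimately show ?thesis by (intro bexI[OF _ s(1)]) simp
qed

text \<open>Columns of exponents in \<open>{1..m}\<close> have positive degree, those beyond have even degree. A cell of \<open>\<nu>\<close>
  with a zero column is compensated by another cell in its column, unless it is lone.\<close>

lemma zero_column:
  assumes \<nu>: "is_partition \<nu>" "l = sum_list \<nu>" and M: "M \<in> monomials r (m + l)" and deg: "total_deg M < m + l"
    and parity: "\<And>c. c \<in> {1..m + l} \<Longrightarrow> odd (cdeg c M) \<longleftrightarrow> c \<le> m"
    and anti: "\<And>a b. \<lbrakk>a \<in> {1..l}; b \<in> {1..l}; a \<noteq> b; snd (cell \<nu> a) = snd (cell \<nu> b)\<rbrakk>
      \<Longrightarrow> \<not> (cdeg (a + m) M = 0 \<and> cdeg (b + m) M = 0)"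
  shows "\<exists>t\<in>(\<lambda>t. t + m) ` lone \<nu>. cdeg t M = 0"
proof (rule ccontr)
  assume no: "\<not> ?thesis"
  let ?g = "\<lambda>a. cdeg (a + m) M"
  define Z where "Z = {a \<in> {1..l}. ?g a = 0}"
  define Y where "Y = {a \<in> {1..l}. ?g a \<noteq> 0}"
  have YZ: "Z \<union> Y = {1..l}" "Z \<inter> Y = {}" "finite Z" "finite Y" by (auto simp: Z_def Y_def)
  have "\<forall>a\<in>Z. \<exists>b\<in>{1..l}. b \<noteq> a \<and> snd (cell \<nu> b) = snd (cell \<nu> a)"
  proof
    fix a assume "a \<in> Z"
    then have a: "a \<in> {1..sum_list \<nu>}" "?g a = 0" by (auto simp: Z_def \<nu>(2))
    then have "a \<notin> lone \<nu>" using no by blast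
    from not_lone[OF \<nu>(1) a(1) this] show "\<exists>b\<in>{1..l}. b \<noteq> a \<and> snd (cell \<nu> b) = snd (cell \<nu> a)"
      unfolding \<nu>(2) .
  qed
  then have "\<forall>a\<in>Z. \<exists>b. b \<in> {1..l} \<and> b \<noteq> a \<and> snd (cell \<nu> b) = snd (cell \<nu> a)" by blast
  from bchoice[OF this] obtain h
    where "\<forall>a\<in>Z. h a \<in> {1..l} \<and> h a \<noteq> a \<and> snd (cell \<nu> (h a)) = snd (cell \<nu> a)" by blast
  then have h: "h a \<in> {1..l} \<and> h a \<noteq> a \<and> snd (cell \<nu> (h a)) = snd (cell \<nu> a)" if "a \<in> Z" for a using that by blast
  \<comment> \<open>Companions are distinct and have nonzero columns of exponents, since a column of
    the diagram contains at most one cell with a zero column.\<close>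
  have "card Z \<le> card Y"
  proof (rule card_inj_on_le[OF _ _ YZ(4)])
    show "inj_on h Z"
    proof (rule inj_onI, rule ccontr)
      fix a b assume ab: "a \<in> Z" "b \<in> Z" "h a = h b" "a \<noteq> b"
      then have "snd (cell \<nu> a) = snd (cell \<nu> b)" using h by metis
      then show False using anti[of a b] ab by (auto simp: Z_def)
    qed
    show "h ` Z \<subseteq> Y"
    proof
      fix b assume "b \<in> h ` Z"
      then obtain a where a: "a \<in> Z" "b = h a" by blast
      then show "b \<in> Y" using anti[of "h a" a] h[OF a(1)] by (auto simp: Z_def Y_def)
    qed
  qed
  moreover have "card {1..l} = card Z + card Y" using card_Un_disjoint[OF YZ(3,4,2)] YZ(1) by simp
  \<comment> \<open>At least half of the last l columns are nonzero, and being even each has degree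
    at least 2. Together with the m odd columns this gives degree at least m + l.\<close>
  ultimately have "l \<le> (\<Sum>a\<in>Y. 2)" by simp
  also have "\<dots> \<le> (\<Sum>a\<in>Y. ?g a)"
  proof (rule sum_mono)
    fix a assume "a \<in> Y"
    then have "?g a \<noteq> 0" "even (?g a)" using parity[of "a + m"] by (auto simp: Y_def)
    then show "2 \<le> ?g a" by presburger
  qed
  also have "\<dots> \<le> (\<Sum>a\<in>{1..l}. ?g a)" by (rule sum_mono2) (auto simp: Y_def)
  also have "\<dots> = (\<Sum>a\<in>{m + 1..m + l}. cdeg a M)"
    by (rule sum.reindex_bij_witness[of _ "\<lambda>a. a - m" "\<lambda>a. a + m"]) auto
  finally have 1: "l \<le> (\<Sum>a\<in>{m + 1..m + l}. cdeg a M)" .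
  have "(\<Sum>a\<in>{1..m}. 1) \<le> (\<Sum>a\<in>{1..m}. cdeg a M)"
  proof (rule sum_mono)
    fix a assume "a \<in> {1..m}"
    then have "odd (cdeg a M)" using parity[of a] by auto
    then show "1 \<le> cdeg a M" by (cases "cdeg a M") auto
  qed
  moreover have "(\<Sum>a\<in>{1..m + l}. cdeg a M) = (\<Sum>a\<in>{1..m}. cdeg a M) + (\<Sum>a\<in>{m + 1..m + l}. cdeg a M)"
    by (rule sum.ub_add_nat) simp
  ultimately show False using 1 deg total_deg_cdeg[OF M] by simp
qed

lemma push_flip:
  fixes U :: "monomial \<Rightarrow> 'k::field"
  assumes f: "f \<in> FI_hom FI_BC m n" and W: "W \<in> monomials r n"
  shows "push m (compose (ob m) (flip n i) f) U W = (- 1) ^ cdeg i W * push m f U W"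
proof -
  have "poly_pull n (flip n i) (gen W) = scale ((- 1) ^ cdeg i W) (gen W :: 'k mpoly)"
    using pull_monomial[OF flip_FI W, of i "1 :: 'k"]
    by (simp add: transport_flip[OF W] tsgn_flip[OF W] scale_single)
  then have "poly_pull m (compose (ob m) (flip n i) f) (gen W)
      = scale ((- 1) ^ cdeg i W) (poly_pull m f (gen W) :: 'k mpoly)"
    by (simp only: poly_pull_comp[OF f flip_FI poly.single_closed[OF W]] poly_pull_scale)
  then show ?thesis
    by (simp add: push_def lin_ext_scale)
qed

context mono_grading
begin

lemma vals_finsum:
  assumes j: "j \<in> I" and F: "finite F" "\<And>i. i \<in> F \<Longrightarrow> f i \<in> carrier (fobj (dualp W j) n :: ('k::field, _) module)"
  shows "vals W j n (\<Oplus>\<^bsub>fobj (dualp W j) n\<^esub>i\<in>F. f i) = (\<lambda>M. \<Sum>i\<in>F. vals W j n (f i) M)"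
proof -
  interpret M: Module.module scalars "fobj (dualp W j) n :: ('k, _) module" by (rule dualp_module[OF j])
  show ?thesis
    using F
  proof (induction F)
    case (insert x F)
    have fx: "f x \<in> carrier (fobj (dualp W j) n)" and fF: "f \<in> F \<rightarrow> carrier (fobj (dualp W j) n)"
      using insert by auto
    show ?case unfolding M.finsum_insert[OF insert(1,2) fF fx] vals_add using insert by simp
  qed (simp add: vals_zero)
qed

text \<open>A vector coming from \<open>n - 1\<close> can be moved past the flip, which then acts on the exponents.\<close>

lemma tens_flip:
  fixes y :: "'k::field mpoly set \<Rightarrow> 'k" and j :: 'j
  defines "V \<equiv> dualp FI_D j :: ('k, 'k mpoly set \<Rightarrow> 'k) FI_diagram"
  assumes char: "CHAR('k) = 0" and d: "\<And>M. dg M = j \<Longrightarrow> total_deg M = d" and dn: "d < n"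
    and y: "y \<in> carrier (fobj V n)" and T: "T \<subseteq> {1..n}"
    and parity: "\<And>M c. vals FI_D j n y M \<noteq> 0 \<Longrightarrow> c \<in> {1..n} \<Longrightarrow> odd (cdeg c M) \<longleftrightarrow> c \<le> m"
    and zero: "\<And>M. vals FI_D j n y M \<noteq> 0 \<Longrightarrow> \<exists>t\<in>T. cdeg t M = 0"
    and sym: "\<And>a b. a \<in> T \<Longrightarrow> b \<in> T \<Longrightarrow> fmap V n n (swap_map n a b) y = 1 \<odot>\<^bsub>fobj V n\<^esub> y"
    and small: "Suc d = n \<Longrightarrow> Suc m = n \<Longrightarrow> d = 0" and j: "j \<in> I" and i: "i \<in> {1..n}"
  shows "tens V n (flip n i) y = (if i \<le> m then - 1 else 1) \<odot>\<^bsub>fobj (IndD V) n\<^esub> tens V n (\<lambda>a\<in>ob n. a) y"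
proof -
  let ?s = "flip n i" and ?e = "\<lambda>a\<in>ob n. a" and ?N = "fobj (IndD V) n"
  have V: "FI_module FI_D V"
    unfolding V_def by (rule graded_co_FI_algebra.dual_piece_FI_module[OF coinv_graded_co_FI j])
  have st: "stab FI_D = FI_BC" by (simp add: stab_def)
  note modV = FI_module.is_module[OF V] and modN = IndD_module[OF V]
  interpret M: Module.module scalars "fobj V n" by (rule modV)
  interpret N: Module.module scalars ?N by (rule modN)
  have finT: "finite T" using T by (rule finite_subset) simp
  have lt: "n - 1 < n" using dn by simp
  obtain u F where u: "u \<in> carrier (fobj V (n - 1))" and F: "\<And>t. t \<in> T \<Longrightarrow> F t \<in> FI_hom FI_BC (n - 1) n"
    and sum: "vals FI_D j n y = (\<lambda>M. \<Sum>t\<in>T. vals FI_D j n (fmap V (n - 1) n (F t) u) M)"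
    unfolding V_def
    by (rule generated_from_below[OF char d dn y[unfolded V_def] T parity zero sym[unfolded V_def] small j]) blast+
  \<comment> \<open>The flip alone is no morphism of type D and does not act on \<open>V\<close>,
    but its composite with a map from n - 1 is one.\<close>
  define G where "G t = compose (ob (n - 1)) ?s (F t)" for t
  have G: "G t \<in> FI_hom FI_BC (n - 1) n" if "t \<in> T" for t unfolding G_def by (rule compose_FI[OF F[OF that] flip_FI])
  have cl: "fmap V (n - 1) n f u \<in> carrier (fobj V n)" if "f \<in> FI_hom FI_BC (n - 1) n" for f
    by (rule V_closed[OF V _ u]) (use that FI_D_less[OF lt] in blast)
  \<comment> \<open>This plays the part of the flip applied to y.\<close>
  define y' where "y' = (\<Oplus>\<^bsub>fobj V n\<^esub>t\<in>T. fmap V (n - 1) n (G t) u)"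
  have y': "y' \<in> carrier (fobj V n)" unfolding y'_def by (rule M.finsum_closed) (use cl G in auto)
  have "vals FI_D j n (\<Oplus>\<^bsub>fobj V n\<^esub>t\<in>T. fmap V (n - 1) n (F t) u) = vals FI_D j n y"
    unfolding sum V_def by (rule vals_finsum[OF j finT]) (use cl F in \<open>simp add: V_def\<close>)
  then have y_eq: "y = (\<Oplus>\<^bsub>fobj V n\<^esub>t\<in>T. fmap V (n - 1) n (F t) u)"
    using vals_inj[of y FI_D j n] y M.finsum_closed[of "\<lambda>t. fmap V (n - 1) n (F t) u" T] cl F
    by (simp add: V_def Pi_def)
  have "tens V n ?s y = (\<Oplus>\<^bsub>?N\<^esub>t\<in>T. tens V n ?s (fmap V (n - 1) n (F t) u))"
    unfolding y_eq by (rule lin_maps_finsum[OF modV modN tens_lin[OF V flip_FI] finT]) (use cl F in blast)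
  also have "\<dots> = (\<Oplus>\<^bsub>?N\<^esub>t\<in>T. tens V n ?e (fmap V (n - 1) n (G t) u))"
    by (rule N.M.finsum_cong')
      (use tens_closed[OF V id_FI cl[OF G]] tens_below[OF V flip_FI F lt u] in \<open>auto simp: G_def\<close>)
  also have "\<dots> = tens V n ?e y'"
    unfolding y'_def by (rule lin_maps_finsum[OF modV modN tens_lin[OF V id_FI] finT, symmetric]) (use cl G in blast)
  finally have 1: "tens V n ?s y = tens V n ?e y'" .
  let ?c = "if i \<le> m then - 1 else 1 :: 'k"
  have "vals FI_D j n y' W = ?c * vals FI_D j n y W" for W
  proof (cases "W \<in> dmon n j")
    case W: True
    then have Wm: "W \<in> monomials r n" by (simp add: dmon_def)
    have push: "vals FI_D j n (fmap V (n - 1) n f u) W = push (n - 1) f (vals FI_D j (n - 1) u) W"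
      if "f \<in> FI_hom FI_BC (n - 1) n" for f
      unfolding V_def by (rule vals_push[OF _ u[unfolded V_def] W]) (use that st in simp)
    \<comment> \<open>At W every summand changes by the same sign, given by the parity of column i,
      and \<open>parity\<close> determines it on the support of y.\<close>
    have "vals FI_D j n y' W = (\<Sum>t\<in>T. vals FI_D j n (fmap V (n - 1) n (G t) u) W)"
      unfolding y'_def V_def by (subst vals_finsum[OF j finT]) (use cl G in \<open>simp_all add: V_def\<close>)
    also have "\<dots> = (\<Sum>t\<in>T. (- 1) ^ cdeg i W * vals FI_D j n (fmap V (n - 1) n (F t) u) W)"
      by (intro sum.cong refl) (simp only: push[OF F] push[OF G], simp only: G_def push_flip[OF F Wm])
    also have "\<dots> = (- 1) ^ cdeg i W * vals FI_D j n y W" unfolding sum by (simp add: sum_distrib_left)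
    also have "\<dots> = ?c * vals FI_D j n y W"
      using parity[of W i] i by (cases "vals FI_D j n y W = 0") (auto simp: minus_one_power_iff)
    finally show ?thesis .
  qed (simp add: vals_def)
  then have "vals FI_D j n y' = vals FI_D j n (?c \<odot>\<^bsub>fobj V n\<^esub> y)" unfolding V_def vals_smult by blast
  then have "y' = ?c \<odot>\<^bsub>fobj V n\<^esub> y"
    by (rule vals_inj[of y' FI_D j n "?c \<odot>\<^bsub>fobj V n\<^esub> y", folded V_def, OF y' module_closed(2)[OF modV y]])
  then show ?thesis unfolding 1 by (simp only: tens_smult[OF V id_FI y])
qed

text \<open>The double flips leave two possibilities: the parities of type BC, or all of them
  reversed. In the first case the last l columns are odd, hence nonzero, and
  \<open>weighted_count\<close> contradicts the bound on d.\<close>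

lemma odd_columns:
  fixes y :: "'k::field mpoly set \<Rightarrow> 'k"
  assumes char: "CHAR('k) = 0" and d: "\<And>M. dg M = j \<Longrightarrow> total_deg M = d"
    and \<mu>: "is_partition \<mu>" "sum_list \<mu> + first_part \<mu> \<le> m" and dn: "d < sum_list \<mu> + l"
    and y: "y \<in> carrier (fobj (dualp FI_D j) (m + l))"
    and flips: "\<And>a b. a \<in> {1..m + l} \<Longrightarrow> b \<in> {1..m + l} \<Longrightarrow>
      fmap (dualp FI_D j) (m + l) (m + l) (compose (ob (m + l)) (flip (m + l) a) (flip (m + l) b)) y
        = ((if a \<le> m then 1 else - 1) * (if b \<le> m then 1 else - 1)) \<odot>\<^bsub>fobj (dualp FI_D j) (m + l)\<^esub> y"
    and swaps: "\<And>a b. \<lbrakk>a \<in> {1..m}; b \<in> {1..m}; a \<noteq> b; snd (cell (pad \<mu> m) a) = snd (cell (pad \<mu> m) b)\<rbrakk> \<Longrightarrow>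
      fmap (dualp FI_D j) (m + l) (m + l) (swap_map (m + l) a b) y = (- 1) \<odot>\<^bsub>fobj (dualp FI_D j) (m + l)\<^esub> y"
    and M: "vals FI_D j (m + l) y M \<noteq> 0" and c: "c \<in> {1..m + l}"
  shows "odd (cdeg c M) \<longleftrightarrow> c \<le> m"
proof (rule ccontr)
  assume neg: "\<not> ?thesis"
  have Mm: "M \<in> monomials r (m + l)" and dgM: "dg M = j" using vals_dmon[OF M] by (auto simp: dmon_def)
  have st: "h \<in> FI_hom (stab FI_D) (m + l) (m + l)" if "h \<in> FI_hom FI_D (m + l) (m + l)" for h
    using FI_BC[OF that] by (simp add: stab_def)
  have even: "even (cdeg a M + cdeg b M) \<longleftrightarrow> (a \<le> m \<longleftrightarrow> b \<le> m)" if ab: "a \<in> {1..m + l}" "b \<in> {1..m + l}" for a b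
  proof -
    have "of_int ((- 1) ^ (cdeg a M + cdeg b M)) * vals FI_D j (m + l) y M
        = ((if a \<le> m then 1 else - 1) * (if b \<le> m then 1 else - 1)) * vals FI_D j (m + l) y M"
      using vals_eigen[OF st[OF double_flip(1)[OF ab]] y flips[OF ab] Mm]
      unfolding double_flip(2)[OF ab Mm] double_flip(3)[OF ab Mm] .
    note sp = sign_parity[OF char this M]
    show ?thesis using sp by (cases "a \<le> m"; cases "b \<le> m") simp_all
  qed
  have "sum_list \<mu> + l \<le> total_deg M"
  proof (rule weighted_count[OF \<mu> Mm])
    show "\<not> (cdeg a M = 0 \<and> cdeg b M = 0)"
      if ab: "a \<in> {1..m}" "b \<in> {1..m}" "a \<noteq> b" "snd (cell (pad \<mu> m) a) = snd (cell (pad \<mu> m) b)" for a b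
    proof (rule vals_antisym[OF char _ _ _ y swaps[OF ab] Mm M])
      show ab': "a \<in> {1..m + l}" "b \<in> {1..m + l}" using ab by auto
      show "swap_map (m + l) a b \<in> FI_hom (stab FI_D) (m + l) (m + l)" by (rule st[OF swap_map_D[OF ab']])
    qed
    show "cdeg i M \<noteq> 0" if i: "i \<in> {1..m + l}" "m < i" for i
    proof
      assume "cdeg i M = 0"
      then have "odd (cdeg c M) \<longleftrightarrow> c \<le> m" using even[OF i(1) c] i(2) by auto
      then show False using neg by contradiction
    qed
  qed
  then show False using dn d[OF dgM] by simp
qed

lemma weight_D:
  assumes char: "CHAR('k::field) = 0" and j: "j \<in> I" and d: "\<And>M. dg M = j \<Longrightarrow> total_deg M = d"
  shows "weight_le_BC (IndD (dualp FI_D j :: ('k, _) FI_diagram)) d"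
  unfolding weight_le_BC_def
proof (intro allI impI, elim conjE, rule ccontr)
  fix n and \<mu> \<nu> :: "nat list"
  let ?V = "dualp FI_D j :: ('k, 'k mpoly set \<Rightarrow> 'k) FI_diagram"
  let ?N = "fobj (IndD ?V) n" and ?\<tau> = "fmap (IndD ?V) n n"
  define m where "m = n - sum_list \<nu>"
  define l where "l = sum_list \<nu>"
  assume \<mu>: "is_partition \<mu>" and \<nu>: "is_partition \<nu>" and n: "sum_list \<nu> + sum_list \<mu> + first_part \<mu> \<le> n"
    and con: "constituent (FI_hom FI_BC n n) (B_irr (pad \<mu> (n - sum_list \<nu>)) \<nu>)
       (B_act (pad \<mu> (n - sum_list \<nu>)) \<nu>) ?N ?\<tau>"
    and "\<not> sum_list \<mu> + sum_list \<nu> \<le> d"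
  then have dl: "d < sum_list \<mu> + l" by (simp add: l_def)
  have V: "FI_module FI_D ?V"
    by (rule graded_co_FI_algebra.dual_piece_FI_module[OF coinv_graded_co_FI j])
  note modN = IndD_module[OF V, of n]
  have \<mu>': "sum_list \<mu> + first_part \<mu> \<le> m" and nml: "n = m + l" using n by (auto simp: m_def l_def)
  note sum = pad_cells(1)[OF \<mu> \<mu>']
  have tot: "sum_list (pad \<mu> m) + sum_list \<nu> = n" by (simp only: sum nml l_def)
  note con' = con[folded m_def, folded tot]
  from constituent_vector[OF char IndD_module[OF V] con'] obtain \<psi>
    where "antisym_vector (pad \<mu> m) \<nu> ?\<tau> ?N \<psi>"
    unfolding tot by blast
  note av = antisym_vectorD[OF this sum[symmetric] l_def, folded nml]
  note \<psi> = av(1,2)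
  have dn: "d < n" using dl \<mu>' nml by simp
  define \<sigma> where "\<sigma> a = (if a \<le> m then 1 else - 1 :: 'k)" for a
  have two: "(1 :: 'k) \<noteq> - 1" using eq_uminus_zero[OF char, of 1] by auto
  \<comment> \<open>All even elements acting on \<psi> by a sign. Defined this way K is visibly
    closed under products and under conjugation by the flip, and it contains the double flips and
    transpositions that are used below.\<close>
  define K where "K = {w \<in> FI_hom FI_D n n. ?\<tau> w \<psi> = 1 \<odot>\<^bsub>?N\<^esub> \<psi> \<or> ?\<tau> w \<psi> = (- 1) \<odot>\<^bsub>?N\<^esub> \<psi>}"
  define \<chi> where "\<chi> w = (if ?\<tau> w \<psi> = 1 \<odot>\<^bsub>?N\<^esub> \<psi> then 1 else - 1 :: 'k)" for w
  have \<chi>: "?\<tau> w \<psi> = \<chi> w \<odot>\<^bsub>?N\<^esub> \<psi>" if "w \<in> K" for w using that by (auto simp: K_def \<chi>_def)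
  have KI: "w \<in> K \<and> \<chi> w = c" if "w \<in> FI_hom FI_D n n" "?\<tau> w \<psi> = c \<odot>\<^bsub>?N\<^esub> \<psi>" "c = 1 \<or> c = - 1" for w c
    using that smult_cancel[OF modN \<psi>, of c 1] by (auto simp: K_def \<chi>_def)
  have \<chi>1: "\<chi> w = 1 \<or> \<chi> w = - 1" for w by (simp add: \<chi>_def)
  have KB: "w \<in> FI_hom FI_BC n n" if "w \<in> K" for w using that FI_BC by (auto simp: K_def)
  have comp: "?\<tau> (compose (ob n) g h) \<psi> = (a * b) \<odot>\<^bsub>?N\<^esub> \<psi>"
    if "g \<in> FI_hom FI_BC n n" "h \<in> FI_hom FI_BC n n" "?\<tau> g \<psi> = a \<odot>\<^bsub>?N\<^esub> \<psi>" "?\<tau> h \<psi> = b \<odot>\<^bsub>?N\<^esub> \<psi>" for g h a b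
  proof -
    interpret N: Module.module scalars ?N by (rule modN)
    have "?\<tau> (compose (ob n) g h) \<psi> = b \<odot>\<^bsub>?N\<^esub> (a \<odot>\<^bsub>?N\<^esub> \<psi>)"
      unfolding IndD_map_comp[OF V that(1,2) \<psi>(1)] that(4) IndD_map_linear(2)[OF V that(1) \<psi>(1) \<psi>(1)] that(3) ..
    then show ?thesis using N.smult_assoc1[of b a \<psi>] \<psi>(1) by (simp add: mult.commute)
  qed
  interpret sign_character n K \<chi>
  proof
    show "K \<subseteq> FI_hom FI_D n n" by (auto simp: K_def)
    show "\<chi> h * \<chi> h = 1" for h using \<chi>1[of h] by auto
    fix g h assume gh: "g \<in> K" "h \<in> K"
    have eps: "eps n g = 1" "eps n h = 1" using gh by (auto simp: K_def FI_D_iff)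
    have "compose (ob n) g h \<in> FI_hom FI_D n n"
      using compose_FI[OF KB[OF gh(2)] KB[OF gh(1)]] eps_compose[OF KB[OF gh(2)] KB[OF gh(1)]] eps by (simp add: FI_D_iff)
    then show "compose (ob n) g h \<in> K \<and> \<chi> (compose (ob n) g h) = \<chi> g * \<chi> h"
      by (rule KI[OF _ comp[OF KB[OF gh(1)] KB[OF gh(2)] \<chi>[OF gh(1)] \<chi>[OF gh(2)]]]) (use \<chi>1[of g] \<chi>1[of h] in auto)
  qed
  have fl: "?\<tau> (flip n i) \<psi> = \<sigma> i \<odot>\<^bsub>?N\<^esub> \<psi>" if "i \<in> {1..n}" for i using av(3)[OF that] by (simp add: \<sigma>_def)
  have i1: "1 \<in> {1..n}" using dn by simp
  \<comment> \<open>The eigenvalue of the flip enters twice and cancels.\<close>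
  have conj: "compose (ob n) (flip n 1) (compose (ob n) w (flip n 1)) \<in> K \<and>
      \<chi> (compose (ob n) (flip n 1) (compose (ob n) w (flip n 1))) = \<chi> w" if w: "w \<in> K" for w
  proof (rule KI)
    note w' = KB[OF w] and ws = compose_FI[OF flip_FI KB[OF w]]
    have "eps n w = 1" using w by (auto simp: K_def FI_D_iff)
    then show "compose (ob n) (flip n 1) (compose (ob n) w (flip n 1)) \<in> FI_hom FI_D n n"
      using compose_FI[OF ws flip_FI] eps_compose[OF ws flip_FI] eps_compose[OF flip_FI w'] eps_flip[OF i1]
      by (simp add: FI_D_iff)
    show "?\<tau> (compose (ob n) (flip n 1) (compose (ob n) w (flip n 1))) \<psi> = \<chi> w \<odot>\<^bsub>?N\<^esub> \<psi>"
      using comp[OF flip_FI ws fl[OF i1] comp[OF w' flip_FI \<chi>[OF w] fl[OF i1]]]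
      by (simp add: \<sigma>_def mult.commute split: if_splits)
  qed (rule \<chi>1)
  have ds: "compose (ob n) (flip n a) (flip n b) \<in> K \<and> \<chi> (compose (ob n) (flip n a) (flip n b)) = \<sigma> a * \<sigma> b"
    if ab: "a \<in> {1..n}" "b \<in> {1..n}" for a b
    by (rule KI[OF double_flip(1)[OF ab] comp[OF flip_FI flip_FI fl[OF ab(1)] fl[OF ab(2)]]]) (auto simp: \<sigma>_def)
  have sw: "swap_map n a b \<in> K \<and> \<chi> (swap_map n a b) = c"
    if "a \<in> {1..n}" "b \<in> {1..n}" "?\<tau> (swap_map n a b) \<psi> = c \<odot>\<^bsub>?N\<^esub> \<psi>" "c = 1 \<or> c = - 1" for a b c
    by (rule KI[OF swap_map_D[OF that(1,2)] that(3,4)])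
  let ?T = "(\<lambda>t. t + m) ` lone \<nu>"
  have T: "?T \<subseteq> {1..n}" by (auto simp: lone_def nml l_def)
  \<comment> \<open>Here l = 1 and |\<mu>| \<ge> m, which leaves no room for the first part: \<mu>
    is empty, and the bound on d gives 0.\<close>
  have small: "d = 0" if "Suc d = n" "Suc m = n"
  proof -
    have "first_part \<mu> = 0" using that dl \<mu>' nml by linarith
    then have "\<mu> = []" using \<mu> by (cases \<mu>) (auto simp: first_part_def is_partition_def)
    then show ?thesis using that dl nml by simp
  qed
  have "\<psi> = \<zero>\<^bsub>?N\<^esub>"
  proof (rule IndD_eigen_zero[OF V i1 conj \<psi>(1) \<chi>])
    \<comment> \<open>The scalar is opposite to the eigenvalue of the flip on \<psi>, since y has
      the reversed parities.\<close>
    show "?\<tau> (flip n 1) \<psi> = (- (if 1 \<le> m then - 1 else 1)) \<odot>\<^bsub>?N\<^esub> \<psi>" using fl[OF i1] by (simp add: \<sigma>_def)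
    show "(if 1 \<le> m then - 1 else 1 :: 'k) \<noteq> - (if 1 \<le> m then - 1 else 1)" using two by simp
    \<comment> \<open>The double flip at 1 is the identity and lies in K.\<close>
    have "K \<noteq> {}" using ds[OF i1 i1] by blast
    then show "of_nat (card K) \<noteq> (0 :: 'k)" using finite_K char by (simp add: of_nat_eq_0_iff_char_dvd card_eq_0_iff)
    fix y assume y: "y \<in> carrier (fobj ?V n)" and eig: "\<And>h. h \<in> K \<Longrightarrow> fmap ?V n n h y = \<chi> h \<odot>\<^bsub>fobj ?V n\<^esub> y"
    have eig_sw: "fmap ?V n n (swap_map n a b) y = c \<odot>\<^bsub>fobj ?V n\<^esub> y"
      if "a \<in> {1..n}" "b \<in> {1..n}" "?\<tau> (swap_map n a b) \<psi> = c \<odot>\<^bsub>?N\<^esub> \<psi>" "c = 1 \<or> c = - 1" for a b c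
      using eig[of "swap_map n a b"] sw[OF that] by simp
    have parity: "odd (cdeg c M) \<longleftrightarrow> c \<le> m" if "vals FI_D j n y M \<noteq> 0" "c \<in> {1..n}" for M c
    proof (rule odd_columns[OF char d \<mu> \<mu>' dl, folded nml, OF _ y _ _ that])
      show "fmap ?V n n (compose (ob n) (flip n a) (flip n b)) y
          = ((if a \<le> m then 1 else - 1) * (if b \<le> m then 1 else - 1)) \<odot>\<^bsub>fobj ?V n\<^esub> y"
        if "a \<in> {1..n}" "b \<in> {1..n}" for a b using eig ds[OF that] unfolding \<sigma>_def by metis
      show "fmap ?V n n (swap_map n a b) y = (- 1) \<odot>\<^bsub>fobj ?V n\<^esub> y"
        if "a \<in> {1..m}" "b \<in> {1..m}" "a \<noteq> b" "snd (cell (pad \<mu> m) a) = snd (cell (pad \<mu> m) b)" for a b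
        by (rule eig_sw[OF _ _ av(4)[OF that]]) (use that nml in auto)
    qed
    show "tens ?V n (flip n 1) y = (if 1 \<le> m then - 1 else 1) \<odot>\<^bsub>?N\<^esub> tens ?V n (\<lambda>a\<in>ob n. a) y"
    proof (rule tens_flip[OF char d dn y T parity _ _ small j i1])
      fix M assume M: "vals FI_D j n y M \<noteq> 0"
      have Mm: "M \<in> monomials r n" and dgM: "dg M = j" using vals_dmon[OF M] by (auto simp: dmon_def)
      show "\<exists>t\<in>?T. cdeg t M = 0"
      proof (rule zero_column[OF \<nu> l_def, where m = m, folded nml, OF Mm])
        show "total_deg M < n" using dn d[OF dgM] by simp
        show "odd (cdeg c M) \<longleftrightarrow> c \<le> m" if "c \<in> {1..n}" for c by (rule parity[OF M that])
        fix a b assume ab: "a \<in> {1..l}" "b \<in> {1..l}" "a \<noteq> b" "snd (cell \<nu> a) = snd (cell \<nu> b)"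
        have abn: "a + m \<in> {1..n}" "b + m \<in> {1..n}" using ab nml by auto
        show "\<not> (cdeg (a + m) M = 0 \<and> cdeg (b + m) M = 0)"
          by (rule vals_antisym[OF char abn _ y eig_sw[OF abn av(5)[OF ab]] Mm M])
            (use swap_map_FI[OF abn] in \<open>simp_all add: stab_def\<close>)
      qed
    next
      fix a b assume ab: "a \<in> ?T" "b \<in> ?T"
      then obtain a' b' where ab': "a = a' + m" "b = b' + m" "a' \<in> lone \<nu>" "b' \<in> lone \<nu>" by blast
      have abn: "a' + m \<in> {1..n}" "b' + m \<in> {1..n}"
        using subsetD[OF T ab(1)] subsetD[OF T ab(2)] ab'(1,2) by simp_all
      show "fmap ?V n n (swap_map n a b) y = 1 \<odot>\<^bsub>fobj ?V n\<^esub> y"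
        unfolding ab'(1,2) by (rule eig_sw[OF abn av(6)[OF ab'(3,4)]]) simp
    qed
  qed
  then show False using \<psi>(2) by contradiction
qed

end

theorem theorem6p1:
  fixes W :: FI_type and r :: nat
  assumes "0 < r"
  shows "graded_co_FI_algebra W (coinv W r :: ('k::field, 'k mpoly set) FI_diagram)
           (multidegs r) (coinv_piece multideg W r) \<and>
         finite_type W (coinv W r :: ('k, 'k mpoly set) FI_diagram)
           (multidegs r) (coinv_piece multideg W r) \<and>
         graded_co_FI_algebra W (coinv W r :: ('k, 'k mpoly set) FI_diagram)
           UNIV (coinv_piece total_deg W r) \<and>
         finite_type W (coinv W r :: ('k, 'k mpoly set) FI_diagram)
           UNIV (coinv_piece total_deg W r) \<and>
         (CHAR('k) = 0 \<longrightarrow>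
           (\<forall>J\<in>multidegs r.
              co_weight_le W
                (graded_piece (coinv W r :: ('k, 'k mpoly set) FI_diagram)
                   (coinv_piece multideg W r) J)
                (size_multideg J)))"
proof (intro conjI impI ballI multi.coinv_graded_co_FI multi.coinv_finite_type
    total.coinv_graded_co_FI total.coinv_finite_type)
  fix J assume char: "CHAR('k) = 0" and J: "J \<in> multidegs r"
  have deg: "total_deg M = size_multideg J" if "multideg M = J" for M
    using that by (simp add: total_deg_multideg)
  show "co_weight_le W (graded_piece (coinv W r :: ('k, 'k mpoly set) FI_diagram)
      (coinv_piece multideg W r) J) (size_multideg J)"
    using multi.weight_A[OF char J deg] multi.weight_BC[OF char J deg] multi.weight_D[OF char J deg]
    by (cases W) (simp_all add: co_weight_le_def weight_le_def)
qed

end
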